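(* Let $1\le k\le n-1$ be integers and let $f$ be a non-negative, bounded, integrable function on $\mathbb{R}^n$. Then $$ \int_{M_{n,k}}\frac{\left(\int_F f(x)\,dx\right)^{n+1}}{\|f|_F\|_\infty^{\,n-k}}\,d\nu_{n,k}(F)\le \frac{\omega_k^{n+1}\,\omega_{n(k+1)}}{\omega_n^{k+1}\,\omega_{k(n+1)}}\left(\int_{\mathbb{R}^n}f(x)\,dx\right)^{k+1}. $$
   Context: $G_{n,k}$ is the Grassmannian of $k$-dimensional linear subspaces of $\mathbb{R}^n$ with Haar probability measure $\mu_{n,k}$. $M_{n,k}$ is the affine Grassmannian of $k$-dimensional affine subspaces of $\mathbb{R}^n$ with the rigid-motion invariant measure $\nu_{n,k}(A)=\int_{G_{n,k}}|\{x\in E^\perp: x+E\in A\}|\,d\mu_{n,k}(E)$, where $|\cdot|$ is Lebesgue measure on $E^\perp$. $f|_F$ is the restriction of $f$ to $F$; $\int_F$ and the $L^\infty$-norm $\|f|_F\|_\infty$ are with respect to $k$-dimensional Lebesgue measure on $F$. $\omega_m$ is the volume of the Euclidean unit ball of $\mathbb{R}^m$. The integrand is read as $0$ when $\|f|_F\|_\infty=0$. *)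

theory Defs
  imports "HOL-Probability.Probability" "HOL-Probability.Essential_Supremum"
begin

definition linear_grassmannian :: "nat \<Rightarrow> (real^'n) set set" where
  "linear_grassmannian k = {E. subspace E \<and> dim E = k}"

definition affine_grassmannian :: "nat \<Rightarrow> (real^'n) set set" where
  "affine_grassmannian k = {F. affine F \<and> aff_dim F = int k}"

text \<open>
  A flat \<open>F = x + E\<close> with \<open>x\<close> orthogonal to \<open>E\<close> is encoded by the point \<open>x\<close> (the point
  of \<open>F\<close> nearest to the origin) and the matrix of the orthogonal projection onto \<open>E\<close>. This
  embeds both Grassmannians into a Euclidean space and induces their usual topologies;
  the Borel sets of an induced topology are the traces of the ambient Borel sets.
\<close>

definition flat_coords :: "(real^'n) set \<Rightarrow> (real^'n) \<times> (real^'n^'n)" where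
  "flat_coords F =
     (closest_point F 0, matrix (\<lambda>x. closest_point F x - closest_point F 0))"

definition flat_borel :: "(real^'n) set set \<Rightarrow> (real^'n) set measure" where
  "flat_borel S = vimage_algebra S flat_coords borel"

definition grassmannian_haar :: "nat \<Rightarrow> (real^'n) set measure \<Rightarrow> bool" where
  "grassmannian_haar k \<mu> \<longleftrightarrow>
     prob_space \<mu> \<and>
     sets \<mu> = sets (flat_borel (linear_grassmannian k)) \<and>
     (\<forall>U. orthogonal_transformation U \<longrightarrow> distr \<mu> \<mu> ((`) U) = \<mu>)"

text \<open>
  The orthogonally invariant Borel probability measure is unique, so the choice is
  immaterial. Its existence is \<open>grassmannian_measure_haar\<close> below.
\<close>

definition grassmannian_measure :: "nat \<Rightarrow> (real^'n) set measure" where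
  "grassmannian_measure k = (SOME \<mu>. grassmannian_haar k \<mu>)"

text \<open>
  Lebesgue measure on a flat \<open>F\<close> of dimension \<open>m\<close>, as a complete measure with space \<open>F\<close>:
  it is transported from \<open>m\<close>-dimensional coordinate space by an isometric parametrization
  of \<open>F\<close>. The result does not depend on the parametrization.
\<close>

definition orthonormal_frame :: "(real^'n) set \<Rightarrow> real^'n \<Rightarrow> (nat \<Rightarrow> real^'n) \<Rightarrow> bool" where
  "orthonormal_frame F a b \<longleftrightarrow>
     (let m = nat (aff_dim F) in
       (\<forall>i<m. \<forall>j<m. b i \<bullet> b j = (if i = j then 1 else 0)) \<and>
       F = {a + (\<Sum>i<m. c i *\<^sub>R b i) | c. True})"

definition flat_lebesgue :: "(real^'n) set \<Rightarrow> (real^'n) measure" where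
  "flat_lebesgue F =
     (SOME M. \<exists>a b. orthonormal_frame F a b \<and>
        M = completion
              (distr (\<Pi>\<^sub>M i\<in>{..<nat (aff_dim F)}. lborel) (restrict_space borel F)
                 (\<lambda>c. a + (\<Sum>i<nat (aff_dim F). c i *\<^sub>R b i))))"

definition affine_grassmannian_measure :: "nat \<Rightarrow> (real^'n) set measure" where
  "affine_grassmannian_measure k =
     measure_of (affine_grassmannian k) (sets (flat_borel (affine_grassmannian k)))
       (\<lambda>A. \<integral>\<^sup>+ E. emeasure (flat_lebesgue (E\<^sup>\<bottom>)) {x \<in> E\<^sup>\<bottom>. (+) x ` E \<in> A}
              \<partial>grassmannian_measure k)"

text \<open>
  Existence of the invariant measure: push forward the uniform distribution on the
  invertible matrices \<open>A\<close> of norm at most \<open>1\<close> under \<open>A \<mapsto> A E\<^sub>0\<close>, for a fixed coordinate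
  subspace \<open>E\<^sub>0\<close>.
\<close>

lemma emeasure_lborel_isometry_le:
  fixes T :: "'a::euclidean_space \<Rightarrow> 'a"
  assumes T: "orthogonal_transformation T" and U: "open U"
  shows "emeasure lborel U \<le> emeasure lborel (T -` U)"
proof -
  let ?K = "{(x, r). 0 < r \<and> ball x r \<subseteq> U}"
  have "\<exists>i. i \<in> ?K \<and> x \<in> ball (fst i) (snd i) \<and> snd i < d" if xd: "x \<in> U" "0 < d" for x d
  proof -
    obtain e where e: "e > 0" "ball x e \<subseteq> U" using U xd(1) by (meson open_contains_ball)
    show ?thesis
      by (rule exI[of _ "(x, min e (d/2))"]) (use e xd in auto)
  qed
  then obtain C where C: "countable C" "C \<subseteq> ?K"
    "pairwise (\<lambda>i j. disjnt (ball (fst i) (snd i)) (ball (fst j) (snd j))) C"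
    "negligible (U - (\<Union>i\<in>C. ball (fst i) (snd i)))"
    by (rule Vitali_covering_theorem_balls)
  define B where "B = (\<Union>i\<in>C. ball (fst i) (snd i))"
  have disj: "disjoint_family_on (\<lambda>i. ball (fst i) (snd i)) C"
    using C(3) by (auto simp: disjoint_family_on_def pairwise_def disjnt_def)
  have cT: "continuous_on UNIV T"
    by (rule linear_continuous_on)
      (use T in \<open>simp add: linear_conv_bounded_linear[symmetric] orthogonal_transformation_linear\<close>)
  obtain S where S: "orthogonal_transformation S" "\<And>x. T (S x) = x" "\<And>x. S (T x) = x"
  proof
    show "orthogonal_transformation (inv T)" using T orthogonal_transformation_inv by blast
    show "T (inv T x) = x" "inv T (T x) = x" for x
      using T by (simp_all add: orthogonal_transformation_bij bij_is_surj surj_f_inv_f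
          orthogonal_transformation_inj)
  qed
  have ball: "T -` ball x r = ball (S x) r" for x r
  proof -
    have "dist x (T y) = dist (S x) y" for y
    proof -
      have "dist x (T y) = norm (T (S x - y))"
        using T S by (simp add: dist_norm linear_diff orthogonal_transformation_linear)
      then show ?thesis using T by (simp add: dist_norm orthogonal_transformation_norm)
    qed
    then show ?thesis by auto
  qed
  have "emeasure lborel U \<le> emeasure lborel B"
  proof -
    have "U - B \<in> null_sets lebesgue"
      using C(4) by (simp add: B_def negligible_iff_null_sets)
    moreover have "U - B \<in> sets lborel"
      using U by (intro sets.Diff) (auto simp: B_def intro!: borel_open)
    ultimately have "U - B \<in> null_sets lborel"
      by (simp add: null_sets_completion_iff)
    moreover have "B \<in> sets lborel" by (auto simp: B_def intro!: borel_open)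
    ultimately have "emeasure lborel (B \<union> (U - B)) = emeasure lborel B"
      by (intro emeasure_Un_null_set)
    moreover have "emeasure lborel U \<le> emeasure lborel (B \<union> (U - B))"
      using U \<open>B \<in> sets lborel\<close> by (intro emeasure_mono) auto
    ultimately show ?thesis by simp
  qed
  also have "\<dots> = (\<integral>\<^sup>+ i. emeasure lborel (ball (fst i) (snd i)) \<partial>count_space C)"
    unfolding B_def by (intro emeasure_UN_countable) (use C disj in auto)
  also have "\<dots> = (\<integral>\<^sup>+ i. emeasure lborel (ball (S (fst i)) (snd i)) \<partial>count_space C)"
    by (intro nn_integral_cong) (use C(2) in \<open>auto simp: emeasure_ball\<close>)
  also have "\<dots> = emeasure lborel (\<Union>i\<in>C. ball (S (fst i)) (snd i))"
  proof (intro emeasure_UN_countable[symmetric])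
    show "disjoint_family_on (\<lambda>i. ball (S (fst i)) (snd i)) C"
      using disj unfolding disjoint_family_on_def ball[symmetric] by fastforce
  qed (use C in auto)
  also have "\<dots> = emeasure lborel (T -` B)"
    by (simp add: B_def ball[symmetric] vimage_UN)
  also have "\<dots> \<le> emeasure lborel (T -` U)"
  proof (rule emeasure_mono)
    show "T -` B \<subseteq> T -` U" using C(2) by (force simp: B_def)
    show "T -` U \<in> sets lborel" using U cT by (simp add: borel_open open_vimage)
  qed
  finally show ?thesis .
qed

lemma lborel_distr_isometry:
  fixes T :: "'a::euclidean_space \<Rightarrow> 'a"
  assumes T: "orthogonal_transformation T"
  shows "distr lborel borel T = lborel"
proof (rule sym, rule lborel_eqI)
  have cT: "continuous_on UNIV F" if "orthogonal_transformation F" for F :: "'a \<Rightarrow> 'a"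
    by (rule linear_continuous_on)
      (use that in \<open>simp add: linear_conv_bounded_linear[symmetric] orthogonal_transformation_linear\<close>)
  fix l u :: 'a
  assume lu: "\<And>b. b \<in> Basis \<Longrightarrow> l \<bullet> b \<le> u \<bullet> b"
  have iT: "orthogonal_transformation (inv T)" using T orthogonal_transformation_inv by blast
  have "emeasure lborel (T -` box l u) \<le> emeasure lborel (inv T -` (T -` box l u))"
    by (intro emeasure_lborel_isometry_le iT open_vimage open_box cT T)
  also have "inv T -` (T -` box l u) = box l u"
    using T by (simp add: vimage_def orthogonal_transformation_bij bij_is_surj surj_f_inv_f)
  finally have "emeasure lborel (T -` box l u) = emeasure lborel (box l u)"
    using emeasure_lborel_isometry_le[OF T open_box, of l u] by (rule antisym)
  moreover have "T \<in> borel_measurable lborel"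
    using cT[OF T] by (simp add: borel_measurable_continuous_onI)
  ultimately show "emeasure (distr lborel borel T) (box l u) = (\<Prod>b\<in>Basis. (u - l) \<bullet> b)"
    using lu by (simp add: emeasure_distr emeasure_lborel_box)
qed simp

lemma closest_point_subspace_eq:
  fixes E :: "'a::euclidean_space set"
  assumes "subspace E" "y \<in> E" "\<And>z. z \<in> E \<Longrightarrow> (x - y) \<bullet> z = 0"
  shows "closest_point E x = y"
proof (rule sym, rule closest_point_unique)
  show "convex E" "closed E" using assms by (simp_all add: subspace_imp_convex closed_subspace)
  show "\<forall>z\<in>E. dist x y \<le> dist x z"
  proof
    fix z assume "z \<in> E"
    then have "(x - y) \<bullet> (y - z) = 0" using assms by (simp add: subspace_diff)
    then have "(norm (x - z))\<^sup>2 = (norm (x - y))\<^sup>2 + (norm (y - z))\<^sup>2"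
      by (metis norm_add_Pythagorean orthogonal_def diff_add_cancel add_diff_eq)
    then show "dist x y \<le> dist x z"
      by (simp add: dist_norm power2_le_imp_le)
  qed
qed fact

lemma closest_point_subspace:
  fixes E :: "'a::euclidean_space set"
  assumes "subspace E"
  shows "closest_point E x \<in> E" "z \<in> E \<Longrightarrow> (x - closest_point E x) \<bullet> z = 0"
proof -
  obtain y z where yz: "y \<in> span E" "\<And>w. w \<in> span E \<Longrightarrow> orthogonal z w" "x = y + z"
    using orthogonal_subspace_decomp_exists by metis
  have "span E = E" using assms by simp
  then have "closest_point E x = y"
    using yz assms unfolding \<open>span E = E\<close>
    by (intro closest_point_subspace_eq) (auto simp: orthogonal_def)
  then show "closest_point E x \<in> E" "z \<in> E \<Longrightarrow> (x - closest_point E x) \<bullet> z = 0" for z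
    using yz unfolding \<open>span E = E\<close> by (auto simp: orthogonal_def)
qed

lemma closest_point_orthogonal_image:
  fixes E :: "'a::euclidean_space set" and U :: "'a \<Rightarrow> 'a"
  assumes U: "orthogonal_transformation U" and E: "subspace E"
  shows "closest_point (U ` E) (U x) = U (closest_point E x)"
proof (rule closest_point_subspace_eq)
  have lin: "linear U" using U orthogonal_transformation_linear by blast
  show "subspace (U ` E)" using lin E by (rule linear_subspace_image)
  show "U (closest_point E x) \<in> U ` E" using closest_point_subspace(1)[OF E] by blast
  fix z assume "z \<in> U ` E"
  then obtain w where "w \<in> E" "z = U w" by blast
  then show "(U x - U (closest_point E x)) \<bullet> z = 0"
    using closest_point_subspace(2)[OF E, of w x] U lin
    by (metis linear_diff orthogonal_transformation_def)
qed

lemma flat_coords_subspace: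
  assumes "subspace E"
  shows "flat_coords E = (0, matrix (closest_point E))"
proof -
  have "closest_point E 0 = 0" by (rule closest_point_self) (use assms subspace_0 in auto)
  then show ?thesis by (simp add: flat_coords_def)
qed

lemma linear_closest_point:
  fixes E :: "'a::euclidean_space set"
  assumes E: "subspace E"
  shows "linear (closest_point E)"
proof (rule linearI)
  show "closest_point E (x + y) = closest_point E x + closest_point E y" for x y
  proof (rule closest_point_subspace_eq[OF E])
    show "closest_point E x + closest_point E y \<in> E"
      using closest_point_subspace(1)[OF E] E by (simp add: subspace_add)
    show "(x + y - (closest_point E x + closest_point E y)) \<bullet> z = 0" if "z \<in> E" for z
      using closest_point_subspace(2)[OF E that, of x] closest_point_subspace(2)[OF E that, of y]
      by (simp add: algebra_simps)
  qed
  show "closest_point E (r *\<^sub>R x) = r *\<^sub>R closest_point E x" for r x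
  proof (rule closest_point_subspace_eq[OF E])
    show "r *\<^sub>R closest_point E x \<in> E"
      using closest_point_subspace(1)[OF E] E by (simp add: subspace_scale)
    show "(r *\<^sub>R x - r *\<^sub>R closest_point E x) \<bullet> z = 0" if "z \<in> E" for z
      using closest_point_subspace(2)[OF E that, of x]
      by (simp flip: scaleR_diff_right)
  qed
qed

lemma orthogonal_image_linear_grassmannian:
  assumes "orthogonal_transformation U" "E \<in> linear_grassmannian k"
  shows "U ` E \<in> linear_grassmannian k"
  using assms dim_image_eq[of U E]
  by (auto simp: linear_grassmannian_def orthogonal_transformation_linear
      linear_subspace_image orthogonal_transformation_inj
      inj_on_subset[OF orthogonal_transformation_inj])

lemma measurable_borel_vec:
  fixes g :: "'a \<Rightarrow> 'b::euclidean_space^'n"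
  assumes "\<And>i. (\<lambda>x. g x $ i) \<in> borel_measurable M"
  shows "g \<in> borel_measurable M"
  using assms
  by (subst borel_measurable_euclidean_space)
     (auto simp: Basis_vec_def inner_axis intro!: borel_measurable_inner)

lemma borel_measurable_det:
  fixes g :: "'a \<Rightarrow> real^'n^'n"
  assumes "\<And>i j. (\<lambda>x. g x $ i $ j) \<in> borel_measurable M"
  shows "(\<lambda>x. det (g x)) \<in> borel_measurable M"
  unfolding det_def using assms by measurable

theorem grassmannian_haar_exists:
  assumes k: "k \<le> CARD('n)"
  shows "\<exists>\<mu> :: (real^'n) set measure. grassmannian_haar k \<mu>"
proof -
  obtain S :: "'n set" where S: "card S = k"
    using k obtain_subset_with_card_n[of k "UNIV :: 'n set"] by auto
  define E0 :: "(real^'n) set" where "E0 = {x. \<forall>i. i \<notin> S \<longrightarrow> x $ i = 0}"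
  define D :: "real^'n^'n" where "D = (\<chi> i j. if i = j \<and> i \<in> S then 1 else 0)"
  have D: "(D *v x) $ i = (if i \<in> S then x $ i else 0)" for x i
    by (simp add: D_def matrix_vector_mult_def if_distrib if_distribR sum.If_cases
        Collect_conj_eq cong: if_cong)
  have "subspace E0" by (auto simp: E0_def subspace_def)
  have "dim E0 = k"
    unfolding E0_def using S dim_substandard_cart[where d = S and 'a = real]
    by (simp add: dim_vec_eq)
  have E0: "E0 = range ((*v) D)"
  proof (safe)
    fix x assume "x \<in> E0"
    then have "D *v x = x" by (simp add: vec_eq_iff D E0_def)
    then show "x \<in> range ((*v) D)" by (metis rangeI)
  next
    fix x show "D *v x \<in> E0" by (simp add: E0_def D)
  qed
  define X where "X = {A :: real^'n^'n. norm A \<le> 1 \<and> det A \<noteq> 0}"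
  define \<gamma> where "\<gamma> = uniform_measure lborel X"
  define \<Psi> where "\<Psi> = (\<lambda>A. if det A = 0 then E0 else (*v) A ` E0)"
  define G where "G = flat_borel (linear_grassmannian k :: (real^'n) set set)"
  have det_meas: "det \<in> borel_measurable (borel :: (real^'n^'n) measure)"
    by (rule borel_measurable_det) (intro borel_measurable_continuous_onI continuous_intros)
  have X_sets [measurable]: "X \<in> sets borel"
  proof -
    have "X = {A \<in> space borel. norm A \<le> 1 \<and> det A \<noteq> 0}" by (simp add: X_def)
    also have "\<dots> \<in> sets borel" using det_meas by measurable
    finally show ?thesis .
  qed
  have X_fin: "emeasure lborel X \<noteq> \<infinity>"
  proof -
    have "emeasure lborel X \<le> emeasure lborel (cball (0 :: real^'n^'n) 1)"
      by (intro emeasure_mono) (auto simp: X_def)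
    also have "\<dots> < \<infinity>" by (rule emeasure_lborel_cball_finite)
    finally show ?thesis by simp
  qed
  have X_pos: "emeasure lborel X \<noteq> 0"
  proof
    assume 0: "emeasure lborel X = 0"
    define V where "V = {A :: real^'n^'n. norm A < 1 \<and> det A \<noteq> 0}"
    have cdet: "continuous_on UNIV (det :: real^'n^'n \<Rightarrow> real)"
      unfolding det_def[abs_def] by (intro continuous_intros)
    have "open V"
      unfolding V_def
      by (intro open_Collect_conj open_Collect_less open_Collect_neq continuous_intros cdet)
    moreover have "V \<noteq> {}"
    proof -
      define c where "c = 1 / (norm (mat 1 :: real^'n^'n) + 1)"
      have c: "c > 0" "c * norm (mat 1 :: real^'n^'n) < 1"
        by (auto simp: c_def field_simps add_pos_nonneg intro!: add_nonneg_pos)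
      have "c *\<^sub>R (mat 1 :: real^'n^'n) = (\<chi> i j. if i = j then c else 0)"
        by (simp add: vec_eq_iff mat_def)
      then have "det (c *\<^sub>R (mat 1 :: real^'n^'n)) = c ^ CARD('n)"
        by (subst det_diagonal) auto
      then have "c *\<^sub>R mat 1 \<in> V" using c by (simp add: V_def)
      then show ?thesis by blast
    qed
    ultimately have "emeasure lborel V \<noteq> 0"
    proof (intro notI)
      assume V: "open V" "V \<noteq> {}" "emeasure lborel V = 0"
      then have "V \<in> null_sets lborel" by (intro null_setsI) auto
      then have "negligible V"
        by (simp add: negligible_iff_null_sets null_sets_completionI)
      then show False using V open_not_negligible by blast
    qed
    moreover have "emeasure lborel V \<le> emeasure lborel X"
      by (intro emeasure_mono) (use X_sets in \<open>auto simp: V_def X_def\<close>)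
    ultimately show False using 0 by simp
  qed
  interpret \<gamma>: prob_space \<gamma>
    unfolding \<gamma>_def using X_pos X_fin by (rule prob_space_uniform_measure)
  have sets_\<gamma>: "sets \<gamma> = sets borel" by (simp add: \<gamma>_def)
  have space_\<gamma>: "space \<gamma> = UNIV" by (simp add: \<gamma>_def)
  have space_G: "space G = linear_grassmannian k" by (simp add: G_def flat_borel_def)
  have inj: "inj ((*v) A)" if "det A \<noteq> 0" for A :: "real^'n^'n"
    using that by (simp add: invertible_det_nz[symmetric] inj_matrix_vector_mult)
  have \<Psi>_in: "\<Psi> A \<in> linear_grassmannian k" for A
    using \<open>subspace E0\<close> \<open>dim E0 = k\<close> inj[of A]
    by (auto simp: \<Psi>_def linear_grassmannian_def linear_subspace_image
        intro!: dim_image_eq[THEN trans] intro: inj_on_subset[OF _ subset_UNIV])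
  have proj: "closest_point (\<Psi> A) x =
      A *v (D *v (\<chi> l. det (\<chi> i j. if j = l then (transpose (A ** D) *v x) $ i
              else (transpose (A ** D) ** (A ** D) + (mat 1 - D)) $ i $ j)
            / det (transpose (A ** D) ** (A ** D) + (mat 1 - D))))"
    if A: "det A \<noteq> 0" for A x
  proof -
    define B where "B = A ** D"
    define H where "H = transpose B ** B + (mat 1 - D)"
    have DD: "D *v (D *v y) = D *v y" for y by (simp add: vec_eq_iff D)
    have Dsym: "(D *v y) \<bullet> z = y \<bullet> (D *v z)" for y z
      by (simp add: inner_vec_def D if_distrib if_distribR cong: if_cong)
    have Bv: "B *v y = A *v (D *v y)" for y by (simp add: B_def matrix_vector_mul_assoc)
    have adj: "(transpose B *v y) \<bullet> z = y \<bullet> (B *v z)" for y z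
      by (simp add: dot_lmul_matrix[symmetric] inner_commute)
    have Hv: "H *v y = transpose B *v (B *v y) + (y - D *v y)" for y
      by (simp add: H_def matrix_vector_mult_add_rdistrib matrix_vector_mult_diff_rdistrib
          matrix_vector_mul_assoc)
    have "det H \<noteq> 0"
    proof -
      have "y = 0" if "H *v y = 0" for y
      proof -
        have "(H *v y) \<bullet> y = (norm (B *v y))\<^sup>2 + (y - D *v y) \<bullet> y"
          by (simp add: Hv inner_add_left adj dot_lmul_matrix power2_norm_eq_inner)
        moreover have "(y - D *v y) \<bullet> y = (y - D *v y) \<bullet> (y - D *v y)"
          using Dsym[of y y] Dsym[of "D *v y" y] DD[of y]
          by (simp add: inner_diff_left inner_diff_right inner_commute)
        ultimately have "(norm (B *v y))\<^sup>2 + (norm (y - D *v y))\<^sup>2 = 0"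
          using that by (simp add: power2_norm_eq_inner)
        then have "B *v y = 0" "y = D *v y"
          by (simp_all add: sum_power2_eq_zero_iff)
        then have "A *v y = A *v 0" by (simp add: Bv)
        then show "y = 0" using inj[OF A] by (meson injD)
      qed
      then show ?thesis
        by (metis matrix_left_invertible_ker invertible_left_inverse invertible_det_nz)
    qed
    define y where "y = (\<chi> l. det (\<chi> i j. if j = l then (transpose B *v x) $ i else H $ i $ j)
         / det H)"
    have Hy: "H *v y = transpose B *v x"
      using cramer[OF \<open>det H \<noteq> 0\<close>, of y "transpose B *v x"] y_def by blast
    have orth: "(H *v y) \<bullet> (z - D *v z) = (y - D *v y) \<bullet> z" for z
    proof -
      have "B *v (z - D *v z) = 0"
        by (simp add: Bv matrix_vector_mult_diff_distrib DD)
      then have "(H *v y) \<bullet> (z - D *v z) = (y - D *v y) \<bullet> (z - D *v z)"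
        by (simp add: Hv inner_add_left adj dot_lmul_matrix)
      also have "\<dots> = (y - D *v y) \<bullet> z"
        by (simp add: inner_diff_right Dsym[symmetric] matrix_vector_mult_diff_distrib DD)
      finally show ?thesis .
    qed
    have yD: "(y - D *v y) \<bullet> z = 0" for z
    proof -
      have "B *v (z - D *v z) = 0"
        by (simp add: Bv matrix_vector_mult_diff_distrib DD)
      then show ?thesis using orth[of z] by (simp add: Hy adj dot_lmul_matrix)
    qed
    have "closest_point (\<Psi> A) x = B *v y"
    proof (rule closest_point_subspace_eq)
      show "subspace (\<Psi> A)" using \<Psi>_in[of A] by (simp add: linear_grassmannian_def)
      have \<Psi>: "\<Psi> A = range ((*v) B)"
        using A by (auto simp: \<Psi>_def E0 Bv)
      then show "B *v y \<in> \<Psi> A" by blast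
      fix w assume "w \<in> \<Psi> A"
      then obtain z where z: "w = B *v z" using \<Psi> by blast
      have "(x - B *v y) \<bullet> w = (H *v y) \<bullet> z - (transpose B *v (B *v y)) \<bullet> z"
        by (simp add: z inner_diff_left adj dot_lmul_matrix Hy)
      also have "\<dots> = (y - D *v y) \<bullet> z" by (simp add: Hv inner_add_left)
      finally show "(x - B *v y) \<bullet> w = 0" by (simp add: yD)
    qed
    then show ?thesis unfolding Bv unfolding y_def H_def B_def .
  qed
  have \<Psi>_meas: "\<Psi> \<in> measurable borel G"
    unfolding G_def flat_borel_def
  proof (rule measurable_vimage_algebra2)
    show "\<Psi> \<in> space borel \<rightarrow> linear_grassmannian k" using \<Psi>_in by auto
    have entries: "(\<lambda>A. A $ i $ j) \<in> borel_measurable (borel :: (real^'n^'n) measure)" for i j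
      by (intro borel_measurable_continuous_onI continuous_intros)
    have mm: "(\<lambda>A. (f A ** g A) $ i $ j) \<in> borel_measurable M"
      if "\<And>i j. (\<lambda>A. f A $ i $ j) \<in> borel_measurable M"
         "\<And>i j. (\<lambda>A. g A $ i $ j) \<in> borel_measurable M"
      for f g :: "real^'n^'n \<Rightarrow> real^'n^'n" and M i j
      using that by (simp add: matrix_matrix_mult_def)
    have mv: "(\<lambda>A. (f A *v g A) $ i) \<in> borel_measurable M"
      if "\<And>i j. (\<lambda>A. f A $ i $ j) \<in> borel_measurable M"
         "\<And>i. (\<lambda>A. g A $ i) \<in> borel_measurable M"
      for f :: "real^'n^'n \<Rightarrow> real^'n^'n" and g M i
      using that by (simp add: matrix_vector_mult_def)
    have tr: "(\<lambda>A. transpose (f A) $ i $ j) \<in> borel_measurable M"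
      if "\<And>i j. (\<lambda>A. f A $ i $ j) \<in> borel_measurable M"
      for f :: "real^'n^'n \<Rightarrow> real^'n^'n" and M i j
      using that by (simp add: transpose_def)
    have B: "(\<lambda>A :: real^'n^'n. (A ** D) $ i $ j) \<in> borel_measurable borel" for i j
      by (intro mm entries) simp
    have H: "(\<lambda>A :: real^'n^'n. (transpose (A ** D) ** (A ** D) + (mat 1 - D)) $ i $ j)
        \<in> borel_measurable borel" for i j
      unfolding vector_add_component
      by (intro borel_measurable_add mm tr B) simp
    have cp: "(\<lambda>A. closest_point (\<Psi> A) x $ i) \<in> borel_measurable borel" for x i
    proof -
      have *: "(\<lambda>A :: real^'n^'n. (\<chi> l. det (\<chi> i j. if j = l then (transpose (A ** D) *v x) $ i
              else (transpose (A ** D) ** (A ** D) + (mat 1 - D)) $ i $ j)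
            / det (transpose (A ** D) ** (A ** D) + (mat 1 - D))) $ l)
          \<in> borel_measurable borel" for l
        unfolding vec_lambda_beta
        apply (intro borel_measurable_divide borel_measurable_det H)
        subgoal for i j
          by (cases "j = l") (auto intro!: mv tr B H simp del: vector_add_component transpose_matrix_vector)
        done
      have "(\<lambda>A. (if det A = 0 then closest_point E0 x $ i else
         (A *v (D *v (\<chi> l. det (\<chi> i j. if j = l then (transpose (A ** D) *v x) $ i
              else (transpose (A ** D) ** (A ** D) + (mat 1 - D)) $ i $ j)
            / det (transpose (A ** D) ** (A ** D) + (mat 1 - D))))) $ i))
          \<in> borel_measurable borel"
        using det_meas
        by (intro measurable_If borel_measurable_const mv entries *) auto
      also have "(\<lambda>A. (if det A = 0 then closest_point E0 x $ i else
         (A *v (D *v (\<chi> l. det (\<chi> i j. if j = l then (transpose (A ** D) *v x) $ i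
              else (transpose (A ** D) ** (A ** D) + (mat 1 - D)) $ i $ j)
            / det (transpose (A ** D) ** (A ** D) + (mat 1 - D))))) $ i))
         = (\<lambda>A. closest_point (\<Psi> A) x $ i)"
        using proj by (auto simp: \<Psi>_def fun_eq_iff)
      finally show ?thesis .
    qed
    have "(\<lambda>A. (0 :: real^'n, matrix (closest_point (\<Psi> A)))) \<in> borel_measurable borel"
    proof (rule borel_measurable_Pair)
      show "(\<lambda>A. matrix (closest_point (\<Psi> A))) \<in> borel_measurable borel"
        by (intro measurable_borel_vec) (simp add: matrix_def cp)
    qed simp
    then show "(\<lambda>A. flat_coords (\<Psi> A)) \<in> borel_measurable borel"
      using \<Psi>_in by (subst flat_coords_subspace) (auto simp: linear_grassmannian_def)
  qed
  have \<Psi>_meas': "\<Psi> \<in> measurable \<gamma> G"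
    using \<Psi>_meas by (simp cong: measurable_cong_sets add: sets_\<gamma>)
  define \<mu> where "\<mu> = distr \<gamma> G \<Psi>"
  have "prob_space \<mu>" unfolding \<mu>_def using \<Psi>_meas' by (rule \<gamma>.prob_space_distr)
  moreover have sets_\<mu>: "sets \<mu> = sets G" by (simp add: \<mu>_def)
  moreover have "distr \<mu> \<mu> ((`) U) = \<mu>" if U: "orthogonal_transformation U" for U
  proof -
    define Q where "Q = matrix U"
    have UQ: "U = (*v) Q"
      using U by (simp add: Q_def fun_eq_iff orthogonal_transformation_linear)
    define T where "T = (\<lambda>A :: real^'n^'n. Q ** A)"
    have detQ: "\<bar>det Q\<bar> = 1" using U by (simp add: Q_def)
    have orthQ: "orthogonal_matrix Q"
      using U by (simp add: Q_def orthogonal_transformation_matrix)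
    have T: "orthogonal_transformation T"
    proof -
      have "linear T"
        by (rule linearI) (simp_all add: T_def vec_eq_iff matrix_matrix_mult_def
            sum_distrib_left sum.distrib algebra_simps)
      moreover have "T A \<bullet> T B = A \<bullet> B" for A B
      proof -
        have cols: "C \<bullet> C' = (\<Sum>j\<in>UNIV. column j C \<bullet> column j C')" for C C' :: "real^'n^'n"
          unfolding inner_vec_def column_def vec_lambda_beta by (rule sum.swap)
        have "column j (T C) = U (column j C)" for j C
          by (simp add: T_def UQ column_def vec_eq_iff matrix_matrix_mult_def
              matrix_vector_mult_def)
        then show ?thesis
          unfolding cols[of "T A"] cols[of A]
          using U by (simp add: orthogonal_transformation_def)
      qed
      ultimately show ?thesis by (simp add: orthogonal_transformation_def)
    qed
    have T_meas: "T \<in> borel_measurable borel"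
      by (intro borel_measurable_continuous_onI linear_continuous_on)
        (use T in \<open>simp add: linear_conv_bounded_linear[symmetric] orthogonal_transformation_linear\<close>)
    have TX: "T -` X = X"
      using detQ orthogonal_transformation_norm[OF T]
      by (auto simp: X_def T_def det_mul)
    have "distr \<gamma> borel T = \<gamma>"
    proof (rule measure_eqI)
      fix A assume "A \<in> sets (distr \<gamma> borel T)"
      then have [measurable]: "A \<in> sets borel" by simp
      have TA [measurable]: "T -` A \<in> sets borel"
        using measurable_sets[OF T_meas, of A] by simp
      have "emeasure (distr \<gamma> borel T) A = emeasure \<gamma> (T -` A)"
        using T_meas by (subst emeasure_distr) (auto simp: space_\<gamma> sets_\<gamma> cong: measurable_cong_sets)
      also have "\<dots> = emeasure lborel (T -` (X \<inter> A)) / emeasure lborel X"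
        using TX by (simp add: \<gamma>_def vimage_Int)
      also have "emeasure lborel (T -` (X \<inter> A)) = emeasure (distr lborel borel T) (X \<inter> A)"
        using T_meas by (subst emeasure_distr) auto
      also have "\<dots> / emeasure lborel X = emeasure \<gamma> A"
        by (simp add: lborel_distr_isometry[OF T] \<gamma>_def)
      finally show "emeasure (distr \<gamma> borel T) A = emeasure \<gamma> A" .
    qed (simp add: sets_\<gamma>)
    note T_inv = this
    have U_meas: "(`) U \<in> measurable G G"
      unfolding G_def flat_borel_def
    proof (rule measurable_vimage_algebra2)
      show "(`) U \<in> space (vimage_algebra (linear_grassmannian k) flat_coords borel)
          \<rightarrow> linear_grassmannian k"
        using orthogonal_image_linear_grassmannian[OF U] by auto
      have eq: "flat_coords (U ` E) = (0, Q ** snd (flat_coords E) ** transpose Q)"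
        if "E \<in> linear_grassmannian k" for E
      proof -
        have E: "subspace E" using that by (simp add: linear_grassmannian_def)
        have UE: "subspace (U ` E)"
          using orthogonal_image_linear_grassmannian[OF U that]
          by (simp add: linear_grassmannian_def)
        have "matrix (closest_point (U ` E)) = Q ** matrix (closest_point E) ** transpose Q"
        proof (rule matrix_eq[THEN iffD2], rule allI)
          fix x
          have QQ: "Q *v (transpose Q *v x) = x"
            using orthQ by (simp add: orthogonal_matrix_def matrix_vector_mul_assoc
                del: transpose_matrix_vector)
          have "matrix (closest_point (U ` E)) *v x = closest_point (U ` E) x"
            using linear_closest_point[OF UE] by simp
          also have "\<dots> = closest_point (U ` E) (U (transpose Q *v x))"
            by (simp add: UQ QQ del: transpose_matrix_vector)
          also have "\<dots> = U (closest_point E (transpose Q *v x))"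
            by (rule closest_point_orthogonal_image[OF U E])
          also have "\<dots> = (Q ** matrix (closest_point E) ** transpose Q) *v x"
            using linear_closest_point[OF E]
            by (simp add: UQ matrix_vector_mul_assoc[symmetric] del: transpose_matrix_vector)
          finally show "matrix (closest_point (U ` E)) *v x =
              (Q ** matrix (closest_point E) ** transpose Q) *v x" .
        qed
        then show ?thesis by (simp add: flat_coords_subspace[OF E] flat_coords_subspace[OF UE])
      qed
      have c: "continuous_on UNIV (\<lambda>p :: (real^'n) \<times> (real^'n^'n).
          (0 :: real^'n, Q ** snd p ** transpose Q))"
      proof (intro continuous_on_Pair continuous_on_const)
        have eq: "(\<lambda>p :: (real^'n) \<times> (real^'n^'n). Q ** snd p ** transpose Q) =
           (\<lambda>p. \<chi> i j. \<Sum>l\<in>UNIV. (\<Sum>m\<in>UNIV. Q $ i $ m * snd p $ m $ l) * transpose Q $ l $ j)"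
          by (simp add: matrix_matrix_mult_def)
        show "continuous_on UNIV (\<lambda>p :: (real^'n) \<times> (real^'n^'n).
            Q ** snd p ** transpose Q)"
          unfolding eq by (intro continuous_intros)
      qed
      have "(\<lambda>E. (0 :: real^'n, Q ** snd (flat_coords E) ** transpose Q)) \<in>
          borel_measurable (vimage_algebra (linear_grassmannian k) flat_coords borel)"
        by (rule measurable_compose[OF measurable_vimage_algebra1
              borel_measurable_continuous_onI[OF c]]) simp
      then show "(\<lambda>E. flat_coords (U ` E)) \<in>
          borel_measurable (vimage_algebra (linear_grassmannian k) flat_coords borel)"
        by (rule measurable_cong[THEN iffD1, rotated]) (simp add: eq)
    qed
    have AE: "AE A in \<gamma>. U ` \<Psi> A = \<Psi> (T A)"
    proof -
      have "U ` \<Psi> A = \<Psi> (T A)" if "A \<in> X" for A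
        using that detQ
        by (auto simp: X_def \<Psi>_def T_def det_mul UQ image_image matrix_vector_mul_assoc)
      then show ?thesis
        unfolding \<gamma>_def by (intro AE_uniform_measureI) auto
    qed
    have T_meas': "T \<in> measurable \<gamma> borel"
      using T_meas by (simp cong: measurable_cong_sets add: sets_\<gamma>)
    have "distr \<mu> \<mu> ((`) U) = distr \<mu> G ((`) U)"
      by (rule distr_cong) (simp_all add: sets_\<mu>)
    also have "\<dots> = distr \<gamma> G ((`) U \<circ> \<Psi>)"
      unfolding \<mu>_def using U_meas \<Psi>_meas' by (rule distr_distr)
    also have "\<dots> = distr \<gamma> G (\<Psi> \<circ> T)"
      using AE U_meas \<Psi>_meas \<Psi>_meas' T_meas'
      by (intro distr_cong_AE) (auto intro: measurable_comp)
    also have "\<dots> = distr (distr \<gamma> borel T) G \<Psi>"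
      using \<Psi>_meas T_meas' by (rule distr_distr[symmetric])
    also have "\<dots> = \<mu>" by (simp add: T_inv \<mu>_def)
    finally show ?thesis .
  qed
  ultimately show ?thesis
    unfolding grassmannian_haar_def G_def by blast
qed

corollary grassmannian_measure_haar:
  "k \<le> CARD('n) \<Longrightarrow> grassmannian_haar k (grassmannian_measure k :: (real^'n) set measure)"
  unfolding grassmannian_measure_def using grassmannian_haar_exists by (rule someI_ex)

end

theory Submission
  imports Defs
begin

text \<open>
  The affine Blaschke-Petkantschin formula writes \<open>(\<integral> f)\<^sup>k\<^sup>+\<^sup>1\<close> as a constant times the integral
  over all \<open>k\<close>-flats \<open>F\<close> of the energy of \<open>f\<close> on \<open>F\<close>: the integral over \<open>F\<^sup>k\<^sup>+\<^sup>1\<close> of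
  \<open>\<Delta>(x\<^sub>0, \<dots>, x\<^sub>k)\<^sup>n\<^sup>-\<^sup>k f(x\<^sub>0) \<cdots> f(x\<^sub>k)\<close>, with \<open>\<Delta>\<close> the volume of the parallelepiped spanned by
  the differences \<open>x\<^sub>i - x\<^sub>0\<close>. Its linear version holds because integration over tuples of vectors
  induces, through the spanned subspace, a finite orthogonally invariant measure on the Grassmannian,
  and such a measure is unique up to a factor. By Groemer's inequality, proved by Steiner
  symmetrization along coordinate lines, the energy of a function with values in \<open>[0, 1]\<close> and given
  integral is least for the indicator of a ball; applied to \<open>f / \<parallel>f|\<^sub>F\<parallel>\<^sub>\<infinity>\<close> it bounds the integrand
  by a multiple of the energy on each flat. The constants are found by evaluating the formula at the
  indicator of the unit ball.
\<close>

section \<open>Finite powers of a measure\<close>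

text \<open>Three obstacles shape the proof. A measure on a subspace E is built from a chosen basis,
  which hides its measurable dependence on E; integrals over E are therefore rewritten as integrals
  over the unit cylinder around E, which involve only the projection matrix of E and are Borel in
  that matrix. No density on the Grassmannian is at hand; instead a tuple X is averaged over its
  linear substitutions X Z, and the powers of the Gram volume arise as Jacobians. Finally f is only
  Lebesgue measurable, so it has to be changed on a null set M, and almost every flat must meet M in
  a null set; this follows from the formula and Groemer's inequality applied to the indicator of M.
  Tuples of k vectors are indexed by a set S of k coordinate indices, and k by k matrices are padded
  by the identity to matrices over all indices. The base vertex of a simplex gets an index outside
  S, which exists because k < n. The constant of the Blaschke-Petkantschin formula is never
  computed: it cancels between the ball and f.\<close>

abbreviation powM :: "'i set \<Rightarrow> 'a measure \<Rightarrow> ('i \<Rightarrow> 'a) measure" where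
  "powM I M \<equiv> PiM I (\<lambda>_. M)"

lemma (in sigma_finite_measure) product_power: "product_sigma_finite (\<lambda>_. M)"
  by (simp add: product_sigma_finite_def sigma_finite_measure_axioms)

lemma distr_PiM_reindex_finite:
  assumes M: "sigma_finite_measure M" and fin: "finite A" and h: "bij_betw h A A'"
  shows "distr (powM A' M) (powM A M) (\<lambda>c. \<lambda>a\<in>A. c (h a)) = powM A M"
proof -
  interpret sigma_finite_measure M by fact
  interpret product_sigma_finite "\<lambda>_. M" by (rule product_power)
  have fin': "finite A'" using fin h by (simp add: bij_betw_finite)
  have hA: "h a \<in> A'" if "a \<in> A" for a using h that by (auto simp: bij_betw_def)
  have [measurable]: "(\<lambda>c. \<lambda>a\<in>A. c (h a)) \<in> measurable (powM A' M) (powM A M)"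
    by (intro measurable_restrict measurable_component_singleton hA)
  show ?thesis
  proof (rule PiM_eqI[OF fin])
    fix X assume X: "\<And>i. i \<in> A \<Longrightarrow> X i \<in> sets M"
    define g where "g = inv_into A h"
    have g: "g a' \<in> A" "h (g a') = a'" if "a' \<in> A'" for a'
      using h that by (auto simp: g_def bij_betw_def intro: inv_into_into f_inv_into_f)
    have gh: "g (h a) = a" if "a \<in> A" for a
      using h that by (simp add: g_def bij_betw_def)
    have eq: "(\<lambda>c. \<lambda>a\<in>A. c (h a)) -` Pi\<^sub>E A X \<inter> space (powM A' M) = Pi\<^sub>E A' (\<lambda>a'. X (g a'))"
      (is "?L = ?R")
    proof (intro equalityI subsetI)
      fix c assume c: "c \<in> ?L"
      have "c a' \<in> X (g a')" if "a' \<in> A'" for a'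
      proof -
        have "(\<lambda>a\<in>A. c (h a)) (g a') \<in> X (g a')" using c g(1)[OF that] unfolding vimage_def Int_iff mem_Collect_eq PiE_iff by blast
        then show ?thesis using g[OF that] by (simp add: restrict_def)
      qed
      then show "c \<in> ?R" using c by (auto simp: space_PiM PiE_iff)
    next
      fix c assume c: "c \<in> ?R"
      have "c (h a) \<in> X a" if "a \<in> A" for a
        using c hA[OF that] gh[OF that] by (metis PiE_mem)
      moreover have "c \<in> space (powM A' M)"
        using c X g sets.sets_into_space by (fastforce simp: space_PiM PiE_iff)
      ultimately show "c \<in> ?L" by (auto simp: PiE_iff)
    qed
    have "emeasure (distr (powM A' M) (powM A M) (\<lambda>c. \<lambda>a\<in>A. c (h a))) (Pi\<^sub>E A X)
        = emeasure (powM A' M) (Pi\<^sub>E A' (\<lambda>a'. X (g a')))"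
      using X fin by (subst emeasure_distr) (simp_all add: eq sets_PiM_I_finite)
    also have "\<dots> = (\<Prod>a'\<in>A'. emeasure M (X (g a')))"
      using X g fin' by (intro emeasure_PiM) auto
    also have "\<dots> = (\<Prod>a\<in>A. emeasure M (X a))"
      by (rule prod.reindex_bij_betw[OF h, symmetric, THEN trans]) (simp add: gh cong: prod.cong)
    finally show "emeasure (distr (powM A' M) (powM A M) (\<lambda>c. \<lambda>a\<in>A. c (h a))) (Pi\<^sub>E A X)
        = (\<Prod>a\<in>A. emeasure M (X a))" .
  qed simp
qed

text \<open>Tonelli's theorem allows a substitution in every component of a tuple at once, with a
  constant Jacobian \<open>c i\<close> for each component. Scalings, translations, isometries and
  matrices acting on each vector of a tuple are all treated as instances.\<close>

lemma nn_integral_PiM_componentwise: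
  assumes M: "sigma_finite_measure M" and fin: "finite T"
    and h: "\<And>i. i \<in> T \<Longrightarrow> h i \<in> measurable M M"
    and c: "\<And>i g. i \<in> T \<Longrightarrow> g \<in> borel_measurable M \<Longrightarrow> c i * (\<integral>\<^sup>+x. g (h i x) \<partial>M) = (\<integral>\<^sup>+x. g x \<partial>M)"
    and G: "G \<in> borel_measurable (powM T M)"
  shows "(\<Prod>i\<in>T. c i) * (\<integral>\<^sup>+X. G (\<lambda>i\<in>T. h i (X i)) \<partial>powM T M) = (\<integral>\<^sup>+X. G X \<partial>powM T M)"
  using fin h c G
proof (induction T arbitrary: G rule: finite_induct)
  case empty
  interpret sigma_finite_measure M by fact
  interpret product_sigma_finite "\<lambda>_. M" by (rule product_power)
  show ?case by (simp add: nn_integral_empty restrict_def space_PiM)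
next
  case (insert i T)
  interpret sigma_finite_measure M by fact
  interpret product_sigma_finite "\<lambda>_. M" by (rule product_power)
  note [measurable] = insert.prems(3)
  have [measurable]: "h j \<in> measurable M M" if "j \<in> insert i T" for j by (rule insert.prems(1)[OF that])
  have hm: "(\<lambda>X. \<lambda>j\<in>insert i T. h j (X j)) \<in> measurable (powM (insert i T) M) (powM (insert i T) M)"
    by (rule measurable_restrict) (rule measurable_compose[OF measurable_component_singleton], auto)
  have hm': "(\<lambda>X. \<lambda>j\<in>T. h j (X j)) \<in> measurable (powM T M) (powM T M)"
    by (rule measurable_restrict) (rule measurable_compose[OF measurable_component_singleton], auto)
  have [simp]: "sigma_finite_measure (powM T M)" using insert(1) by (rule sigma_finite)
  have meas1[measurable]: "(\<lambda>X. \<integral>\<^sup>+y. G (X(i:=y)) \<partial>M) \<in> borel_measurable (powM T M)"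
    by (rule borel_measurable_nn_integral) measurable
  have "(\<Prod>j\<in>insert i T. c j) * (\<integral>\<^sup>+X. G (\<lambda>j\<in>insert i T. h j (X j)) \<partial>powM (insert i T) M)
     = (\<Prod>j\<in>T. c j) * (c i * (\<integral>\<^sup>+X. (\<integral>\<^sup>+y. G (\<lambda>j\<in>insert i T. h j ((X(i:=y)) j)) \<partial>M) \<partial>powM T M))"
    using insert(1,2) by (subst product_nn_integral_insert[OF insert(1,2)])
       (auto intro!: measurable_compose[OF hm] insert.prems simp: ac_simps)
  also have "(\<integral>\<^sup>+X. (\<integral>\<^sup>+y. G (\<lambda>j\<in>insert i T. h j ((X(i:=y)) j)) \<partial>M) \<partial>powM T M)
     = (\<integral>\<^sup>+X. (\<integral>\<^sup>+y. G ((\<lambda>j\<in>T. h j (X j))(i:=h i y)) \<partial>M) \<partial>powM T M)"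
    by (intro nn_integral_cong arg_cong[of _ _ G]) (use insert(2) in \<open>auto simp: fun_eq_iff\<close>)
  also have "c i * \<dots> = (\<integral>\<^sup>+X. c i * (\<integral>\<^sup>+y. G ((\<lambda>j\<in>T. h j (X j))(i:=h i y)) \<partial>M) \<partial>powM T M)"
  proof (rule nn_integral_cmult[symmetric])
    have "(\<lambda>(X,y). G (X(i:=h i y))) \<in> borel_measurable (powM T M \<Otimes>\<^sub>M M)"
      by measurable
    then have "(\<lambda>X. \<integral>\<^sup>+y. G (X(i:=h i y)) \<partial>M) \<in> borel_measurable (powM T M)"
      by (rule borel_measurable_nn_integral)
    from measurable_compose[OF hm' this]
    show "(\<lambda>X. \<integral>\<^sup>+y. G ((\<lambda>j\<in>T. h j (X j))(i:=h i y)) \<partial>M) \<in> borel_measurable (powM T M)" .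
  qed
  also have "\<dots> = (\<integral>\<^sup>+X. (\<integral>\<^sup>+y. G ((\<lambda>j\<in>T. h j (X j))(i:=y)) \<partial>M) \<partial>powM T M)"
  proof (rule nn_integral_cong)
    fix X assume X: "X \<in> space (powM T M)"
    have "(\<lambda>j\<in>T. h j (X j)) \<in> space (powM T M)"
      using measurable_space[OF hm' X] .
    then have "(\<lambda>y. G ((\<lambda>j\<in>T. h j (X j))(i:=y))) \<in> borel_measurable M"
      using insert(2) by measurable
    then show "c i * (\<integral>\<^sup>+y. G ((\<lambda>j\<in>T. h j (X j))(i:=h i y)) \<partial>M) = (\<integral>\<^sup>+y. G ((\<lambda>j\<in>T. h j (X j))(i:=y)) \<partial>M)"
      by (rule insert.prems(2)[OF insertI1])
  qed
  also have "(\<Prod>j\<in>T. c j) * \<dots> = (\<integral>\<^sup>+X. (\<integral>\<^sup>+y. G (X(i:=y)) \<partial>M) \<partial>powM T M)"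
    by (rule insert.IH[OF insert.prems(1,2) meas1]) auto
  also have "\<dots> = (\<integral>\<^sup>+X. G X \<partial>powM (insert i T) M)"
    by (rule product_nn_integral_insert[symmetric]) (use insert in auto)
  finally show ?case .
qed

text \<open>Steiner symmetrization freezes the feet of all lines before any position on a line is
  integrated, so the variables of a whole tuple have to be regrouped. By Tonelli's theorem the
  factors commute, one index at a time.\<close>

lemma nn_integral_PiM_split:
  assumes M: "sigma_finite_measure M" and N: "sigma_finite_measure N" and L: "sigma_finite_measure L"
    and fin: "finite T"
    and \<phi>: "case_prod \<phi> \<in> measurable (M \<Otimes>\<^sub>M N) L"
    and s: "\<And>g. g \<in> borel_measurable L \<Longrightarrow> (\<integral>\<^sup>+x. g x \<partial>L) = (\<integral>\<^sup>+u. \<integral>\<^sup>+z. g (\<phi> u z) \<partial>N \<partial>M)"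
    and G: "G \<in> borel_measurable (powM T L)"
  shows "(\<integral>\<^sup>+X. G X \<partial>powM T L)
     = (\<integral>\<^sup>+y. \<integral>\<^sup>+z. G (\<lambda>i\<in>T. \<phi> (y i) (z i)) \<partial>powM T N \<partial>powM T M)"
  using fin G
proof (induction T arbitrary: G rule: finite_induct)
  case empty
  interpret M: product_sigma_finite "\<lambda>_. M" by (rule sigma_finite_measure.product_power[OF M])
  interpret N: product_sigma_finite "\<lambda>_. N" by (rule sigma_finite_measure.product_power[OF N])
  interpret L: product_sigma_finite "\<lambda>_. L" by (rule sigma_finite_measure.product_power[OF L])
  show ?case by (simp add: M.nn_integral_empty N.nn_integral_empty L.nn_integral_empty restrict_def space_PiM)
next
  case (insert i T)
  interpret M0: sigma_finite_measure M by fact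
  interpret N0: sigma_finite_measure N by fact
  interpret L0: sigma_finite_measure L by fact
  interpret M: product_sigma_finite "\<lambda>_. M" by (rule sigma_finite_measure.product_power[OF M])
  interpret N: product_sigma_finite "\<lambda>_. N" by (rule sigma_finite_measure.product_power[OF N])
  interpret L: product_sigma_finite "\<lambda>_. L" by (rule sigma_finite_measure.product_power[OF L])
  note [measurable] = insert.prems \<phi>
  interpret PM: sigma_finite_measure "powM T M" using insert(1) by (rule M.sigma_finite)
  interpret PN: sigma_finite_measure "powM T N" using insert(1) by (rule N.sigma_finite)
  interpret PP: pair_sigma_finite M "powM T N" ..
  let ?M = "powM T M" and ?N = "powM T N"
  have r: "(\<lambda>(X,Z). \<lambda>j\<in>T. \<phi> (X j) (Z j)) \<in> measurable (?M \<Otimes>\<^sub>M ?N) (powM T L)"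
    unfolding split_beta by (rule measurable_restrict) measurable
  have r': "(\<lambda>(X,Z). \<lambda>j\<in>insert i T. \<phi> (X j) (Z j)) \<in>
      measurable (powM (insert i T) M \<Otimes>\<^sub>M powM (insert i T) N) (powM (insert i T) L)"
    unfolding split_beta by (rule measurable_restrict) measurable
  note [measurable] = r r'
  have m1: "(\<lambda>X. \<integral>\<^sup>+x. G (X(i:=x)) \<partial>L) \<in> borel_measurable (powM T L)"
    by (rule L0.borel_measurable_nn_integral) measurable
  have "(\<integral>\<^sup>+X. G X \<partial>powM (insert i T) L) = (\<integral>\<^sup>+X. \<integral>\<^sup>+x. G (X(i:=x)) \<partial>L \<partial>powM T L)"
    by (rule L.product_nn_integral_insert) (use insert in auto)
  also have "\<dots> = (\<integral>\<^sup>+y. \<integral>\<^sup>+z. (\<integral>\<^sup>+x. G ((\<lambda>j\<in>T. \<phi> (y j) (z j))(i:=x)) \<partial>L) \<partial>?N \<partial>?M)"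
    by (rule insert.IH[OF m1])
  also have "\<dots> = (\<integral>\<^sup>+y. \<integral>\<^sup>+z. (\<integral>\<^sup>+u. \<integral>\<^sup>+v. G ((\<lambda>j\<in>T. \<phi> (y j) (z j))(i:=\<phi> u v)) \<partial>N \<partial>M) \<partial>?N \<partial>?M)"
  proof (intro nn_integral_cong)
    fix y z assume yz: "y \<in> space ?M" "z \<in> space ?N"
    have "(\<lambda>j\<in>T. \<phi> (y j) (z j)) \<in> space (powM T L)"
      using measurable_space[OF r, of "(y,z)"] yz by (simp add: space_pair_measure)
    then have "(\<lambda>x. G ((\<lambda>j\<in>T. \<phi> (y j) (z j))(i:=x))) \<in> borel_measurable L"
      using insert(2) by measurable
    from s[OF this] show "(\<integral>\<^sup>+x. G ((\<lambda>j\<in>T. \<phi> (y j) (z j))(i:=x)) \<partial>L) =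
       (\<integral>\<^sup>+u. \<integral>\<^sup>+v. G ((\<lambda>j\<in>T. \<phi> (y j) (z j))(i:=\<phi> u v)) \<partial>N \<partial>M)" .
  qed
  \<comment> \<open>The new \<open>M\<close>-variable \<open>u\<close> moves outside the old
    \<open>N\<close>-variables \<open>z\<close>; this exchange is the heart of the
    regrouping.\<close>
  also have "\<dots> = (\<integral>\<^sup>+y. \<integral>\<^sup>+u. \<integral>\<^sup>+z. \<integral>\<^sup>+v. G ((\<lambda>j\<in>T. \<phi> (y j) (z j))(i:=\<phi> u v)) \<partial>N \<partial>?N \<partial>M \<partial>?M)"
  proof (intro nn_integral_cong)
    fix y assume y: "y \<in> space ?M"
    have "(\<lambda>p. \<lambda>j\<in>T. \<phi> (y j) (p j)) \<in> measurable ?N (powM T L)"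
      proof (rule measurable_restrict)
      fix j assume j: "j \<in> T"
      have yj: "y j \<in> space M" using y j by (auto simp: space_PiM PiE_iff)
      show "(\<lambda>p. \<phi> (y j) (p j)) \<in> measurable ?N L"
        using measurable_compose[OF measurable_component_singleton[OF j] measurable_Pair2[OF \<phi> yj]] by simp
    qed
    note [measurable] = this
    have "(\<lambda>q. (\<lambda>j\<in>T. \<phi> (y j) (snd (fst q) j))(i:=\<phi> (fst (fst q)) (snd q))) \<in> measurable ((M \<Otimes>\<^sub>M ?N) \<Otimes>\<^sub>M N) (powM (insert i T) L)"
      by (intro measurable_fun_upd[where J=T]) auto
    then have "(\<lambda>q. G ((\<lambda>j\<in>T. \<phi> (y j) (snd (fst q) j))(i:=\<phi> (fst (fst q)) (snd q)))) \<in> borel_measurable ((M \<Otimes>\<^sub>M ?N) \<Otimes>\<^sub>M N)"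
      by measurable
    then have "(\<lambda>(u,z). \<integral>\<^sup>+v. G ((\<lambda>j\<in>T. \<phi> (y j) (z j))(i:=\<phi> u v)) \<partial>N) \<in> borel_measurable (M \<Otimes>\<^sub>M ?N)"
      unfolding split_beta by (rule N0.borel_measurable_nn_integral[of "\<lambda>q v. G ((\<lambda>j\<in>T. \<phi> (y j) (snd q j))(i:=\<phi> (fst q) v))", unfolded split_beta])
    from PP.Fubini'[OF this] show "(\<integral>\<^sup>+z. \<integral>\<^sup>+u. \<integral>\<^sup>+v. G ((\<lambda>j\<in>T. \<phi> (y j) (z j))(i:=\<phi> u v)) \<partial>N \<partial>M \<partial>?N) =
       (\<integral>\<^sup>+u. \<integral>\<^sup>+z. \<integral>\<^sup>+v. G ((\<lambda>j\<in>T. \<phi> (y j) (z j))(i:=\<phi> u v)) \<partial>N \<partial>?N \<partial>M)" .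
  qed
  also have "\<dots> = (\<integral>\<^sup>+y. \<integral>\<^sup>+u. \<integral>\<^sup>+z. \<integral>\<^sup>+v. G (\<lambda>j\<in>insert i T. \<phi> ((y(i:=u)) j) ((z(i:=v)) j)) \<partial>N \<partial>?N \<partial>M \<partial>?M)"
    by (intro nn_integral_cong arg_cong[of _ _ G]) (use insert(2) in \<open>auto simp: fun_eq_iff\<close>)
  also have "\<dots> = (\<integral>\<^sup>+y. \<integral>\<^sup>+u. \<integral>\<^sup>+z. G (\<lambda>j\<in>insert i T. \<phi> ((y(i:=u)) j) (z j)) \<partial>powM (insert i T) N \<partial>M \<partial>?M)"
  proof (intro nn_integral_cong)
    fix y u assume yu: "y \<in> space ?M" "u \<in> space M"
    have "y(i:=u) \<in> space (powM (insert i T) M)" using yu by (auto simp: space_PiM PiE_iff extensional_def)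
    from measurable_compose[OF measurable_Pair2[OF r' this] insert.prems]
    have "(\<lambda>z. G (\<lambda>j\<in>insert i T. \<phi> ((y(i:=u)) j) (z j))) \<in> borel_measurable (powM (insert i T) N)"
      unfolding split_conv .
    from N.product_nn_integral_insert[OF insert(1,2) this, symmetric]
    show "(\<integral>\<^sup>+z. \<integral>\<^sup>+v. G (\<lambda>j\<in>insert i T. \<phi> ((y(i:=u)) j) ((z(i:=v)) j)) \<partial>N \<partial>?N) =
      (\<integral>\<^sup>+z. G (\<lambda>j\<in>insert i T. \<phi> ((y(i:=u)) j) (z j)) \<partial>powM (insert i T) N)" .
  qed
  also have "\<dots> = (\<integral>\<^sup>+y. \<integral>\<^sup>+z. G (\<lambda>j\<in>insert i T. \<phi> (y j) (z j)) \<partial>powM (insert i T) N \<partial>powM (insert i T) M)"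
  proof (rule M.product_nn_integral_insert[OF insert(1,2), symmetric])
    interpret PN': sigma_finite_measure "powM (insert i T) N" using insert(1) by (intro N.sigma_finite) simp
    show "(\<lambda>y. \<integral>\<^sup>+z. G (\<lambda>j\<in>insert i T. \<phi> (y j) (z j)) \<partial>powM (insert i T) N) \<in> borel_measurable (powM (insert i T) M)"
      by (rule PN'.borel_measurable_nn_integral)
        (use measurable_compose[OF r' insert.prems] in \<open>simp add: split_beta\<close>)
  qed
  finally show ?case .
qed

lemma AE_PiM_component_finite:
  assumes M: "sigma_finite_measure M" and fin: "finite T" and i: "i \<in> T" and AE: "AE x in M. P x"
  shows "AE X in powM T M. P (X i)"
proof -
  interpret sigma_finite_measure M by fact
  interpret product_sigma_finite "\<lambda>_. M" by (rule product_power)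
  from AE obtain N where N: "{x\<in>space M. \<not> P x} \<subseteq> N" "N \<in> sets M" "emeasure M N = 0"
    by (auto elim!: AE_E)
  let ?B = "Pi\<^sub>E T (\<lambda>j. if j = i then N else space M)"
  have "emeasure (powM T M) ?B = (\<Prod>j\<in>T. emeasure M (if j = i then N else space M))"
    using fin N by (intro emeasure_PiM) auto
  also have "\<dots> = 0" using fin i N by (auto intro!: prod_zero)
  finally have "?B \<in> null_sets (powM T M)"
    using fin N by (auto intro!: sets_PiM_I_finite)
  moreover have "{X \<in> space (powM T M). \<not> P (X i)} \<subseteq> ?B"
    using N i by (auto simp: space_PiM PiE_iff extensional_def)
  ultimately show ?thesis by (rule AE_I')
qed

section \<open>Lebesgue measure on linear subspaces\<close>

definition orthonormal_set :: "'a::euclidean_space set \<Rightarrow> bool" where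
  "orthonormal_set B \<longleftrightarrow> (\<forall>x\<in>B. \<forall>y\<in>B. x \<bullet> y = (if x = y then 1 else 0))"

text \<open>The measure lives on the Borel sets of the whole space and is concentrated on the span.
  Measures on different subspaces thus share one sigma-algebra, and integrands need not be
  restricted. Coordinates are indexed by the basis vectors themselves; for orthonormal
  \<open>B\<close> only the span matters, by \<open>span_lborel_cong\<close>.\<close>

definition span_lborel :: "'a::euclidean_space set \<Rightarrow> 'a measure" where
  "span_lborel B = distr (\<Pi>\<^sub>M b\<in>B. lborel) borel (\<lambda>c. \<Sum>b\<in>B. c b *\<^sub>R b)"

abbreviation ball_vol :: "nat \<Rightarrow> ennreal" where
  "ball_vol m \<equiv> ennreal (unit_ball_vol (real m))"

lemma sets_span_lborel [simp, measurable_cong]: "sets (span_lborel B) = sets borel"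
  and space_span_lborel [simp]: "space (span_lborel B) = UNIV"
  by (simp_all add: span_lborel_def)

lemma orthonormal_set_pairwise: "orthonormal_set B \<Longrightarrow> pairwise orthogonal B"
  by (auto simp: orthonormal_set_def pairwise_def orthogonal_def)

lemma orthonormal_set_norm: "orthonormal_set B \<Longrightarrow> b \<in> B \<Longrightarrow> norm b = 1"
  by (simp add: orthonormal_set_def norm_eq_sqrt_inner)

lemma orthonormal_set_independent: "orthonormal_set B \<Longrightarrow> independent B"
  by (rule pairwise_orthogonal_independent[OF orthonormal_set_pairwise])
    (auto dest: orthonormal_set_norm)

lemma orthonormal_set_finite: "orthonormal_set B \<Longrightarrow> finite B"
  using orthonormal_set_independent independent_imp_finite by blast

lemma orthonormal_setI:
  assumes "pairwise orthogonal B" "\<And>b. b \<in> B \<Longrightarrow> norm b = 1"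
  shows "orthonormal_set B"
  unfolding orthonormal_set_def
proof (intro ballI)
  fix x y assume xy: "x \<in> B" "y \<in> B"
  have "x \<bullet> x = 1" using assms(2)[OF xy(1)] by (simp add: dot_square_norm)
  moreover have "x \<noteq> y \<Longrightarrow> x \<bullet> y = 0"
    using assms(1) xy unfolding pairwise_def orthogonal_def by blast
  ultimately show "x \<bullet> y = (if x = y then 1 else 0)" by metis
qed

lemma orthonormal_set_Basis: "orthonormal_set (Basis :: 'a::euclidean_space set)"
  by (auto simp: orthonormal_set_def inner_Basis)

lemma orthonormal_set_card: "orthonormal_set (B :: 'a::euclidean_space set) \<Longrightarrow> card B = dim (span B)"
  by (simp add: dim_eq_card_independent orthonormal_set_independent)

lemma cball_borel [measurable]: "cball (a::'a::euclidean_space) r \<in> sets borel"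
  by (intro borel_closed closed_cball)

lemma orthonormal_set_basis_exists:
  fixes S :: "'a::euclidean_space set"
  assumes "subspace S"
  shows "\<exists>B. orthonormal_set B \<and> card B = dim S \<and> span B = S"
proof -
  obtain B where B: "pairwise orthogonal B" "\<And>x. x \<in> B \<Longrightarrow> norm x = 1" "card B = dim S" "span B = S"
    using orthonormal_basis_subspace[OF assms] by metis
  then show ?thesis using orthonormal_setI[OF B(1,2)] by blast
qed

lemma orthonormal_set_extend:
  fixes B :: "'a::euclidean_space set"
  assumes B: "orthonormal_set B"
  obtains C where "orthonormal_set C" "B \<inter> C = {}" "orthonormal_set (B \<union> C)"
    "card B + card C = DIM('a)" "span C = {y. \<forall>x\<in>span B. orthogonal x y}"
proof -
  let ?E = "{y. \<forall>x\<in>span B. orthogonal x y}"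
  have "subspace ?E" by (rule subspace_orthogonal_to_vectors)
  from orthonormal_set_basis_exists[OF this] obtain C
    where oC: "orthonormal_set C" and C: "card C = dim ?E" "span C = ?E" by blast
  have BC: "x \<bullet> y = 0" if "x \<in> B" "y \<in> C" for x y
    using span_base[OF that(2)] span_base[OF that(1)] C(2) by (auto simp: orthogonal_def)
  have ne: "x \<noteq> y" if "x \<in> B" "y \<in> C" for x y
    using BC[OF that] orthonormal_set_norm[OF B that(1)] dot_square_norm[of x] by auto
  have "orthonormal_set (B \<union> C)"
    unfolding orthonormal_set_def
  proof (intro ballI)
    fix x y assume "x \<in> B \<union> C" "y \<in> B \<union> C"
    moreover have "x \<bullet> y = 0 \<and> x \<noteq> y" if "x \<in> C" "y \<in> B"
      using BC[OF that(2,1)] ne[OF that(2,1)] by (metis inner_commute)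
    ultimately show "x \<bullet> y = (if x = y then 1 else 0)"
      using BC[of x y] ne[of x y] B oC unfolding orthonormal_set_def by (metis Un_iff)
  qed
  moreover have "B \<inter> C = {}" using ne by blast
  moreover have "dim ?E + dim (span B) = DIM('a)"
    using dim_subspace_orthogonal_to_vectors[of "span B" "UNIV :: 'a set"] by simp
  ultimately show ?thesis using that[OF oC _ _ _ C(2)] C(1) orthonormal_set_card[OF B] by simp
qed

lemma sum_scaleR_in_span: "(\<Sum>b\<in>B. c b *\<^sub>R b) \<in> span B"
  by (intro span_sum span_scale span_base)

lemma measurable_sum_scaleR [measurable]:
  "(\<lambda>c. \<Sum>b\<in>B. c b *\<^sub>R (b::'a::euclidean_space)) \<in> borel_measurable (\<Pi>\<^sub>M b\<in>B. lborel)"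
  by measurable

lemma nn_integral_span_lborel:
  assumes [measurable]: "g \<in> borel_measurable borel"
  shows "(\<integral>\<^sup>+x. g x \<partial>span_lborel B) = (\<integral>\<^sup>+c. g (\<Sum>b\<in>B. c b *\<^sub>R b) \<partial>(\<Pi>\<^sub>M b\<in>B. lborel))"
  unfolding span_lborel_def by (subst nn_integral_distr) auto

lemma sigma_finite_lborel: "sigma_finite_measure lborel" ..

lemma product_sigma_finite_lborel: "product_sigma_finite (\<lambda>_. lborel)"
  by (rule sigma_finite_measure.product_power[OF sigma_finite_lborel])

lemma norm_sum_orthonormal:
  assumes B: "orthonormal_set B"
  shows "norm (\<Sum>b\<in>B. c b *\<^sub>R b) = sqrt (\<Sum>b\<in>B. (c b)\<^sup>2)"
proof -
  have "(norm (\<Sum>b\<in>B. c b *\<^sub>R b))\<^sup>2 = (\<Sum>b\<in>B. (norm (c b *\<^sub>R b))\<^sup>2)"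
    by (rule norm_sum_Pythagorean)
      (use B in \<open>auto simp: orthonormal_set_finite pairwise_def orthogonal_def orthonormal_set_def\<close>)
  also have "\<dots> = (\<Sum>b\<in>B. (c b)\<^sup>2)"
    by (intro sum.cong) (use B in \<open>auto simp: orthonormal_set_norm\<close>)
  finally show ?thesis by (metis norm_ge_zero real_sqrt_unique)
qed

lemma emeasure_span_lborel_cball:
  assumes B: "orthonormal_set B" and r: "r > 0"
  shows "emeasure (span_lborel B) (cball 0 r) = ennreal (unit_ball_vol (real (card B)) * r ^ card B)"
proof -
  have "emeasure (span_lborel B) (cball 0 r) =
     emeasure (\<Pi>\<^sub>M b\<in>B. lborel) ({f. sqrt (\<Sum>i\<in>B. (f i)\<^sup>2) \<le> r} \<inter> space (\<Pi>\<^sub>M b\<in>B. lborel))"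
    unfolding span_lborel_def
    by (subst emeasure_distr) (auto simp: norm_sum_orthonormal[OF B] intro!: arg_cong2[where f=emeasure])
  then show ?thesis using emeasure_cball_aux[OF orthonormal_set_finite[OF B] r] by simp
qed

lemma sigma_finite_span_lborel:
  assumes B: "orthonormal_set B"
  shows "sigma_finite_measure (span_lborel B)"
proof
  show "\<exists>A. countable A \<and> A \<subseteq> sets (span_lborel B) \<and> \<Union> A = space (span_lborel B) \<and>
     (\<forall>a\<in>A. emeasure (span_lborel B) a \<noteq> \<infinity>)"
  proof (intro exI conjI)
    show "countable (range (\<lambda>n::nat. cball (0::'a) (real n + 1)))" by simp
    show "\<Union> (range (\<lambda>n::nat. cball (0::'a) (real n + 1))) = space (span_lborel B)"
    proof -
      have "\<exists>n::nat. norm x \<le> real n + 1" for x :: 'a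
        using real_arch_simple[of "norm x"] by (metis add_increasing2 zero_le_one)
      then show ?thesis by auto
    qed
    show "\<forall>a\<in>range (\<lambda>n::nat. cball (0::'a) (real n + 1)). emeasure (span_lborel B) a \<noteq> \<infinity>"
      using emeasure_span_lborel_cball[OF B] by (auto simp: add_nonneg_pos)
  qed auto
qed

lemma AE_span_lborel: "AE x in span_lborel (B::'a::euclidean_space set). x \<in> span B"
  unfolding span_lborel_def
  by (subst AE_distr_iff) (auto simp: sum_scaleR_in_span closed_subspace borel_closed)

lemma nn_integral_span_lborel_Un:
  fixes B C :: "'a::euclidean_space set"
  assumes fin: "finite B" "finite C" and disj: "B \<inter> C = {}"
    and [measurable]: "G \<in> borel_measurable borel"
  shows "(\<integral>\<^sup>+x. G x \<partial>span_lborel (B \<union> C)) = (\<integral>\<^sup>+u. \<integral>\<^sup>+z. G (u + z) \<partial>span_lborel C \<partial>span_lborel B)"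
proof -
  interpret product_sigma_finite "\<lambda>_::'a. lborel :: real measure" by (rule product_sigma_finite_lborel)
  interpret C: sigma_finite_measure "PiM C (\<lambda>_::'a. lborel :: real measure)" using fin(2) by (rule sigma_finite)
  have "(\<integral>\<^sup>+x. G x \<partial>span_lborel (B \<union> C))
     = (\<integral>\<^sup>+x. \<integral>\<^sup>+y. G (\<Sum>b\<in>B\<union>C. merge B C (x,y) b *\<^sub>R b) \<partial>powM C lborel \<partial>powM B lborel)"
    by (subst nn_integral_span_lborel) (auto intro!: product_nn_integral_fold disj fin)
  also have "\<dots> = (\<integral>\<^sup>+x. \<integral>\<^sup>+y. G ((\<Sum>b\<in>B. x b *\<^sub>R b) + (\<Sum>b\<in>C. y b *\<^sub>R b)) \<partial>powM C lborel \<partial>powM B lborel)"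
  proof (intro nn_integral_cong arg_cong[where f=G])
    fix x y :: "'a \<Rightarrow> real"
    have "(\<Sum>b\<in>B\<union>C. merge B C (x,y) b *\<^sub>R b) = (\<Sum>b\<in>B. merge B C (x,y) b *\<^sub>R b) + (\<Sum>b\<in>C. merge B C (x,y) b *\<^sub>R b)"
      using fin disj by (rule sum.union_disjoint)
    also have "(\<Sum>b\<in>B. merge B C (x,y) b *\<^sub>R b) = (\<Sum>b\<in>B. x b *\<^sub>R b)"
      by (intro sum.cong) (auto simp: merge_def)
    also have "(\<Sum>b\<in>C. merge B C (x,y) b *\<^sub>R b) = (\<Sum>b\<in>C. y b *\<^sub>R b)"
      using disj by (intro sum.cong) (auto simp: merge_def)
    finally show "(\<Sum>b\<in>B\<union>C. merge B C (x,y) b *\<^sub>R b) = (\<Sum>b\<in>B. x b *\<^sub>R b) + (\<Sum>b\<in>C. y b *\<^sub>R b)" .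
  qed
  also have "\<dots> = (\<integral>\<^sup>+x. \<integral>\<^sup>+z. G ((\<Sum>b\<in>B. x b *\<^sub>R b) + z) \<partial>span_lborel C \<partial>powM B lborel)"
    by (intro nn_integral_cong) (simp add: nn_integral_span_lborel)
  also have "\<dots> = (\<integral>\<^sup>+u. \<integral>\<^sup>+z. G (u + z) \<partial>span_lborel C \<partial>span_lborel B)"
  proof -
    have "(\<lambda>u. \<integral>\<^sup>+y. G (u + (\<Sum>b\<in>C. y b *\<^sub>R b)) \<partial>powM C lborel) \<in> borel_measurable borel"
      by (rule C.borel_measurable_nn_integral) measurable
    then show ?thesis
      by (subst nn_integral_span_lborel[where B=B]) (simp_all add: nn_integral_span_lborel)
  qed
  finally show ?thesis .
qed

lemma distr_span_lborel:
  fixes T :: "'a::euclidean_space \<Rightarrow> 'b::euclidean_space"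
  assumes T: "linear T" and inj: "inj_on T B" and fin: "finite B"
  shows "distr (span_lborel B) borel T = span_lborel (T ` B)"
proof -
  have [measurable]: "T \<in> borel_measurable borel"
    using T by (intro borel_measurable_continuous_onI linear_continuous_on) (simp add: linear_conv_bounded_linear)
  have *: "distr (powM (T ` B) lborel) (powM B lborel) (\<lambda>c. \<lambda>a\<in>B. c (T a)) = powM B (lborel :: real measure)"
    by (rule distr_PiM_reindex_finite[OF sigma_finite_lborel fin]) (use inj in \<open>simp add: bij_betw_def\<close>)
  have m: "(\<lambda>c. \<lambda>a\<in>B. c (T a)) \<in> measurable (powM (T ` B) lborel) (powM B (lborel :: real measure))"
    by (intro measurable_restrict measurable_component_singleton) auto
  have "distr (span_lborel B) borel T = distr (powM B lborel) borel (\<lambda>c. T (\<Sum>b\<in>B. c b *\<^sub>R b))"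
    unfolding span_lborel_def by (subst distr_distr) (auto simp: comp_def)
  also have "\<dots> = distr (powM B lborel) borel (\<lambda>c. \<Sum>b\<in>B. c b *\<^sub>R T b)"
    using T by (simp add: linear_sum linear_cmul)
  also have "\<dots> = distr (powM (T ` B) lborel) borel ((\<lambda>c. \<Sum>b\<in>B. c b *\<^sub>R T b) \<circ> (\<lambda>c. \<lambda>a\<in>B. c (T a)))"
    by (subst *[symmetric], rule distr_distr[OF _ m]) measurable
  also have "(\<lambda>c. \<Sum>b\<in>B. c b *\<^sub>R T b) \<circ> (\<lambda>c. \<lambda>a\<in>B. c (T a)) = (\<lambda>c. \<Sum>b\<in>T ` B. c b *\<^sub>R b)"
    using inj by (simp add: fun_eq_iff sum.reindex)
  finally show ?thesis by (simp add: span_lborel_def)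
qed

lemma orthonormal_bij_transformation:
  fixes f :: "'a::euclidean_space \<Rightarrow> 'a"
  assumes B: "orthonormal_set B" and B': "orthonormal_set B'" and f: "bij_betw f B B'" and card: "card B = DIM('a)"
  obtains T where "orthogonal_transformation T" "\<And>b. b \<in> B \<Longrightarrow> T b = f b"
proof -
  obtain T where T: "linear T" "\<And>b. b \<in> B \<Longrightarrow> T b = f b"
    using linear_independent_extend[OF orthonormal_set_independent[OF B], of f] by blast
  have "dim B = DIM('a)" using card orthonormal_set_card[OF B] by simp
  then have "span B = UNIV" by (simp add: dim_eq_full)
  moreover have "finite B" using B by (rule orthonormal_set_finite)
  ultimately have rep: "\<exists>c. x = (\<Sum>b\<in>B. c b *\<^sub>R b)" for x
    using span_finite[of B] by blast
  have "norm (T x) = norm x" for x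
  proof -
    obtain c where c: "x = (\<Sum>b\<in>B. c b *\<^sub>R b)" using rep by blast
    have "T x = (\<Sum>b\<in>B. c b *\<^sub>R f b)" unfolding c using T by (simp add: linear_sum linear_cmul)
    also have "\<dots> = (\<Sum>b\<in>B'. c (inv_into B f b) *\<^sub>R b)"
      using f by (subst sum.reindex_bij_betw[OF f, symmetric]) (simp add: bij_betw_def cong: sum.cong)
    also have "norm \<dots> = sqrt (\<Sum>b\<in>B'. (c (inv_into B f b))\<^sup>2)" by (rule norm_sum_orthonormal[OF B'])
    also have "(\<Sum>b\<in>B'. (c (inv_into B f b))\<^sup>2) = (\<Sum>b\<in>B. (c b)\<^sup>2)"
      using f by (subst sum.reindex_bij_betw[OF f, symmetric]) (simp add: bij_betw_def cong: sum.cong)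
    finally show ?thesis by (simp add: c norm_sum_orthonormal[OF B])
  qed
  then have "orthogonal_transformation T" using T(1) orthogonal_transformation by blast
  then show ?thesis using that T(2) by blast
qed

text \<open>An orthogonal transformation that carries the standard basis to \<open>B\<close>
  transports Lebesgue measure to the measure built from \<open>B\<close>, while Lebesgue measure is
  invariant under it.\<close>

lemma span_lborel_full:
  fixes B :: "'a::euclidean_space set"
  assumes B: "orthonormal_set B" and card: "card B = DIM('a)"
  shows "span_lborel B = lborel"
proof -
  obtain f where f: "bij_betw f (Basis::'a set) B"
    using card orthonormal_set_finite[OF B] by (metis finite_Basis finite_same_card_bij)
  obtain T where T: "orthogonal_transformation T" "\<And>b. b \<in> Basis \<Longrightarrow> T b = f b"
    using orthonormal_bij_transformation[OF orthonormal_set_Basis B f] by auto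
  have "lborel = distr lborel borel T" by (rule lborel_distr_isometry[OF T(1), symmetric])
  also have "\<dots> = distr (span_lborel Basis) borel T" by (simp add: span_lborel_def lborel_eq[symmetric])
  also have "\<dots> = span_lborel (T ` Basis)"
    by (rule distr_span_lborel[OF orthogonal_transformation_linear[OF T(1)]
          inj_on_subset[OF orthogonal_transformation_inj[OF T(1)] subset_UNIV] finite_Basis])
  also have "T ` Basis = B" using f T(2) by (simp add: bij_betw_def)
  finally show ?thesis by simp
qed

lemma nn_integral_lborel_orthogonal_split:
  fixes B C :: "'a::euclidean_space set"
  assumes BC: "orthonormal_set (B \<union> C)" "B \<inter> C = {}" "card B + card C = DIM('a)"
    and G: "G \<in> borel_measurable borel"
  shows "(\<integral>\<^sup>+x. G x \<partial>lborel) = (\<integral>\<^sup>+u. \<integral>\<^sup>+z. G (u + z) \<partial>span_lborel C \<partial>span_lborel B)"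
proof -
  have fin: "finite B" "finite C" using orthonormal_set_finite[OF BC(1)] by auto
  have "span_lborel (B \<union> C) = lborel"
    by (rule span_lborel_full[OF BC(1)]) (use BC fin in \<open>simp add: card_Un_disjoint\<close>)
  then show ?thesis using nn_integral_span_lborel_Un[OF fin BC(2) G] by simp
qed

lemma closest_point_span_add:
  fixes B C :: "'a::euclidean_space set"
  assumes "u \<in> span B" "\<And>x. x \<in> span B \<Longrightarrow> orthogonal x z"
  shows "closest_point (span B) (u + z) = u"
  by (rule closest_point_subspace_eq) (use assms in \<open>auto simp: orthogonal_def inner_commute\<close>)

lemma measurable_linear:
  fixes T :: "'a::euclidean_space \<Rightarrow> 'b::euclidean_space"
  shows "linear T \<Longrightarrow> T \<in> borel_measurable borel"
  by (intro borel_measurable_continuous_onI linear_continuous_on) (simp add: linear_conv_bounded_linear)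

lemma measurable_closest_point_span [measurable]:
  "closest_point (span B) \<in> borel_measurable (borel :: 'a::euclidean_space measure)"
  by (intro measurable_linear linear_closest_point subspace_span)

text \<open>Integration over a subspace as integration over a cylinder around it; unlike the
  definition of the measure, this depends on the orthogonal projection only.\<close>

lemma nn_integral_span_lborel_cylinder:
  fixes B :: "'a::euclidean_space set"
  assumes B: "orthonormal_set B" and [measurable]: "g \<in> borel_measurable borel"
  shows "ball_vol (DIM('a) - card B) * (\<integral>\<^sup>+x. g x \<partial>span_lborel B)
    = (\<integral>\<^sup>+x. g (closest_point (span B) x) * indicator (cball 0 1) (x - closest_point (span B) x) \<partial>lborel)"
proof -
  obtain C where C: "orthonormal_set C" "B \<inter> C = {}" "orthonormal_set (B \<union> C)"
    "card B + card C = DIM('a)" "span C = {y. \<forall>x\<in>span B. orthogonal x y}"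
    using orthonormal_set_extend[OF B] by metis
  let ?P = "closest_point (span B)"
  have "(\<integral>\<^sup>+x. g (?P x) * indicator (cball 0 1) (x - ?P x) \<partial>lborel)
     = (\<integral>\<^sup>+u. \<integral>\<^sup>+z. g (?P (u + z)) * indicator (cball 0 1) (u + z - ?P (u + z)) \<partial>span_lborel C \<partial>span_lborel B)"
    by (rule nn_integral_lborel_orthogonal_split[OF C(3,2,4)]) measurable
  also have "\<dots> = (\<integral>\<^sup>+u. \<integral>\<^sup>+z. g u * indicator (cball 0 1) z \<partial>span_lborel C \<partial>span_lborel B)"
  proof (rule nn_integral_cong_AE, rule AE_mp[OF AE_span_lborel], rule AE_I2, rule impI)
    fix u assume u: "u \<in> span B"
    show "(\<integral>\<^sup>+z. g (?P (u + z)) * indicator (cball 0 1) (u + z - ?P (u + z)) \<partial>span_lborel C)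
       = (\<integral>\<^sup>+z. g u * indicator (cball 0 1) z \<partial>span_lborel C)"
    proof (rule nn_integral_cong_AE, rule AE_mp[OF AE_span_lborel], rule AE_I2, rule impI)
      fix z assume "z \<in> span C"
      then have "?P (u + z) = u" using u C(5) by (intro closest_point_span_add) auto
      then show "g (?P (u + z)) * indicator (cball 0 1) (u + z - ?P (u + z)) = g u * indicator (cball 0 1) z"
        by simp
    qed
  qed
  also have "\<dots> = (\<integral>\<^sup>+u. g u * emeasure (span_lborel C) (cball 0 1) \<partial>span_lborel B)"
    by (intro nn_integral_cong) (simp add: nn_integral_cmult)
  also have "\<dots> = (\<integral>\<^sup>+u. g u \<partial>span_lborel B) * emeasure (span_lborel C) (cball 0 1)"
    by (rule nn_integral_multc) measurable
  also have "emeasure (span_lborel C) (cball 0 1) = ball_vol (DIM('a) - card B)"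
    using C(4) emeasure_span_lborel_cball[OF C(1), of 1] by (simp add: Nat.diff_add_inverse flip: C(4))
  finally show ?thesis by (simp add: mult.commute)
qed

lemma unit_ball_vol_ennreal: "ball_vol m \<noteq> 0" "ball_vol m \<noteq> \<infinity>"
  using unit_ball_vol_pos[of "real m"] by (simp_all add: ennreal_eq_0_iff not_le)

text \<open>The cylinder integral sees \<open>B\<close> only through its span and its cardinality.
  Dividing by the volume of the unit ball of the complement, which is finite and positive, removes
  the choice of basis.\<close>

lemma span_lborel_cong:
  fixes B :: "'a::euclidean_space set"
  assumes B: "orthonormal_set B" and B': "orthonormal_set B'" and eq: "span B = span B'"
  shows "span_lborel B = span_lborel B'"
proof (rule measure_eqI)
  fix A assume "A \<in> sets (span_lborel B)"
  then have [measurable]: "A \<in> sets borel" by simp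
  have "card B = card B'" using B B' eq by (simp add: orthonormal_set_card)
  then have "ball_vol (DIM('a) - card B) * (\<integral>\<^sup>+x. indicator A x \<partial>span_lborel B) =
     ball_vol (DIM('a) - card B) * (\<integral>\<^sup>+x. indicator A x \<partial>span_lborel B')"
    using nn_integral_span_lborel_cylinder[OF B, of "indicator A"] nn_integral_span_lborel_cylinder[OF B', of "indicator A"] eq
    by simp
  then show "emeasure (span_lborel B) A = emeasure (span_lborel B') A"
    using unit_ball_vol_ennreal by (simp add: ennreal_mult_cancel_left)
qed simp

lemma nn_integral_span_lborel_scale:
  fixes B :: "'a::euclidean_space set"
  assumes fin: "finite B" and a: "a \<noteq> 0" and g [measurable]: "g \<in> borel_measurable borel"
  shows "ennreal (\<bar>a\<bar> ^ card B) * (\<integral>\<^sup>+x. g (a *\<^sub>R x) \<partial>span_lborel B) = (\<integral>\<^sup>+x. g x \<partial>span_lborel B)"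
proof -
  have "(\<Prod>b\<in>B. ennreal \<bar>a\<bar>) * (\<integral>\<^sup>+X. g (\<Sum>b\<in>B. (\<lambda>b\<in>B. a * X b) b *\<^sub>R b) \<partial>powM B lborel) =
     (\<integral>\<^sup>+X. g (\<Sum>b\<in>B. X b *\<^sub>R b) \<partial>powM B lborel)"
  proof (rule nn_integral_PiM_componentwise[OF sigma_finite_lborel fin])
    fix h :: "real \<Rightarrow> ennreal" assume "h \<in> borel_measurable lborel"
    then show "ennreal \<bar>a\<bar> * (\<integral>\<^sup>+x. h (a * x) \<partial>lborel) = (\<integral>\<^sup>+x. h x \<partial>lborel)"
      using nn_integral_real_affine[of h a 0] a by simp
  qed measurable
  then show ?thesis
    by (simp add: nn_integral_span_lborel ennreal_power scaleR_sum_right)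
qed

lemma nn_integral_span_lborel_translate:
  fixes B :: "'a::euclidean_space set"
  assumes fin: "finite B" and v: "v \<in> span B" and g [measurable]: "g \<in> borel_measurable borel"
  shows "(\<integral>\<^sup>+x. g (v + x) \<partial>span_lborel B) = (\<integral>\<^sup>+x. g x \<partial>span_lborel B)"
proof -
  obtain u where u: "v = (\<Sum>b\<in>B. u b *\<^sub>R b)" using v span_finite[OF fin] by blast
  have "(\<Prod>b\<in>B. 1) * (\<integral>\<^sup>+X. g (\<Sum>b\<in>B. (\<lambda>b\<in>B. u b + X b) b *\<^sub>R b) \<partial>powM B lborel) =
     (\<integral>\<^sup>+X. g (\<Sum>b\<in>B. X b *\<^sub>R b) \<partial>powM B lborel)"
  proof (rule nn_integral_PiM_componentwise[OF sigma_finite_lborel fin])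
    fix h :: "real \<Rightarrow> ennreal" and b assume "h \<in> borel_measurable lborel"
    then show "1 * (\<integral>\<^sup>+x. h (u b + x) \<partial>lborel) = (\<integral>\<^sup>+x. h x \<partial>lborel)"
      using nn_integral_real_affine[of h 1 "u b"] by simp
  qed measurable
  then show ?thesis
    by (simp add: nn_integral_span_lborel u scaleR_add_left sum.distrib)
qed

section \<open>Linear substitutions in tuples of vectors\<close>

lemma measurable_PiM_lincomb:
  fixes A :: "real^'n^'n" and M :: "'b::euclidean_space measure"
  assumes [measurable_cong]: "sets M = sets borel"
  shows "(\<lambda>X j. \<Sum>i\<in>UNIV. (A$i$j) *\<^sub>R X i) \<in> measurable (powM (UNIV::'n set) M) (powM UNIV M)"
  by (rule measurable_PiM_single') (simp_all add: sets_eq_imp_space_eq[OF assms])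

lemma det_shear:
  fixes m n :: "'n::finite"
  assumes "m \<noteq> n"
  shows "det ((\<chi> i j. if i = m \<and> j = n then c else of_bool (i = j)) :: real^'n^'n) = 1"
proof -
  have "(\<chi> i j. if i = m \<and> j = n then c else of_bool (i = j)) =
     ((\<chi> k. if k = m then row m (mat 1) + c *s row n (mat 1) else row k (mat 1)) :: real^'n^'n)"
    using assms by (auto simp: vec_eq_iff row_def mat_def)
  then show ?thesis using det_row_operation[OF assms, of "mat 1 :: real^'n^'n" c] by simp
qed

text \<open>Each of the \<open>card B\<close> coordinates of the tuple undergoes the same linear
  map, the transpose of \<open>A\<close>, so the Jacobian is a power of the determinant. The proof
  runs through the elementary matrices: products multiply the Jacobians, a diagonal matrix scales
  each vector, a transposition permutes the factors of the product measure, and a shear translates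
  one vector by a multiple of another.\<close>

lemma nn_integral_PiM_right_mult:
  fixes A :: "real^'n^'n" and B :: "'b::euclidean_space set"
  assumes B: "orthonormal_set B" and A: "det A \<noteq> 0"
    and G: "G \<in> borel_measurable (PiM UNIV (\<lambda>_::'n. span_lborel B))"
  shows "ennreal (\<bar>det A\<bar> ^ card B) *
       (\<integral>\<^sup>+X. G (\<lambda>j. \<Sum>i\<in>UNIV. (A$i$j) *\<^sub>R X i) \<partial>powM UNIV (span_lborel B))
     = (\<integral>\<^sup>+X. G X \<partial>powM UNIV (span_lborel B))"
proof -
  let ?M = "span_lborel B"
  let ?\<Pi> = "powM (UNIV::'n set) ?M"
  have fin: "finite B" using B by (rule orthonormal_set_finite)
  interpret sf: sigma_finite_measure ?M using B by (rule sigma_finite_span_lborel)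
  interpret P: product_sigma_finite "\<lambda>_::'n. ?M" by (rule sf.product_power)
  define act where "act = (\<lambda>(A::real^'n^'n) (X::'n \<Rightarrow> 'b) j. \<Sum>i\<in>UNIV. (A$i$j) *\<^sub>R X i)"
  have act_meas: "act A \<in> measurable ?\<Pi> ?\<Pi>" for A
    unfolding act_def by (rule measurable_PiM_lincomb) simp
  have "det A \<noteq> 0 \<longrightarrow> (\<forall>G\<in>borel_measurable ?\<Pi>. ennreal (\<bar>det A\<bar> ^ card B) * (\<integral>\<^sup>+X. G (act A X) \<partial>?\<Pi>) = (\<integral>\<^sup>+X. G X \<partial>?\<Pi>))"
  proof (induction A rule: induct_matrix_elementary)
    case (1 A1 A2)
    show ?case
    proof (intro impI ballI)
      fix G :: "('n \<Rightarrow> 'b) \<Rightarrow> ennreal" assume d: "det (A1 ** A2) \<noteq> 0" and G: "G \<in> borel_measurable ?\<Pi>"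
      have d12: "det A1 \<noteq> 0" "det A2 \<noteq> 0" using d by (auto simp: det_mul)
      have eq: "act (A1 ** A2) X = act A2 (act A1 X)" for X
      proof
        fix j
        have "act (A1 ** A2) X j = (\<Sum>i\<in>UNIV. \<Sum>l\<in>UNIV. (A1$i$l * A2$l$j) *\<^sub>R X i)"
          by (simp add: act_def matrix_matrix_mult_def scaleR_sum_left)
        also have "\<dots> = (\<Sum>l\<in>UNIV. \<Sum>i\<in>UNIV. (A1$i$l * A2$l$j) *\<^sub>R X i)" by (rule sum.swap)
        also have "\<dots> = act A2 (act A1 X) j" by (simp add: act_def scaleR_sum_right mult.commute)
        finally show "act (A1 ** A2) X j = act A2 (act A1 X) j" .
      qed
      have G2: "(\<lambda>X. G (act A2 X)) \<in> borel_measurable ?\<Pi>"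
        by (rule measurable_compose[OF act_meas G])
      have "ennreal (\<bar>det (A1 ** A2)\<bar> ^ card B) * (\<integral>\<^sup>+X. G (act (A1 ** A2) X) \<partial>?\<Pi>)
         = ennreal (\<bar>det A2\<bar> ^ card B) * (ennreal (\<bar>det A1\<bar> ^ card B) * (\<integral>\<^sup>+X. G (act A2 (act A1 X)) \<partial>?\<Pi>))"
        by (simp add: eq det_mul abs_mult power_mult_distrib ennreal_mult ac_simps)
      also have "\<dots> = (\<integral>\<^sup>+X. G X \<partial>?\<Pi>)"
        using 1(1)[THEN mp, OF d12(1), THEN bspec, OF G2] 1(2)[THEN mp, OF d12(2), THEN bspec, OF G]
        by simp
      finally show "ennreal (\<bar>det (A1 ** A2)\<bar> ^ card B) * (\<integral>\<^sup>+X. G (act (A1 ** A2) X) \<partial>?\<Pi>) = (\<integral>\<^sup>+X. G X \<partial>?\<Pi>)" .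
    qed
  next
    case (2 A i)
    then show ?case by (simp add: det_zero_row)
  next
    case (3 A)
    show ?case
    proof (intro impI ballI)
      fix G :: "('n \<Rightarrow> 'b) \<Rightarrow> ennreal" assume d: "det A \<noteq> 0" and G: "G \<in> borel_measurable ?\<Pi>"
      have det: "det A = (\<Prod>i\<in>UNIV. A$i$i)" using 3 by (rule det_diagonal)
      have Aii: "A$i$i \<noteq> 0" for i using d unfolding det by (metis UNIV_I finite prod_zero_iff)
      have eq: "act A X = (\<lambda>i\<in>UNIV. (A$i$i) *\<^sub>R X i)" for X
      proof
        fix j
        have "act A X j = (\<Sum>i\<in>UNIV. if i = j then (A$j$j) *\<^sub>R X j else 0)"
          unfolding act_def by (rule sum.cong) (auto simp: 3)
        then show "act A X j = (\<lambda>i\<in>UNIV. (A$i$i) *\<^sub>R X i) j" by simp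
      qed
      have "(\<Prod>i\<in>UNIV. ennreal (\<bar>A$i$i\<bar> ^ card B)) * (\<integral>\<^sup>+X. G (\<lambda>i\<in>UNIV. (A$i$i) *\<^sub>R X i) \<partial>?\<Pi>) = (\<integral>\<^sup>+X. G X \<partial>?\<Pi>)"
        by (rule nn_integral_PiM_componentwise[OF sf.sigma_finite_measure_axioms _ _ _ G])
          (auto intro!: nn_integral_span_lborel_scale[OF fin Aii])
      then show "ennreal (\<bar>det A\<bar> ^ card B) * (\<integral>\<^sup>+X. G (act A X) \<partial>?\<Pi>) = (\<integral>\<^sup>+X. G X \<partial>?\<Pi>)"
        by (simp add: eq det prod_ennreal abs_prod prod_power_distrib)
    qed
  next
    case (4 m n)
    let ?A = "(\<chi> i j. mat 1 $ i $ Transposition.transpose m n j) :: real^'n^'n"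
    show ?case
    proof (intro impI ballI)
      fix G :: "('n \<Rightarrow> 'b) \<Rightarrow> ennreal" assume G: "G \<in> borel_measurable ?\<Pi>"
      have p: "Transposition.transpose m n permutes UNIV" by (rule permutes_swap_id) auto
      have det: "\<bar>det ?A\<bar> = 1"
        using det_permute_columns[OF p, of "mat 1 :: real^'n^'n"] by (simp add: sign_def)
      have eq: "act ?A X = (\<lambda>j\<in>UNIV. X (Transposition.transpose m n j))" for X
      proof
        fix j
        have "act ?A X j = (\<Sum>i\<in>UNIV. if i = Transposition.transpose m n j then X i else 0)"
          unfolding act_def by (rule sum.cong) (auto simp: mat_def)
        then show "act ?A X j = (\<lambda>j\<in>UNIV. X (Transposition.transpose m n j)) j" by simp
      qed
      have b: "bij_betw (Transposition.transpose m n) (UNIV::'n set) UNIV"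
        using p by (rule permutes_imp_bij)
      have "(\<integral>\<^sup>+X. G (act ?A X) \<partial>?\<Pi>) = (\<integral>\<^sup>+X. G X \<partial>distr ?\<Pi> ?\<Pi> (act ?A))"
        by (rule nn_integral_distr[OF act_meas, symmetric]) (use G in simp)
      also have "distr ?\<Pi> ?\<Pi> (act ?A) = ?\<Pi>"
        unfolding eq by (rule distr_PiM_reindex_finite[OF sf.sigma_finite_measure_axioms _ b]) simp
      finally show "ennreal (\<bar>det ?A\<bar> ^ card B) * (\<integral>\<^sup>+X. G (act ?A X) \<partial>?\<Pi>) = (\<integral>\<^sup>+X. G X \<partial>?\<Pi>)"
        by (simp add: det)
    qed
  next
    case (5 m n c)
    let ?A = "(\<chi> i j. if i = m \<and> j = n then c else of_bool (i = j)) :: real^'n^'n"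
    let ?U = "UNIV - {n}"
    have U: "insert n ?U = UNIV" "finite ?U" "n \<notin> ?U" by auto
    show ?case
    proof (intro impI ballI)
      fix G :: "('n \<Rightarrow> 'b) \<Rightarrow> ennreal" assume G: "G \<in> borel_measurable ?\<Pi>"
      have eq: "act ?A X = X(n := c *\<^sub>R X m + X n)" for X
      proof
        fix j
        show "act ?A X j = (X(n := c *\<^sub>R X m + X n)) j"
        proof (cases "j = n")
          case True
          have "act ?A X j = (\<Sum>i\<in>UNIV. (if i = m then c *\<^sub>R X m else 0) + (if i = n then X n else 0))"
            unfolding act_def by (rule sum.cong) (use True 5 in auto)
          then show ?thesis using True by (simp add: sum.distrib)
        next
          case False
          have "act ?A X j = (\<Sum>i\<in>UNIV. if i = j then X j else 0)"
            unfolding act_def by (rule sum.cong) (use False in auto)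
          then show ?thesis using False by simp
        qed
      qed
      let ?V = "powM ?U ?M"
      have "(\<integral>\<^sup>+X. G (act ?A X) \<partial>?\<Pi>) = (\<integral>\<^sup>+X. \<integral>\<^sup>+x. G (act ?A (X(n:=x))) \<partial>?M \<partial>?V)"
        using P.product_nn_integral_insert[OF U(2,3), of "\<lambda>X. G (act ?A X)"]
          measurable_compose[OF act_meas[of ?A] G] unfolding U(1) by blast
      also have "\<dots> = (\<integral>\<^sup>+X. \<integral>\<^sup>+x. G (X(n:=x)) \<partial>?M \<partial>?V)"
      proof (rule nn_integral_cong_AE)
        \<comment> \<open>The measure is invariant only under translations by vectors of the span,
          and almost every \<open>X m\<close> is such a vector.\<close>
        have "AE X in ?V. X m \<in> span B"
          by (rule AE_PiM_component_finite[OF sf.sigma_finite_measure_axioms U(2) _ AE_span_lborel]) (use 5 in simp)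
        then show "AE X in ?V. (\<integral>\<^sup>+x. G (act ?A (X(n:=x))) \<partial>?M) = (\<integral>\<^sup>+x. G (X(n:=x)) \<partial>?M)"
        proof (rule AE_mp[OF _ AE_I2], intro impI)
          fix X assume X: "X \<in> space ?V" "X m \<in> span B"
          have "(\<lambda>x. X(n:=x)) \<in> measurable ?M (powM (insert n ?U) ?M)"
            by (rule measurable_component_update[OF X(1) U(3)])
          from measurable_compose[OF this[unfolded U(1)] G]
          have m: "(\<lambda>x. G (X(n:=x))) \<in> borel_measurable borel" by simp
          have "(\<integral>\<^sup>+x. G (act ?A (X(n:=x))) \<partial>?M) = (\<integral>\<^sup>+x. G (X(n := c *\<^sub>R X m + x)) \<partial>?M)"
            using 5 by (simp add: eq)
          also have "\<dots> = (\<integral>\<^sup>+x. G (X(n:=x)) \<partial>?M)"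
            by (rule nn_integral_span_lborel_translate[OF fin _ m]) (use X in \<open>simp add: span_scale\<close>)
          finally show "(\<integral>\<^sup>+x. G (act ?A (X(n:=x))) \<partial>?M) = (\<integral>\<^sup>+x. G (X(n:=x)) \<partial>?M)" .
        qed
      qed
      also have "\<dots> = (\<integral>\<^sup>+X. G X \<partial>?\<Pi>)"
        using P.product_nn_integral_insert[OF U(2,3), of G] G unfolding U(1) by simp
      finally show "ennreal (\<bar>det ?A\<bar> ^ card B) * (\<integral>\<^sup>+X. G (act ?A X) \<partial>?\<Pi>) = (\<integral>\<^sup>+X. G X \<partial>?\<Pi>)"
        using 5 by (simp add: det_shear)
    qed
  qed
  then show ?thesis using A G unfolding act_def by blast
qed

text \<open>A matrix over the index set \<open>S\<close> is encoded as a matrix over all indices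
  that agrees with the identity off the block. Its determinant is that of the block, which keeps the
  determinants of all sizes in one type.\<close>

definition block_matrix :: "'n set \<Rightarrow> real^'n^'n \<Rightarrow> bool" where
  "block_matrix S A \<longleftrightarrow> (\<forall>i j. i \<notin> S \<or> j \<notin> S \<longrightarrow> A$i$j = of_bool (i = j))"

text \<open>Vectors with indices outside \<open>S\<close> are added as dummies confined to the unit
  ball. A block matrix leaves them fixed, so their contribution \<open>q\<close> is the same finite
  positive factor on both sides of the formula for full tuples and cancels.\<close>

lemma nn_integral_PiM_right_mult_block:
  fixes A :: "real^'n^'n" and B :: "'b::euclidean_space set" and S :: "'n set"
  assumes B: "orthonormal_set B" and A: "det A \<noteq> 0" "block_matrix S A"
    and G [measurable]: "G \<in> borel_measurable (powM S (span_lborel B))"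
  shows "ennreal (\<bar>det A\<bar> ^ card B) *
       (\<integral>\<^sup>+X. G (\<lambda>j\<in>S. \<Sum>i\<in>S. (A$i$j) *\<^sub>R X i) \<partial>powM S (span_lborel B))
     = (\<integral>\<^sup>+X. G X \<partial>powM S (span_lborel B))"
proof -
  let ?M = "span_lborel B"
  interpret sf: sigma_finite_measure ?M using B by (rule sigma_finite_span_lborel)
  interpret P: product_sigma_finite "\<lambda>_::'n. ?M" by (rule sf.product_power)
  define C where "C = (\<lambda>X::'n \<Rightarrow> 'b. \<Prod>j\<in>-S. indicator (cball 0 1) (X j) :: ennreal)"
  define q where "q = (\<integral>\<^sup>+X. C X \<partial>powM (-S) ?M)"
  have "q = (\<Prod>j\<in>-S. \<integral>\<^sup>+x. indicator (cball 0 1) x \<partial>?M)"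
    unfolding q_def C_def by (rule P.product_nn_integral_prod) auto
  also have "\<dots> = ball_vol (card B) ^ card (-S)"
    using emeasure_span_lborel_cball[OF B, of 1] by simp
  finally have "q = ennreal (unit_ball_vol (real (card B)) ^ card (-S))" by (simp add: ennreal_power)
  moreover have "unit_ball_vol (real (card B)) ^ card (-S) > 0" by simp
  ultimately have q: "q \<noteq> 0" "q \<noteq> \<infinity>" by (simp_all only: ennreal_eq_0_iff not_le ennreal_neq_top infinity_ennreal_def not_False_eq_True)
  have U: "S \<union> -S = UNIV" "S \<inter> -S = {}" by auto
  have fold: "(\<integral>\<^sup>+X. H (restrict X S) * C X \<partial>powM UNIV ?M) = (\<integral>\<^sup>+X. H X \<partial>powM S ?M) * q"
    if [measurable]: "H \<in> borel_measurable (powM S ?M)" for H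
  proof -
    have r[measurable]: "(\<lambda>X. restrict X S) \<in> measurable (powM UNIV ?M) (powM S ?M)"
      by (rule measurable_restrict_subset) simp
    have m: "(\<lambda>X. H (restrict X S) * C X) \<in> borel_measurable (powM (S \<union> -S) ?M)"
      unfolding U(1) C_def by measurable
    have [measurable]: "C \<in> borel_measurable (powM (-S) ?M)"
      unfolding C_def by measurable
    have "(\<integral>\<^sup>+X. H (restrict X S) * C X \<partial>powM UNIV ?M) =
       (\<integral>\<^sup>+X. \<integral>\<^sup>+Y. H (restrict (merge S (-S) (X,Y)) S) * C (merge S (-S) (X,Y)) \<partial>powM (-S) ?M \<partial>powM S ?M)"
      using P.product_nn_integral_fold[OF U(2) _ _ m] unfolding U(1) by simp
    also have "\<dots> = (\<integral>\<^sup>+X. \<integral>\<^sup>+Y. H X * C Y \<partial>powM (-S) ?M \<partial>powM S ?M)"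
    proof (intro nn_integral_cong)
      fix X Y :: "'n \<Rightarrow> 'b" assume X: "X \<in> space (powM S ?M)"
      then have "restrict (merge S (-S) (X,Y)) S = X"
        by (auto simp: fun_eq_iff space_PiM PiE_iff extensional_def merge_def)
      moreover have "C (merge S (-S) (X,Y)) = C Y"
        unfolding C_def by (rule prod.cong) (auto simp: merge_def)
      ultimately show "H (restrict (merge S (-S) (X,Y)) S) * C (merge S (-S) (X,Y)) = H X * C Y" by simp
    qed
    also have "\<dots> = (\<integral>\<^sup>+X. H X * q \<partial>powM S ?M)"
      unfolding q_def by (intro nn_integral_cong nn_integral_cmult) measurable
    also have "\<dots> = (\<integral>\<^sup>+X. H X \<partial>powM S ?M) * q" by (rule nn_integral_multc) measurable
    finally show ?thesis .
  qed
  have r: "(\<lambda>X. restrict X S) \<in> measurable (powM UNIV ?M) (powM S ?M)"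
    by (rule measurable_restrict_subset) simp
  have m: "(\<lambda>X. G (restrict X S) * C X) \<in> borel_measurable (powM UNIV ?M)"
    unfolding C_def using measurable_compose[OF r G] by measurable
  have "(\<integral>\<^sup>+X. G X \<partial>powM S ?M) * q
    = ennreal (\<bar>det A\<bar> ^ card B) *
      (\<integral>\<^sup>+X. G (restrict (\<lambda>j. \<Sum>i\<in>UNIV. (A$i$j) *\<^sub>R X i) S) * C (\<lambda>j. \<Sum>i\<in>UNIV. (A$i$j) *\<^sub>R X i) \<partial>powM UNIV ?M)"
    using nn_integral_PiM_right_mult[OF B A(1) m] fold[OF G] by simp
  also have "(\<integral>\<^sup>+X. G (restrict (\<lambda>j. \<Sum>i\<in>UNIV. (A$i$j) *\<^sub>R X i) S) * C (\<lambda>j. \<Sum>i\<in>UNIV. (A$i$j) *\<^sub>R X i) \<partial>powM UNIV ?M)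
    = (\<integral>\<^sup>+X. G (\<lambda>j\<in>S. \<Sum>i\<in>S. (A$i$j) *\<^sub>R restrict X S i) * C X \<partial>powM UNIV ?M)"
  proof (intro nn_integral_cong arg_cong2[where f="(*)"] arg_cong[where f=G])
    fix X :: "'n \<Rightarrow> 'b"
    show "restrict (\<lambda>j. \<Sum>i\<in>UNIV. (A$i$j) *\<^sub>R X i) S = (\<lambda>j\<in>S. \<Sum>i\<in>S. (A$i$j) *\<^sub>R restrict X S i)"
    proof
      fix j
      have "(\<Sum>i\<in>UNIV. (A$i$j) *\<^sub>R X i) = (\<Sum>i\<in>S. (A$i$j) *\<^sub>R restrict X S i)" if "j \<in> S"
        using A(2) that by (intro sum.mono_neutral_cong_right) (auto simp: block_matrix_def)
      then show "restrict (\<lambda>j. \<Sum>i\<in>UNIV. (A$i$j) *\<^sub>R X i) S j = (\<lambda>j\<in>S. \<Sum>i\<in>S. (A$i$j) *\<^sub>R restrict X S i) j"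
        by simp
    qed
    have "(\<Sum>i\<in>UNIV. (A$i$j) *\<^sub>R X i) = X j" if "j \<in> -S" for j
    proof -
      have "(\<Sum>i\<in>UNIV. (A$i$j) *\<^sub>R X i) = (\<Sum>i\<in>UNIV. if i = j then X i else 0)"
        using A(2) that by (intro sum.cong) (auto simp: block_matrix_def)
      then show ?thesis by simp
    qed
    then show "C (\<lambda>j. \<Sum>i\<in>UNIV. (A$i$j) *\<^sub>R X i) = C X" unfolding C_def by (intro prod.cong) auto
  qed
  also have "\<dots> = (\<integral>\<^sup>+X. G (\<lambda>j\<in>S. \<Sum>i\<in>S. (A$i$j) *\<^sub>R X i) \<partial>powM S ?M) * q"
  proof (rule fold)
    have "(\<lambda>X. \<lambda>j\<in>S. \<Sum>i\<in>S. (A$i$j) *\<^sub>R X i) \<in> measurable (powM S ?M) (powM S ?M)"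
      by (rule measurable_restrict) (auto simp: sets_span_lborel cong: measurable_cong_sets)
    then show "(\<lambda>X. G (\<lambda>j\<in>S. \<Sum>i\<in>S. (A$i$j) *\<^sub>R X i)) \<in> borel_measurable (powM S ?M)"
      by measurable
  qed
  finally have "q * (\<integral>\<^sup>+X. G X \<partial>powM S ?M) =
      q * (ennreal (\<bar>det A\<bar> ^ card B) * (\<integral>\<^sup>+X. G (\<lambda>j\<in>S. \<Sum>i\<in>S. (A$i$j) *\<^sub>R X i) \<partial>powM S ?M))"
    by (simp only: ac_simps)
  then show ?thesis using q by (simp add: ennreal_mult_cancel_left)
qed

lemma bij_betw_axis: "bij_betw (\<lambda>i::'n. axis i 1 :: real^'n) UNIV Basis"
  by (auto simp: bij_betw_def inj_on_def axis_eq_axis Basis_vec_def)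

lemma nn_integral_lborel_vec:
  fixes g :: "real^'n \<Rightarrow> ennreal"
  assumes [measurable]: "g \<in> borel_measurable borel"
  shows "(\<integral>\<^sup>+x. g x \<partial>lborel) = (\<integral>\<^sup>+X. g (\<chi> i. X i) \<partial>PiM UNIV (\<lambda>_::'n. lborel))"
proof -
  let ?r = "\<lambda>c::real^'n \<Rightarrow> real. \<lambda>a\<in>UNIV::'n set. c (axis a 1)"
  have m: "?r \<in> measurable (powM Basis lborel) (powM UNIV lborel)"
    by (intro measurable_restrict measurable_component_singleton) auto
  have [measurable]: "(\<lambda>X. (\<chi> i. X i)::real^'n) \<in> borel_measurable (PiM UNIV (\<lambda>_::'n. lborel))"
    by (rule measurable_borel_vec) simp
  have "(\<integral>\<^sup>+X. g (\<chi> i. X i) \<partial>PiM UNIV (\<lambda>_::'n. lborel)) = (\<integral>\<^sup>+X. g (\<chi> i. X i) \<partial>distr (powM Basis lborel) (PiM UNIV (\<lambda>_::'n. lborel)) ?r)"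
    by (subst distr_PiM_reindex_finite[OF sigma_finite_lborel _ bij_betw_axis]) simp_all
  also have "\<dots> = (\<integral>\<^sup>+c. g (\<chi> i. ?r c i) \<partial>powM Basis lborel)"
    by (subst nn_integral_distr[OF m]) auto
  also have "\<dots> = (\<integral>\<^sup>+c. g (\<Sum>b\<in>Basis. c b *\<^sub>R b) \<partial>powM Basis lborel)"
  proof (intro nn_integral_cong arg_cong[where f=g])
    fix c :: "real^'n \<Rightarrow> real"
    have "(\<Sum>b\<in>Basis. c b *\<^sub>R b) = (\<Sum>i\<in>UNIV. c (axis i 1) *\<^sub>R axis i (1::real))"
      by (rule sum.reindex_bij_betw[OF bij_betw_axis, symmetric])
    then show "(\<chi> i. ?r c i) = (\<Sum>b\<in>Basis. c b *\<^sub>R b)"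
      by (simp add: vec_eq_iff axis_def if_distrib[where f="\<lambda>x. _ * x"] cong: if_cong)
  qed
  also have "\<dots> = (\<integral>\<^sup>+x. g x \<partial>span_lborel Basis)" by (rule nn_integral_span_lborel[symmetric]) measurable
  also have "span_lborel Basis = (lborel :: (real^'n) measure)" by (rule span_lborel_full[OF orthonormal_set_Basis]) simp
  finally show ?thesis by simp
qed

text \<open>A vector is a tuple of reals, that is, of elements of the one-dimensional span of 1, so
  this is the tuple formula with exponent 1. The transpose appears because tuples are multiplied
  from the right.\<close>

lemma nn_integral_lborel_matrix_vector_mult:
  fixes A :: "real^'n^'n"
  assumes A: "det A \<noteq> 0" and [measurable]: "g \<in> borel_measurable borel"
  shows "ennreal \<bar>det A\<bar> * (\<integral>\<^sup>+x. g (A *v x) \<partial>lborel) = (\<integral>\<^sup>+x. g x \<partial>lborel)"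
proof -
  have sl: "span_lborel {1} = (lborel :: real measure)"
    by (rule span_lborel_full) (auto simp: orthonormal_set_def)
  have [measurable]: "(\<lambda>X. (\<chi> i. X i)::real^'n) \<in> borel_measurable (PiM UNIV (\<lambda>_::'n. lborel))"
    by (rule measurable_borel_vec) simp
  have [measurable]: "(*v) A \<in> borel_measurable borel" by (intro measurable_linear) simp
  have "ennreal (\<bar>det (transpose A)\<bar> ^ card {1::real}) *
      (\<integral>\<^sup>+X. g (\<chi> j. (\<Sum>i\<in>UNIV. (transpose A$i$j) *\<^sub>R X i)) \<partial>PiM UNIV (\<lambda>_::'n. span_lborel {1}))
    = (\<integral>\<^sup>+X. g (\<chi> j. X j) \<partial>PiM UNIV (\<lambda>_::'n. span_lborel {1}))"
  proof (rule nn_integral_PiM_right_mult)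
    show "(\<lambda>X. g (\<chi> j. X j)) \<in> borel_measurable (PiM UNIV (\<lambda>_::'n. span_lborel {1}))"
      unfolding sl by measurable
  qed (use A in \<open>auto simp: orthonormal_set_def det_transpose\<close>)
  moreover have "(\<chi> j. (\<Sum>i\<in>UNIV. (transpose A$i$j) *\<^sub>R X i)) = A *v (\<chi> i. X i)" for X
    by (simp add: vec_eq_iff transpose_def matrix_vector_mult_def)
  ultimately show ?thesis
    unfolding sl by (simp add: nn_integral_lborel_vec det_transpose)
qed

section \<open>Gram determinants\<close>

definition coord_basis :: "'n set \<Rightarrow> (real^'n) set" where
  "coord_basis S = (\<lambda>i. axis i 1) ` S"

abbreviation coord_lborel :: "'n::finite set \<Rightarrow> (real^'n) measure" where
  "coord_lborel S \<equiv> span_lborel (coord_basis S)"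

definition coord_proj :: "'n set \<Rightarrow> real^'n \<Rightarrow> real^'n" where
  "coord_proj S x = (\<chi> i. if i \<in> S then x $ i else 0)"

text \<open>Columns outside \<open>S\<close> are standard basis vectors. If all \<open>Z j\<close>
  lie in the coordinate subspace of \<open>S\<close>, this is a block matrix; for arbitrary vectors
  its determinant is the minor with rows and columns in \<open>S\<close>.\<close>

definition col_matrix :: "'n set \<Rightarrow> ('n \<Rightarrow> real^'n) \<Rightarrow> real^'n^'n" where
  "col_matrix S Z = (\<chi> i j. if j \<in> S then Z j $ i else of_bool (i = j))"

definition gram :: "'n set \<Rightarrow> ('n \<Rightarrow> 'a::real_inner) \<Rightarrow> real^'n^'n" where
  "gram S X = (\<chi> i j. if i \<in> S \<and> j \<in> S then X i \<bullet> X j else of_bool (i = j))"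

text \<open>Volume of the parallelepiped spanned by the vectors with indices in \<open>S\<close>;
  the identity padding in \<open>gram\<close> does not affect the determinant. Gram determinants are
  non-negative, and the absolute value builds this fact into the definition.\<close>

definition gram_vol :: "'n::finite set \<Rightarrow> ('n \<Rightarrow> 'a::real_inner) \<Rightarrow> real" where
  "gram_vol S X = sqrt \<bar>det (gram S X)\<bar>"

definition tuple_mult :: "'n set \<Rightarrow> ('n \<Rightarrow> 'a::real_vector) \<Rightarrow> ('n \<Rightarrow> real^'n) \<Rightarrow> 'n \<Rightarrow> 'a" where
  "tuple_mult S X Z = (\<lambda>j\<in>S. \<Sum>i\<in>S. (Z j $ i) *\<^sub>R X i)"

lemma orthonormal_coord_basis: "orthonormal_set (coord_basis S)"
  by (auto simp: orthonormal_set_def coord_basis_def inner_axis_axis axis_eq_axis)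

lemma finite_coord_basis [simp]: "finite (coord_basis S)"
  by (simp add: coord_basis_def)

lemma card_coord_basis [simp]: "card (coord_basis S) = card S"
  unfolding coord_basis_def by (rule card_image) (auto simp: inj_on_def axis_eq_axis)

lemma axis_in_span_coord_basis: "i \<in> S \<Longrightarrow> axis i 1 \<in> span (coord_basis S)"
  by (rule span_base) (simp add: coord_basis_def)

lemma coord_proj_eq_sum: "coord_proj S v = (\<Sum>i\<in>S. (v $ i) *\<^sub>R axis i 1)"
  by (auto simp: vec_eq_iff coord_proj_def axis_def if_distrib[where f="\<lambda>x. _ * x"] cong: if_cong)

lemma span_coord_basis: "span (coord_basis S) = {x. \<forall>i. i \<notin> S \<longrightarrow> x $ i = 0}" (is "_ = ?E")
proof
  have "subspace ?E" by (auto simp: subspace_def)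
  moreover have "coord_basis S \<subseteq> ?E" by (auto simp: coord_basis_def axis_def)
  ultimately show "span (coord_basis S) \<subseteq> ?E" by (rule span_minimal[rotated])
  show "?E \<subseteq> span (coord_basis S)"
  proof
    fix x :: "real^'a" assume "x \<in> ?E"
    then have "x = coord_proj S x" by (auto simp: coord_proj_def vec_eq_iff)
    also have "\<dots> \<in> span (coord_basis S)"
      unfolding coord_proj_eq_sum by (intro span_sum span_scale axis_in_span_coord_basis)
    finally show "x \<in> span (coord_basis S)" .
  qed
qed

lemma coord_proj_span [simp]: "coord_proj S x \<in> span (coord_basis S)"
  by (simp add: span_coord_basis coord_proj_def)

lemma coord_proj_id: "x \<in> span (coord_basis S) \<Longrightarrow> coord_proj S x = x"
  by (auto simp: span_coord_basis coord_proj_def vec_eq_iff)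

lemma closest_point_coord: "closest_point (span (coord_basis S)) = coord_proj S"
proof
  fix x :: "real^'a"
  show "closest_point (span (coord_basis S)) x = coord_proj S x"
  proof (rule closest_point_subspace_eq)
    fix z :: "real^'a" assume "z \<in> span (coord_basis S)"
    then have z: "z $ i = 0" if "i \<notin> S" for i using that by (simp add: span_coord_basis)
    show "(x - coord_proj S x) \<bullet> z = 0"
      unfolding inner_vec_def by (rule sum.neutral) (auto simp: coord_proj_def z)
  qed simp_all
qed

lemma linear_coord_proj: "linear (coord_proj S)"
  by (rule linearI) (auto simp: coord_proj_def vec_eq_iff)

lemma gram_cong: "(\<And>i. i \<in> S \<Longrightarrow> X i = Y i) \<Longrightarrow> gram S X = gram S Y"
  by (auto simp: gram_def vec_eq_iff)

lemma gram_vol_cong: "(\<And>i. i \<in> S \<Longrightarrow> X i = Y i) \<Longrightarrow> gram_vol S X = gram_vol S Y"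
  unfolding gram_vol_def using gram_cong by metis

lemma gram_vol_nonneg [simp]: "0 \<le> gram_vol S X"
  by (simp add: gram_vol_def)

lemma gram_orthogonal: "orthogonal_transformation U \<Longrightarrow> gram S (\<lambda>j. U (X j)) = gram S X"
  by (auto simp: gram_def vec_eq_iff orthogonal_transformation_def)

lemma gram_vol_orthogonal: "orthogonal_transformation U \<Longrightarrow> gram_vol S (\<lambda>j. U (X j)) = gram_vol S X"
  by (simp add: gram_vol_def gram_orthogonal)

lemma block_col_matrix:
  "(\<And>j. j \<in> S \<Longrightarrow> Z j \<in> span (coord_basis S)) \<Longrightarrow> block_matrix S (col_matrix S Z)"
  by (auto simp: block_matrix_def col_matrix_def span_coord_basis)

lemma sum_if_mem: "(\<Sum>l\<in>(UNIV::'n::finite set). if l \<in> S then f l else (0::'b::comm_monoid_add)) = sum f S"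
  by (simp add: sum.If_cases)

lemma gram_eq_transpose_mult:
  assumes Z: "\<And>j. j \<in> S \<Longrightarrow> Z j \<in> span (coord_basis S)"
  shows "gram S Z = transpose (col_matrix S Z) ** col_matrix S Z"
proof -
  have Z0: "Z j $ i = 0" if "j \<in> S" "i \<notin> S" for i j using Z[OF that(1)] that(2) by (simp add: span_coord_basis)
  have "(\<Sum>l\<in>UNIV. col_matrix S Z $ l $ i * col_matrix S Z $ l $ j) = gram S Z $ i $ j" for i j
  proof -
    consider "i \<in> S" "j \<in> S" | "i \<in> S" "j \<notin> S" | "i \<notin> S" by blast
    then show ?thesis
    proof cases
      case 1 then show ?thesis by (simp add: col_matrix_def gram_def inner_vec_def)
    next
      case 2
      then have "(\<Sum>l\<in>UNIV. col_matrix S Z $ l $ i * col_matrix S Z $ l $ j) = 0"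
        by (intro sum.neutral) (auto simp: col_matrix_def Z0)
      then show ?thesis using 2 by (auto simp: gram_def)
    next
      case 3
      then have "(\<Sum>l\<in>UNIV. col_matrix S Z $ l $ i * col_matrix S Z $ l $ j) =
        (\<Sum>l\<in>UNIV. if l = i then col_matrix S Z $ i $ j else 0)"
        by (intro sum.cong) (auto simp: col_matrix_def)
      also have "\<dots> = gram S Z $ i $ j" using 3 by (auto simp: col_matrix_def gram_def Z0)
      finally show ?thesis .
    qed
  qed
  then show ?thesis by (simp add: vec_eq_iff matrix_matrix_mult_def transpose_def)
qed

lemma gram_vol_coord:
  assumes Z: "\<And>j. j \<in> S \<Longrightarrow> Z j \<in> span (coord_basis S)"
  shows "gram_vol S Z = \<bar>det (col_matrix S Z)\<bar>"
  using gram_eq_transpose_mult[OF Z] by (simp add: gram_vol_def det_mul det_transpose abs_mult)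

lemma gram_tuple_mult:
  assumes Z: "\<And>j. j \<in> S \<Longrightarrow> Z j \<in> span (coord_basis S)"
  shows "gram S (tuple_mult S X Z) = transpose (col_matrix S Z) ** gram S X ** col_matrix S Z"
proof -
  let ?C = "col_matrix S Z"
  have Z0: "Z j $ i = 0" if "j \<in> S" "i \<notin> S" for i j using Z[OF that(1)] that(2) by (simp add: span_coord_basis)
  have "(\<Sum>m\<in>UNIV. (\<Sum>l\<in>UNIV. ?C $ l $ i * gram S X $ l $ m) * ?C $ m $ j) = gram S (tuple_mult S X Z) $ i $ j" for i j
  proof -
    have row: "(\<Sum>l\<in>UNIV. ?C $ l $ i * gram S X $ l $ m) =
       (if i \<in> S then (if m \<in> S then tuple_mult S X Z i \<bullet> X m else 0) else of_bool (i = m))" for m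
    proof (cases "i \<in> S")
      case True
      have "(\<Sum>l\<in>UNIV. ?C $ l $ i * gram S X $ l $ m) = (\<Sum>l\<in>UNIV. if l \<in> S then (if m \<in> S then Z i $ l * (X l \<bullet> X m) else 0) else 0)"
        using True by (intro sum.cong) (auto simp: col_matrix_def gram_def Z0)
      also have "\<dots> = (\<Sum>l\<in>S. (if m \<in> S then Z i $ l * (X l \<bullet> X m) else 0))" by (rule sum_if_mem)
      also have "\<dots> = (if m \<in> S then tuple_mult S X Z i \<bullet> X m else 0)"
        using True by (simp add: tuple_mult_def inner_sum_left)
      finally show ?thesis using True by simp
    next
      case False
      have "(\<Sum>l\<in>UNIV. ?C $ l $ i * gram S X $ l $ m) = (\<Sum>l\<in>UNIV. if l = i then gram S X $ i $ m else 0)"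
        using False by (intro sum.cong) (auto simp: col_matrix_def)
      then show ?thesis using False by (simp add: gram_def)
    qed
    have "(\<Sum>m\<in>UNIV. (\<Sum>l\<in>UNIV. ?C $ l $ i * gram S X $ l $ m) * ?C $ m $ j) =
       (\<Sum>m\<in>UNIV. (if i \<in> S then (if m \<in> S then tuple_mult S X Z i \<bullet> X m else 0) else of_bool (i = m)) * ?C $ m $ j)"
      by (simp only: row)
    also have "\<dots> = gram S (tuple_mult S X Z) $ i $ j"
    proof (cases "i \<in> S")
      case True
      have "(\<Sum>m\<in>UNIV. (if i \<in> S then (if m \<in> S then tuple_mult S X Z i \<bullet> X m else 0) else of_bool (i = m)) * ?C $ m $ j)
        = (\<Sum>m\<in>UNIV. if m \<in> S then (tuple_mult S X Z i \<bullet> X m) * ?C $ m $ j else 0)"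
        using True by (intro sum.cong) auto
      also have "\<dots> = (\<Sum>m\<in>S. (tuple_mult S X Z i \<bullet> X m) * ?C $ m $ j)" by (rule sum_if_mem)
      also have "\<dots> = gram S (tuple_mult S X Z) $ i $ j"
      proof (cases "j \<in> S")
        case j: True
        have "tuple_mult S X Z i \<bullet> tuple_mult S X Z j = (\<Sum>m\<in>S. (tuple_mult S X Z i \<bullet> X m) * Z j $ m)"
          using j by (subst (2) tuple_mult_def) (simp add: inner_sum_right mult.commute)
        then show ?thesis using True j by (simp add: gram_def col_matrix_def)
      next
        case False
        then have "(\<Sum>m\<in>S. (tuple_mult S X Z i \<bullet> X m) * ?C $ m $ j) = 0"
          by (intro sum.neutral) (auto simp: col_matrix_def)
        then show ?thesis using True False by (auto simp: gram_def)
      qed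
      finally show ?thesis .
    next
      case False
      have "(\<Sum>m\<in>UNIV. (if i \<in> S then (if m \<in> S then tuple_mult S X Z i \<bullet> X m else 0) else of_bool (i = m)) * ?C $ m $ j)
        = (\<Sum>m\<in>UNIV. if m = i then ?C $ i $ j else 0)"
        using False by (intro sum.cong) auto
      then show ?thesis using False by (auto simp: gram_def col_matrix_def Z0)
    qed
    finally show ?thesis .
  qed
  then show ?thesis by (simp add: vec_eq_iff matrix_matrix_mult_def transpose_def)
qed

lemma gram_vol_tuple_mult:
  assumes Z: "\<And>j. j \<in> S \<Longrightarrow> Z j \<in> span (coord_basis S)"
  shows "gram_vol S (tuple_mult S X Z) = gram_vol S X * \<bar>det (col_matrix S Z)\<bar>"
  by (simp add: gram_vol_def gram_tuple_mult[OF Z] det_mul det_transpose abs_mult real_sqrt_mult)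

lemma gram_mult_inner:
  assumes c: "\<And>i. i \<notin> S \<Longrightarrow> c $ i = 0"
  shows "c \<bullet> (gram S X *v c) = (norm (\<Sum>i\<in>S. (c $ i) *\<^sub>R X i))\<^sup>2"
proof -
  have "(gram S X *v c) $ i = (if i \<in> S then X i \<bullet> (\<Sum>j\<in>S. (c $ j) *\<^sub>R X j) else c $ i)" for i
  proof (cases "i \<in> S")
    case True
    have "(gram S X *v c) $ i = (\<Sum>j\<in>UNIV. if j \<in> S then (X i \<bullet> X j) * c $ j else 0)"
      unfolding matrix_vector_mult_def using True by (auto intro!: sum.cong simp: gram_def c)
    also have "\<dots> = (\<Sum>j\<in>S. (X i \<bullet> X j) * c $ j)" by (rule sum_if_mem)
    finally show ?thesis using True by (simp add: inner_sum_right mult.commute)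
  next
    case False
    have "(gram S X *v c) $ i = (\<Sum>j\<in>UNIV. if j = i then c $ i else 0)"
      unfolding matrix_vector_mult_def using False by (auto intro!: sum.cong simp: gram_def c)
    then show ?thesis using False by simp
  qed
  then have "c \<bullet> (gram S X *v c) = (\<Sum>i\<in>UNIV. if i \<in> S then c $ i * (X i \<bullet> (\<Sum>j\<in>S. (c $ j) *\<^sub>R X j)) else 0)"
    unfolding inner_vec_def by (intro sum.cong) (auto simp: c)
  also have "\<dots> = (\<Sum>i\<in>S. c $ i * (X i \<bullet> (\<Sum>j\<in>S. (c $ j) *\<^sub>R X j)))" by (rule sum_if_mem)
  also have "\<dots> = (\<Sum>i\<in>S. (c $ i) *\<^sub>R X i) \<bullet> (\<Sum>j\<in>S. (c $ j) *\<^sub>R X j)"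
    by (simp add: inner_sum_left)
  finally show ?thesis by (simp add: power2_norm_eq_inner)
qed

lemma gram_mult_outside:
  assumes "i \<notin> S" shows "(gram S X *v c) $ i = c $ i"
proof -
  have "(gram S X *v c) $ i = (\<Sum>j\<in>UNIV. if j = i then c $ i else 0)"
    unfolding matrix_vector_mult_def using assms by (auto intro!: sum.cong simp: gram_def)
  then show ?thesis by simp
qed

lemma det_nonzero_iff_inj: "det (A :: real^'n^'n) \<noteq> 0 \<longleftrightarrow> (\<forall>x. A *v x = 0 \<longrightarrow> x = 0)"
  by (simp only: invertible_det_nz[symmetric] invertible_left_inverse matrix_left_invertible_ker)

text \<open>The coefficients of a linear relation among the vectors form a vector in the kernel of
  the Gram matrix. Coefficients outside \<open>S\<close> are cut off, because the padded matrix acts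
  there as the identity.\<close>

lemma det_gram_nonzero_lincomb:
  fixes X :: "'n::finite \<Rightarrow> 'a::real_inner"
  assumes "det (gram S X) \<noteq> 0" "(\<Sum>i\<in>S. (c $ i) *\<^sub>R X i) = 0" "i \<in> S"
  shows "c $ i = 0"
proof -
  define d where "d = coord_proj S c"
  have d: "d $ i = (if i \<in> S then c $ i else 0)" for i by (simp add: d_def coord_proj_def)
  have s: "(\<Sum>i\<in>S. (d $ i) *\<^sub>R X i) = 0" using assms(2) by (simp add: d cong: sum.cong)
  have "gram S X *v d = 0"
    unfolding vec_eq_iff
  proof
    fix i show "(gram S X *v d) $ i = 0 $ i"
    proof (cases "i \<in> S")
      case True
      have "(gram S X *v d) $ i = (\<Sum>j\<in>UNIV. if j \<in> S then (X i \<bullet> X j) * d $ j else 0)"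
        unfolding matrix_vector_mult_def using True by (auto intro!: sum.cong simp: gram_def d)
      also have "\<dots> = (\<Sum>j\<in>S. (X i \<bullet> X j) * d $ j)" by (rule sum_if_mem)
      also have "\<dots> = X i \<bullet> (\<Sum>j\<in>S. (d $ j) *\<^sub>R X j)" by (simp add: inner_sum_right mult.commute)
      finally show ?thesis using s by simp
    qed (simp add: gram_mult_outside d)
  qed
  then have "d = 0" using assms(1) det_nonzero_iff_inj by blast
  then show ?thesis using d[of i] assms(3) by simp
qed

lemma det_gram_nonzero_if_col_matrix:
  fixes X :: "'n \<Rightarrow> real^'n"
  assumes "det (col_matrix S X) \<noteq> 0"
  shows "det (gram S X) \<noteq> 0"
  unfolding det_nonzero_iff_inj
proof (intro allI impI)
  fix c assume c: "gram S X *v c = 0"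
  have c0: "c $ i = 0" if "i \<notin> S" for i using gram_mult_outside[OF that, of X c] c by simp
  have "(norm (\<Sum>i\<in>S. (c $ i) *\<^sub>R X i))\<^sup>2 = 0" using gram_mult_inner[of S c X] c0 c by simp
  then have "(\<Sum>i\<in>S. (c $ i) *\<^sub>R X i) = 0" by simp
  moreover have "col_matrix S X *v c = (\<Sum>i\<in>S. (c $ i) *\<^sub>R X i)"
  proof -
    have "(col_matrix S X *v c) $ r = (\<Sum>j\<in>UNIV. if j \<in> S then c $ j * X j $ r else 0)" for r
      unfolding matrix_vector_mult_def by (auto intro!: sum.cong simp: col_matrix_def c0)
    then show ?thesis by (simp add: vec_eq_iff sum_if_mem)
  qed
  ultimately show "c = 0" using assms det_nonzero_iff_inj by metis
qed

lemma dim_span_gram_nonzero: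
  fixes X :: "'n::finite \<Rightarrow> 'a::euclidean_space"
  assumes g: "det (gram S X) \<noteq> 0"
  shows "dim (span (X ` S)) = card S"
proof -
  have inj: "inj_on X S"
  proof (rule inj_onI, rule ccontr)
    fix i j assume ij: "i \<in> S" "j \<in> S" "X i = X j" "i \<noteq> j"
    have "(\<Sum>l\<in>S. ((axis i 1 - axis j 1) $ l) *\<^sub>R X l) = (\<Sum>l\<in>S. (if l = i then X i else 0) - (if l = j then X j else 0))"
      by (rule sum.cong) (auto simp: axis_def)
    also have "\<dots> = 0" using ij by (simp add: sum_subtractf)
    finally have "(axis i 1 - axis j 1) $ i = (0::real)" using det_gram_nonzero_lincomb[OF g _ ij(1)] by blast
    then show False using ij(4) by (simp add: axis_def)
  qed
  have "independent (X ` S)"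
  proof (rule independent_if_scalars_zero)
    fix f x assume f: "(\<Sum>x\<in>X ` S. f x *\<^sub>R x) = 0" and x: "x \<in> X ` S"
    obtain i where i: "i \<in> S" "x = X i" using x by blast
    have "(\<Sum>l\<in>S. ((\<chi> l. f (X l)) $ l) *\<^sub>R X l) = 0" using f inj by (simp add: sum.reindex)
    from det_gram_nonzero_lincomb[OF g this i(1)] show "f x = 0" using i by simp
  qed simp
  then show ?thesis using inj by (simp add: dim_eq_card_independent card_image)
qed

text \<open>Orthonormal bases of the two subspaces and of their complements are matched. The
  resulting transformation reduces statements about any subspace of dimension \<open>card S\<close>
  to the coordinate subspace.\<close>

lemma subspace_orthogonal_image_coord:
  fixes E :: "(real^'n) set" and S :: "'n set"
  assumes E: "subspace E" and d: "dim E = card S"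
  obtains U :: "real^'n \<Rightarrow> real^'n"
    where "orthogonal_transformation U" "U ` span (coord_basis S) = E"
proof -
  obtain B where B: "orthonormal_set B" "card B = dim E" "span B = E"
    using orthonormal_set_basis_exists[OF E] by blast
  obtain C where C: "orthonormal_set C" "B \<inter> C = {}" "orthonormal_set (B \<union> C)" "card B + card C = DIM(real^'n)"
      "span C = {y. \<forall>x\<in>span B. orthogonal x y}"
    by (rule orthonormal_set_extend[OF B(1)]) (rule that; assumption)
  obtain C0 where C0: "orthonormal_set C0" "coord_basis S \<inter> C0 = {}" "orthonormal_set (coord_basis S \<union> C0)"
     "card (coord_basis S) + card C0 = DIM(real^'n)" "span C0 = {y. \<forall>x\<in>span (coord_basis S). orthogonal x y}"
    by (rule orthonormal_set_extend[OF orthonormal_coord_basis[of S]]) (rule that; assumption)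
  have fin: "finite B" "finite C" "finite C0" using B(1) C(1) C0(1) by (simp_all add: orthonormal_set_finite)
  obtain f where f: "bij_betw f (coord_basis S) B" using B(2) d fin by (metis card_coord_basis finite_coord_basis finite_same_card_bij)
  obtain g where g: "bij_betw g C0 C" using B(2) d fin C(4) C0(4) by (metis add_left_cancel card_coord_basis finite_same_card_bij)
  define h where "h x = (if x \<in> coord_basis S then f x else g x)" for x
  have hf: "bij_betw h (coord_basis S) B" using f by (rule bij_betw_cong[THEN iffD1, rotated]) (simp add: h_def)
  have "bij_betw h C0 C" using g by (rule bij_betw_cong[THEN iffD1, rotated]) (use C0(2) in \<open>auto simp: h_def\<close>)
  with hf have hb: "bij_betw h (coord_basis S \<union> C0) (B \<union> C)" using C(2) by (rule bij_betw_combine)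
  have "card (coord_basis S \<union> C0) = DIM(real^'n)" using C0(2,4) fin by (simp add: card_Un_disjoint)
  from orthonormal_bij_transformation[OF C0(3) C(3) hb this]
  obtain U where U: "orthogonal_transformation U" "\<And>b. b \<in> coord_basis S \<union> C0 \<Longrightarrow> U b = h b" by metis
  have "U ` span (coord_basis S) = span (U ` coord_basis S)"
    using U(1) by (simp add: orthogonal_transformation_linear span_linear_image)
  also have "U ` coord_basis S = B" using U(2) hf by (simp add: bij_betw_def)
  finally show ?thesis using that U(1) B(3) by simp
qed

lemma col_matrix_mult_vec:
  assumes z: "z \<in> span (coord_basis S)"
  shows "col_matrix S B *v z = (\<Sum>i\<in>S. (z $ i) *\<^sub>R B i)"
proof -
  have "(col_matrix S B *v z) $ r = (\<Sum>j\<in>UNIV. if j \<in> S then z $ j * B j $ r else 0)" for r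
    unfolding matrix_vector_mult_def using z by (auto intro!: sum.cong simp: col_matrix_def span_coord_basis)
  then show ?thesis by (simp add: vec_eq_iff sum_if_mem)
qed

text \<open>An independent tuple spans a subspace of dimension \<open>card S\<close>, which is an
  isometric image of the coordinate subspace. Pulled back by the isometry, the tuple becomes a
  square matrix, and its Gram volume an ordinary determinant.\<close>

lemma tuple_polar:
  fixes X :: "'n \<Rightarrow> real^'n"
  assumes g: "det (gram S X) \<noteq> 0"
  obtains U :: "real^'n \<Rightarrow> real^'n" and B where "orthogonal_transformation U" "U ` span (coord_basis S) = span (X ` S)"
    "\<And>j. j \<in> S \<Longrightarrow> B j \<in> span (coord_basis S)" "\<And>j. j \<in> S \<Longrightarrow> X j = U (B j)"
    "gram_vol S X = \<bar>det (col_matrix S B)\<bar>" "det (col_matrix S B) \<noteq> 0"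
proof -
  obtain U where U: "orthogonal_transformation U" "U ` span (coord_basis S) = span (X ` S)"
    using subspace_orthogonal_image_coord[OF subspace_span dim_span_gram_nonzero[OF g]] by blast
  have "\<exists>b. b \<in> span (coord_basis S) \<and> X j = U b" if "j \<in> S" for j
    using U(2) span_base[of "X j" "X ` S"] that by (metis imageE imageI)
  then obtain B where B: "\<And>j. j \<in> S \<Longrightarrow> B j \<in> span (coord_basis S) \<and> X j = U (B j)" by metis
  have "gram S X = gram S (\<lambda>j. U (B j))" by (rule gram_cong) (use B in auto)
  then have "gram S X = gram S B" using gram_orthogonal[OF U(1)] by metis
  then have v: "gram_vol S X = \<bar>det (col_matrix S B)\<bar>"
    using gram_vol_coord[of S B] B by (simp add: gram_vol_def)
  moreover have "det (col_matrix S B) \<noteq> 0" using v g by (auto simp: gram_vol_def)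
  ultimately show ?thesis using that U B by blast
qed

text \<open>A block matrix commutes with the projection onto the coordinate subspace and does not
  change the component orthogonal to it. It therefore respects the cylinder over the subspace, and
  the change of variables for Lebesgue measure on the full space transfers to the subspace.\<close>

lemma nn_integral_coord_left_mult:
  fixes A :: "real^'n^'n"
  assumes A: "det A \<noteq> 0" "block_matrix S A" and [measurable]: "g \<in> borel_measurable borel"
  shows "ennreal \<bar>det A\<bar> * (\<integral>\<^sup>+x. g (A *v x) \<partial>coord_lborel S) = (\<integral>\<^sup>+x. g x \<partial>coord_lborel S)"
proof -
  let ?L = "coord_lborel S"
  let ?w = "ball_vol (DIM(real^'n) - card (coord_basis S))"
  have [measurable]: "(*v) A \<in> borel_measurable borel" by (intro measurable_linear) simp
  have [measurable]: "coord_proj S \<in> borel_measurable borel" by (intro measurable_linear linear_coord_proj)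
  have row: "(A *v x) $ i = x $ i" if "i \<notin> S" for x i
  proof -
    have "(A *v x) $ i = (\<Sum>j\<in>UNIV. if j = i then x $ i else 0)"
      unfolding matrix_vector_mult_def using A(2) that by (auto intro!: sum.cong simp: block_matrix_def)
    then show ?thesis by simp
  qed
  have rowS: "(A *v x) $ i = (A *v coord_proj S x) $ i" if "i \<in> S" for x i
    unfolding matrix_vector_mult_def using A(2) that
    by (auto intro!: sum.cong simp: block_matrix_def coord_proj_def)
  have comm: "coord_proj S (A *v x) = A *v coord_proj S x" for x
    using row[of _ "coord_proj S x"] rowS[of _ x] by (auto simp: vec_eq_iff coord_proj_def)
  have diff: "A *v x - coord_proj S (A *v x) = x - coord_proj S x" for x
    using row[of _ x] by (auto simp: vec_eq_iff coord_proj_def)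
  have "?w * (\<integral>\<^sup>+x. g x \<partial>?L) = (\<integral>\<^sup>+x. g (coord_proj S x) * indicator (cball 0 1) (x - coord_proj S x) \<partial>lborel)"
    using nn_integral_span_lborel_cylinder[OF orthonormal_coord_basis, of g S] by (simp add: closest_point_coord)
  also have "\<dots> = ennreal \<bar>det A\<bar> * (\<integral>\<^sup>+x. g (coord_proj S (A *v x)) * indicator (cball 0 1) (A *v x - coord_proj S (A *v x)) \<partial>lborel)"
    by (rule nn_integral_lborel_matrix_vector_mult[OF A(1), symmetric]) measurable
  also have "\<dots> = ennreal \<bar>det A\<bar> * (\<integral>\<^sup>+x. g (A *v coord_proj S x) * indicator (cball 0 1) (x - coord_proj S x) \<partial>lborel)"
    by (simp only: comm[symmetric] diff)
  also have "\<dots> = ennreal \<bar>det A\<bar> * (?w * (\<integral>\<^sup>+x. g (A *v x) \<partial>?L))"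
    using nn_integral_span_lborel_cylinder[OF orthonormal_coord_basis, of "\<lambda>x. g (A *v x)" S] by (simp add: closest_point_coord)
  also have "\<dots> = ?w * (ennreal \<bar>det A\<bar> * (\<integral>\<^sup>+x. g (A *v x) \<partial>?L))" by (simp only: ac_simps)
  finally show ?thesis using unit_ball_vol_ennreal by (subst (asm) ennreal_mult_cancel_left) auto
qed

text \<open>Seen through the cylinder, the zero set of \<open>l\<close> becomes its preimage under
  the projection. This is a subspace of the whole space, proper because it misses \<open>b\<close>,
  and hence negligible.\<close>

lemma span_lborel_hyperplane_null:
  fixes B :: "'a::euclidean_space set" and l :: "'a \<Rightarrow> real"
  assumes B: "orthonormal_set B" and l: "linear l" and b: "b \<in> span B" "l b \<noteq> 0"
  shows "AE x in span_lborel B. l x \<noteq> 0"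
proof -
  have [measurable]: "l \<in> borel_measurable borel" using l by (rule measurable_linear)
  let ?P = "closest_point (span B)"
  let ?H = "{x. l (?P x) = 0}"
  have lP: "linear (\<lambda>x. l (?P x))" using linear_compose[OF linear_closest_point[OF subspace_span] l] by (simp add: comp_def)
  have sub: "subspace ?H" using lP by (rule linear_subspace_kernel)
  have "?P b = b" using b(1) by (simp add: closest_point_self)
  then have "b \<notin> ?H" using b by simp
  then have "dim ?H \<noteq> DIM('a)" using sub by (metis UNIV_I dim_eq_full span_eq_iff)
  then have "dim ?H < DIM('a)" using dim_subset_UNIV[of ?H] by simp
  then have "negligible ?H" by (rule negligible_lowdim)
  then have "?H \<in> null_sets lebesgue" by (simp add: negligible_iff_null_sets)
  moreover have H: "?H \<in> sets lborel" by measurable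
  ultimately have "AE x in lborel. x \<notin> ?H" by (intro AE_not_in) (simp add: null_sets_completion_iff)
  then have "(\<integral>\<^sup>+x. indicator {x. l x = 0} (?P x) * indicator (cball 0 1) (x - ?P x) \<partial>lborel) = 0"
    by (subst nn_integral_0_iff_AE) (auto elim!: eventually_mono)
  then have "ball_vol (DIM('a) - card B) * (\<integral>\<^sup>+x. indicator {x. l x = 0} x \<partial>span_lborel B) = 0"
    by (subst nn_integral_span_lborel_cylinder[OF B]) auto
  then have "emeasure (span_lborel B) {x. l x = 0} = 0" using unit_ball_vol_ennreal by simp
  then show ?thesis by (intro AE_I[of _ _ "{x. l x = 0}"]) auto
qed

lemma measurable_col_matrix [measurable]:
  assumes [measurable_cong]: "sets M = sets (borel :: (real^'n) measure)"
  shows "(\<lambda>X. det (col_matrix T X)) \<in> borel_measurable (powM T M)"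
proof (rule borel_measurable_det)
  fix i j
  have [measurable]: "(\<lambda>x::real^'n. x $ i) \<in> borel_measurable M"
    by (simp add: measurable_cong_sets[OF assms refl])
  show "(\<lambda>X. col_matrix T X $ i $ j) \<in> borel_measurable (powM T M)"
    by (cases "j \<in> T") (simp_all add: col_matrix_def)
qed

text \<open>Induction on the number of columns. The determinant is linear in the new column, and at
  \<open>axis j 1\<close> it equals the previous determinant, since this is the vector that the
  padding puts in column \<open>j\<close>. A linear form that is nonzero somewhere on the span
  vanishes only on a null set.\<close>

lemma AE_det_col_matrix:
  fixes B :: "(real^'n) set"
  assumes B: "orthonormal_set B" and T: "\<And>j. j \<in> T \<Longrightarrow> axis j 1 \<in> span B"
  shows "AE X in powM T (span_lborel B). det (col_matrix T X) \<noteq> 0"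
proof -
  have "finite T" by simp
  then show ?thesis using T
  proof (induction T rule: finite_induct)
    case empty
    have "col_matrix {} X = mat 1" for X :: "'n \<Rightarrow> real^'n" by (auto simp: col_matrix_def mat_def vec_eq_iff)
    then show ?case by simp
  next
    case (insert j T)
    let ?M = "span_lborel B"
    interpret sf: sigma_finite_measure ?M using B by (rule sigma_finite_span_lborel)
    interpret P: product_sigma_finite "\<lambda>_::'n. ?M" by (rule sf.product_power)
    let ?D = "{X \<in> space (powM (insert j T) ?M). det (col_matrix (insert j T) X) = 0}"
    have D: "?D \<in> sets (powM (insert j T) ?M)"
      using measurable_col_matrix[of ?M "insert j T"] by measurable
    have "emeasure (powM (insert j T) ?M) ?D = (\<integral>\<^sup>+X. indicator ?D X \<partial>powM (insert j T) ?M)"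
      using D by simp
    also have "\<dots> = (\<integral>\<^sup>+X. \<integral>\<^sup>+x. indicator ?D (X(j:=x)) \<partial>?M \<partial>powM T ?M)"
      using D by (intro P.product_nn_integral_insert insert) simp
    also have "\<dots> = (\<integral>\<^sup>+X. 0 \<partial>powM T ?M)"
    proof (rule nn_integral_cong_AE)
      have "AE X in powM T ?M. det (col_matrix T X) \<noteq> 0" using insert by simp
      then show "AE X in powM T ?M. (\<integral>\<^sup>+x. indicator ?D (X(j:=x)) \<partial>?M) = 0"
      proof (rule AE_mp[OF _ AE_I2], intro impI)
        fix X assume X: "X \<in> space (powM T ?M)" "det (col_matrix T X) \<noteq> 0"
        define l where "l x = det (col_matrix (insert j T) (X(j:=x)))" for x
        have lt: "l x = det (\<chi> i. if i = j then x else column i (col_matrix T X))" for x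
        proof -
          have "transpose (col_matrix (insert j T) (X(j:=x))) = (\<chi> i. if i = j then x else column i (col_matrix T X))"
            using insert(2) by (auto simp: vec_eq_iff transpose_def col_matrix_def column_def)
          then show ?thesis unfolding l_def by (metis det_transpose)
        qed
        have l1: "linear l"
          by (rule linearI) (simp_all add: lt det_row_add[where a="\<lambda>i. x" for x] det_row_mul scalar_mult_eq_scaleR[symmetric])
        have "col_matrix (insert j T) (X(j:=axis j 1)) = col_matrix T X"
          using insert(2) by (auto simp: vec_eq_iff col_matrix_def axis_def)
        then have l2: "l (axis j 1) \<noteq> 0" using X(2) by (simp add: l_def)
        have "AE x in ?M. l x \<noteq> 0"
          by (rule span_lborel_hyperplane_null[OF B l1 _ l2]) (use insert in auto)
        then have ae: "AE x in ?M. indicator ?D (X(j:=x)) = (0::ennreal)"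
          by eventually_elim (simp add: l_def)
        have "(\<lambda>x. X(j:=x)) \<in> measurable ?M (powM (insert j T) ?M)"
          by (rule measurable_component_update[OF X(1) insert(2)])
        then have "(\<lambda>x. indicator ?D (X(j:=x)) :: ennreal) \<in> borel_measurable ?M"
          using D by (rule measurable_compose[OF _ borel_measurable_indicator])
        then show "(\<integral>\<^sup>+x. indicator ?D (X(j:=x)) \<partial>?M) = 0" using ae by (subst nn_integral_0_iff_AE) auto
      qed
    qed
    finally have "emeasure (powM (insert j T) ?M) ?D = 0" by simp
    then show ?case using D by (intro AE_I[of _ _ ?D]) auto
  qed
qed

text \<open>Iterated form of the cylinder formula: \<open>g\<close> is the projection,
  \<open>w\<close> the indicator of the unit cylinder and \<open>c\<close> the volume of the unit
  ball of the complement, which enters once per vector. With \<open>c = 1\<close> and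
  \<open>w = 1\<close> it transports a power of a measure along a map.\<close>

lemma nn_integral_PiM_transfer:
  assumes M: "sigma_finite_measure M" and L: "sigma_finite_measure L" and fin: "finite T"
    and g: "g \<in> measurable M L" and w: "w \<in> borel_measurable M"
    and c: "\<And>f. f \<in> borel_measurable L \<Longrightarrow> c * (\<integral>\<^sup>+x. f x \<partial>L) = (\<integral>\<^sup>+x. f (g x) * w x \<partial>M)"
    and G: "G \<in> borel_measurable (powM T L)"
  shows "c ^ card T * (\<integral>\<^sup>+X. G X \<partial>powM T L)
    = (\<integral>\<^sup>+X. G (\<lambda>i\<in>T. g (X i)) * (\<Prod>i\<in>T. w (X i)) \<partial>powM T M)"
  using fin G
proof (induction T arbitrary: G rule: finite_induct)
  case empty
  interpret M: product_sigma_finite "\<lambda>_. M" by (rule sigma_finite_measure.product_power[OF M])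
  interpret L: product_sigma_finite "\<lambda>_. L" by (rule sigma_finite_measure.product_power[OF L])
  show ?case by (simp add: M.nn_integral_empty L.nn_integral_empty restrict_def space_PiM)
next
  case (insert i T)
  interpret M0: sigma_finite_measure M by fact
  interpret L0: sigma_finite_measure L by fact
  interpret M: product_sigma_finite "\<lambda>_. M" by (rule sigma_finite_measure.product_power[OF M])
  interpret L: product_sigma_finite "\<lambda>_. L" by (rule sigma_finite_measure.product_power[OF L])
  note [measurable] = insert.prems g w
  have r: "(\<lambda>X. \<lambda>j\<in>T. g (X j)) \<in> measurable (powM T M) (powM T L)"
    by (rule measurable_restrict) measurable
  have r': "(\<lambda>X. \<lambda>j\<in>insert i T. g (X j)) \<in> measurable (powM (insert i T) M) (powM (insert i T) L)"
    by (rule measurable_restrict) measurable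
  note [measurable] = r r'
  let ?H = "\<lambda>X. \<integral>\<^sup>+x. G (X(i:=x)) \<partial>L"
  have H[measurable]: "?H \<in> borel_measurable (powM T L)"
    by (rule L0.borel_measurable_nn_integral) measurable
  have "c ^ card (insert i T) * (\<integral>\<^sup>+X. G X \<partial>powM (insert i T) L)
      = c * (c ^ card T * (\<integral>\<^sup>+X. ?H X \<partial>powM T L))"
    using insert(1,2) L.product_nn_integral_insert[OF insert(1,2) insert.prems] by (simp add: mult.assoc fun_upd_def)
  also have "\<dots> = c * (\<integral>\<^sup>+X. ?H (\<lambda>j\<in>T. g (X j)) * (\<Prod>j\<in>T. w (X j)) \<partial>powM T M)"
    by (subst insert.IH[OF H]) simp
  also have "\<dots> = (\<integral>\<^sup>+X. c * (?H (\<lambda>j\<in>T. g (X j)) * (\<Prod>j\<in>T. w (X j))) \<partial>powM T M)"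
    by (rule nn_integral_cmult[symmetric]) (use measurable_compose[OF r H] in measurable)
  also have "\<dots> = (\<integral>\<^sup>+X. \<integral>\<^sup>+x. G (\<lambda>j\<in>insert i T. g ((X(i:=x)) j)) * (\<Prod>j\<in>insert i T. w ((X(i:=x)) j)) \<partial>M \<partial>powM T M)"
  proof (rule nn_integral_cong)
    fix X assume X: "X \<in> space (powM T M)"
    have "(\<lambda>j\<in>T. g (X j)) \<in> space (powM T L)" using measurable_space[OF r X] .
    then have m: "(\<lambda>x. G ((\<lambda>j\<in>T. g (X j))(i:=x))) \<in> borel_measurable L"
      using insert(2) by measurable
    have "c * (?H (\<lambda>j\<in>T. g (X j)) * (\<Prod>j\<in>T. w (X j))) = (c * ?H (\<lambda>j\<in>T. g (X j))) * (\<Prod>j\<in>T. w (X j))"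
      by (simp add: mult.assoc)
    also have "\<dots> = (\<integral>\<^sup>+x. G ((\<lambda>j\<in>T. g (X j))(i:=g x)) * w x \<partial>M) * (\<Prod>j\<in>T. w (X j))"
      by (subst c[OF m]) simp
    also have "\<dots> = (\<integral>\<^sup>+x. (G ((\<lambda>j\<in>T. g (X j))(i:=g x)) * w x) * (\<Prod>j\<in>T. w (X j)) \<partial>M)"
      by (rule nn_integral_multc[symmetric]) (use measurable_compose[OF g m] in measurable)
    also have "\<dots> = (\<integral>\<^sup>+x. G (\<lambda>j\<in>insert i T. g ((X(i:=x)) j)) * (\<Prod>j\<in>insert i T. w ((X(i:=x)) j)) \<partial>M)"
    proof (rule nn_integral_cong)
      fix x
      have "(\<lambda>j\<in>T. g (X j))(i:=g x) = (\<lambda>j\<in>insert i T. g ((X(i:=x)) j))"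
        using insert(2) by (auto simp: fun_eq_iff)
      moreover have "(\<Prod>j\<in>insert i T. w ((X(i:=x)) j)) = w x * (\<Prod>j\<in>T. w (X j))"
        using insert(1,2) by (auto intro!: arg_cong2[where f="(*)"] prod.cong)
      ultimately show "(G ((\<lambda>j\<in>T. g (X j))(i:=g x)) * w x) * (\<Prod>j\<in>T. w (X j)) =
          G (\<lambda>j\<in>insert i T. g ((X(i:=x)) j)) * (\<Prod>j\<in>insert i T. w ((X(i:=x)) j))"
        by (simp add: mult.assoc)
    qed
    finally show "c * (?H (\<lambda>j\<in>T. g (X j)) * (\<Prod>j\<in>T. w (X j))) =
       (\<integral>\<^sup>+x. G (\<lambda>j\<in>insert i T. g ((X(i:=x)) j)) * (\<Prod>j\<in>insert i T. w ((X(i:=x)) j)) \<partial>M)" .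
  qed
  also have "\<dots> = (\<integral>\<^sup>+X. G (\<lambda>j\<in>insert i T. g (X j)) * (\<Prod>j\<in>insert i T. w (X j)) \<partial>powM (insert i T) M)"
  proof (rule M.product_nn_integral_insert[OF insert(1,2), symmetric])
    have "(\<lambda>X. \<Prod>j\<in>insert i T. w (X j)) \<in> borel_measurable (powM (insert i T) M)"
      by (rule borel_measurable_prod_ennreal) (rule measurable_compose[OF measurable_component_singleton[where M="\<lambda>_. M"] w])
    then show "(\<lambda>X. G (\<lambda>j\<in>insert i T. g (X j)) * (\<Prod>j\<in>insert i T. w (X j))) \<in> borel_measurable (powM (insert i T) M)"
      using measurable_compose[OF r' insert.prems] by measurable
  qed
  finally show ?case .
qed

section \<open>Domination between tuples and the volume of the dominated set\<close>

definition tuple_comb :: "'n::finite set \<Rightarrow> ('n \<Rightarrow> 'a::real_vector) \<Rightarrow> real^'n \<Rightarrow> 'a" where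
  "tuple_comb S X v = (\<Sum>i\<in>S. (v $ i) *\<^sub>R X i)"

text \<open>The quadratic form of the Gram matrix of \<open>Z\<close> lies below that of
  \<open>X\<close>. The relation survives isometries of either tuple and invertible substitutions
  made in both, and an independent \<open>X\<close> dominates a set of tuples \<open>Z\<close> of
  finite positive volume in the coordinate subspace. It serves as the cutoff in the averaging
  argument.\<close>

definition dominated :: "'n::finite set \<Rightarrow> ('n \<Rightarrow> 'a::real_normed_vector) \<Rightarrow> ('n \<Rightarrow> 'b::real_normed_vector) \<Rightarrow> bool" where
  "dominated S Z X \<longleftrightarrow> (\<forall>v. norm (tuple_comb S Z v) \<le> norm (tuple_comb S X v))"

abbreviation std_tuple :: "'n::finite \<Rightarrow> real^'n" where
  "std_tuple \<equiv> (\<lambda>i. axis i 1)"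

lemma tuple_comb_mult: "tuple_comb S (tuple_mult S X Z) v = tuple_comb S X (tuple_comb S Z v)"
proof -
  have "tuple_comb S (tuple_mult S X Z) v = (\<Sum>j\<in>S. \<Sum>i\<in>S. (v $ j * Z j $ i) *\<^sub>R X i)"
    by (simp add: tuple_comb_def tuple_mult_def scaleR_sum_right)
  also have "\<dots> = (\<Sum>i\<in>S. \<Sum>j\<in>S. (v $ j * Z j $ i) *\<^sub>R X i)" by (rule sum.swap)
  also have "\<dots> = tuple_comb S X (tuple_comb S Z v)"
    by (simp add: tuple_comb_def scaleR_sum_left)
  finally show ?thesis .
qed

lemma tuple_comb_std: "tuple_comb S std_tuple v = coord_proj S v"
  by (simp add: tuple_comb_def coord_proj_eq_sum)

lemma tuple_comb_coord_proj: "tuple_comb S X (coord_proj S v) = tuple_comb S X v"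
  by (simp add: tuple_comb_def coord_proj_def)

lemma tuple_comb_linear: "linear U \<Longrightarrow> (\<And>j. j \<in> S \<Longrightarrow> X j = U (B j)) \<Longrightarrow> tuple_comb S X v = U (tuple_comb S B v)"
  by (simp add: tuple_comb_def linear_sum linear_cmul)

lemma tuple_comb_surj:
  assumes d: "det (col_matrix S Z) \<noteq> 0" and Z: "\<And>j. j \<in> S \<Longrightarrow> Z j \<in> span (coord_basis S)"
  obtains v where "tuple_comb S Z v = coord_proj S w"
proof -
  have "invertible (col_matrix S Z)" using d by (simp add: invertible_det_nz)
  then obtain A' where "col_matrix S Z ** A' = mat 1" unfolding invertible_right_inverse by blast
  then have "col_matrix S Z *v (A' *v coord_proj S w) = coord_proj S w"
    by (simp add: matrix_vector_mul_assoc)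
  then obtain v where v: "col_matrix S Z *v v = coord_proj S w" by blast
  have "v $ i = 0" if i: "i \<notin> S" for i
  proof -
    have "(col_matrix S Z *v v) $ i = (\<Sum>j\<in>UNIV. if j = i then v $ i else 0)"
      unfolding matrix_vector_mult_def using block_col_matrix[of S Z] Z i
      by (auto intro!: sum.cong simp: block_matrix_def)
    then show ?thesis using v i by (simp add: coord_proj_def)
  qed
  then have "v \<in> span (coord_basis S)" by (simp add: span_coord_basis)
  then show ?thesis using that v col_matrix_mult_vec by (metis tuple_comb_def)
qed

text \<open>Both norms are continuous in \<open>v\<close>, so a violation occurs on an open set.
  Testing countably many \<open>v\<close> makes the relation measurable.\<close>

lemma dominated_dense:
  fixes Z :: "'n::finite \<Rightarrow> 'a::real_normed_vector" and X :: "'n \<Rightarrow> 'b::real_normed_vector"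
  assumes D: "\<And>U::(real^'n) set. open U \<Longrightarrow> U \<noteq> {} \<Longrightarrow> \<exists>d\<in>D. d \<in> U"
  shows "dominated S Z X \<longleftrightarrow> (\<forall>v\<in>D. norm (tuple_comb S Z v) \<le> norm (tuple_comb S X v))"
proof
  assume *: "\<forall>v\<in>D. norm (tuple_comb S Z v) \<le> norm (tuple_comb S X v)"
  have "open {v. norm (tuple_comb S X v) < norm (tuple_comb S Z v)}"
    unfolding tuple_comb_def by (intro open_Collect_less continuous_intros)
  with D * show "dominated S Z X" unfolding dominated_def by (metis (mono_tags, lifting) empty_Collect_eq mem_Collect_eq not_le)
qed (simp add: dominated_def)

lemma pred_dominated:
  fixes Z :: "'c \<Rightarrow> 'n::finite \<Rightarrow> 'a::euclidean_space" and X :: "'c \<Rightarrow> 'n \<Rightarrow> 'b::euclidean_space"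
  assumes [measurable]: "\<And>i. i \<in> S \<Longrightarrow> (\<lambda>\<omega>. Z \<omega> i) \<in> borel_measurable M" "\<And>i. i \<in> S \<Longrightarrow> (\<lambda>\<omega>. X \<omega> i) \<in> borel_measurable M"
  shows "Measurable.pred M (\<lambda>\<omega>. dominated S (Z \<omega>) (X \<omega>))"
proof -
  obtain D :: "(real^'n) set" where D: "countable D" "\<And>U. open U \<Longrightarrow> U \<noteq> {} \<Longrightarrow> \<exists>d\<in>D. d \<in> U"
    by (metis countable_dense_exists)
  have "Measurable.pred M (\<lambda>\<omega>. \<forall>v\<in>D. norm (tuple_comb S (Z \<omega>) v) \<le> norm (tuple_comb S (X \<omega>) v))"
    using D(1) unfolding tuple_comb_def by measurable
  then show ?thesis by (simp add: dominated_dense[OF D(2)])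
qed

text \<open>Write \<open>X\<close> as an isometric image of a square matrix \<open>B\<close>.
  Multiplication by \<open>B\<close> turns tuples dominated by the standard tuple into those
  dominated by \<open>B\<close>; it acts on vectors of a space of dimension \<open>card S\<close>,
  whence the exponent of the determinant.\<close>

lemma dominated_volume:
  fixes X :: "'n \<Rightarrow> real^'n"
  assumes g: "det (gram S X) \<noteq> 0"
  shows "(\<integral>\<^sup>+Z. indicator {Z. dominated S Z X} Z \<partial>powM S (coord_lborel S))
    = ennreal (gram_vol S X ^ card S) *
      (\<integral>\<^sup>+Z. indicator {Z. dominated S Z std_tuple} Z \<partial>powM S (coord_lborel S))"
proof -
  obtain U :: "real^'n \<Rightarrow> real^'n" and B where UB: "orthogonal_transformation U"
    "\<And>j. j \<in> S \<Longrightarrow> B j \<in> span (coord_basis S)" "\<And>j. j \<in> S \<Longrightarrow> X j = U (B j)"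
    "gram_vol S X = \<bar>det (col_matrix S B)\<bar>" "det (col_matrix S B) \<noteq> 0"
    by (rule tuple_polar[OF g]) blast
  let ?L = "powM S (coord_lborel S)"
  have tX: "tuple_comb S X v = U (tuple_comb S B v)" for v
    by (rule tuple_comb_linear[OF orthogonal_transformation_linear[OF UB(1)] UB(3)])
  have dX: "dominated S Z X \<longleftrightarrow> dominated S Z B" for Z :: "'n \<Rightarrow> real^'n"
    unfolding dominated_def tX using orthogonal_transformation_norm[OF UB(1)] by simp
  have dZ: "dominated S (tuple_mult S Z B) B \<longleftrightarrow> dominated S Z std_tuple" for Z :: "'n \<Rightarrow> real^'n"
    unfolding dominated_def tuple_comb_mult tuple_comb_std
  proof safe
    fix w assume *: "\<forall>v. norm (tuple_comb S Z (tuple_comb S B v)) \<le> norm (tuple_comb S B v)"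
    obtain v where "tuple_comb S B v = coord_proj S w" using tuple_comb_surj[OF UB(5,2)] by blast
    then show "norm (tuple_comb S Z w) \<le> norm (coord_proj S w)"
      using *[rule_format, of v] by (simp add: tuple_comb_coord_proj)
  next
    fix v assume *: "\<forall>w. norm (tuple_comb S Z w) \<le> norm (coord_proj S w)"
    have "tuple_comb S B v \<in> span (coord_basis S)"
      unfolding tuple_comb_def using UB(2) by (intro span_sum span_scale) auto
    then show "norm (tuple_comb S Z (tuple_comb S B v)) \<le> norm (tuple_comb S B v)"
      using *[rule_format, of "tuple_comb S B v"] by (simp add: coord_proj_id)
  qed
  have act: "(\<lambda>j\<in>S. \<Sum>i\<in>S. (col_matrix S B $ i $ j) *\<^sub>R Z i) = tuple_mult S Z B" for Z :: "'n \<Rightarrow> real^'n"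
    by (auto simp: tuple_mult_def col_matrix_def fun_eq_iff)
  have "Measurable.pred ?L (\<lambda>Z. dominated S Z B)"
    by (rule pred_dominated) (auto intro!: measurable_component_singleton simp: measurable_cong_sets[OF refl sets_span_lborel[symmetric]])
  then have m: "(\<lambda>Z. indicator {Z. dominated S Z B} Z :: ennreal) \<in> borel_measurable ?L"
    by measurable
  have "(\<integral>\<^sup>+Z. indicator {Z. dominated S Z X} Z \<partial>?L) = (\<integral>\<^sup>+Z. indicator {Z. dominated S Z B} Z \<partial>?L)"
    by (simp add: dX)
  also have "\<dots> = ennreal (\<bar>det (col_matrix S B)\<bar> ^ card (coord_basis S)) *
      (\<integral>\<^sup>+Z. indicator {Z. dominated S Z B} (tuple_mult S Z B) \<partial>?L)"
    using nn_integral_PiM_right_mult_block[OF orthonormal_coord_basis UB(5) block_col_matrix[OF UB(2)] m] by (simp add: act)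
  also have "(\<integral>\<^sup>+Z. indicator {Z. dominated S Z B} (tuple_mult S Z B) \<partial>?L) = (\<integral>\<^sup>+Z. indicator {Z. dominated S Z std_tuple} Z \<partial>?L)"
    by (intro nn_integral_cong) (simp add: indicator_def dZ)
  finally show ?thesis by (simp add: UB(4))
qed

text \<open>Evaluation at \<open>axis j 1\<close> bounds every vector of a dominated tuple by 1, and
  conversely the triangle inequality shows that tuples of short vectors are dominated. So
  \<open>K\<close> is squeezed between the volumes of two products of balls.\<close>

lemma dominated_std_finite_pos:
  fixes S :: "'n::finite set"
  defines "K \<equiv> (\<integral>\<^sup>+Z. indicator {Z. dominated S Z std_tuple} Z \<partial>powM S (coord_lborel S))"
  shows "K \<noteq> 0" "K \<noteq> \<infinity>"
proof -
  let ?M = "coord_lborel S"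
  let ?L = "powM S ?M"
  interpret sf: sigma_finite_measure ?M by (rule sigma_finite_span_lborel[OF orthonormal_coord_basis])
  interpret P: product_sigma_finite "\<lambda>_::'n. ?M" by (rule sf.product_power)
  have box: "(\<integral>\<^sup>+Z. (\<Prod>j\<in>S. indicator (cball 0 r) (Z j)) \<partial>?L) = ennreal ((unit_ball_vol (real (card S)) * r ^ card S) ^ card S)"
    if r: "r > 0" for r
  proof -
    have "(\<integral>\<^sup>+Z. (\<Prod>j\<in>S. indicator (cball 0 r) (Z j)) \<partial>?L) = (\<Prod>j\<in>S. \<integral>\<^sup>+x. indicator (cball 0 r) x \<partial>?M)"
      by (rule P.product_nn_integral_prod) auto
    also have "\<dots> = ennreal (unit_ball_vol (real (card S)) * r ^ card S) ^ card S"
      using emeasure_span_lborel_cball[OF orthonormal_coord_basis r, of S] by simp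
    finally show ?thesis using r by (simp add: ennreal_power)
  qed
  have "K \<le> (\<integral>\<^sup>+Z. (\<Prod>j\<in>S. indicator (cball 0 1) (Z j)) \<partial>?L)"
    unfolding K_def
  proof (rule nn_integral_mono)
    fix Z :: "'n \<Rightarrow> real^'n"
    have "Z j \<in> cball 0 1" if d: "dominated S Z std_tuple" and j: "j \<in> S" for j
    proof -
      have "tuple_comb S Z (axis j 1) = (\<Sum>i\<in>S. if i = j then Z j else 0)"
        unfolding tuple_comb_def by (rule sum.cong) (auto simp: axis_def)
      also have "\<dots> = Z j" using j by simp
      finally have "norm (Z j) \<le> norm (coord_proj S (axis j 1))"
        using d unfolding dominated_def tuple_comb_std by metis
      also have "coord_proj S (axis j 1) = axis j 1" using j by (intro coord_proj_id axis_in_span_coord_basis)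
      finally show ?thesis by simp
    qed
    then show "indicator {Z. dominated S Z std_tuple} Z \<le> (\<Prod>j\<in>S. indicator (cball 0 1) (Z j) :: ennreal)"
      by (auto simp: indicator_def)
  qed
  then show "K \<noteq> \<infinity>" using box[of 1] by (auto simp: top_unique)
  \<comment> \<open>With this radius \<open>card S * r\<close> is at most 1, as the sum of
    \<open>card S\<close> terms requires; the added 1 in the denominator covers an empty
    \<open>S\<close>.\<close>
  define r where "r = 1 / (real (card S) + 1)"
  have r: "r > 0" by (simp add: r_def)
  have "(\<integral>\<^sup>+Z. (\<Prod>j\<in>S. indicator (cball 0 r) (Z j)) \<partial>?L) \<le> K"
    unfolding K_def
  proof (rule nn_integral_mono)
    fix Z :: "'n \<Rightarrow> real^'n"
    have "dominated S Z std_tuple" if Z: "\<forall>j\<in>S. norm (Z j) \<le> r"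
      unfolding dominated_def tuple_comb_std
    proof
      fix v
      have "norm (tuple_comb S Z v) \<le> (\<Sum>i\<in>S. norm ((v $ i) *\<^sub>R Z i))" unfolding tuple_comb_def by (rule norm_sum)
      also have "\<dots> \<le> (\<Sum>i\<in>S. norm (coord_proj S v) * r)"
      proof (rule sum_mono)
        fix i assume i: "i \<in> S"
        have "\<bar>v $ i\<bar> \<le> norm (coord_proj S v)"
          using component_le_norm_cart[of "coord_proj S v" i] i by (simp add: coord_proj_def)
        then show "norm ((v $ i) *\<^sub>R Z i) \<le> norm (coord_proj S v) * r"
          using Z i by (simp add: mult_mono)
      qed
      also have "\<dots> = norm (coord_proj S v) * (real (card S) * r)" by simp
      also have "\<dots> \<le> norm (coord_proj S v) * 1" by (intro mult_left_mono) (simp_all add: r_def)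
      finally show "norm (tuple_comb S Z v) \<le> norm (coord_proj S v)" by simp
    qed
    then show "(\<Prod>j\<in>S. indicator (cball 0 r) (Z j) :: ennreal) \<le> indicator {Z. dominated S Z std_tuple} Z"
      by (cases "\<forall>j\<in>S. norm (Z j) \<le> r") (auto simp: indicator_def intro!: prod_le_1)
  qed
  moreover have "(unit_ball_vol (real (card S)) * r ^ card S) ^ card S > 0" using r by simp
  ultimately show "K \<noteq> 0" using box[OF r] by (metis ennreal_eq_0_iff le_zero_eq not_le)
qed

lemma measurable_gram_vol:
  fixes X :: "'c \<Rightarrow> 'n::finite \<Rightarrow> 'a::euclidean_space"
  assumes [measurable]: "\<And>i. i \<in> S \<Longrightarrow> (\<lambda>\<omega>. X \<omega> i) \<in> borel_measurable M"
  shows "(\<lambda>\<omega>. gram_vol S (X \<omega>)) \<in> borel_measurable M"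
proof -
  have "(\<lambda>\<omega>. det (gram S (X \<omega>))) \<in> borel_measurable M"
  proof (rule borel_measurable_det)
    fix i j show "(\<lambda>\<omega>. gram S (X \<omega>) $ i $ j) \<in> borel_measurable M"
      by (cases "i \<in> S \<and> j \<in> S") (auto simp: gram_def)
  qed
  then show ?thesis unfolding gram_vol_def by measurable
qed

lemma lborel_eq_span_lborel: "(lborel :: 'a::euclidean_space measure) = span_lborel Basis"
  by (rule span_lborel_full[OF orthonormal_set_Basis, symmetric]) simp

lemma AE_det_gram_nonzero:
  "AE X in powM (S::'n set) (lborel :: (real^'n) measure). det (gram S X) \<noteq> 0"
proof -
  have "AE X in powM S (span_lborel (Basis :: (real^'n) set)). det (col_matrix S X) \<noteq> 0"
    by (rule AE_det_col_matrix[OF orthonormal_set_Basis]) simp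
  then show ?thesis unfolding lborel_eq_span_lborel
    by eventually_elim (rule det_gram_nonzero_if_col_matrix)
qed

lemma AE_coord_tuple:
  "AE Z in powM (S::'n::finite set) (coord_lborel S). (\<forall>j\<in>S. Z j \<in> span (coord_basis S)) \<and> det (col_matrix S Z) \<noteq> 0"
proof -
  have "AE Z in powM S (coord_lborel S). \<forall>j\<in>S. Z j \<in> span (coord_basis S)"
    by (intro AE_finite_allI AE_PiM_component_finite sigma_finite_span_lborel orthonormal_coord_basis AE_span_lborel) auto
  moreover have "AE Z in powM S (coord_lborel S). det (col_matrix S Z) \<noteq> 0"
    by (rule AE_det_col_matrix[OF orthonormal_coord_basis axis_in_span_coord_basis])
  ultimately show ?thesis by eventually_elim simp
qed

section \<open>The linear Blaschke-Petkantschin formula\<close>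

definition flat_avg :: "'n::finite set \<Rightarrow> nat \<Rightarrow> (('n \<Rightarrow> real^'n) \<Rightarrow> ennreal) \<Rightarrow> (real^'n) set \<Rightarrow> ennreal" where
  "flat_avg S N F B = (\<integral>\<^sup>+Z. F Z * ennreal (gram_vol S Z ^ N) \<partial>powM S (span_lborel B))"

text \<open>Cylinder form of \<open>flat_avg\<close>, which it equals up to a power of a ball
  volume. Only the projection matrix enters, so this is a Borel function of a matrix, whereas
  \<open>flat_avg\<close> refers to a chosen basis.\<close>

definition proj_avg :: "'n::finite set \<Rightarrow> nat \<Rightarrow> (('n \<Rightarrow> real^'n) \<Rightarrow> ennreal) \<Rightarrow> real^'n^'n \<Rightarrow> ennreal" where
  "proj_avg S N F P = (\<integral>\<^sup>+Y. F (\<lambda>j\<in>S. P *v Y j) * ennreal (gram_vol S (\<lambda>j\<in>S. P *v Y j) ^ N)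
      * (\<Prod>j\<in>S. indicator (cball 0 1) (Y j - P *v Y j)) \<partial>powM S lborel)"

text \<open>Orthogonal projection onto the span of an independent tuple: Cramer's rule solves the
  normal equations. The explicit formula shows that the projection matrix of the span depends
  measurably on the tuple.\<close>

definition proj_vec :: "'n::finite set \<Rightarrow> ('n \<Rightarrow> real^'n) \<Rightarrow> real^'n \<Rightarrow> real^'n" where
  "proj_vec S X v = (\<Sum>l\<in>S. (det ((\<chi> i j. if j = l then (if i \<in> S then X i \<bullet> v else 0) else gram S X $ i $ j) :: real^'n^'n)
      / det (gram S X)) *\<^sub>R X l)"

definition proj_matrix :: "'n::finite set \<Rightarrow> ('n \<Rightarrow> real^'n) \<Rightarrow> real^'n^'n" where
  "proj_matrix S X = (\<chi> i j. proj_vec S X (axis j 1) $ i)"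

lemma proj_vec_eq:
  fixes X :: "'n \<Rightarrow> real^'n"
  assumes g: "det (gram S X) \<noteq> 0"
  shows "proj_vec S X v = closest_point (span (X ` S)) v"
proof (rule closest_point_subspace_eq[symmetric])
  define b where "b = (\<chi> i. if i \<in> S then X i \<bullet> v else 0)"
  define y where "y = (\<chi> l. det ((\<chi> i j. if j = l then b $ i else gram S X $ i $ j) :: real^'n^'n) / det (gram S X))"
  have gy: "gram S X *v y = b" using cramer[OF g, of y b] by (simp add: y_def)
  have pv: "proj_vec S X v = (\<Sum>l\<in>S. (y $ l) *\<^sub>R X l)" unfolding proj_vec_def y_def b_def vec_lambda_beta ..
  show "proj_vec S X v \<in> span (X ` S)"
    unfolding proj_vec_def by (intro span_sum span_scale span_base) auto
  fix z assume z: "z \<in> span (X ` S)"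
  have "(v - proj_vec S X v) \<bullet> X i = 0" if i: "i \<in> S" for i
  proof -
    have "(gram S X *v y) $ i = (\<Sum>j\<in>UNIV. if j \<in> S then y $ j * (X j \<bullet> X i) else 0)"
      unfolding matrix_vector_mult_def using i gy gram_mult_outside[of _ S X y]
      by (auto intro!: sum.cong simp: gram_def inner_commute b_def)
    also have "\<dots> = (\<Sum>l\<in>S. y $ l * (X l \<bullet> X i))" by (rule sum_if_mem)
    also have "\<dots> = proj_vec S X v \<bullet> X i" by (simp add: pv inner_sum_left)
    finally have "proj_vec S X v \<bullet> X i = X i \<bullet> v" using gy i by (simp add: b_def)
    then show ?thesis by (simp add: inner_diff_left inner_commute[of v])
  qed
  then have "X ` S \<subseteq> {z. (v - proj_vec S X v) \<bullet> z = 0}" by auto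
  then have "span (X ` S) \<subseteq> {z. (v - proj_vec S X v) \<bullet> z = 0}"
    by (rule span_minimal) (auto simp: subspace_def inner_add_right)
  then show "(v - proj_vec S X v) \<bullet> z = 0" using z by auto
qed simp

lemma proj_matrix_eq:
  "det (gram S X) \<noteq> 0 \<Longrightarrow> proj_matrix S X = matrix (closest_point (span (X ` S)))"
  by (simp add: proj_matrix_def matrix_def proj_vec_eq)

lemma measurable_nth_borel: "(\<lambda>x::real^'n. x $ i) \<in> borel_measurable borel"
  by (intro borel_measurable_continuous_onI continuous_intros)

lemma measurable_component_borel:
  assumes "sets M = sets borel" "i \<in> S"
  shows "(\<lambda>X. X i) \<in> borel_measurable (powM S M)"
  using measurable_component_singleton[OF assms(2), of "\<lambda>_. M"] measurable_cong_sets[OF refl assms(1)] by blast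

lemma measurable_proj_matrix:
  fixes X :: "'c \<Rightarrow> 'n::finite \<Rightarrow> real^'n"
  assumes [measurable]: "\<And>i. i \<in> S \<Longrightarrow> (\<lambda>\<omega>. X \<omega> i) \<in> borel_measurable M"
  shows "(\<lambda>\<omega>. proj_matrix S (X \<omega>)) \<in> borel_measurable M"
proof -
  have gm: "(\<lambda>\<omega>. gram S (X \<omega>) $ i $ j) \<in> borel_measurable M" for i j
    by (cases "i \<in> S \<and> j \<in> S") (auto simp: gram_def)
  have dm: "(\<lambda>\<omega>. det (gram S (X \<omega>))) \<in> borel_measurable M" using gm by (rule borel_measurable_det)
  have "(\<lambda>\<omega>. det ((\<chi> i j. if j = l then (if i \<in> S then X \<omega> i \<bullet> v else 0) else gram S (X \<omega>) $ i $ j) :: real^'n^'n)) \<in> borel_measurable M" for l v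
  proof (rule borel_measurable_det)
    fix i j
    show "(\<lambda>\<omega>. ((\<chi> i j. if j = l then (if i \<in> S then X \<omega> i \<bullet> v else 0) else gram S (X \<omega>) $ i $ j) :: real^'n^'n) $ i $ j) \<in> borel_measurable M"
      using gm by (cases "j = l"; cases "i \<in> S") auto
  qed
  then have pv: "(\<lambda>\<omega>. proj_vec S (X \<omega>) v) \<in> borel_measurable M" for v
    unfolding proj_vec_def using dm by (intro borel_measurable_sum borel_measurable_scaleR borel_measurable_divide) auto
  have "(\<lambda>\<omega>. proj_matrix S (X \<omega>) $ i $ j) \<in> borel_measurable M" for i j
    unfolding proj_matrix_def using measurable_compose[OF pv measurable_nth_borel] by simp
  then show ?thesis by (intro measurable_borel_vec)
qed

lemma measurable_tuple_mult:
  assumes "sets M = sets (borel :: (real^'n) measure)" "sets N = sets (borel :: (real^'n) measure)"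
  shows "(\<lambda>p. tuple_mult S (fst p) (snd p)) \<in> measurable (powM S M \<Otimes>\<^sub>M powM S N) (powM S M)"
  unfolding tuple_mult_def
proof (rule measurable_restrict)
  fix j assume j: "j \<in> S"
  have 1: "(\<lambda>p. fst p i) \<in> borel_measurable (powM S M \<Otimes>\<^sub>M powM S N)" if "i \<in> S" for i
    using measurable_compose[OF measurable_fst measurable_component_borel[OF assms(1) that]] .
  have 2: "(\<lambda>p. snd p j) \<in> borel_measurable (powM S M \<Otimes>\<^sub>M powM S N)"
    using measurable_compose[OF measurable_snd measurable_component_borel[OF assms(2) j]] .
  have "(\<lambda>p. \<Sum>i\<in>S. (snd p j $ i) *\<^sub>R fst p i) \<in> borel_measurable (powM S M \<Otimes>\<^sub>M powM S N)"
    by (intro borel_measurable_sum borel_measurable_scaleR 1 measurable_compose[OF 2 measurable_nth_borel])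
  then show "(\<lambda>p. \<Sum>i\<in>S. (snd p j $ i) *\<^sub>R fst p i) \<in> measurable (powM S M \<Otimes>\<^sub>M powM S N) M"
    using measurable_cong_sets[OF refl assms(1)] by blast
qed

lemma gram_vol_pos: "det (gram S X) \<noteq> 0 \<Longrightarrow> 0 < gram_vol S X"
  by (simp add: gram_vol_def)

text \<open>Averaging over the linear substitutions that \<open>X\<close> dominates: the volume of this set of
  substitutions is \<open>gram_vol S X ^ card S\<close> up to a constant, which \<open>1 / gram_vol S X ^ card S\<close> cancels.\<close>

lemma averaging_identity:
  fixes F :: "('n::finite \<Rightarrow> real^'n) \<Rightarrow> ennreal" and S :: "'n set"
  assumes F [measurable]: "F \<in> borel_measurable (powM S lborel)"
  shows "(\<integral>\<^sup>+Z. indicator {Z. dominated S Z std_tuple} Z \<partial>powM S (coord_lborel S))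
       * (\<integral>\<^sup>+X. F X \<partial>powM S lborel)
    = (\<integral>\<^sup>+X. ennreal (1 / gram_vol S X ^ card S) * indicator {X. dominated S std_tuple X} X
         * (\<integral>\<^sup>+Z. ennreal (\<bar>det (col_matrix S Z)\<bar> ^ (CARD('n) - card S)) * F (tuple_mult S X Z)
              \<partial>powM S (coord_lborel S)) \<partial>powM S lborel)"
    (is "?K * _ = _")
proof -
  let ?\<Lambda> = "powM S (lborel :: (real^'n) measure)"
  let ?L = "powM S (coord_lborel S)"
  let ?k = "card S" and ?n = "CARD('n)"
  interpret pl: product_sigma_finite "\<lambda>_::'n. lborel :: (real^'n) measure" by (rule product_sigma_finite_lborel)
  interpret sf: sigma_finite_measure "coord_lborel S" by (rule sigma_finite_span_lborel[OF orthonormal_coord_basis])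
  interpret ps: product_sigma_finite "\<lambda>_::'n. coord_lborel S" by (rule sf.product_power)
  interpret Lam: sigma_finite_measure ?\<Lambda> by (rule pl.sigma_finite) simp
  interpret L: sigma_finite_measure ?L by (rule ps.sigma_finite) simp
  interpret pair_sigma_finite ?\<Lambda> ?L ..
  have X1: "(\<lambda>p. fst p i) \<in> borel_measurable (?\<Lambda> \<Otimes>\<^sub>M ?L)" if "i \<in> S" for i
    by (rule measurable_compose[OF measurable_fst measurable_component_borel]) (use that in simp_all)
  have Z1: "(\<lambda>p. snd p i) \<in> borel_measurable (?\<Lambda> \<Otimes>\<^sub>M ?L)" if "i \<in> S" for i
    by (rule measurable_compose[OF measurable_snd measurable_component_borel]) (use that in simp_all)
  have gv[measurable]: "(\<lambda>p. gram_vol S (fst p)) \<in> borel_measurable (?\<Lambda> \<Otimes>\<^sub>M ?L)"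
    using X1 by (rule measurable_gram_vol)
  have dm[measurable]: "Measurable.pred (?\<Lambda> \<Otimes>\<^sub>M ?L) (\<lambda>p. dominated S (snd p) (fst p))"
    using X1 Z1 by (intro pred_dominated)
  have dm2[measurable]: "Measurable.pred (?\<Lambda> \<Otimes>\<^sub>M ?L) (\<lambda>p. dominated S std_tuple (fst p))"
    using X1 by (intro pred_dominated) auto
  have cm[measurable]: "(\<lambda>p. det (col_matrix S (snd p))) \<in> borel_measurable (?\<Lambda> \<Otimes>\<^sub>M ?L)"
    by (rule measurable_compose[OF measurable_snd measurable_col_matrix]) simp
  have tm[measurable]: "(\<lambda>p. F (tuple_mult S (fst p) (snd p))) \<in> borel_measurable (?\<Lambda> \<Otimes>\<^sub>M ?L)"
    by (rule measurable_compose[OF measurable_tuple_mult F]) simp_all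
  \<comment> \<open>\<open>Q\<close> spreads \<open>F X\<close> over the substitutions
    \<open>Z\<close> that \<open>X\<close> dominates, with total mass \<open>?K * F X\<close>.
    Exchanging the integrals and replacing \<open>X\<close> by the product of \<open>X\<close> and
    \<open>Z\<close> moves the condition onto \<open>X\<close> alone and turns \<open>Q\<close> into
    \<open>R\<close>, up to the Jacobian.\<close>
  define Q where "Q X Z = F X * (ennreal (1 / gram_vol S X ^ ?k) * indicator {Z. dominated S Z X} Z)" for X and Z :: "'n \<Rightarrow> real^'n"
  define R where "R X Z = ennreal (1 / gram_vol S X ^ ?k) * indicator {X. dominated S std_tuple X} X
     * (ennreal (\<bar>det (col_matrix S Z)\<bar> ^ (?n - ?k)) * F (tuple_mult S X Z))" for X Z
  have Qm: "case_prod Q \<in> borel_measurable (?\<Lambda> \<Otimes>\<^sub>M ?L)"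
    unfolding Q_def split_beta indicator_def by measurable
  have Rm: "case_prod R \<in> borel_measurable (?\<Lambda> \<Otimes>\<^sub>M ?L)"
    unfolding R_def split_beta indicator_def by measurable
  have "?K * (\<integral>\<^sup>+X. F X \<partial>?\<Lambda>) = (\<integral>\<^sup>+X. ?K * F X \<partial>?\<Lambda>)"
    by (rule nn_integral_cmult[symmetric]) measurable
  also have "\<dots> = (\<integral>\<^sup>+X. \<integral>\<^sup>+Z. Q X Z \<partial>?L \<partial>?\<Lambda>)"
  proof (rule nn_integral_cong_AE, rule AE_mp[OF AE_det_gram_nonzero AE_I2], intro impI)
    fix X :: "'n \<Rightarrow> real^'n" assume X: "X \<in> space ?\<Lambda>" "det (gram S X) \<noteq> 0"
    have "Measurable.pred ?L (\<lambda>Z. dominated S Z X)"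
      by (rule pred_dominated) (auto intro: measurable_component_borel)
    then have [measurable]: "(\<lambda>Z. indicator {Z. dominated S Z X} Z :: ennreal) \<in> borel_measurable ?L"
      by measurable
    have "(\<integral>\<^sup>+Z. Q X Z \<partial>?L) = F X * (ennreal (1 / gram_vol S X ^ ?k) * (\<integral>\<^sup>+Z. indicator {Z. dominated S Z X} Z \<partial>?L))"
      unfolding Q_def by (subst nn_integral_cmult; (subst nn_integral_cmult)?) measurable
    also have "\<dots> = F X * (ennreal (1 / gram_vol S X ^ ?k) * ennreal (gram_vol S X ^ ?k)) * ?K"
      unfolding dominated_volume[OF X(2)] by (simp only: mult.assoc)
    also have "ennreal (1 / gram_vol S X ^ ?k) * ennreal (gram_vol S X ^ ?k) = 1"
      using gram_vol_pos[OF X(2)] by (simp flip: ennreal_mult)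
    finally show "?K * F X = (\<integral>\<^sup>+Z. Q X Z \<partial>?L)" by (simp add: mult.commute)
  qed
  also have "\<dots> = (\<integral>\<^sup>+Z. \<integral>\<^sup>+X. Q X Z \<partial>?\<Lambda> \<partial>?L)"
    by (rule Fubini'[OF Qm, symmetric])
  also have "\<dots> = (\<integral>\<^sup>+Z. \<integral>\<^sup>+X. R X Z \<partial>?\<Lambda> \<partial>?L)"
  proof (rule nn_integral_cong_AE, rule AE_mp[OF AE_coord_tuple AE_I2], intro impI, elim conjE)
    fix Z :: "'n \<Rightarrow> real^'n" assume Z: "Z \<in> space ?L" "\<forall>j\<in>S. Z j \<in> span (coord_basis S)" "det (col_matrix S Z) \<noteq> 0"
    let ?d = "\<bar>det (col_matrix S Z)\<bar>"
    have Z2: "Z j \<in> span (coord_basis S)" if "j \<in> S" for j using Z(2) that by simp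
    have Qz: "(\<lambda>X. Q X Z) \<in> borel_measurable ?\<Lambda>" using measurable_Pair1[OF Qm Z(1)] by simp
    have act: "(\<lambda>j\<in>S. \<Sum>i\<in>S. (col_matrix S Z $ i $ j) *\<^sub>R X i) = tuple_mult S X Z" for X :: "'n \<Rightarrow> real^'n"
      by (auto simp: tuple_mult_def col_matrix_def fun_eq_iff)
    have tmz: "(\<lambda>X. tuple_mult S X Z) \<in> measurable ?\<Lambda> ?\<Lambda>"
      using measurable_Pair1[OF measurable_tuple_mult[of lborel "coord_lborel S" S] Z(1)] by simp
    have "(\<integral>\<^sup>+X. Q X Z \<partial>?\<Lambda>) = ennreal (?d ^ ?n) * (\<integral>\<^sup>+X. Q (tuple_mult S X Z) Z \<partial>?\<Lambda>)"
      using nn_integral_PiM_right_mult_block[OF orthonormal_set_Basis Z(3) block_col_matrix[OF Z2], of "\<lambda>X. Q X Z"] Qz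
      by (simp add: act flip: lborel_eq_span_lborel)
    also have "\<dots> = (\<integral>\<^sup>+X. ennreal (?d ^ ?n) * Q (tuple_mult S X Z) Z \<partial>?\<Lambda>)"
      by (rule nn_integral_cmult[symmetric]) (rule measurable_compose[OF tmz Qz])
    also have "\<dots> = (\<integral>\<^sup>+X. R X Z \<partial>?\<Lambda>)"
    proof (rule nn_integral_cong)
      fix X :: "'n \<Rightarrow> real^'n"
      \<comment> \<open>An invertible \<open>Z\<close> cancels from both sides of the comparison,
        since its combinations run over the whole coordinate subspace.\<close>
      have dz: "dominated S Z (tuple_mult S X Z) \<longleftrightarrow> dominated S std_tuple X"
        unfolding dominated_def tuple_comb_mult tuple_comb_std
      proof safe
        fix w assume *: "\<forall>v. norm (tuple_comb S Z v) \<le> norm (tuple_comb S X (tuple_comb S Z v))"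
        obtain v where "tuple_comb S Z v = coord_proj S w" using tuple_comb_surj[OF Z(3) Z2] by blast
        then show "norm (coord_proj S w) \<le> norm (tuple_comb S X w)"
          using *[rule_format, of v] by (simp add: tuple_comb_coord_proj)
      next
        fix v assume *: "\<forall>w. norm (coord_proj S w) \<le> norm (tuple_comb S X w)"
        have "tuple_comb S Z v \<in> span (coord_basis S)"
          unfolding tuple_comb_def using Z2 by (intro span_sum span_scale) auto
        then show "norm (tuple_comb S Z v) \<le> norm (tuple_comb S X (tuple_comb S Z v))"
          using *[rule_format, of "tuple_comb S Z v"] by (simp add: coord_proj_id)
      qed
      have kn: "?k \<le> ?n" by (rule card_mono) auto
      \<comment> \<open>Of the \<open>?n\<close> powers of the determinant produced by the
        substitution, \<open>?k\<close> are absorbed by the Gram volume of the product.\<close>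
      have "ennreal (?d ^ ?n) * ennreal (1 / gram_vol S (tuple_mult S X Z) ^ ?k)
         = ennreal (?d ^ (?n - ?k) * (?d ^ ?k * (1 / (gram_vol S X * ?d) ^ ?k)))"
        using kn by (simp add: gram_vol_tuple_mult[OF Z2] flip: ennreal_mult power_add)
      also have "?d ^ ?k * (1 / (gram_vol S X * ?d) ^ ?k) = 1 / gram_vol S X ^ ?k"
        using Z(3) by (simp add: power_mult_distrib)
      also have "ennreal (?d ^ (?n - ?k) * (1 / gram_vol S X ^ ?k)) = ennreal (?d ^ (?n - ?k)) * ennreal (1 / gram_vol S X ^ ?k)"
        by (rule ennreal_mult) auto
      finally have "ennreal (?d ^ ?n) * ennreal (1 / gram_vol S (tuple_mult S X Z) ^ ?k) =
         ennreal (?d ^ (?n - ?k)) * ennreal (1 / gram_vol S X ^ ?k)" .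
      moreover have "ennreal (?d ^ ?n) * Q (tuple_mult S X Z) Z =
         (ennreal (?d ^ ?n) * ennreal (1 / gram_vol S (tuple_mult S X Z) ^ ?k)) * F (tuple_mult S X Z) * indicator {X. dominated S std_tuple X} X"
        unfolding Q_def by (simp add: dz indicator_def mult_ac)
      ultimately show "ennreal (?d ^ ?n) * Q (tuple_mult S X Z) Z = R X Z"
        unfolding R_def by (simp only: mult_ac)
    qed
    finally show "(\<integral>\<^sup>+X. Q X Z \<partial>?\<Lambda>) = (\<integral>\<^sup>+X. R X Z \<partial>?\<Lambda>)" .
  qed
  also have "\<dots> = (\<integral>\<^sup>+X. \<integral>\<^sup>+Z. R X Z \<partial>?L \<partial>?\<Lambda>)"
    by (rule Fubini'[OF Rm])
  also have "\<dots> = (\<integral>\<^sup>+X. ennreal (1 / gram_vol S X ^ ?k) * indicator {X. dominated S std_tuple X} X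
         * (\<integral>\<^sup>+Z. ennreal (\<bar>det (col_matrix S Z)\<bar> ^ (?n - ?k)) * F (tuple_mult S X Z) \<partial>?L) \<partial>?\<Lambda>)"
  proof (rule nn_integral_cong)
    fix X assume X: "X \<in> space ?\<Lambda>"
    have "(\<lambda>Z. ennreal (\<bar>det (col_matrix S Z)\<bar> ^ (?n - ?k)) * F (tuple_mult S X Z)) \<in> borel_measurable ?L"
    proof -
      have "(\<lambda>p. ennreal (\<bar>det (col_matrix S (snd p))\<bar> ^ (?n - ?k)) * F (tuple_mult S (fst p) (snd p))) \<in> borel_measurable (?\<Lambda> \<Otimes>\<^sub>M ?L)"
        by measurable
      from measurable_Pair2[OF this X] show ?thesis by simp
    qed
    then show "(\<integral>\<^sup>+Z. R X Z \<partial>?L) = ennreal (1 / gram_vol S X ^ ?k) * indicator {X. dominated S std_tuple X} X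
         * (\<integral>\<^sup>+Z. ennreal (\<bar>det (col_matrix S Z)\<bar> ^ (?n - ?k)) * F (tuple_mult S X Z) \<partial>?L)"
      unfolding R_def by (rule nn_integral_cmult)
  qed
  finally show ?thesis .
qed

lemma measurable_gram_vol_PiM:
  fixes M :: "'a::euclidean_space measure"
  assumes "sets M = sets borel"
  shows "gram_vol S \<in> borel_measurable (powM S M)"
  using measurable_gram_vol[of S "\<lambda>X. X" "powM S M", OF measurable_component_borel[OF assms]] .

lemma col_matrix_image:
  assumes "\<And>j. j \<in> S \<Longrightarrow> B j \<in> span (coord_basis S)"
  shows "col_matrix S (\<lambda>j\<in>S. col_matrix S B *v Z j) = col_matrix S B ** col_matrix S Z"
proof -
  have "(\<Sum>l\<in>UNIV. col_matrix S B $ i $ l * col_matrix S Z $ l $ j) = col_matrix S B $ i $ j" if "j \<notin> S" for i j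
  proof -
    have "(\<Sum>l\<in>UNIV. col_matrix S B $ i $ l * col_matrix S Z $ l $ j) = (\<Sum>l\<in>UNIV. if l = j then col_matrix S B $ i $ j else 0)"
      using that by (intro sum.cong) (auto simp: col_matrix_def)
    then show ?thesis by simp
  qed
  then show ?thesis
    by (auto simp: vec_eq_iff matrix_matrix_mult_def matrix_vector_mult_def col_matrix_def)
qed

lemma span_orthogonal_image: "orthogonal_transformation U \<Longrightarrow> span (U ` B) = U ` span B"
  by (simp add: orthogonal_transformation_linear span_linear_image)

lemma orthonormal_set_image: "orthogonal_transformation U \<Longrightarrow> orthonormal_set B \<Longrightarrow> orthonormal_set (U ` B)"
  by (auto simp: orthonormal_set_def orthogonal_transformation_def dest: injD[OF orthogonal_transformation_inj, rotated])

lemma flat_avg_image: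
  fixes U :: "real^'n \<Rightarrow> real^'n"
  assumes U: "orthogonal_transformation U"
    and F: "F \<in> borel_measurable (powM S lborel)"
  shows "flat_avg S N F (U ` coord_basis S) =
    (\<integral>\<^sup>+Z. ennreal (\<bar>det (col_matrix S Z)\<bar> ^ N) * F (\<lambda>j\<in>S. U (Z j)) \<partial>powM S (coord_lborel S))"
proof -
  let ?B = "U ` coord_basis S"
  have Um: "U \<in> borel_measurable borel" using U by (intro measurable_linear orthogonal_transformation_linear)
  have oB: "orthonormal_set ?B" using U orthonormal_coord_basis by (rule orthonormal_set_image)
  have sl: "span_lborel ?B = distr (coord_lborel S) borel U"
    by (rule distr_span_lborel[symmetric])
      (use U in \<open>simp_all add: orthogonal_transformation_linear inj_on_subset[OF orthogonal_transformation_inj]\<close>)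
  have F': "F \<in> borel_measurable (powM S (span_lborel ?B))"
    using F by (simp cong: measurable_cong_sets sets_PiM_cong)
  have [measurable]: "gram_vol S \<in> borel_measurable (powM S (span_lborel ?B))"
    by (rule measurable_gram_vol_PiM) simp
  have G: "(\<lambda>Z. F Z * ennreal (gram_vol S Z ^ N)) \<in> borel_measurable (powM S (span_lborel ?B))"
    using F' by measurable
  have "flat_avg S N F ?B = 1 ^ card S * (\<integral>\<^sup>+Z. F Z * ennreal (gram_vol S Z ^ N) \<partial>powM S (span_lborel ?B))"
    by (simp add: flat_avg_def)
  also have "\<dots> = (\<integral>\<^sup>+Z. (F (\<lambda>j\<in>S. U (Z j)) * ennreal (gram_vol S (\<lambda>j\<in>S. U (Z j)) ^ N)) * (\<Prod>j\<in>S. 1) \<partial>powM S (coord_lborel S))"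
  proof (rule nn_integral_PiM_transfer[OF _ _ _ _ _ _ G])
    fix f :: "real^'n \<Rightarrow> ennreal" assume "f \<in> borel_measurable (span_lborel ?B)"
    then show "1 * (\<integral>\<^sup>+x. f x \<partial>span_lborel ?B) = (\<integral>\<^sup>+x. f (U x) * 1 \<partial>coord_lborel S)"
      using Um by (simp add: sl nn_integral_distr)
  qed (use Um sigma_finite_span_lborel[OF oB] sigma_finite_span_lborel[OF orthonormal_coord_basis] in simp_all)
  also have "\<dots> = (\<integral>\<^sup>+Z. ennreal (\<bar>det (col_matrix S Z)\<bar> ^ N) * F (\<lambda>j\<in>S. U (Z j)) \<partial>powM S (coord_lborel S))"
  proof (rule nn_integral_cong_AE, rule AE_mp[OF AE_coord_tuple AE_I2], intro impI, elim conjE)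
    fix Z :: "'n \<Rightarrow> real^'n" assume Z: "\<forall>j\<in>S. Z j \<in> span (coord_basis S)"
    have "gram_vol S (\<lambda>j\<in>S. U (Z j)) = gram_vol S (\<lambda>j. U (Z j))" by (rule gram_vol_cong) simp
    also have "\<dots> = \<bar>det (col_matrix S Z)\<bar>" using gram_vol_orthogonal[OF U] gram_vol_coord Z by metis
    finally show "(F (\<lambda>j\<in>S. U (Z j)) * ennreal (gram_vol S (\<lambda>j\<in>S. U (Z j)) ^ N)) * (\<Prod>j\<in>S. 1) =
       ennreal (\<bar>det (col_matrix S Z)\<bar> ^ N) * F (\<lambda>j\<in>S. U (Z j))" by (simp add: mult.commute)
  qed
  finally show ?thesis .
qed

lemma flat_avg_cylinder:
  fixes B :: "(real^'n) set"
  assumes B: "orthonormal_set B" and F: "F \<in> borel_measurable (powM S lborel)"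
  shows "ball_vol (CARD('n) - card B) ^ card S * flat_avg S N F B
    = proj_avg S N F (matrix (closest_point (span B)))"
proof -
  have F': "F \<in> borel_measurable (powM S (span_lborel B))"
    using F by (simp cong: measurable_cong_sets sets_PiM_cong)
  have [measurable]: "gram_vol S \<in> borel_measurable (powM S (span_lborel B))"
    by (rule measurable_gram_vol_PiM) simp
  have G: "(\<lambda>Z. F Z * ennreal (gram_vol S Z ^ N)) \<in> borel_measurable (powM S (span_lborel B))"
    using F' by measurable
  have "ball_vol (CARD('n) - card B) ^ card S * flat_avg S N F B
     = (\<integral>\<^sup>+Y. (F (\<lambda>j\<in>S. closest_point (span B) (Y j)) * ennreal (gram_vol S (\<lambda>j\<in>S. closest_point (span B) (Y j)) ^ N))
        * (\<Prod>j\<in>S. indicator (cball 0 1) (Y j - closest_point (span B) (Y j))) \<partial>powM S lborel)"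
    unfolding flat_avg_def
  proof (rule nn_integral_PiM_transfer[OF _ _ _ _ _ _ G])
    show "(\<lambda>x. indicator (cball 0 1) (x - closest_point (span B) x) :: ennreal) \<in> borel_measurable lborel"
      by measurable
    fix f :: "real^'n \<Rightarrow> ennreal" assume "f \<in> borel_measurable (span_lborel B)"
    then show "ball_vol (CARD('n) - card B) * (\<integral>\<^sup>+x. f x \<partial>span_lborel B)
      = (\<integral>\<^sup>+x. f (closest_point (span B) x) * indicator (cball 0 1) (x - closest_point (span B) x) \<partial>lborel)"
      using nn_integral_span_lborel_cylinder[OF B, of f] by simp
  qed (use sigma_finite_span_lborel[OF B] sigma_finite_lborel in simp_all)
  then show ?thesis
    by (simp add: proj_avg_def linear_closest_point[OF subspace_span])
qed

text \<open>With \<open>X = U B\<close>, the product of \<open>X\<close> and \<open>Z\<close>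
  consists of the vectors obtained from the \<open>Z j\<close> by applying the matrix of
  \<open>B\<close> and then \<open>U\<close>. Substituting this matrix in every \<open>Z j\<close>
  turns the integral into one over all tuples in the span of \<open>X\<close>. The substitution
  contributes \<open>card S\<close> powers of the Gram volume and the weight the remaining ones,
  \<open>CARD('n)\<close> in all. Apart from this factor only the span of \<open>X\<close> is
  left.\<close>

lemma inner_average:
  fixes X :: "'n \<Rightarrow> real^'n"
  assumes g: "det (gram S X) \<noteq> 0" and F: "F \<in> borel_measurable (powM S lborel)"
  shows "ball_vol (CARD('n) - card S) ^ card S *
     (\<integral>\<^sup>+Z. ennreal (\<bar>det (col_matrix S Z)\<bar> ^ (CARD('n) - card S)) * F (tuple_mult S X Z)
              \<partial>powM S (coord_lborel S))
     = ennreal (1 / gram_vol S X ^ CARD('n)) * proj_avg S (CARD('n) - card S) F (proj_matrix S X)"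
proof -
  let ?L = "powM S (coord_lborel S)"
  let ?k = "card S" and ?n = "CARD('n)" and ?N = "CARD('n) - card S"
  obtain U :: "real^'n \<Rightarrow> real^'n" and B where UB: "orthogonal_transformation U"
    "U ` span (coord_basis S) = span (X ` S)"
    "\<And>j. j \<in> S \<Longrightarrow> B j \<in> span (coord_basis S)" "\<And>j. j \<in> S \<Longrightarrow> X j = U (B j)"
    "gram_vol S X = \<bar>det (col_matrix S B)\<bar>" "det (col_matrix S B) \<noteq> 0"
    by (rule tuple_polar[OF g]) blast
  let ?M = "col_matrix S B" and ?W = "gram_vol S X"
  have W: "?W > 0" using g by (rule gram_vol_pos)
  have Um: "U \<in> borel_measurable borel" using UB(1) by (intro measurable_linear orthogonal_transformation_linear)
  define G where "G Z = ennreal (\<bar>det (col_matrix S Z)\<bar> ^ ?N) * F (\<lambda>j\<in>S. U (Z j))" for Z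
  have "(\<lambda>Z. \<lambda>j\<in>S. U (Z j)) \<in> measurable ?L (powM S lborel)"
  proof (rule measurable_restrict)
    fix j assume "j \<in> S"
    then have "(\<lambda>Z. Z j) \<in> borel_measurable ?L" by (intro measurable_component_borel) simp_all
    from measurable_compose[OF this Um] show "(\<lambda>Z. U (Z j)) \<in> measurable ?L lborel" by simp
  qed
  then have Gm: "G \<in> borel_measurable ?L"
    unfolding G_def using measurable_col_matrix[of "coord_lborel S" S] F
    by measurable
  have "(\<Prod>i\<in>S. ennreal \<bar>det ?M\<bar>) * (\<integral>\<^sup>+Z. G (\<lambda>j\<in>S. ?M *v Z j) \<partial>?L) = (\<integral>\<^sup>+Z. G Z \<partial>?L)"
  proof (rule nn_integral_PiM_componentwise[OF sigma_finite_span_lborel[OF orthonormal_coord_basis] _ _ _ Gm])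
    show "(*v) ?M \<in> measurable (coord_lborel S) (coord_lborel S)"
      using measurable_linear[of "(*v) ?M"] by (simp cong: measurable_cong_sets)
    show "ennreal \<bar>det ?M\<bar> * (\<integral>\<^sup>+x. f (?M *v x) \<partial>coord_lborel S) = (\<integral>\<^sup>+x. f x \<partial>coord_lborel S)"
      if "f \<in> borel_measurable (coord_lborel S)" for f
      using nn_integral_coord_left_mult[OF UB(6) block_col_matrix[OF UB(3)], of f] that by simp
  qed simp
  also have "(\<integral>\<^sup>+Z. G (\<lambda>j\<in>S. ?M *v Z j) \<partial>?L) = (\<integral>\<^sup>+Z. ennreal (?W ^ ?N) * (ennreal (\<bar>det (col_matrix S Z)\<bar> ^ ?N) * F (tuple_mult S X Z)) \<partial>?L)"
  proof (rule nn_integral_cong_AE, rule AE_mp[OF AE_coord_tuple AE_I2], intro impI, elim conjE)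
    fix Z :: "'n \<Rightarrow> real^'n" assume Z: "\<forall>j\<in>S. Z j \<in> span (coord_basis S)"
    have "(\<lambda>j\<in>S. U ((\<lambda>j\<in>S. ?M *v Z j) j)) = tuple_mult S X Z"
    proof
      fix j
      have "U (?M *v Z j) = (\<Sum>i\<in>S. (Z j $ i) *\<^sub>R X i)" if "j \<in> S"
      proof -
        have "U (?M *v Z j) = U (\<Sum>i\<in>S. (Z j $ i) *\<^sub>R B i)" using Z that by (simp add: col_matrix_mult_vec)
        also have "\<dots> = (\<Sum>i\<in>S. (Z j $ i) *\<^sub>R X i)"
          using orthogonal_transformation_linear[OF UB(1)] UB(4) by (simp add: linear_sum linear_cmul)
        finally show ?thesis .
      qed
      then show "(\<lambda>j\<in>S. U ((\<lambda>j\<in>S. ?M *v Z j) j)) j = tuple_mult S X Z j" by (simp add: tuple_mult_def)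
    qed
    moreover have "col_matrix S (\<lambda>j\<in>S. ?M *v Z j) = ?M ** col_matrix S Z"
      by (rule col_matrix_image) (rule UB(3))
    ultimately show "G (\<lambda>j\<in>S. ?M *v Z j) = ennreal (?W ^ ?N) * (ennreal (\<bar>det (col_matrix S Z)\<bar> ^ ?N) * F (tuple_mult S X Z))"
      unfolding G_def
      by (simp add: det_mul abs_mult UB(5) power_mult_distrib ennreal_mult mult.assoc)
  qed
  also have "\<dots> = ennreal (?W ^ ?N) * (\<integral>\<^sup>+Z. ennreal (\<bar>det (col_matrix S Z)\<bar> ^ ?N) * F (tuple_mult S X Z) \<partial>?L)"
  proof (rule nn_integral_cmult)
    have "(\<lambda>Z. tuple_mult S X Z) \<in> measurable ?L (powM S lborel)"
      unfolding tuple_mult_def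
    proof (rule measurable_restrict)
      fix j assume "j \<in> S"
      then have m: "(\<lambda>Z. Z j) \<in> borel_measurable ?L" by (intro measurable_component_borel) simp_all
      have "(\<lambda>Z. \<Sum>i\<in>S. (Z j $ i) *\<^sub>R X i) \<in> borel_measurable ?L"
        by (intro borel_measurable_sum borel_measurable_scaleR measurable_compose[OF m measurable_nth_borel]) simp
      then show "(\<lambda>Z. \<Sum>i\<in>S. (Z j $ i) *\<^sub>R X i) \<in> measurable ?L lborel" by simp
    qed
    then show "(\<lambda>Z. ennreal (\<bar>det (col_matrix S Z)\<bar> ^ ?N) * F (tuple_mult S X Z)) \<in> borel_measurable ?L"
      using measurable_col_matrix[of "coord_lborel S" S] F by measurable
  qed
  finally have "ennreal (?W ^ ?n) * (\<integral>\<^sup>+Z. ennreal (\<bar>det (col_matrix S Z)\<bar> ^ ?N) * F (tuple_mult S X Z) \<partial>?L) = (\<integral>\<^sup>+Z. G Z \<partial>?L)"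
  proof -
    have "?k \<le> ?n" by (rule card_mono) auto
    then have "ennreal (?W ^ ?n) = ennreal (?W ^ ?k) * ennreal (?W ^ ?N)" by (simp flip: ennreal_mult power_add)
    moreover assume "(\<Prod>i\<in>S. ennreal \<bar>det ?M\<bar>) * (ennreal (?W ^ ?N) * (\<integral>\<^sup>+Z. ennreal (\<bar>det (col_matrix S Z)\<bar> ^ ?N) * F (tuple_mult S X Z) \<partial>?L)) = (\<integral>\<^sup>+Z. G Z \<partial>?L)"
    ultimately show ?thesis by (simp add: UB(5) ennreal_power mult.assoc)
  qed
  then have "ennreal (1 / ?W ^ ?n) * (\<integral>\<^sup>+Z. G Z \<partial>?L) =
      (ennreal (1 / ?W ^ ?n) * ennreal (?W ^ ?n)) * (\<integral>\<^sup>+Z. ennreal (\<bar>det (col_matrix S Z)\<bar> ^ ?N) * F (tuple_mult S X Z) \<partial>?L)"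
    by (simp add: mult.assoc)
  also have "ennreal (1 / ?W ^ ?n) * ennreal (?W ^ ?n) = 1" using W by (simp flip: ennreal_mult)
  finally have 1: "(\<integral>\<^sup>+Z. ennreal (\<bar>det (col_matrix S Z)\<bar> ^ ?N) * F (tuple_mult S X Z) \<partial>?L) =
     ennreal (1 / ?W ^ ?n) * flat_avg S ?N F (U ` coord_basis S)"
    using flat_avg_image[OF UB(1) F, of ?N] by (simp add: G_def)
  have card: "card (U ` coord_basis S) = ?k"
    using UB(1) by (simp add: card_image inj_on_subset[OF orthogonal_transformation_inj])
  have 2: "ball_vol ?N ^ ?k * flat_avg S ?N F (U ` coord_basis S) = proj_avg S ?N F (proj_matrix S X)"
    using flat_avg_cylinder[OF orthonormal_set_image[OF UB(1) orthonormal_coord_basis[of S]] F, of ?N] card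
    by (simp add: proj_matrix_eq[OF g] span_orthogonal_image[OF UB(1)] UB(2))
  show ?thesis unfolding 1 using 2 by (simp add: mult_ac)
qed

text \<open>Everything in the averaged identity that depends on \<open>X\<close> beyond its span.
  The exponent \<open>card S\<close> normalizes the cutoff, and \<open>CARD('n)\<close> comes from
  \<open>inner_average\<close>. The image of this density under \<open>proj_matrix\<close> is the
  measure that tuples induce on the Grassmannian.\<close>

definition tuple_weight :: "'n::finite set \<Rightarrow> ('n \<Rightarrow> real^'n) \<Rightarrow> ennreal" where
  "tuple_weight S X = ennreal (1 / gram_vol S X ^ card S) * indicator {X. dominated S std_tuple X} X
     * ennreal (1 / gram_vol S X ^ CARD('n))"

text \<open>Almost every tuple is independent, so the inner integral may be replaced by its value
  from \<open>inner_average\<close>. On the right, \<open>F\<close> now enters only through a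
  function of the projection matrix, integrated against the image of \<open>tuple_weight\<close>; it
  remains to identify that image with a multiple of the Haar measure.\<close>

lemma pre_Blaschke_Petkantschin:
  fixes S :: "'n::finite set"
  defines "K \<equiv> (\<integral>\<^sup>+Z. indicator {Z. dominated S Z (std_tuple::'n \<Rightarrow> real^'n)} Z \<partial>powM S (coord_lborel S))"
  assumes F: "F \<in> borel_measurable (powM S lborel)"
  shows "ball_vol (CARD('n) - card S) ^ card S * K * (\<integral>\<^sup>+X. F X \<partial>powM S lborel)
    = (\<integral>\<^sup>+X. tuple_weight S X * proj_avg S (CARD('n) - card S) F (proj_matrix S X) \<partial>powM S lborel)"
proof -
  let ?w = "ball_vol (CARD('n) - card S) ^ card S"
  let ?\<Lambda> = "powM S (lborel :: (real^'n) measure)"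
  let ?L = "powM S (coord_lborel S)"
  let ?I = "\<lambda>X. \<integral>\<^sup>+Z. ennreal (\<bar>det (col_matrix S Z)\<bar> ^ (CARD('n) - card S)) * F (tuple_mult S X Z) \<partial>?L"
  let ?a = "\<lambda>X. ennreal (1 / gram_vol S X ^ card S) * indicator {X. dominated S std_tuple X} X"
  interpret sf: sigma_finite_measure "coord_lborel S" by (rule sigma_finite_span_lborel[OF orthonormal_coord_basis])
  interpret ps: product_sigma_finite "\<lambda>_::'n. coord_lborel S" by (rule sf.product_power)
  interpret L: sigma_finite_measure ?L by (rule ps.sigma_finite) simp
  have "?w * K * (\<integral>\<^sup>+X. F X \<partial>?\<Lambda>) = ?w * (\<integral>\<^sup>+X. ?a X * ?I X \<partial>?\<Lambda>)"
    unfolding K_def mult.assoc averaging_identity[OF F] ..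
  also have "\<dots> = (\<integral>\<^sup>+X. ?w * (?a X * ?I X) \<partial>?\<Lambda>)"
  proof (rule nn_integral_cmult[symmetric])
    have "(\<lambda>p. F (tuple_mult S (fst p) (snd p))) \<in> borel_measurable (?\<Lambda> \<Otimes>\<^sub>M ?L)"
      by (rule measurable_compose[OF measurable_tuple_mult F]) simp_all
    moreover have "(\<lambda>p. det (col_matrix S (snd p))) \<in> borel_measurable (?\<Lambda> \<Otimes>\<^sub>M ?L)"
      by (rule measurable_compose[OF measurable_snd measurable_col_matrix]) simp
    ultimately have "(\<lambda>(X,Z). ennreal (\<bar>det (col_matrix S Z)\<bar> ^ (CARD('n) - card S)) * F (tuple_mult S X Z)) \<in> borel_measurable (?\<Lambda> \<Otimes>\<^sub>M ?L)"
      unfolding split_beta by measurable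
    then have "?I \<in> borel_measurable ?\<Lambda>" by (rule L.borel_measurable_nn_integral)
    moreover have "gram_vol S \<in> borel_measurable ?\<Lambda>" by (rule measurable_gram_vol_PiM) simp
    moreover have "Measurable.pred ?\<Lambda> (\<lambda>X. dominated S std_tuple X)"
      by (rule pred_dominated) (auto intro: measurable_component_borel)
    ultimately show "(\<lambda>X. ?a X * ?I X) \<in> borel_measurable ?\<Lambda>" unfolding indicator_def by measurable
  qed
  also have "\<dots> = (\<integral>\<^sup>+X. tuple_weight S X * proj_avg S (CARD('n) - card S) F (proj_matrix S X) \<partial>?\<Lambda>)"
  proof (rule nn_integral_cong_AE, rule AE_mp[OF AE_det_gram_nonzero AE_I2], intro impI)
    fix X :: "'n \<Rightarrow> real^'n" assume X: "det (gram S X) \<noteq> 0"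
    have "?w * (?a X * ?I X) = ?a X * (?w * ?I X)" by (simp only: mult_ac)
    then show "?w * (?a X * ?I X) = tuple_weight S X * proj_avg S (CARD('n) - card S) F (proj_matrix S X)"
      unfolding inner_average[OF X F] by (simp only: tuple_weight_def mult_ac)
  qed
  finally show ?thesis .
qed

section \<open>Uniqueness of uniformly distributed measures\<close>

lemma measurable_emeasure_ball:
  fixes m :: "'a::{metric_space, second_countable_topology} measure"
  assumes m: "finite_measure m" and sets [measurable_cong]: "sets m = sets borel" "sets m' = sets borel"
    and V [measurable]: "V \<in> sets borel"
  shows "(\<lambda>x. emeasure m (V \<inter> ball x r)) \<in> borel_measurable m'"
proof -
  interpret finite_measure m by fact
  have eq: "emeasure m (V \<inter> ball x r) = (\<integral>\<^sup>+y. indicator V y * indicator {p. dist (fst p) (snd p) < r} (x, y) \<partial>m)" for x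
  proof -
    have "emeasure m (V \<inter> ball x r) = (\<integral>\<^sup>+y. indicator (V \<inter> ball x r) y \<partial>m)" by (simp add: sets)
    then show ?thesis by (auto intro!: nn_integral_cong simp: indicator_def)
  qed
  have "Measurable.pred (m' \<Otimes>\<^sub>M m) (\<lambda>p. dist (fst p) (snd p) < r)" by measurable
  then show ?thesis unfolding eq by (intro borel_measurable_nn_integral) (simp add: split_beta indicator_def)
qed

text \<open>Christensen's argument: both measures are compared through the measure of the pairs
  of points of an open set at distance less than \<open>r\<close>, as \<open>r \<rightarrow> 0\<close>.\<close>

lemma uniformly_distributed_open:
  fixes m1 m2 :: "'a::{metric_space, second_countable_topology} measure"
  assumes fin: "finite_measure m1" "finite_measure m2"
    and sets [measurable_cong]: "sets m1 = sets borel" "sets m2 = sets borel"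
    and r: "\<And>i::nat. 0 < r i" "r \<longlonglongrightarrow> 0"
    and ae1: "AE x in m1. \<forall>i. emeasure m2 (ball x (r i)) = g2 i"
    and ae2: "AE x in m2. \<forall>i. emeasure m1 (ball x (r i)) = g1 i"
    and g: "\<And>i. g1 i \<noteq> 0" "\<And>i. g2 i \<noteq> 0" "\<And>i. g1 i \<noteq> \<infinity>" "\<And>i. g2 i \<noteq> \<infinity>"
    and U: "open U"
  shows "emeasure m1 U * emeasure m2 UNIV = emeasure m2 U * emeasure m1 UNIV"
proof -
  interpret m1: finite_measure m1 by fact
  interpret m2: finite_measure m2 by fact
  interpret P: pair_sigma_finite m1 m2 ..
  have sp: "space m1 = UNIV" "space m2 = UNIV" using sets_eq_imp_space_eq[OF sets(1)] sets_eq_imp_space_eq[OF sets(2)] by simp_all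
  have bm [measurable]: "Measurable.pred (m1 \<Otimes>\<^sub>M m2) (\<lambda>p. dist (fst p) (snd p) < r i)" for i by measurable
  have [measurable]: "U \<in> sets borel" using U by simp
  have lim: "(\<lambda>i. \<integral>\<^sup>+x. indicator V x * (emeasure m (V \<inter> ball x (r i)) / h i) \<partial>m') \<longlonglongrightarrow> emeasure m' V"
    if V: "open V" and m: "finite_measure m" "finite_measure m'" "sets m = sets borel" "sets m' = sets borel"
      and ae: "AE x in m'. \<forall>i. emeasure m (ball x (r i)) = h i" and h: "\<And>i. h i \<noteq> 0" "\<And>i. h i \<noteq> \<infinity>"
    for V and m m' :: "'a measure" and h :: "nat \<Rightarrow> ennreal"
  proof -
    interpret m: finite_measure m by fact
    interpret m': finite_measure m' by fact
    note [measurable_cong] = m(3,4)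
    have [measurable]: "V \<in> sets borel" using V by simp
    have [measurable]: "(\<lambda>x. emeasure m (V \<inter> ball x (r i))) \<in> borel_measurable m'" for i
      using V m by (intro measurable_emeasure_ball) simp_all
    have "(\<lambda>i. \<integral>\<^sup>+x. indicator V x * (emeasure m (V \<inter> ball x (r i)) / h i) \<partial>m') \<longlonglongrightarrow> (\<integral>\<^sup>+x. indicator V x \<partial>m')"
    proof (rule nn_integral_dominated_convergence[where w="\<lambda>_. 1"])
      show "(\<integral>\<^sup>+x. 1 \<partial>m') < \<infinity>" using m'.emeasure_finite[of "space m'"] by (simp add: less_top[symmetric])
      show "AE x in m'. indicator V x * (emeasure m (V \<inter> ball x (r i)) / h i) \<le> 1" for i
        using ae
      proof eventually_elim
        fix x assume x: "\<forall>i. emeasure m (ball x (r i)) = h i"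
        have "emeasure m (V \<inter> ball x (r i)) \<le> emeasure m (ball x (r i))" by (rule emeasure_mono) (auto simp: m(3))
        then have "emeasure m (V \<inter> ball x (r i)) \<le> h i" using x by simp
        then have "emeasure m (V \<inter> ball x (r i)) / h i \<le> h i / h i" by (rule divide_right_mono_ennreal)
        also have "h i / h i = 1" using h[of i] by (simp add: less_top)
        finally show "indicator V x * (emeasure m (V \<inter> ball x (r i)) / h i) \<le> 1" by (simp add: indicator_def)
      qed
      show "AE x in m'. (\<lambda>i. indicator V x * (emeasure m (V \<inter> ball x (r i)) / h i)) \<longlonglongrightarrow> indicator V x"
        using ae
      proof eventually_elim
        fix x assume x: "\<forall>i. emeasure m (ball x (r i)) = h i"
        show "(\<lambda>i. indicator V x * (emeasure m (V \<inter> ball x (r i)) / h i)) \<longlonglongrightarrow> indicator V x"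
        proof (cases "x \<in> V")
          case True
          then obtain e where e: "e > 0" "ball x e \<subseteq> V" using V by (meson open_contains_ball)
          have "\<forall>\<^sub>F i in sequentially. r i < e" using r(2) e(1) by (rule order_tendstoD(2))
          then have "\<forall>\<^sub>F i in sequentially. indicator V x * (emeasure m (V \<inter> ball x (r i)) / h i) = 1"
          proof eventually_elim
            fix i assume "r i < e"
            then have "V \<inter> ball x (r i) = ball x (r i)" using e(2) by auto
            then show "indicator V x * (emeasure m (V \<inter> ball x (r i)) / h i) = 1"
              using True x h[of i] by (simp add: less_top)
          qed
          then show ?thesis using True by (simp add: tendsto_eventually)
        qed simp
      qed
    qed measurable
    then show ?thesis by (simp add: m(4))
  qed
  have sw: "(\<integral>\<^sup>+x. indicator V x * emeasure m2 (V \<inter> ball x (r i)) \<partial>m1) = (\<integral>\<^sup>+y. indicator V y * emeasure m1 (V \<inter> ball y (r i)) \<partial>m2)"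
    if V: "open V" for V i
  proof -
    have [measurable]: "V \<in> sets borel" using V by simp
    have "(\<integral>\<^sup>+x. indicator V x * emeasure m2 (V \<inter> ball x (r i)) \<partial>m1)
       = (\<integral>\<^sup>+x. \<integral>\<^sup>+y. indicator V x * indicator (V \<inter> ball x (r i)) y \<partial>m2 \<partial>m1)"
      by (intro nn_integral_cong nn_integral_cmult_indicator[symmetric]) (simp add: sets)
    also have "\<dots> = (\<integral>\<^sup>+x. \<integral>\<^sup>+y. indicator V x * (indicator V y * indicator {p. dist (fst p) (snd p) < r i} (x, y)) \<partial>m2 \<partial>m1)"
      by (intro nn_integral_cong) (auto simp: indicator_def)
    also have "\<dots> = (\<integral>\<^sup>+y. \<integral>\<^sup>+x. indicator V x * (indicator V y * indicator {p. dist (fst p) (snd p) < r i} (x, y)) \<partial>m1 \<partial>m2)"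
      using bm[of i] by (intro P.Fubini'[symmetric]) (simp add: split_beta indicator_def)
    also have "\<dots> = (\<integral>\<^sup>+y. \<integral>\<^sup>+x. indicator V y * indicator (V \<inter> ball y (r i)) x \<partial>m1 \<partial>m2)"
      by (intro nn_integral_cong) (auto simp: indicator_def dist_commute)
    also have "\<dots> = (\<integral>\<^sup>+y. indicator V y * emeasure m1 (V \<inter> ball y (r i)) \<partial>m2)"
      by (intro nn_integral_cong nn_integral_cmult_indicator) (simp add: sets)
    finally show ?thesis .
  qed
  define a where "a V i = (\<integral>\<^sup>+x. indicator V x * (emeasure m2 (V \<inter> ball x (r i)) / g2 i) \<partial>m1)" for V i
  define b where "b V i = (\<integral>\<^sup>+x. indicator V x * (emeasure m1 (V \<inter> ball x (r i)) / g1 i) \<partial>m2)" for V i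
  have a: "a V \<longlonglongrightarrow> emeasure m1 V" and b: "b V \<longlonglongrightarrow> emeasure m2 V" if "open V" for V
    unfolding a_def b_def using that fin sets ae1 ae2 g by (intro lim; simp)+
  have mm2: "(\<lambda>x. indicator V x * emeasure m2 (V \<inter> ball x (r i))) \<in> borel_measurable m1"
    and mm1: "(\<lambda>x. indicator V x * emeasure m1 (V \<inter> ball x (r i))) \<in> borel_measurable m2" if V: "open V" for V i
  proof -
    have [measurable]: "V \<in> sets borel" using V by simp
    note [measurable] = measurable_emeasure_ball[OF fin(2) sets(2,1)] measurable_emeasure_ball[OF fin(1) sets]
    show "(\<lambda>x. indicator V x * emeasure m2 (V \<inter> ball x (r i))) \<in> borel_measurable m1"
      "(\<lambda>x. indicator V x * emeasure m1 (V \<inter> ball x (r i))) \<in> borel_measurable m2" by measurable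
  qed
  have ab: "a V i * g2 i = b V i * g1 i" if V: "open V" for V i
  proof -
    have "a V i * g2 i = (\<integral>\<^sup>+x. indicator V x * emeasure m2 (V \<inter> ball x (r i)) \<partial>m1) / g2 i * g2 i"
      unfolding a_def by (subst nn_integral_divide[symmetric, OF mm2[OF V]]) (simp add: ennreal_times_divide)
    also have "\<dots> = (\<integral>\<^sup>+x. indicator V x * emeasure m2 (V \<inter> ball x (r i)) \<partial>m1)"
      using g(2,4)[of i] by (simp add: ennreal_divide_times ennreal_mult_divide_eq less_top)
    also have "\<dots> = (\<integral>\<^sup>+x. indicator V x * emeasure m1 (V \<inter> ball x (r i)) \<partial>m2)" by (rule sw[OF V])
    also have "\<dots> = (\<integral>\<^sup>+x. indicator V x * emeasure m1 (V \<inter> ball x (r i)) \<partial>m2) / g1 i * g1 i"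
      using g(1,3)[of i] by (simp add: ennreal_divide_times ennreal_mult_divide_eq less_top)
    also have "\<dots> = b V i * g1 i"
      unfolding b_def by (subst nn_integral_divide[symmetric, OF mm1[OF V]]) (simp add: ennreal_times_divide)
    finally show ?thesis .
  qed
  have aU: "a UNIV i = emeasure m1 UNIV" for i
  proof -
    have "a UNIV i = (\<integral>\<^sup>+x. 1 \<partial>m1)" unfolding a_def
      by (rule nn_integral_cong_AE, use ae1 in eventually_elim) (use g[of i] in \<open>simp add: less_top\<close>)
    then show ?thesis by (simp add: sp)
  qed
  have bU: "b UNIV i = emeasure m2 UNIV" for i
  proof -
    have "b UNIV i = (\<integral>\<^sup>+x. 1 \<partial>m2)" unfolding b_def
      by (rule nn_integral_cong_AE, use ae2 in eventually_elim) (use g[of i] in \<open>simp add: less_top\<close>)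
    then show ?thesis by (simp add: sp)
  qed
  have eq: "emeasure m2 UNIV * a U i = emeasure m1 UNIV * b U i" for i
  proof -
    have "g2 i * (emeasure m2 UNIV * a U i) = (a U i * g2 i) * emeasure m2 UNIV" by (simp only: mult_ac)
    also have "\<dots> = b U i * (b UNIV i * g1 i)" unfolding ab[OF U] bU by (simp only: mult_ac)
    also have "\<dots> = g2 i * (emeasure m1 UNIV * b U i)" unfolding ab[OF open_UNIV, symmetric] aU by (simp only: mult_ac)
    finally show ?thesis using g(2,4)[of i] by (simp add: ennreal_mult_cancel_left)
  qed
  have "(\<lambda>i. emeasure m2 UNIV * a U i) \<longlonglongrightarrow> emeasure m2 UNIV * emeasure m1 U"
    by (intro ennreal_tendsto_cmult a U) (use m2.emeasure_finite sp in \<open>simp add: less_top[symmetric]\<close>)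
  moreover have "(\<lambda>i. emeasure m1 UNIV * b U i) \<longlonglongrightarrow> emeasure m1 UNIV * emeasure m2 U"
    by (intro ennreal_tendsto_cmult b U) (use m1.emeasure_finite sp in \<open>simp add: less_top[symmetric]\<close>)
  ultimately have "emeasure m2 UNIV * emeasure m1 U = emeasure m1 UNIV * emeasure m2 U"
    unfolding eq by (rule LIMSEQ_unique)
  then show ?thesis by (simp add: mult.commute)
qed

text \<open>Open sets generate the Borel sets, so the comparison on open sets is enough once balls
  are known to have positive finite measure. The hypotheses are stated almost everywhere because
  they are applied on a space of matrices, where the measure of a ball is controlled if its centre
  is a projection.\<close>

lemma uniformly_distributed_unique:
  fixes m1 m2 :: "'a::{metric_space, second_countable_topology} measure"
  assumes fin: "finite_measure m1" "finite_measure m2"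
    and sets [measurable_cong]: "sets m1 = sets borel" "sets m2 = sets borel"
    and ae1: "AE x in m1. \<forall>i::nat. emeasure m1 (ball x (1 / real (Suc i))) = g1 i \<and> emeasure m2 (ball x (1 / real (Suc i))) = g2 i"
    and ae2: "AE x in m2. \<forall>i::nat. emeasure m1 (ball x (1 / real (Suc i))) = g1 i \<and> emeasure m2 (ball x (1 / real (Suc i))) = g2 i"
  shows "scale_measure (emeasure m2 UNIV) m1 = scale_measure (emeasure m1 UNIV) m2"
proof (cases "emeasure m1 UNIV = 0 \<or> emeasure m2 UNIV = 0")
  case True
  have null: "emeasure m A = 0" if "emeasure m UNIV = 0" "sets m = sets borel" for m :: "'a measure" and A
    using emeasure_mono[of A UNIV m] that by (metis emeasure_notin_sets le_zero_eq sets.top sets_eq_imp_space_eq space_borel subset_UNIV)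
  show ?thesis
    by (rule measure_eqI) (use True null sets in auto)
next
  case False
  interpret m1: finite_measure m1 by fact
  interpret m2: finite_measure m2 by fact
  have sp: "space m1 = UNIV" "space m2 = UNIV" using sets_eq_imp_space_eq[OF sets(1)] sets_eq_imp_space_eq[OF sets(2)] by simp_all
  define r where "r i = 1 / real (Suc i)" for i
  have r: "r i > 0" for i by (simp add: r_def)
  have r0: "r \<longlonglongrightarrow> 0" unfolding r_def by (rule LIMSEQ_Suc[OF lim_1_over_n])
  note ae1 = ae1[folded r_def] and ae2 = ae2[folded r_def]
  have pos: "g i \<noteq> 0" if m: "finite_measure m" "sets m = sets borel" "emeasure m UNIV \<noteq> 0"
      and ae: "AE x in m. \<forall>i. emeasure m (ball x (r i)) = g i"
    for m :: "'a measure" and g :: "nat \<Rightarrow> ennreal" and i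
  proof
    assume g0: "g i = 0"
    interpret m: finite_measure m by fact
    have spm: "space m = UNIV" using sets_eq_imp_space_eq[OF m(2)] by simp
    from ae obtain N where N: "{x \<in> space m. \<not> (\<forall>i. emeasure m (ball x (r i)) = g i)} \<subseteq> N" "N \<in> sets m" "emeasure m N = 0"
      by (auto elim!: AE_E)
    \<comment> \<open>If the balls about almost all centres were null, countably many of them would
      cover the complement of the exceptional set, and the whole measure would vanish.\<close>
    obtain F where F: "F \<subseteq> (\<lambda>x. ball x (r i)) ` (- N)" "countable F" "\<Union>F = \<Union>((\<lambda>x. ball x (r i)) ` (- N))"
      by (rule Lindelof[of "(\<lambda>x. ball x (r i)) ` (- N)"]) auto
    have "emeasure m X = 0" if X: "X \<in> F" for X
    proof -
      obtain x where x: "x \<notin> N" "X = ball x (r i)" using X F(1) by auto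
      then have "emeasure m (ball x (r i)) = g i" using N(1) spm by blast
      then show ?thesis using x g0 by simp
    qed
    then have "X \<in> null_sets m" if X: "X \<in> F" for X
      using X F(1) by (intro null_setsI) (auto simp: m(2))
    then have "(\<Union>X\<in>F. X) \<in> null_sets m" by (rule null_sets_UN'[OF F(2)])
    then have "emeasure m (\<Union>F) = 0" by auto
    have "- N \<subseteq> \<Union>F" unfolding F(3) using r[of i] by (auto intro!: bexI)
    then have "UNIV = N \<union> \<Union>F" by auto
    moreover have "emeasure m (N \<union> \<Union>F) \<le> emeasure m N + emeasure m (\<Union>F)"
      by (rule emeasure_subadditive) (use N(2) F(1,2) m(2) in \<open>auto intro!: sets.countable_Union\<close>)
    ultimately show False using N(3) \<open>emeasure m (\<Union>F) = 0\<close> m(3) by simp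
  qed
  have ex: "\<exists>x. P x" if "AE x in m. P x" "emeasure m UNIV \<noteq> 0" "space m = UNIV" for m :: "'a measure" and P
  proof (rule ccontr)
    assume no: "\<nexists>x. P x"
    have "AE x in m. False" using that(1) by (rule eventually_mono) (use no in blast)
    then show False using that(2,3) by (simp add: trivial_limit_def[symmetric] ae_filter_eq_bot_iff)
  qed
  have gfin: "g1 i \<noteq> \<infinity> \<and> g2 i \<noteq> \<infinity>" for i
  proof -
    obtain x where "\<forall>i. emeasure m1 (ball x (r i)) = g1 i \<and> emeasure m2 (ball x (r i)) = g2 i"
      using ex[OF ae1] False sp by blast
    then show ?thesis
      using m1.emeasure_finite[of "ball x (r i)"] m2.emeasure_finite[of "ball x (r i)"] by simp
  qed
  have gpos: "g1 i \<noteq> 0" "g2 i \<noteq> 0" for i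
  proof -
    have "AE x in m1. \<forall>i. emeasure m1 (ball x (r i)) = g1 i" using ae1 by (rule eventually_mono) simp
    from pos[OF fin(1) sets(1) _ this] False show "g1 i \<noteq> 0" by blast
    have "AE x in m2. \<forall>i. emeasure m2 (ball x (r i)) = g2 i" using ae2 by (rule eventually_mono) simp
    from pos[OF fin(2) sets(2) _ this] False show "g2 i \<noteq> 0" by blast
  qed
  have op: "emeasure m1 U * emeasure m2 UNIV = emeasure m2 U * emeasure m1 UNIV" if "open U" for U
    by (rule uniformly_distributed_open[OF fin sets r r0, where ?g1.0="\<lambda>i. g1 i" and ?g2.0="\<lambda>i. g2 i"])
      (use ae1 ae2 gpos gfin that in \<open>auto elim!: eventually_mono\<close>)
  show ?thesis
  proof (rule measure_eqI_generator_eq[where E="{S. open S}" and \<Omega>=UNIV and A="\<lambda>_. UNIV"])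
    show "sets (scale_measure (emeasure m2 UNIV) m1) = sigma_sets UNIV {S. open S}"
      "sets (scale_measure (emeasure m1 UNIV) m2) = sigma_sets UNIV {S. open S}"
      by (simp_all add: sets borel_def)
    show "emeasure (scale_measure (emeasure m2 UNIV) m1) X = emeasure (scale_measure (emeasure m1 UNIV) m2) X"
      if "X \<in> {S. open S}" for X using op[of X] that by (simp add: mult.commute)
    show "emeasure (scale_measure (emeasure m2 UNIV) m1) UNIV \<noteq> \<infinity>"
      using m1.emeasure_finite m2.emeasure_finite by (simp add: sp[symmetric] ennreal_mult_eq_top_iff)
  qed (auto simp: Int_stable_def)
qed

section \<open>Orthogonal conjugation of projection matrices\<close>

abbreviation flat_proj :: "(real^'n) set \<Rightarrow> real^'n^'n" where
  "flat_proj E \<equiv> snd (flat_coords E)"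

lemma flat_proj_subspace: "subspace E \<Longrightarrow> flat_proj E = matrix (closest_point E)"
  by (simp add: flat_coords_subspace)

lemma measurable_fst_borel: "fst \<in> borel_measurable (borel :: ('a::second_countable_topology \<times> 'b::second_countable_topology) measure)"
  by (intro borel_measurable_continuous_onI continuous_intros)

lemma measurable_snd_borel: "snd \<in> borel_measurable (borel :: ('a::second_countable_topology \<times> 'b::second_countable_topology) measure)"
  by (intro borel_measurable_continuous_onI continuous_intros)

lemma measurable_flat_coords: "flat_coords \<in> borel_measurable (flat_borel S)"
  unfolding flat_borel_def by (rule measurable_vimage_algebra1) simp

lemma measurable_flat_proj: "flat_proj \<in> borel_measurable (flat_borel S)"
  by (rule measurable_compose[OF measurable_flat_coords measurable_snd_borel])

lemma norm_mult_orthogonal_matrix_right: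
  fixes U :: "real^'n \<Rightarrow> real^'n" and M :: "real^'n^'n"
  assumes U: "orthogonal_transformation U"
  shows "norm (M ** transpose (matrix U)) = norm M"
proof -
  have "(M ** transpose (matrix U)) $ i = U (M $ i)" for i
  proof -
    have "(M ** transpose (matrix U)) $ i = matrix U *v (M $ i)"
      by (simp add: vec_eq_iff matrix_matrix_mult_def matrix_vector_mult_def transpose_def mult.commute)
    then show ?thesis using U by (simp add: orthogonal_transformation_linear)
  qed
  moreover have "norm A = L2_set (\<lambda>i. norm (A $ i)) UNIV" for A :: "real^'n^'n" by (rule norm_vec_def)
  ultimately show ?thesis by (simp only: orthogonal_transformation_norm[OF U])
qed

lemma norm_transpose_matrix: "norm (transpose (M :: real^'n^'m)) = norm M"
proof -
  have "(norm (transpose M))\<^sup>2 = (norm M)\<^sup>2"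
    unfolding power2_norm_eq_inner inner_vec_def transpose_def vec_lambda_beta by (rule sum.swap)
  then show ?thesis by (simp add: power2_eq_iff_nonneg)
qed

text \<open>Orthogonal matrices act isometrically on rows and, after transposition, on columns.
  Conjugation therefore maps balls of matrices to balls, so a conjugation invariant measure gives
  balls about conjugate projections the same mass.\<close>

lemma norm_conj_orthogonal:
  fixes U :: "real^'n \<Rightarrow> real^'n" and M :: "real^'n^'n"
  assumes U: "orthogonal_transformation U"
  shows "norm (matrix U ** M ** transpose (matrix U)) = norm M"
proof -
  have "norm (matrix U ** M ** transpose (matrix U)) = norm (matrix U ** M)"
    by (rule norm_mult_orthogonal_matrix_right[OF U])
  also have "\<dots> = norm (transpose M ** transpose (matrix U))"
    by (metis norm_transpose_matrix matrix_transpose_mul)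
  also have "\<dots> = norm M" by (simp only: norm_mult_orthogonal_matrix_right[OF U] norm_transpose_matrix)
  finally show ?thesis .
qed

lemma matrix_linear_apply: "linear f \<Longrightarrow> matrix f *v x = f (x :: real^'n)" for f :: "real^'n \<Rightarrow> real^'m"
  by simp

lemma matrix_closest_point_image:
  fixes U :: "real^'n \<Rightarrow> real^'n"
  assumes U: "orthogonal_transformation U" and E: "subspace E"
  shows "matrix (closest_point (U ` E)) = matrix U ** matrix (closest_point E) ** transpose (matrix U)"
proof (rule matrix_eq[THEN iffD2], rule allI)
  fix x
  have UE: "subspace (U ` E)" using U E by (simp add: linear_subspace_image orthogonal_transformation_linear)
  have Ul: "matrix U *v y = U y" for y using U by (simp add: orthogonal_transformation_linear)
  have "orthogonal_matrix (matrix U)" using U by (simp add: orthogonal_transformation_matrix)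
  then have Q1: "matrix U ** transpose (matrix U) = mat 1" by (simp only: orthogonal_matrix_def)
  have "matrix U *v (transpose (matrix U) *v x) = (matrix U ** transpose (matrix U)) *v x"
    by (rule matrix_vector_mul_assoc)
  then have QQ: "U (transpose (matrix U) *v x) = x" by (simp only: Ul Q1 matrix_vector_mul_lid)
  have "matrix (closest_point (U ` E)) *v x = closest_point (U ` E) (U (transpose (matrix U) *v x))"
    by (simp only: QQ matrix_linear_apply[OF linear_closest_point[OF UE]])
  also have "\<dots> = U (closest_point E (transpose (matrix U) *v x))"
    by (rule closest_point_orthogonal_image[OF U E])
  also have "\<dots> = (matrix U ** matrix (closest_point E) ** transpose (matrix U)) *v x"
    by (simp only: Ul matrix_vector_mul_assoc[symmetric] matrix_linear_apply[OF linear_closest_point[OF E]])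
  finally show "matrix (closest_point (U ` E)) *v x = (matrix U ** matrix (closest_point E) ** transpose (matrix U)) *v x" .
qed

lemma measurable_conj: "(\<lambda>A::real^'n^'n. Q ** A ** R) \<in> borel_measurable borel"
proof -
  have "(\<lambda>A::real^'n^'n. Q ** A ** R) = (\<lambda>A. \<chi> i j. \<Sum>l\<in>UNIV. (\<Sum>m\<in>UNIV. Q $ i $ m * A $ m $ l) * R $ l $ j)"
    by (simp add: matrix_matrix_mult_def)
  then show ?thesis by (simp only:) (intro borel_measurable_continuous_onI continuous_intros)
qed

lemma measurable_orthogonal_image:
  fixes U :: "real^'n \<Rightarrow> real^'n"
  assumes U: "orthogonal_transformation U"
  shows "(`) U \<in> measurable (flat_borel (linear_grassmannian k)) (flat_borel (linear_grassmannian k))"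
  unfolding flat_borel_def
proof (rule measurable_vimage_algebra2)
  let ?V = "vimage_algebra (linear_grassmannian k) flat_coords borel :: (real^'n) set measure"
  show "(`) U \<in> space ?V \<rightarrow> linear_grassmannian k"
    using orthogonal_image_linear_grassmannian[OF U] by auto
  have "(\<lambda>E. (0 :: real^'n, matrix U ** flat_proj E ** transpose (matrix U))) \<in> borel_measurable ?V"
    by (intro borel_measurable_Pair borel_measurable_const
        measurable_compose[OF measurable_flat_proj[unfolded flat_borel_def] measurable_conj])
  moreover have "flat_coords (U ` E) = (0, matrix U ** flat_proj E ** transpose (matrix U))"
    if "E \<in> linear_grassmannian k" for E
  proof -
    have E: "subspace E" "subspace (U ` E)"
      using that orthogonal_image_linear_grassmannian[OF U that] by (auto simp: linear_grassmannian_def)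
    then show ?thesis using matrix_closest_point_image[OF U E(1)] by (simp add: flat_coords_subspace)
  qed
  ultimately show "(\<lambda>E. flat_coords (U ` E)) \<in> borel_measurable ?V"
    by (subst measurable_cong) auto
qed

lemma tuple_weight_orthogonal:
  assumes U: "orthogonal_transformation (U :: real^'n \<Rightarrow> real^'n)"
  shows "tuple_weight S (\<lambda>j\<in>S. U (X j)) = tuple_weight S X"
proof -
  have "gram_vol S (\<lambda>j\<in>S. U (X j)) = gram_vol S (\<lambda>j. U (X j))" by (rule gram_vol_cong) simp
  then have 1: "gram_vol S (\<lambda>j\<in>S. U (X j)) = gram_vol S X" by (simp add: gram_vol_orthogonal[OF U])
  have "tuple_comb S (\<lambda>j\<in>S. U (X j)) v = U (tuple_comb S X v)" for v
    by (rule tuple_comb_linear[OF orthogonal_transformation_linear[OF U]]) simp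
  then have 2: "dominated S std_tuple (\<lambda>j\<in>S. U (X j)) \<longleftrightarrow> dominated S std_tuple X"
    by (simp add: dominated_def orthogonal_transformation_norm[OF U])
  show ?thesis unfolding tuple_weight_def 1 by (simp add: indicator_def 2)
qed

lemma proj_matrix_orthogonal:
  assumes U: "orthogonal_transformation (U :: real^'n \<Rightarrow> real^'n)" and g: "det (gram S X) \<noteq> 0"
  shows "proj_matrix S (\<lambda>j\<in>S. U (X j)) = matrix U ** proj_matrix S X ** transpose (matrix U)"
proof -
  have "gram S (\<lambda>j\<in>S. U (X j)) = gram S (\<lambda>j. U (X j))" by (rule gram_cong) simp
  then have g': "det (gram S (\<lambda>j\<in>S. U (X j))) \<noteq> 0" using g by (simp add: gram_orthogonal[OF U])
  have "(\<lambda>j\<in>S. U (X j)) ` S = U ` (X ` S)" by auto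
  then have "span ((\<lambda>j\<in>S. U (X j)) ` S) = U ` span (X ` S)" by (simp add: span_orthogonal_image[OF U])
  then show ?thesis
    by (simp add: proj_matrix_eq[OF g] proj_matrix_eq[OF g'] matrix_closest_point_image[OF U])
qed

lemma measurable_matrix_vector_mult:
  fixes A :: "'c \<Rightarrow> real^'n^'n" and x :: "'c \<Rightarrow> real^'n"
  assumes A: "A \<in> borel_measurable M" and x: "x \<in> borel_measurable M"
  shows "(\<lambda>\<omega>. A \<omega> *v x \<omega>) \<in> borel_measurable M"
proof (rule measurable_borel_vec)
  have e: "(\<lambda>A::real^'n^'n. A $ r $ c) \<in> borel_measurable borel" for r c
    by (intro borel_measurable_continuous_onI continuous_intros)
  fix r show "(\<lambda>\<omega>. (A \<omega> *v x \<omega>) $ r) \<in> borel_measurable M"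
    unfolding matrix_vector_mult_def vec_lambda_beta
    by (intro borel_measurable_sum borel_measurable_times measurable_compose[OF A e] measurable_compose[OF x measurable_nth_borel])
qed

text \<open>Integrand and projection vary together with a parameter, because later the base vertex
  of the simplex and the direction of the flat both move.\<close>

lemma measurable_proj_avg_param:
  fixes F :: "'c \<Rightarrow> ('n::finite \<Rightarrow> real^'n) \<Rightarrow> ennreal"
  assumes F: "case_prod F \<in> borel_measurable (M \<Otimes>\<^sub>M powM S lborel)" and P: "P \<in> borel_measurable M"
  shows "(\<lambda>\<omega>. proj_avg S N (F \<omega>) (P \<omega>)) \<in> borel_measurable M"
proof -
  let ?\<Lambda> = "powM S (lborel :: (real^'n) measure)"
  interpret pl: product_sigma_finite "\<lambda>_::'n. lborel :: (real^'n) measure" by (rule product_sigma_finite_lborel)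
  interpret Lam: sigma_finite_measure ?\<Lambda> by (rule pl.sigma_finite) simp
  have Y: "(\<lambda>p. snd p j) \<in> borel_measurable (M \<Otimes>\<^sub>M ?\<Lambda>)" if "j \<in> S" for j
    by (rule measurable_compose[OF measurable_snd measurable_component_borel]) (use that in simp_all)
  have PY: "(\<lambda>p. P (fst p) *v snd p j) \<in> borel_measurable (M \<Otimes>\<^sub>M ?\<Lambda>)" if "j \<in> S" for j
    by (intro measurable_matrix_vector_mult measurable_compose[OF measurable_fst P] Y that)
  have r: "(\<lambda>p. \<lambda>j\<in>S. P (fst p) *v snd p j) \<in> measurable (M \<Otimes>\<^sub>M ?\<Lambda>) ?\<Lambda>"
    by (rule measurable_restrict) (use PY in simp)
  have gv: "gram_vol S \<in> borel_measurable ?\<Lambda>" by (rule measurable_gram_vol_PiM) simp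
  have Fr: "(\<lambda>p. F (fst p) (\<lambda>j\<in>S. P (fst p) *v snd p j)) \<in> borel_measurable (M \<Otimes>\<^sub>M ?\<Lambda>)"
    using measurable_compose[OF measurable_Pair[OF measurable_fst r] F] by simp
  have "(\<lambda>p. (\<Prod>j\<in>S. indicator (cball 0 1) (snd p j - P (fst p) *v snd p j)) :: ennreal) \<in> borel_measurable (M \<Otimes>\<^sub>M ?\<Lambda>)"
    by (intro borel_measurable_prod_ennreal measurable_compose[OF _ borel_measurable_indicator[OF cball_borel]]
        borel_measurable_diff Y PY)
  then have "(\<lambda>(\<omega>,Y). F \<omega> (\<lambda>j\<in>S. P \<omega> *v Y j) * ennreal (gram_vol S (\<lambda>j\<in>S. P \<omega> *v Y j) ^ N)
      * (\<Prod>j\<in>S. indicator (cball 0 1) (Y j - P \<omega> *v Y j))) \<in> borel_measurable (M \<Otimes>\<^sub>M ?\<Lambda>)"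
    unfolding split_beta using Fr measurable_compose[OF r gv]
    by measurable
  then show ?thesis unfolding proj_avg_def by (rule Lam.borel_measurable_nn_integral)
qed

lemma measurable_proj_avg:
  assumes F: "F \<in> borel_measurable (powM S lborel)"
  shows "proj_avg S N F \<in> borel_measurable (borel :: (real^'n^'n) measure)"
proof -
  have "case_prod (\<lambda>_::real^'n^'n. F) \<in> borel_measurable (borel \<Otimes>\<^sub>M powM S lborel)"
    using measurable_compose[OF measurable_snd F] by (simp add: case_prod_unfold)
  from measurable_proj_avg_param[OF this, of "\<lambda>P. P"] show ?thesis by simp
qed

lemma subspace_mem_linear_grassmannian_image:
  fixes E :: "(real^'n) set" and S :: "'n set"
  assumes "E \<in> linear_grassmannian (card S)"
  obtains U :: "real^'n \<Rightarrow> real^'n" where "orthogonal_transformation U" "E = U ` span (coord_basis S)"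
proof -
  have "subspace E" "dim E = card S" using assms by (simp_all add: linear_grassmannian_def)
  then show ?thesis using subspace_orthogonal_image_coord[of E S] that by metis
qed

lemma flat_proj_image_coord:
  fixes U :: "real^'n \<Rightarrow> real^'n"
  assumes U: "orthogonal_transformation U"
  shows "flat_proj (U ` span (coord_basis S)) = matrix U ** matrix (coord_proj S) ** transpose (matrix U)"
proof -
  have "subspace (U ` span (coord_basis S))"
    using U by (simp add: linear_subspace_image orthogonal_transformation_linear)
  then show ?thesis
    using matrix_closest_point_image[OF U subspace_span, of "coord_basis S"]
    by (simp add: flat_proj_subspace closest_point_coord)
qed

lemma grassmannian_haar_facts:
  assumes "grassmannian_haar k (\<mu> :: (real^'n) set measure)"
  shows "prob_space \<mu>" "sets \<mu> = sets (flat_borel (linear_grassmannian k))" "space \<mu> = linear_grassmannian k"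
    "flat_proj \<in> borel_measurable \<mu>"
proof -
  show "prob_space \<mu>" and s: "sets \<mu> = sets (flat_borel (linear_grassmannian k))"
    using assms by (simp_all add: grassmannian_haar_def)
  show "space \<mu> = linear_grassmannian k" using sets_eq_imp_space_eq[OF s] by (simp add: flat_borel_def)
  show "flat_proj \<in> borel_measurable \<mu>" using measurable_flat_proj measurable_cong_sets[OF s refl] by blast
qed

text \<open>Both measures are moved to the space of matrices: \<open>m1\<close> is the image of
  \<open>tuple_weight\<close>, \<open>m2\<close> the image of the Haar measure. Each is invariant
  under orthogonal conjugation and concentrated on a single orbit, the projections of rank
  \<open>card S\<close>, so it gives all balls of one radius about such projections the same
  measure. Hence the two are proportional, and the averaged identity becomes the formula.\<close>

theorem Blaschke_Petkantschin_linear: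
  fixes \<mu> :: "(real^'n) set measure" and S :: "'n set"
  assumes haar: "grassmannian_haar (card S) \<mu>"
  shows "\<exists>c. \<forall>F\<in>borel_measurable (powM S lborel).
     (\<integral>\<^sup>+X. F X \<partial>powM S lborel) = c * (\<integral>\<^sup>+E. proj_avg S (CARD('n) - card S) F (flat_proj E) \<partial>\<mu>)"
proof -
  let ?k = "card S" and ?N = "CARD('n) - card S"
  let ?\<Lambda> = "powM S (lborel :: (real^'n) measure)"
  define K where "K = (\<integral>\<^sup>+Z. indicator {Z. dominated S Z (std_tuple::'n \<Rightarrow> real^'n)} Z \<partial>powM S (coord_lborel S))"
  define w where "w = ball_vol ?N ^ ?k"
  have K: "K \<noteq> 0" "K \<noteq> \<infinity>" using dominated_std_finite_pos[of S] by (simp_all add: K_def)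
  have w: "w \<noteq> 0" "w \<noteq> \<infinity>"
  proof -
    have "w = ennreal (unit_ball_vol (real ?N) ^ ?k)" by (simp add: w_def ennreal_power)
    moreover have "unit_ball_vol (real ?N) ^ ?k > 0" by simp
    ultimately show "w \<noteq> 0" "w \<noteq> \<infinity>" by (simp_all only: ennreal_eq_0_iff not_le ennreal_neq_top infinity_ennreal_def not_False_eq_True)
  qed
  have pre: "w * K * (\<integral>\<^sup>+X. F X \<partial>?\<Lambda>) = (\<integral>\<^sup>+X. tuple_weight S X * proj_avg S ?N F (proj_matrix S X) \<partial>?\<Lambda>)"
    if "F \<in> borel_measurable ?\<Lambda>" for F
    unfolding w_def K_def by (rule pre_Blaschke_Petkantschin[OF that])
  interpret pl: product_sigma_finite "\<lambda>_::'n. lborel :: (real^'n) measure" by (rule product_sigma_finite_lborel)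
  interpret prob_space \<mu> using haar by (simp add: grassmannian_haar_def)
  have inv: "\<And>U. orthogonal_transformation U \<Longrightarrow> distr \<mu> \<mu> ((`) U) = \<mu>"
    using haar by (simp add: grassmannian_haar_def)
  note sets_\<mu> = grassmannian_haar_facts(2)[OF haar] and space_\<mu> = grassmannian_haar_facts(3)[OF haar]
    and fp = grassmannian_haar_facts(4)[OF haar]
  have twm: "tuple_weight S \<in> borel_measurable ?\<Lambda>"
  proof -
    have "gram_vol S \<in> borel_measurable ?\<Lambda>" by (rule measurable_gram_vol_PiM) simp
    moreover have "Measurable.pred ?\<Lambda> (\<lambda>X. dominated S std_tuple X)"
      by (rule pred_dominated) (auto intro: measurable_component_borel)
    ultimately show ?thesis unfolding tuple_weight_def[abs_def] indicator_def by measurable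
  qed
  have pm: "proj_matrix S \<in> borel_measurable ?\<Lambda>"
    by (rule measurable_proj_matrix) (auto intro: measurable_component_borel)
  define m1 where "m1 = distr (density ?\<Lambda> (tuple_weight S)) borel (proj_matrix S)"
  define m2 where "m2 = distr \<mu> borel flat_proj"
  have sets [simp]: "sets m1 = sets borel" "sets m2 = sets borel" by (simp_all add: m1_def m2_def)
  have int1: "(\<integral>\<^sup>+P. \<phi> P \<partial>m1) = (\<integral>\<^sup>+X. tuple_weight S X * \<phi> (proj_matrix S X) \<partial>?\<Lambda>)"
    if \<phi>: "\<phi> \<in> borel_measurable borel" for \<phi>
    unfolding m1_def using measurable_compose[OF pm \<phi>] twm pm \<phi>
    by (subst nn_integral_distr) (auto simp: nn_integral_density)
  have int2: "(\<integral>\<^sup>+P. \<phi> P \<partial>m2) = (\<integral>\<^sup>+E. \<phi> (flat_proj E) \<partial>\<mu>)" if "\<phi> \<in> borel_measurable borel" for \<phi>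
    unfolding m2_def using fp that by (subst nn_integral_distr) simp_all
  have m2: "emeasure m2 UNIV = 1"
    unfolding m2_def using fp by (subst emeasure_distr) (auto simp: emeasure_space_1)
  interpret m2: finite_measure m2 by (rule finite_measureI) (simp add: sets_eq_imp_space_eq[OF sets(2)] m2)
  let ?C = "\<lambda>U A. matrix U ** A ** transpose (matrix U) :: real^'n^'n"
  have inv1: "(\<integral>\<^sup>+P. \<phi> (?C U P) \<partial>m1) = (\<integral>\<^sup>+P. \<phi> P \<partial>m1)"
    if U: "orthogonal_transformation U" and \<phi>: "\<phi> \<in> borel_measurable borel" for U \<phi>
  proof -
    have Um: "U \<in> borel_measurable lborel" using measurable_linear[OF orthogonal_transformation_linear[OF U]] by simp
    have m: "(\<lambda>X. tuple_weight S X * \<phi> (proj_matrix S X)) \<in> borel_measurable ?\<Lambda>"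
      using twm measurable_compose[OF pm \<phi>] by (rule borel_measurable_times_ennreal)
    have "(\<integral>\<^sup>+P. \<phi> P \<partial>m1) = (\<Prod>i\<in>S. 1) * (\<integral>\<^sup>+X. tuple_weight S (\<lambda>j\<in>S. U (X j)) * \<phi> (proj_matrix S (\<lambda>j\<in>S. U (X j))) \<partial>?\<Lambda>)"
      unfolding int1[OF \<phi>]
    proof (rule nn_integral_PiM_componentwise[OF sigma_finite_lborel _ _ _ m, symmetric])
      show "U \<in> measurable lborel lborel" using Um by simp
      fix g :: "real^'n \<Rightarrow> ennreal" assume g: "g \<in> borel_measurable lborel"
      have "(\<integral>\<^sup>+x. g x \<partial>lborel) = (\<integral>\<^sup>+x. g x \<partial>distr lborel borel U)" by (simp add: lborel_distr_isometry[OF U])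
      also have "\<dots> = (\<integral>\<^sup>+x. g (U x) \<partial>lborel)" using Um g by (subst nn_integral_distr) auto
      finally show "1 * (\<integral>\<^sup>+x. g (U x) \<partial>lborel) = (\<integral>\<^sup>+x. g x \<partial>lborel)" by simp
    qed simp
    also have "\<dots> = (\<integral>\<^sup>+X. tuple_weight S X * \<phi> (?C U (proj_matrix S X)) \<partial>?\<Lambda>)"
      by (simp, rule nn_integral_cong_AE, use AE_det_gram_nonzero[of S] in eventually_elim)
        (simp add: tuple_weight_orthogonal[OF U] proj_matrix_orthogonal[OF U])
    also have "\<dots> = (\<integral>\<^sup>+P. \<phi> (?C U P) \<partial>m1)"
      by (rule int1[symmetric]) (rule measurable_compose[OF measurable_conj \<phi>])
    finally show ?thesis by simp
  qed
  have inv2: "(\<integral>\<^sup>+P. \<phi> (?C U P) \<partial>m2) = (\<integral>\<^sup>+P. \<phi> P \<partial>m2)"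
    if U: "orthogonal_transformation U" and \<phi>: "\<phi> \<in> borel_measurable borel" for U \<phi>
  proof -
    have Um: "(`) U \<in> measurable \<mu> \<mu>"
      using measurable_orthogonal_image[OF U] measurable_cong_sets[OF sets_\<mu> sets_\<mu>] by blast
    have "(\<integral>\<^sup>+P. \<phi> P \<partial>m2) = (\<integral>\<^sup>+E. \<phi> (flat_proj E) \<partial>distr \<mu> \<mu> ((`) U))" by (simp add: int2[OF \<phi>] inv[OF U])
    also have "\<dots> = (\<integral>\<^sup>+E. \<phi> (flat_proj (U ` E)) \<partial>\<mu>)"
      using Um measurable_compose[OF fp \<phi>] by (subst nn_integral_distr) simp_all
    also have "\<dots> = (\<integral>\<^sup>+E. \<phi> (?C U (flat_proj E)) \<partial>\<mu>)"
    proof (rule nn_integral_cong)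
      fix E assume "E \<in> space \<mu>"
      then have E: "E \<in> linear_grassmannian ?k" by (simp add: space_\<mu>)
      then have "subspace E" "subspace (U ` E)"
        using orthogonal_image_linear_grassmannian[OF U E] by (simp_all add: linear_grassmannian_def)
      then show "\<phi> (flat_proj (U ` E)) = \<phi> (?C U (flat_proj E))"
        by (simp add: flat_proj_subspace matrix_closest_point_image[OF U])
    qed
    also have "\<dots> = (\<integral>\<^sup>+P. \<phi> (?C U P) \<partial>m2)"
      by (rule int2[symmetric]) (rule measurable_compose[OF measurable_conj \<phi>])
    finally show ?thesis by simp
  qed
  \<comment> \<open>The projection onto the coordinate subspace represents the orbit; every ball is
    compared with a ball about \<open>P0\<close>.\<close>
  define P0 where "P0 = (matrix (coord_proj S) :: real^'n^'n)"
  have ballC: "emeasure m (ball (?C U P0) r) = emeasure m (ball P0 r)"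
    if U: "orthogonal_transformation U" and m: "sets m = sets borel"
      "\<And>\<phi>. \<phi> \<in> borel_measurable borel \<Longrightarrow> (\<integral>\<^sup>+P. \<phi> (?C U P) \<partial>m) = (\<integral>\<^sup>+P. \<phi> P \<partial>m)"
    for U r and m :: "(real^'n^'n) measure"
  proof -
    have d: "dist (?C U P0) (?C U P) = dist P0 P" for P
    proof -
      have "?C U P0 - ?C U P = ?C U (P0 - P)" 
      proof -
        have l: "A ** (B - C) = A ** B - A ** C" and r: "(B - C) ** A = B ** A - C ** A" for A B C :: "real^'n^'n"
          by (simp_all add: vec_eq_iff matrix_matrix_mult_def algebra_simps sum_subtractf)
        show ?thesis by (simp only: l r)
      qed
      then show ?thesis by (simp add: dist_norm norm_conj_orthogonal[OF U])
    qed
    have "emeasure m (ball (?C U P0) r) = (\<integral>\<^sup>+P. indicator (ball (?C U P0) r) (?C U P) \<partial>m)"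
      by (subst m(2)[OF borel_measurable_indicator[OF borel_open[OF open_ball]]]) (simp add: m(1))
    also have "\<dots> = (\<integral>\<^sup>+P. indicator (ball P0 r) P \<partial>m)"
      by (intro nn_integral_cong) (simp add: indicator_def d)
    finally show ?thesis by (simp add: m(1))
  qed
  have ballE: "emeasure m1 (ball (flat_proj E) r) = emeasure m1 (ball P0 r) \<and> emeasure m2 (ball (flat_proj E) r) = emeasure m2 (ball P0 r)"
    if E: "E \<in> linear_grassmannian ?k" for E r
  proof -
    obtain U :: "real^'n \<Rightarrow> real^'n" where U: "orthogonal_transformation U" "E = U ` span (coord_basis S)"
      using subspace_mem_linear_grassmannian_image[OF E] by blast
    have "flat_proj E = ?C U P0" unfolding U(2) P0_def by (rule flat_proj_image_coord[OF U(1)])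
    then show ?thesis using ballC[OF U(1) sets(1) inv1[OF U(1)]] ballC[OF U(1) sets(2) inv2[OF U(1)]] by simp
  qed
  have sp: "X \<in> space ?\<Lambda> \<Longrightarrow> det (gram S X) \<noteq> 0 \<Longrightarrow> span (X ` S) \<in> linear_grassmannian ?k \<and> proj_matrix S X = flat_proj (span (X ` S))" for X
    using dim_span_gram_nonzero[of S X] by (simp add: linear_grassmannian_def proj_matrix_eq flat_proj_subspace del: dim_span)
  text \<open>A concrete integrand of finite positive integral shows that \<open>m1\<close> is finite.\<close>
  define F0 where "F0 X = (\<Prod>j\<in>S. indicator (cball 0 1) (X j) :: ennreal)" for X :: "'n \<Rightarrow> real^'n"
  have F0m: "F0 \<in> borel_measurable ?\<Lambda>"
    unfolding F0_def
    by (intro borel_measurable_prod_ennreal measurable_compose[OF measurable_component_borel borel_measurable_indicator]) simp_all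
  define h0 where "h0 = proj_avg S ?N F0 P0"
  \<comment> \<open>The integrand \<open>F0\<close> does not change when an isometry is applied to
    all vectors, so its average is the same number on every subspace.\<close>
  have h0E: "proj_avg S ?N F0 (flat_proj E) = h0" if E: "E \<in> linear_grassmannian ?k" for E
  proof -
    have *: "proj_avg S ?N F0 (flat_proj (U ` span (coord_basis S))) = w * (\<integral>\<^sup>+Z. ennreal (\<bar>det (col_matrix S Z)\<bar> ^ ?N) * F0 Z \<partial>powM S (coord_lborel S))"
      if U: "orthogonal_transformation U" for U :: "real^'n \<Rightarrow> real^'n"
    proof -
      have FZ: "F0 (\<lambda>j\<in>S. U (Z j)) = F0 Z" for Z
        unfolding F0_def by (rule prod.cong) (auto simp: indicator_def orthogonal_transformation_norm[OF U])
      have c: "card (U ` coord_basis S) = ?k"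
        using U by (simp add: card_image inj_on_subset[OF orthogonal_transformation_inj])
      have "flat_proj (U ` span (coord_basis S)) = matrix (closest_point (span (U ` coord_basis S)))"
        using flat_proj_subspace[OF subspace_span, of "U ` coord_basis S"] by (simp add: span_orthogonal_image[OF U])
      then have "proj_avg S ?N F0 (flat_proj (U ` span (coord_basis S))) = w * flat_avg S ?N F0 (U ` coord_basis S)"
        using flat_avg_cylinder[OF orthonormal_set_image[OF U orthonormal_coord_basis[of S]] F0m, of ?N] by (simp add: c w_def)
      also have "flat_avg S ?N F0 (U ` coord_basis S) = (\<integral>\<^sup>+Z. ennreal (\<bar>det (col_matrix S Z)\<bar> ^ ?N) * F0 Z \<partial>powM S (coord_lborel S))"
        by (simp only: flat_avg_image[OF U F0m] FZ)
      finally show ?thesis .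
    qed
    obtain U :: "real^'n \<Rightarrow> real^'n" where U: "orthogonal_transformation U" "E = U ` span (coord_basis S)"
      using subspace_mem_linear_grassmannian_image[OF E] by blast
    have "flat_proj ((\<lambda>x. x) ` span (coord_basis S)) = P0"
      by (simp add: P0_def flat_proj_subspace closest_point_coord)
    then have h: "h0 = proj_avg S ?N F0 (flat_proj ((\<lambda>x. x) ` span (coord_basis S)))" by (simp add: h0_def)
    show ?thesis unfolding U(2) *[OF U(1)] h *[OF orthogonal_transformation_id] ..
  qed
  have "(\<integral>\<^sup>+X. F0 X \<partial>?\<Lambda>) = (\<Prod>j\<in>S. \<integral>\<^sup>+x. indicator (cball 0 1) x \<partial>(lborel :: (real^'n) measure))"
    unfolding F0_def by (rule pl.product_nn_integral_prod) auto
  also have "\<dots> = ball_vol CARD('n) ^ ?k"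
    using emeasure_cball[of 1 "0::real^'n"] by simp
  finally have I0: "(\<integral>\<^sup>+X. F0 X \<partial>?\<Lambda>) = ennreal (unit_ball_vol (real CARD('n)) ^ ?k)" by (simp add: ennreal_power)
  have "unit_ball_vol (real CARD('n)) ^ ?k > 0" by simp
  then have I0': "(\<integral>\<^sup>+X. F0 X \<partial>?\<Lambda>) \<noteq> 0" "(\<integral>\<^sup>+X. F0 X \<partial>?\<Lambda>) \<noteq> \<infinity>"
    unfolding I0 by (simp_all only: ennreal_eq_0_iff not_le ennreal_neq_top infinity_ennreal_def not_False_eq_True)
  \<comment> \<open>The left side is finite and positive. Being the product of \<open>h0\<close> and
    the total mass of \<open>m1\<close>, it forces this mass to be finite.\<close>
  have "w * K * (\<integral>\<^sup>+X. F0 X \<partial>?\<Lambda>) = (\<integral>\<^sup>+X. h0 * (tuple_weight S X * 1) \<partial>?\<Lambda>)"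
    unfolding pre[OF F0m]
    by (rule nn_integral_cong_AE, rule AE_mp[OF AE_det_gram_nonzero AE_I2], use sp h0E in \<open>auto simp: mult.commute\<close>)
  also have "\<dots> = h0 * (\<integral>\<^sup>+X. tuple_weight S X * 1 \<partial>?\<Lambda>)"
    by (rule nn_integral_cmult) (use twm in simp)
  also have "(\<integral>\<^sup>+X. tuple_weight S X * 1 \<partial>?\<Lambda>) = (\<integral>\<^sup>+P. 1 \<partial>m1)" by (rule int1[symmetric]) simp
  also have "\<dots> = emeasure m1 UNIV" by (simp add: sets_eq_imp_space_eq[OF sets(1)])
  finally have T: "w * K * (\<integral>\<^sup>+X. F0 X \<partial>?\<Lambda>) = h0 * emeasure m1 UNIV" .
  have wK: "w * K \<noteq> 0" "w * K \<noteq> \<infinity>" using w K by (simp_all add: ennreal_mult_eq_top_iff)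
  have "h0 \<noteq> 0" using T wK I0' by auto
  moreover have "h0 * emeasure m1 UNIV \<noteq> \<infinity>" using wK(2) I0'(2) unfolding T[symmetric] by (simp add: ennreal_mult_eq_top_iff)
  ultimately have fin1: "emeasure m1 UNIV \<noteq> \<infinity>" by (auto simp: ennreal_mult_eq_top_iff)
  interpret m1: finite_measure m1 by (rule finite_measureI) (use fin1 in \<open>simp add: sets_eq_imp_space_eq[OF sets(1)]\<close>)
  have pb: "Measurable.pred borel (\<lambda>x. emeasure m (ball x r) = c)" if "finite_measure m" "sets m = sets borel"
    for m :: "(real^'n^'n) measure" and c r
  proof -
    have [measurable]: "(\<lambda>x. emeasure m (ball x r)) \<in> borel_measurable borel"
      using measurable_emeasure_ball[OF that refl, of UNIV r] by simp
    show ?thesis by measurable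
  qed
  define G where "G P \<longleftrightarrow> (\<forall>i::nat. emeasure m1 (ball P (1 / real (Suc i))) = emeasure m1 (ball P0 (1 / real (Suc i))) \<and>
     emeasure m2 (ball P (1 / real (Suc i))) = emeasure m2 (ball P0 (1 / real (Suc i))))" for P
  have Gm: "{P \<in> space borel. G P} \<in> sets borel"
    unfolding G_def using pb[OF m1.finite_measure_axioms sets(1)] pb[OF m2.finite_measure_axioms sets(2)] by measurable
  have GE: "G (flat_proj E)" if "E \<in> linear_grassmannian ?k" for E
    using ballE[OF that] by (simp add: G_def)
  have GX: "G (proj_matrix S X)" if "X \<in> space ?\<Lambda>" "det (gram S X) \<noteq> 0" for X
    using sp[OF that] GE[of "span (X ` S)"] by simp
  have ae1: "AE P in m1. G P"
    unfolding m1_def using pm Gm twm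
    by (subst AE_distr_iff)
      (auto simp: AE_density intro!: AE_mp[OF AE_det_gram_nonzero[of S] AE_I2] GX)
  have ae2: "AE P in m2. G P"
    unfolding m2_def using fp Gm GE by (subst AE_distr_iff) (auto simp: space_\<mu>)
  have eq: "scale_measure (emeasure m2 UNIV) m1 = scale_measure (emeasure m1 UNIV) m2"
    by (rule uniformly_distributed_unique[OF m1.finite_measure_axioms m2.finite_measure_axioms sets
        ae1[unfolded G_def] ae2[unfolded G_def]])
  show ?thesis
  proof (intro exI ballI)
    fix F :: "('n \<Rightarrow> real^'n) \<Rightarrow> ennreal" assume F: "F \<in> borel_measurable ?\<Lambda>"
    let ?\<phi> = "proj_avg S ?N F"
    have \<phi>: "?\<phi> \<in> borel_measurable borel" by (rule measurable_proj_avg[OF F])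
    have "w * K * (\<integral>\<^sup>+X. F X \<partial>?\<Lambda>) = (\<integral>\<^sup>+P. ?\<phi> P \<partial>m1)"
      unfolding pre[OF F] int1[OF \<phi>] ..
    \<comment> \<open>Scaling by the total mass of \<open>m2\<close> changes nothing, because
      \<open>m2\<close> is a probability measure.\<close>
    also have "\<dots> = (\<integral>\<^sup>+P. ?\<phi> P \<partial>scale_measure (emeasure m2 UNIV) m1)"
      unfolding m2 by simp
    also have "\<dots> = emeasure m1 UNIV * (\<integral>\<^sup>+P. ?\<phi> P \<partial>m2)"
      unfolding eq using \<phi> by (subst nn_integral_scale_measure) (simp_all cong: measurable_cong_sets)
    also have "\<dots> = emeasure m1 UNIV * (\<integral>\<^sup>+E. ?\<phi> (flat_proj E) \<partial>\<mu>)" unfolding int2[OF \<phi>] ..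
    also have "\<dots> = w * K * (emeasure m1 UNIV / (w * K) * (\<integral>\<^sup>+E. ?\<phi> (flat_proj E) \<partial>\<mu>))"
    proof -
      have "w * K * (emeasure m1 UNIV / (w * K)) = emeasure m1 UNIV"
        unfolding ennreal_times_divide mult.commute[of "w * K" "emeasure m1 UNIV"]
        by (rule mult_divide_eq_ennreal) (use wK in simp_all)
      then show ?thesis by (subst mult.assoc[symmetric]) simp
    qed
    finally show "(\<integral>\<^sup>+X. F X \<partial>?\<Lambda>) = emeasure m1 UNIV / (w * K) * (\<integral>\<^sup>+E. ?\<phi> (flat_proj E) \<partial>\<mu>)"
      using wK by (subst (asm) ennreal_mult_cancel_left) auto
  qed
qed

section \<open>Intervals minimize convex energies\<close>

lemma convex_measurable:
  fixes \<phi> :: "real \<Rightarrow> real"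
  shows "convex_on UNIV \<phi> \<Longrightarrow> \<phi> \<in> borel_measurable borel"
  by (intro borel_measurable_continuous_onI convex_on_continuous) auto

lemma convex_on_UNIV_le_max:
  fixes \<phi> :: "real \<Rightarrow> real"
  assumes "convex_on UNIV \<phi>" "a \<le> x" "x \<le> b"
  shows "\<phi> x \<le> max (\<phi> a) (\<phi> b)"
proof -
  have "convex_on {a..b} \<phi>" by (rule convex_on_subset[OF assms(1)]) auto
  then show ?thesis by (rule convex_on_le_max) (use assms in auto)
qed

text \<open>Averages of translates of a convex function are convex. The result has to be real-valued
  so that convexity can be used again; it is finite because \<open>X\<close> is bounded where the
  weight \<open>w\<close> does not vanish.\<close>

lemma convex_nn_integral:
  fixes \<phi> :: "real \<Rightarrow> real" and X :: "'a \<Rightarrow> real"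
  assumes \<phi>: "convex_on UNIV \<phi>" "\<And>x. 0 \<le> \<phi> x"
    and [measurable]: "X \<in> borel_measurable M" "w \<in> borel_measurable M"
    and w: "(\<integral>\<^sup>+\<omega>. w \<omega> \<partial>M) \<noteq> \<infinity>" and X: "\<And>\<omega>. \<omega> \<in> space M \<Longrightarrow> w \<omega> \<noteq> 0 \<Longrightarrow> \<bar>X \<omega>\<bar> \<le> K"
  obtains \<psi> where "convex_on UNIV \<psi>" "\<And>x. 0 \<le> \<psi> x"
    "\<And>x. ennreal (\<psi> x) = (\<integral>\<^sup>+\<omega>. ennreal (\<phi> (a * x + X \<omega>)) * w \<omega> \<partial>M)"
proof -
  have [measurable]: "\<phi> \<in> borel_measurable borel" using \<phi>(1) by (rule convex_measurable)
  let ?I = "\<lambda>x. \<integral>\<^sup>+\<omega>. ennreal (\<phi> (a * x + X \<omega>)) * w \<omega> \<partial>M"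
  have fin: "?I x \<noteq> \<infinity>" for x
  proof -
    \<comment> \<open>A convex function on an interval is at most the larger of its two end values,
      so \<open>C\<close> bounds all translates that carry weight.\<close>
    define C where "C = max (\<phi> (a * x - K)) (\<phi> (a * x + K))"
    have "?I x \<le> (\<integral>\<^sup>+\<omega>. ennreal C * w \<omega> \<partial>M)"
    proof (rule nn_integral_mono)
      fix \<omega> assume \<omega>: "\<omega> \<in> space M"
      show "ennreal (\<phi> (a * x + X \<omega>)) * w \<omega> \<le> ennreal C * w \<omega>"
      proof (cases "w \<omega> = 0")
        case False
        have "\<phi> (a * x + X \<omega>) \<le> C" unfolding C_def
          using X[OF \<omega> False] by (intro convex_on_UNIV_le_max[OF \<phi>(1)]) auto
        then show ?thesis by (intro mult_right_mono ennreal_leI) auto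
      qed simp
    qed
    also have "\<dots> = ennreal C * (\<integral>\<^sup>+\<omega>. w \<omega> \<partial>M)" by (rule nn_integral_cmult) measurable
    also have "\<dots> < \<infinity>" using w by (simp add: ennreal_mult_less_top less_top)
    finally show ?thesis by simp
  qed
  define \<psi> where "\<psi> x = enn2real (?I x)" for x
  have \<psi>: "ennreal (\<psi> x) = ?I x" for x unfolding \<psi>_def using fin[of x] by (simp add: less_top)
  have \<psi>0: "0 \<le> \<psi> x" for x by (simp add: \<psi>_def)
  have "convex_on UNIV \<psi>"
  proof (rule convex_onI)
    fix t x y :: real assume t: "0 < t" "t < 1"
    have "ennreal (\<psi> ((1 - t) *\<^sub>R x + t *\<^sub>R y)) \<le>
       (\<integral>\<^sup>+\<omega>. ennreal (1 - t) * (ennreal (\<phi> (a * x + X \<omega>)) * w \<omega>) + ennreal t * (ennreal (\<phi> (a * y + X \<omega>)) * w \<omega>) \<partial>M)"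
      unfolding \<psi>
    proof (rule nn_integral_mono)
      fix \<omega>
      have "a * ((1 - t) *\<^sub>R x + t *\<^sub>R y) + X \<omega> = (1 - t) *\<^sub>R (a * x + X \<omega>) + t *\<^sub>R (a * y + X \<omega>)"
        by (simp add: algebra_simps)
      then have "\<phi> (a * ((1 - t) *\<^sub>R x + t *\<^sub>R y) + X \<omega>) \<le> (1 - t) * \<phi> (a * x + X \<omega>) + t * \<phi> (a * y + X \<omega>)"
        using convex_onD[OF \<phi>(1), of t "a * x + X \<omega>" "a * y + X \<omega>"] t by simp
      then have "ennreal (\<phi> (a * ((1 - t) *\<^sub>R x + t *\<^sub>R y) + X \<omega>)) \<le> ennreal ((1 - t) * \<phi> (a * x + X \<omega>) + t * \<phi> (a * y + X \<omega>))"
        by (rule ennreal_leI)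
      also have "\<dots> = ennreal (1 - t) * ennreal (\<phi> (a * x + X \<omega>)) + ennreal t * ennreal (\<phi> (a * y + X \<omega>))"
        using t \<phi>(2) by (simp add: ennreal_plus ennreal_mult)
      finally have "ennreal (\<phi> (a * ((1 - t) *\<^sub>R x + t *\<^sub>R y) + X \<omega>)) * w \<omega> \<le> \<dots> * w \<omega>"
        by (rule mult_right_mono) simp
      then show "ennreal (\<phi> (a * ((1 - t) *\<^sub>R x + t *\<^sub>R y) + X \<omega>)) * w \<omega> \<le>
         ennreal (1 - t) * (ennreal (\<phi> (a * x + X \<omega>)) * w \<omega>) + ennreal t * (ennreal (\<phi> (a * y + X \<omega>)) * w \<omega>)"
        by (simp add: distrib_right mult.assoc)
    qed
    also have "\<dots> = ennreal (1 - t) * ?I x + ennreal t * ?I y"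
      by (subst nn_integral_add) (simp_all add: nn_integral_cmult)
    also have "\<dots> = ennreal ((1 - t) * \<psi> x + t * \<psi> y)"
      unfolding \<psi>[symmetric] using t \<psi>0 by (simp add: ennreal_plus ennreal_mult)
    finally show "\<psi> ((1 - t) *\<^sub>R x + t *\<^sub>R y) \<le> (1 - t) * \<psi> x + t * \<psi> y"
      using t \<psi>0 by (subst (asm) ennreal_le_iff) auto
  qed simp
  then show ?thesis using that \<psi> \<psi>0 by blast
qed

text \<open>The point \<open>b\<close> is a proper convex combination of \<open>a\<close> and
  \<open>s\<close>. If \<phi> were smaller at \<open>s\<close> than at \<open>b\<close>, the
  convexity bound at \<open>b\<close> would be smaller than the value there.\<close>

lemma convex_beyond_right:
  fixes \<phi> :: "real \<Rightarrow> real"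
  assumes \<phi>: "convex_on UNIV \<phi>" and "a < b" "b \<le> s" "\<phi> a \<le> \<phi> b"
  shows "\<phi> b \<le> \<phi> s"
proof (rule ccontr)
  assume n: "\<not> \<phi> b \<le> \<phi> s"
  then have "b < s" using assms(3) by (cases "b = s") auto
  define t where "t = (b - a) / (s - a)"
  have t: "0 < t" "t < 1" using assms(2) \<open>b < s\<close> by (simp_all add: t_def)
  have "b = a + t * (s - a)" using assms(2) \<open>b < s\<close> by (simp add: t_def)
  then have "b = (1 - t) *\<^sub>R a + t *\<^sub>R s" by (simp add: algebra_simps)
  then have "\<phi> b \<le> (1 - t) * \<phi> a + t * \<phi> s" using convex_onD[OF \<phi>, of t a s] t by simp
  also have "\<dots> \<le> (1 - t) * \<phi> b + t * \<phi> s" using assms(4) t by (intro add_right_mono mult_left_mono) auto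
  also have "\<dots> < (1 - t) * \<phi> b + t * \<phi> b" using n t by simp
  finally show False by (simp add: algebra_simps)
qed

lemma convex_beyond_left:
  fixes \<phi> :: "real \<Rightarrow> real"
  assumes \<phi>: "convex_on UNIV \<phi>" and "a < b" "s \<le> a" "\<phi> b \<le> \<phi> a"
  shows "\<phi> a \<le> \<phi> s"
proof -
  have "convex_on UNIV (\<lambda>x. \<phi> (- x))"
  proof (rule convex_onI)
    fix t x y :: real assume "0 < t" "t < 1"
    then show "\<phi> (- ((1 - t) *\<^sub>R x + t *\<^sub>R y)) \<le> (1 - t) * \<phi> (- x) + t * \<phi> (- y)"
      using convex_onD[OF \<phi>, of t "-x" "-y"] by (simp add: algebra_simps)
  qed simp
  from convex_beyond_right[OF this, of "-b" "-a" "-s"] show ?thesis using assms by simp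
qed

text \<open>The bathtub principle: among densities of mass \<open>m\<close> on
  \<open>[-R, R]\<close> with values at most 1, the integral against \<phi> is least for a sublevel
  set of \<phi>, which by convexity can be taken to be an interval of length \<open>m\<close>. Its
  position depends on \<phi>, hence the unspecified centre \<open>c\<close>.\<close>

lemma bathtub_convex:
  fixes f \<phi> :: "real \<Rightarrow> real"
  assumes \<phi>: "convex_on UNIV \<phi>" "\<And>x. 0 \<le> \<phi> x"
    and [measurable]: "f \<in> borel_measurable borel" and f: "\<And>s. 0 \<le> f s" "\<And>s. f s \<le> 1" "\<And>s. R < \<bar>s\<bar> \<Longrightarrow> f s = 0"
    and m: "ennreal m = (\<integral>\<^sup>+s. ennreal (f s) \<partial>lborel)" "0 \<le> m"
  shows "\<exists>c. (\<integral>\<^sup>+s. indicator {-m/2<..<m/2} s * ennreal (\<phi> (c + s)) \<partial>lborel) \<le> (\<integral>\<^sup>+s. ennreal (f s) * ennreal (\<phi> s) \<partial>lborel)"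
proof (cases "m = 0")
  case True
  then show ?thesis by (auto simp: indicator_def)
next
  case False
  have [measurable]: "\<phi> \<in> borel_measurable borel" using \<phi>(1) by (rule convex_measurable)
  have m0: "m > 0" using False m(2) by simp
  have "ennreal m \<le> (\<integral>\<^sup>+s. indicator {-R..R} s \<partial>lborel)"
    unfolding m(1)
  proof (rule nn_integral_mono)
    fix s show "ennreal (f s) \<le> indicator {-R..R} s"
      using f(2)[of s] f(3)[of s] by (cases "\<bar>s\<bar> \<le> R") (auto simp: indicator_def)
  qed
  also have "\<dots> = ennreal (if -R \<le> R then 2 * R else 0)" by (simp add: ennreal_neg)
  finally have mR: "m \<le> 2 * R" using m0 by (auto split: if_splits simp: ennreal_le_iff2)
  have cont: "continuous_on UNIV \<phi>" using \<phi>(1) by (intro convex_on_continuous) auto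
  \<comment> \<open>\<open>lo\<close> and \<open>hi\<close> are the extreme centres for which an
    interval of length \<open>m\<close> stays inside \<open>[-R, R]\<close>.\<close>
  define lo where "lo = -R + m/2"
  define hi where "hi = R - m/2"
  have lh: "lo \<le> hi" using mR by (simp add: lo_def hi_def)
  let ?d = "\<lambda>c. \<phi> (c + m/2) - \<phi> (c - m/2)"
  have le_ends: "\<phi> s \<le> max (\<phi> (c - m/2)) (\<phi> (c + m/2))" if "s \<in> {c - m/2..c + m/2}" for s c
    using that by (intro convex_on_UNIV_le_max[OF \<phi>(1)]) auto
  have right: "\<phi> (c + m/2) \<le> \<phi> s" if "?d c \<ge> 0" "c + m/2 \<le> s" for c s
    by (rule convex_beyond_right[OF \<phi>(1), of "c - m/2"]) (use that m0 in auto)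
  have left: "\<phi> (c - m/2) \<le> \<phi> s" if "?d c \<le> 0" "s \<le> c - m/2" for c s
    by (rule convex_beyond_left[OF \<phi>(1), of _ "c + m/2"]) (use that m0 in auto)
  \<comment> \<open>The level \<open>T\<close> separates the values inside the interval from those
    outside. If the difference of the two end values changes sign, the intermediate value theorem
    finds a centre with equal end values; otherwise \<phi> favours one end of
    \<open>[-R, R]\<close>, and the interval is pushed against that end.\<close>
  have "\<exists>c T. lo \<le> c \<and> c \<le> hi \<and> 0 \<le> T \<and> (\<forall>s\<in>{c-m/2..c+m/2}. \<phi> s \<le> T) \<and> (\<forall>s. \<bar>s\<bar> \<le> R \<and> s \<notin> {c-m/2..c+m/2} \<longrightarrow> T \<le> \<phi> s)"
  proof -
    consider "?d lo \<ge> 0" | "?d hi \<le> 0" | "?d lo \<le> 0" "?d hi \<ge> 0" by linarith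
    then show ?thesis
    proof cases
      case 1
      have "T \<le> \<phi> s" if "T = \<phi> (lo + m/2)" "\<bar>s\<bar> \<le> R" "s \<notin> {lo-m/2..lo+m/2}" for s T
        using right[OF 1, of s] that by (auto simp: lo_def)
      moreover have "\<phi> s \<le> \<phi> (lo + m/2)" if "s \<in> {lo-m/2..lo+m/2}" for s
        using le_ends[OF that] 1 by auto
      ultimately show ?thesis using lh \<phi>(2) by (intro exI[of _ lo] exI[of _ "\<phi> (lo + m/2)"]) auto
    next
      case 2
      have "T \<le> \<phi> s" if "T = \<phi> (hi - m/2)" "\<bar>s\<bar> \<le> R" "s \<notin> {hi-m/2..hi+m/2}" for s T
        using left[OF 2, of s] that by (auto simp: hi_def)
      moreover have "\<phi> s \<le> \<phi> (hi - m/2)" if "s \<in> {hi-m/2..hi+m/2}" for s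
        using le_ends[OF that] 2 by auto
      ultimately show ?thesis using lh \<phi>(2) by (intro exI[of _ hi] exI[of _ "\<phi> (hi - m/2)"]) auto
    next
      case 3
      have "continuous_on {lo..hi} ?d"
        by (intro continuous_intros continuous_on_compose2[OF cont]) auto
      then obtain c where c: "lo \<le> c" "c \<le> hi" "?d c = 0" using IVT'[of ?d lo 0 hi] 3 lh by auto
      have "T \<le> \<phi> s" if "T = \<phi> (c + m/2)" "s \<notin> {c-m/2..c+m/2}" for s T
        using left[of c s] right[of c s] that c(3) by auto
      moreover have "\<phi> s \<le> \<phi> (c + m/2)" if "s \<in> {c-m/2..c+m/2}" for s
        using le_ends[OF that] c(3) by auto
      ultimately show ?thesis using c \<phi>(2) by (intro exI[of _ c] exI[of _ "\<phi> (c + m/2)"]) auto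
    qed
  qed
  then obtain c T where c: "lo \<le> c" "c \<le> hi" "0 \<le> T" "\<And>s. s \<in> {c-m/2..c+m/2} \<Longrightarrow> \<phi> s \<le> T"
    "\<And>s. \<bar>s\<bar> \<le> R \<Longrightarrow> s \<notin> {c-m/2..c+m/2} \<Longrightarrow> T \<le> \<phi> s" by blast
  let ?I = "{c-m/2..c+m/2}"
  \<comment> \<open>On \<open>[-R, R]\<close> the indicator minus \<open>f\<close> and \<phi> minus
    \<open>T\<close> never have the same strict sign. The negative terms are moved to the other
    side, because the integrals take values in the extended non-negative reals.\<close>
  have pt: "indicator ?I s * \<phi> s + f s * T \<le> f s * \<phi> s + indicator ?I s * T" for s
  proof (cases "s \<in> ?I")
    case True
    have "0 \<le> (1 - f s) * (T - \<phi> s)" using f(2)[of s] c(4)[OF True] by simp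
    then show ?thesis using True by (simp add: algebra_simps)
  next
    case False
    then have "f s * T \<le> f s * \<phi> s"
      using f(1,3)[of s] c(5)[of s] by (cases "\<bar>s\<bar> \<le> R") (auto intro: mult_left_mono)
    then show ?thesis using False by simp
  qed
  have "(\<integral>\<^sup>+s. ennreal (indicator ?I s * \<phi> s) \<partial>lborel) + ennreal T * ennreal m =
     (\<integral>\<^sup>+s. ennreal (indicator ?I s * \<phi> s) + ennreal T * ennreal (f s) \<partial>lborel)"
    unfolding m(1) by (subst nn_integral_add) (simp_all add: nn_integral_cmult)
  also have "\<dots> = (\<integral>\<^sup>+s. ennreal (indicator ?I s * \<phi> s + f s * T) \<partial>lborel)"
    using \<phi>(2) f(1) c(3) by (intro nn_integral_cong) (simp add: ennreal_plus ennreal_mult[symmetric] mult.commute)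
  also have "\<dots> \<le> (\<integral>\<^sup>+s. ennreal (f s * \<phi> s + indicator ?I s * T) \<partial>lborel)"
    by (intro nn_integral_mono ennreal_leI pt)
  also have "\<dots> = (\<integral>\<^sup>+s. ennreal (f s) * ennreal (\<phi> s) + ennreal T * indicator ?I s \<partial>lborel)"
    using \<phi>(2) f(1) c(3) by (intro nn_integral_cong) (simp add: ennreal_plus ennreal_mult indicator_def)
  also have "\<dots> = (\<integral>\<^sup>+s. ennreal (f s) * ennreal (\<phi> s) \<partial>lborel) + ennreal T * emeasure lborel ?I"
    by (subst nn_integral_add) (simp_all add: nn_integral_cmult)
  also have "emeasure lborel ?I = ennreal m" using m0 by simp
  finally have le: "(\<integral>\<^sup>+s. ennreal (indicator ?I s * \<phi> s) \<partial>lborel) \<le> (\<integral>\<^sup>+s. ennreal (f s) * ennreal (\<phi> s) \<partial>lborel)"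
    unfolding add.commute[of _ "ennreal T * ennreal m"] ennreal_add_left_cancel_le
    by (simp add: ennreal_mult_eq_top_iff)
  have "(\<integral>\<^sup>+s. indicator {-m/2<..<m/2} s * ennreal (\<phi> (c + s)) \<partial>lborel) \<le>
     (\<integral>\<^sup>+s. ennreal (indicator ?I (c + s) * \<phi> (c + s)) \<partial>lborel)"
    by (intro nn_integral_mono) (auto simp: indicator_def)
  also have "\<dots> = (\<integral>\<^sup>+s. ennreal (indicator ?I s * \<phi> s) \<partial>lborel)"
    using nn_integral_real_affine[of "\<lambda>s. ennreal (indicator ?I s * \<phi> s)" 1 c] by simp
  finally show ?thesis using le by (intro exI[of _ c]) (rule order_trans)
qed

lemma convex_abs_power: "convex_on UNIV (\<lambda>x::real. \<bar>x\<bar> ^ n)"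
proof (rule convex_onI)
  fix t x y :: real assume t: "0 < t" "t < 1"
  have c: "convex_on {0::real..} (\<lambda>x. x ^ n)"
    by (cases "even n") (auto intro: convex_power_odd convex_on_subset[OF convex_power_even])
  have "\<bar>(1 - t) *\<^sub>R x + t *\<^sub>R y\<bar> \<le> (1 - t) * \<bar>x\<bar> + t * \<bar>y\<bar>"
    using t abs_triangle_ineq[of "(1 - t) * x" "t * y"] by (simp add: abs_mult)
  then have "\<bar>(1 - t) *\<^sub>R x + t *\<^sub>R y\<bar> ^ n \<le> ((1 - t) * \<bar>x\<bar> + t * \<bar>y\<bar>) ^ n" by (intro power_mono) auto
  also have "\<dots> \<le> (1 - t) * \<bar>x\<bar> ^ n + t * \<bar>y\<bar> ^ n"
    using convex_onD[OF c, of t "\<bar>x\<bar>" "\<bar>y\<bar>"] t by simp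
  finally show "\<bar>(1 - t) *\<^sub>R x + t *\<^sub>R y\<bar> ^ n \<le> (1 - t) * \<bar>x\<bar> ^ n + t * \<bar>y\<bar> ^ n" .
qed simp

lemma fun_upd_sum_prod:
  assumes "finite T" "i \<notin> T"
  shows "(\<Sum>j\<in>insert i T. a j * (s(i:=x)) j) = a i * x + (\<Sum>j\<in>T. a j * s j :: real)"
    and "(\<Prod>j\<in>insert i T. h j ((s(i:=x)) j)) = h i x * (\<Prod>j\<in>T. h j (s j) :: ennreal)"
proof -
  have "(\<Sum>j\<in>T. a j * (s(i:=x)) j) = (\<Sum>j\<in>T. a j * s j)" by (rule sum.cong) (use assms in auto)
  then show "(\<Sum>j\<in>insert i T. a j * (s(i:=x)) j) = a i * x + (\<Sum>j\<in>T. a j * s j :: real)" using assms by simp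
  have "(\<Prod>j\<in>T. h j ((s(i:=x)) j)) = (\<Prod>j\<in>T. h j (s j))" by (rule prod.cong) (use assms in auto)
  then show "(\<Prod>j\<in>insert i T. h j ((s(i:=x)) j)) = h i x * (\<Prod>j\<in>T. h j (s j) :: ennreal)" using assms by simp
qed

text \<open>One density after the other is replaced by an interval. Integrating out all others
  leaves a convex function of one variable, to which the bathtub principle applies; the integral
  over the new interval is then absorbed into the convex function, and the induction hypothesis is
  used for the function so obtained, which is why \<phi> is arbitrary in the induction. The linear
  form sees only the weighted sum of the centres, which is the shift \<open>C\<close>.\<close>

lemma intervals_minimize_shifted:
  fixes f :: "'i \<Rightarrow> real \<Rightarrow> real" and \<phi> :: "real \<Rightarrow> real"
  assumes fin: "finite T"
    and fm: "\<And>i. i \<in> T \<Longrightarrow> f i \<in> borel_measurable borel"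
    and f: "\<And>i s. i \<in> T \<Longrightarrow> 0 \<le> f i s" "\<And>i s. i \<in> T \<Longrightarrow> f i s \<le> 1" "\<And>i s. i \<in> T \<Longrightarrow> R < \<bar>s\<bar> \<Longrightarrow> f i s = 0"
    and m: "\<And>i. i \<in> T \<Longrightarrow> ennreal (m i) = (\<integral>\<^sup>+s. ennreal (f i s) \<partial>lborel)" "\<And>i. i \<in> T \<Longrightarrow> 0 \<le> m i"
    and \<phi>: "convex_on UNIV \<phi>" "\<And>x. 0 \<le> \<phi> x"
  shows "\<exists>C. (\<integral>\<^sup>+s. ennreal (\<phi> (C + (\<Sum>i\<in>T. a i * s i))) * (\<Prod>i\<in>T. indicator {-m i/2<..<m i/2} (s i)) \<partial>powM T lborel)
     \<le> (\<integral>\<^sup>+s. ennreal (\<phi> (\<Sum>i\<in>T. a i * s i)) * (\<Prod>i\<in>T. ennreal (f i (s i))) \<partial>powM T lborel)"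
  using fin fm f m \<phi>
proof (induction T arbitrary: \<phi> rule: finite_induct)
  case empty
  then show ?case by (intro exI[of _ 0]) simp
next
  case (insert i T)
  interpret product_sigma_finite "\<lambda>_::'i. lborel :: real measure" by (rule product_sigma_finite_lborel)
  interpret PT: sigma_finite_measure "PiM T (\<lambda>_::'i. lborel :: real measure)" using insert(1) by (rule sigma_finite)
  interpret pair_sigma_finite lborel "PiM T (\<lambda>_::'i. lborel :: real measure)" ..
  note \<phi> = insert.prems(7,8)
  have [measurable]: "\<phi> \<in> borel_measurable borel" using \<phi>(1) by (rule convex_measurable)
  have fm[measurable]: "f j \<in> borel_measurable borel" if "j \<in> insert i T" for j using insert.prems(1) that .
  let ?P = "powM T lborel"
  let ?F = "\<lambda>s. \<Prod>j\<in>T. ennreal (f j (s j))" and ?J = "\<lambda>s. \<Prod>j\<in>T. indicator {-m j/2<..<m j/2} (s j) :: ennreal"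
  let ?S = "\<lambda>s. \<Sum>j\<in>T. a j * s j"
  have Sm[measurable]: "?S \<in> borel_measurable ?P" by measurable
  have Fm[measurable]: "?F \<in> borel_measurable ?P" by (intro borel_measurable_prod_ennreal measurable_compose[OF measurable_component_singleton]) (auto intro: measurable_compose[OF fm])
  have Jm[measurable]: "?J \<in> borel_measurable ?P" by measurable
  have Fint: "(\<integral>\<^sup>+s. ?F s \<partial>?P) \<noteq> \<infinity>"
  proof -
    have "(\<integral>\<^sup>+s. ?F s \<partial>?P) = (\<Prod>j\<in>T. \<integral>\<^sup>+x. ennreal (f j x) \<partial>lborel)"
      by (rule product_nn_integral_prod[OF insert(1)]) measurable
    also have "\<dots> = (\<Prod>j\<in>T. ennreal (m j))" using insert.prems(5) by simp
    also have "\<dots> = ennreal (\<Prod>j\<in>T. m j)" using insert.prems(6) by (simp add: prod_ennreal)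
    finally show ?thesis by simp
  qed
  have Fb: "\<bar>?S s\<bar> \<le> (\<Sum>j\<in>T. \<bar>a j\<bar> * R)" if "?F s \<noteq> 0" for s
  proof -
    have "\<bar>s j\<bar> \<le> R" if "j \<in> T" for j
    proof (rule ccontr)
      assume "\<not> \<bar>s j\<bar> \<le> R"
      then have "f j (s j) = 0" using insert.prems(4)[of j "s j"] that by simp
      then show False using \<open>?F s \<noteq> 0\<close> that insert(1) by (auto simp: prod_zero_iff)
    qed
    then have "(\<Sum>j\<in>T. \<bar>a j * s j\<bar>) \<le> (\<Sum>j\<in>T. \<bar>a j\<bar> * R)" by (intro sum_mono) (simp add: abs_mult mult_left_mono)
    then show ?thesis using sum_abs[of "\<lambda>j. a j * s j" T] by linarith
  qed
  \<comment> \<open>\<psi> is the energy as a function of the variable \<open>i\<close>, with the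
    original densities kept in all other variables.\<close>
  obtain \<psi> where \<psi>: "convex_on UNIV \<psi>" "\<And>x. 0 \<le> \<psi> x"
      "\<And>x. ennreal (\<psi> x) = (\<integral>\<^sup>+s. ennreal (\<phi> (a i * x + ?S s)) * ?F s \<partial>?P)"
    by (rule convex_nn_integral[OF \<phi> Sm Fm Fint, of "\<Sum>j\<in>T. \<bar>a j\<bar> * R" "a i"]) (use Fb in auto)
  obtain c where c: "(\<integral>\<^sup>+x. indicator {-m i/2<..<m i/2} x * ennreal (\<psi> (c + x)) \<partial>lborel) \<le> (\<integral>\<^sup>+x. ennreal (f i x) * ennreal (\<psi> x) \<partial>lborel)"
    using bathtub_convex[OF \<psi>(1,2) fm[of i], of R "m i"] insert.prems(2-6) by auto
  let ?w = "\<lambda>x. indicator {-m i/2<..<m i/2} x :: ennreal"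
  \<comment> \<open>The integral over the interval just found, with its centre \<open>c\<close>, is
    absorbed here; what remains is a convex function of the form in the other variables.\<close>
  obtain \<phi>' where \<phi>': "convex_on UNIV \<phi>'" "\<And>x. 0 \<le> \<phi>' x"
      "\<And>y. ennreal (\<phi>' y) = (\<integral>\<^sup>+x. ennreal (\<phi> (1 * y + (a i * c + a i * x))) * ?w x \<partial>lborel)"
  proof (rule convex_nn_integral[OF \<phi>, of "\<lambda>x. a i * c + a i * x" lborel ?w "\<bar>a i * c\<bar> + \<bar>a i\<bar> * m i" 1])
    show "(\<integral>\<^sup>+x. ?w x \<partial>lborel) \<noteq> \<infinity>" using insert.prems(6)[of i] by simp
    fix x assume "?w x \<noteq> 0"
    then have "\<bar>x\<bar> \<le> m i" by (auto simp: indicator_def split: if_splits)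
    then have "\<bar>a i * x\<bar> \<le> \<bar>a i\<bar> * m i" by (simp add: abs_mult mult_left_mono)
    then show "\<bar>a i * c + a i * x\<bar> \<le> \<bar>a i * c\<bar> + \<bar>a i\<bar> * m i" by linarith
  qed auto
  have [measurable]: "\<phi>' \<in> borel_measurable borel" using \<phi>'(1) by (rule convex_measurable)
  obtain C' where C': "(\<integral>\<^sup>+s. ennreal (\<phi>' (C' + ?S s)) * ?J s \<partial>?P) \<le> (\<integral>\<^sup>+s. ennreal (\<phi>' (?S s)) * ?F s \<partial>?P)"
    using insert.IH[OF _ _ _ _ _ _ \<phi>'(1,2)] insert.prems(1-6) by auto
  have um: "(\<lambda>s. \<Sum>j\<in>insert i T. a j * s j) \<in> borel_measurable (powM (insert i T) lborel)" by measurable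
  have FmI: "(\<lambda>s. \<Prod>j\<in>insert i T. ennreal (f j (s j))) \<in> borel_measurable (powM (insert i T) lborel)"
    by (intro borel_measurable_prod_ennreal measurable_compose[OF measurable_component_singleton]) (auto intro: measurable_compose[OF fm])
  have JmI: "(\<lambda>s. \<Prod>j\<in>insert i T. indicator {-m j/2<..<m j/2} (s j) :: ennreal) \<in> borel_measurable (powM (insert i T) lborel)"
    by measurable
  have "(\<integral>\<^sup>+s. ennreal (\<phi> ((C' + a i * c) + (\<Sum>j\<in>insert i T. a j * s j))) * (\<Prod>j\<in>insert i T. indicator {-m j/2<..<m j/2} (s j)) \<partial>powM (insert i T) lborel)
    = (\<integral>\<^sup>+s. \<integral>\<^sup>+x. ennreal (\<phi> ((C' + a i * c) + (a i * x + ?S s))) * (?w x * ?J s) \<partial>lborel \<partial>?P)"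
    using um JmI by (subst product_nn_integral_insert[OF insert(1,2)]) (simp_all only: fun_upd_sum_prod(1)[OF insert(1,2)] fun_upd_sum_prod(2)[OF insert(1,2), of "\<lambda>j. indicator {-m j/2<..<m j/2}"], measurable)
  also have "\<dots> = (\<integral>\<^sup>+s. ennreal (\<phi>' (C' + ?S s)) * ?J s \<partial>?P)"
  proof (rule nn_integral_cong)
    fix s
    have "(\<integral>\<^sup>+x. ennreal (\<phi> ((C' + a i * c) + (a i * x + ?S s))) * (?w x * ?J s) \<partial>lborel)
      = (\<integral>\<^sup>+x. (ennreal (\<phi> (1 * (C' + ?S s) + (a i * c + a i * x))) * ?w x) * ?J s \<partial>lborel)"
      by (intro nn_integral_cong) (simp add: algebra_simps)
    also have "\<dots> = ennreal (\<phi>' (C' + ?S s)) * ?J s"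
      unfolding \<phi>'(3) by (rule nn_integral_multc) measurable
    finally show "(\<integral>\<^sup>+x. ennreal (\<phi> ((C' + a i * c) + (a i * x + ?S s))) * (?w x * ?J s) \<partial>lborel) = ennreal (\<phi>' (C' + ?S s)) * ?J s" .
  qed
  also note C'
  also have "(\<integral>\<^sup>+s. ennreal (\<phi>' (?S s)) * ?F s \<partial>?P) = (\<integral>\<^sup>+s. \<integral>\<^sup>+x. ?w x * (ennreal (\<phi> (a i * (c + x) + ?S s)) * ?F s) \<partial>lborel \<partial>?P)"
  proof (rule nn_integral_cong)
    fix s
    show "ennreal (\<phi>' (?S s)) * ?F s = (\<integral>\<^sup>+x. ?w x * (ennreal (\<phi> (a i * (c + x) + ?S s)) * ?F s) \<partial>lborel)"
      unfolding \<phi>'(3) by (subst nn_integral_multc[symmetric]) (auto intro!: nn_integral_cong simp: algebra_simps)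
  qed
  also have "\<dots> = (\<integral>\<^sup>+x. \<integral>\<^sup>+s. ?w x * (ennreal (\<phi> (a i * (c + x) + ?S s)) * ?F s) \<partial>?P \<partial>lborel)"
    by (rule Fubini') measurable
  also have "\<dots> = (\<integral>\<^sup>+x. ?w x * ennreal (\<psi> (c + x)) \<partial>lborel)"
    unfolding \<psi>(3) by (intro nn_integral_cong nn_integral_cmult) measurable
  also note c
  also have "(\<integral>\<^sup>+x. ennreal (f i x) * ennreal (\<psi> x) \<partial>lborel) = (\<integral>\<^sup>+x. \<integral>\<^sup>+s. ennreal (f i x) * (ennreal (\<phi> (a i * x + ?S s)) * ?F s) \<partial>?P \<partial>lborel)"
    unfolding \<psi>(3) by (intro nn_integral_cong nn_integral_cmult[symmetric]) measurable
  also have "\<dots> = (\<integral>\<^sup>+x. \<integral>\<^sup>+s. ennreal (\<phi> (a i * x + ?S s)) * (ennreal (f i x) * ?F s) \<partial>?P \<partial>lborel)"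
    by (simp only: mult_ac)
  also have "\<dots> = (\<integral>\<^sup>+s. ennreal (\<phi> (\<Sum>j\<in>insert i T. a j * s j)) * (\<Prod>j\<in>insert i T. ennreal (f j (s j))) \<partial>powM (insert i T) lborel)"
    using um FmI by (subst product_nn_integral_insert_rev[OF insert(1,2)])
      (simp_all only: fun_upd_sum_prod(1)[OF insert(1,2)] fun_upd_sum_prod(2)[OF insert(1,2), of "\<lambda>j x. ennreal (f j x)"], measurable)
  finally show ?case by blast
qed

text \<open>Smoothing by intervals symmetric about 0 keeps a function both convex and even. Thus
  \<psi> describes the energy of centred intervals as a function of an overall shift.\<close>

lemma boxes_centered:
  fixes \<phi> :: "real \<Rightarrow> real"
  assumes "finite T" and "\<And>i. i \<in> T \<Longrightarrow> 0 \<le> m i"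
    and "convex_on UNIV \<phi>" "\<And>x. 0 \<le> \<phi> x" "\<And>x. \<phi> (- x) = \<phi> x"
  shows "\<exists>\<psi>. convex_on UNIV \<psi> \<and> (\<forall>x. 0 \<le> \<psi> x \<and> \<psi> (- x) = \<psi> x \<and>
     ennreal (\<psi> x) = (\<integral>\<^sup>+s. ennreal (\<phi> (x + (\<Sum>i\<in>T. a i * s i))) * (\<Prod>i\<in>T. indicator {-m i/2<..<m i/2} (s i)) \<partial>powM T lborel))"
  using assms
proof (induction T rule: finite_induct)
  case empty
  interpret product_sigma_finite "\<lambda>_::'a. lborel :: real measure" by (rule product_sigma_finite_lborel)
  show ?case using empty by (intro exI[of _ \<phi>]) (simp add: nn_integral_empty space_PiM)
next
  case (insert i T)
  interpret product_sigma_finite "\<lambda>_::'a. lborel :: real measure" by (rule product_sigma_finite_lborel)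
  interpret PT: sigma_finite_measure "PiM T (\<lambda>_::'a. lborel :: real measure)" using insert(1) by (rule sigma_finite)
  note [measurable] = convex_measurable[OF insert.prems(2)]
  let ?P = "powM T lborel"
  let ?J = "\<lambda>s. \<Prod>j\<in>T. indicator {-m j/2<..<m j/2} (s j) :: ennreal"
  let ?S = "\<lambda>s. \<Sum>j\<in>T. a j * s j"
  let ?w = "\<lambda>x. indicator {-m i/2<..<m i/2} x :: ennreal"
  obtain \<psi> where \<psi>: "convex_on UNIV \<psi>" "\<And>x. 0 \<le> \<psi> x" "\<And>x. \<psi> (- x) = \<psi> x"
    "\<And>x. ennreal (\<psi> x) = (\<integral>\<^sup>+s. ennreal (\<phi> (x + ?S s)) * ?J s \<partial>?P)"
    using insert.IH insert.prems by auto
  note [measurable] = convex_measurable[OF \<psi>(1)]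
  obtain \<xi> where \<xi>: "convex_on UNIV \<xi>" "\<And>x. 0 \<le> \<xi> x"
      "\<And>y. ennreal (\<xi> y) = (\<integral>\<^sup>+x. ennreal (\<psi> (1 * y + a i * x)) * ?w x \<partial>lborel)"
  proof (rule convex_nn_integral[OF \<psi>(1,2), of "\<lambda>x. a i * x" lborel ?w "\<bar>a i\<bar> * m i" 1])
    show "(\<integral>\<^sup>+x. ?w x \<partial>lborel) \<noteq> \<infinity>" using insert.prems(1)[of i] by simp
    fix x assume "?w x \<noteq> 0"
    then have "\<bar>x\<bar> \<le> m i" by (auto simp: indicator_def split: if_splits)
    then show "\<bar>a i * x\<bar> \<le> \<bar>a i\<bar> * m i" by (simp add: abs_mult mult_left_mono)
  qed auto
  have even: "\<xi> (- y) = \<xi> y" for y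
  proof -
    have "ennreal (\<xi> (- y)) = (\<integral>\<^sup>+x. ennreal (\<psi> (1 * (- y) + a i * (- x))) * ?w (- x) \<partial>lborel)"
      unfolding \<xi>(3) using nn_integral_real_affine[of "\<lambda>x. ennreal (\<psi> (1 * (- y) + a i * x)) * ?w x" "-1" 0] by simp
    also have "\<dots> = (\<integral>\<^sup>+x. ennreal (\<psi> (1 * y + a i * x)) * ?w x \<partial>lborel)"
    proof (rule nn_integral_cong)
      fix x
      have "\<psi> (1 * (- y) + a i * (- x)) = \<psi> (1 * y + a i * x)" using \<psi>(3)[of "1 * y + a i * x"] by simp
      moreover have "?w (- x) = ?w x" by (auto simp: indicator_def)
      ultimately show "ennreal (\<psi> (1 * (- y) + a i * (- x))) * ?w (- x) = ennreal (\<psi> (1 * y + a i * x)) * ?w x" by simp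
    qed
    finally show ?thesis unfolding \<xi>(3)[symmetric] using \<xi>(2) by simp
  qed
  have rep: "ennreal (\<xi> y) = (\<integral>\<^sup>+s. ennreal (\<phi> (y + (\<Sum>j\<in>insert i T. a j * s j))) * (\<Prod>j\<in>insert i T. indicator {-m j/2<..<m j/2} (s j)) \<partial>powM (insert i T) lborel)" for y
  proof -
    have um: "(\<lambda>s. \<Sum>j\<in>insert i T. a j * s j) \<in> borel_measurable (powM (insert i T) lborel)" by measurable
    have JmI: "(\<lambda>s. \<Prod>j\<in>insert i T. indicator {-m j/2<..<m j/2} (s j) :: ennreal) \<in> borel_measurable (powM (insert i T) lborel)"
      by measurable
    have "ennreal (\<xi> y) = (\<integral>\<^sup>+x. \<integral>\<^sup>+s. (ennreal (\<phi> ((y + a i * x) + ?S s)) * ?J s) * ?w x \<partial>?P \<partial>lborel)"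
      unfolding \<xi>(3) \<psi>(4) by (subst nn_integral_multc[symmetric]) simp_all
    also have "\<dots> = (\<integral>\<^sup>+x. \<integral>\<^sup>+s. ennreal (\<phi> (y + (a i * x + ?S s))) * (?w x * ?J s) \<partial>?P \<partial>lborel)"
      by (simp only: mult_ac add.assoc)
    also have "\<dots> = (\<integral>\<^sup>+s. ennreal (\<phi> (y + (\<Sum>j\<in>insert i T. a j * s j))) * (\<Prod>j\<in>insert i T. indicator {-m j/2<..<m j/2} (s j)) \<partial>powM (insert i T) lborel)"
      using um JmI by (subst product_nn_integral_insert_rev[OF insert(1,2)])
        (simp_all only: fun_upd_sum_prod(1)[OF insert(1,2)] fun_upd_sum_prod(2)[OF insert(1,2), of "\<lambda>j. indicator {-m j/2<..<m j/2}"], measurable)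
    finally show ?thesis .
  qed
  show ?case using \<xi>(1,2) even rep by (intro exI[of _ \<xi>]) auto
qed

text \<open>An even convex function is least at 0. Applied to the energy of centred intervals under
  an overall shift, this removes the unknown shift \<open>C\<close>.\<close>

lemma intervals_minimize:
  fixes f :: "'i \<Rightarrow> real \<Rightarrow> real" and \<phi> :: "real \<Rightarrow> real"
  assumes fin: "finite T"
    and fm: "\<And>i. i \<in> T \<Longrightarrow> f i \<in> borel_measurable borel"
    and f: "\<And>i s. i \<in> T \<Longrightarrow> 0 \<le> f i s" "\<And>i s. i \<in> T \<Longrightarrow> f i s \<le> 1" "\<And>i s. i \<in> T \<Longrightarrow> R < \<bar>s\<bar> \<Longrightarrow> f i s = 0"
    and m: "\<And>i. i \<in> T \<Longrightarrow> ennreal (m i) = (\<integral>\<^sup>+s. ennreal (f i s) \<partial>lborel)" "\<And>i. i \<in> T \<Longrightarrow> 0 \<le> m i"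
    and \<phi>: "convex_on UNIV \<phi>" "\<And>x. 0 \<le> \<phi> x" "\<And>x. \<phi> (- x) = \<phi> x"
  shows "(\<integral>\<^sup>+s. ennreal (\<phi> (\<Sum>i\<in>T. a i * s i)) * (\<Prod>i\<in>T. indicator {-m i/2<..<m i/2} (s i)) \<partial>powM T lborel)
     \<le> (\<integral>\<^sup>+s. ennreal (\<phi> (\<Sum>i\<in>T. a i * s i)) * (\<Prod>i\<in>T. ennreal (f i (s i))) \<partial>powM T lborel)"
proof -
  obtain C where C: "(\<integral>\<^sup>+s. ennreal (\<phi> (C + (\<Sum>i\<in>T. a i * s i))) * (\<Prod>i\<in>T. indicator {-m i/2<..<m i/2} (s i)) \<partial>powM T lborel)
     \<le> (\<integral>\<^sup>+s. ennreal (\<phi> (\<Sum>i\<in>T. a i * s i)) * (\<Prod>i\<in>T. ennreal (f i (s i))) \<partial>powM T lborel)"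
    using intervals_minimize_shifted[where f=f and R=R and m=m and \<phi>=\<phi> and a=a, OF fin fm f m \<phi>(1,2)] by blast
  obtain \<psi> where \<psi>: "convex_on UNIV \<psi>" "\<And>x. \<psi> (- x) = \<psi> x"
    "\<And>x. ennreal (\<psi> x) = (\<integral>\<^sup>+s. ennreal (\<phi> (x + (\<Sum>i\<in>T. a i * s i))) * (\<Prod>i\<in>T. indicator {-m i/2<..<m i/2} (s i)) \<partial>powM T lborel)"
    using boxes_centered[where m=m and \<phi>=\<phi> and a=a, OF fin m(2) \<phi>] by blast
  have "\<psi> 0 \<le> \<psi> C" using convex_onD[OF \<psi>(1), of "1/2" C "- C"] \<psi>(2)[of C] by simp
  then have "ennreal (\<psi> 0) \<le> ennreal (\<psi> C)" by (rule ennreal_leI)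
  then show ?thesis unfolding \<psi>(3) using C by simp
qed

section \<open>Steiner symmetrization\<close>

text \<open>The Gram volume of the edges from the vertex \<open>j0\<close> is the volume of the
  simplex times the factorial of \<open>card S\<close>. Up to this factor the energy is the
  \<open>N\<close>-th moment of the volume of a simplex whose vertices are distributed with density
  \<open>g\<close>.\<close>

definition simplex_energy :: "'n::finite set \<Rightarrow> 'n \<Rightarrow> nat \<Rightarrow> (real^'n \<Rightarrow> real) \<Rightarrow> ennreal" where
  "simplex_energy S j0 N g = (\<integral>\<^sup>+X. ennreal (gram_vol S (\<lambda>j. X j - X j0) ^ N) * (\<Prod>i\<in>insert j0 S. ennreal (g (X i)))
      \<partial>powM (insert j0 S) (coord_lborel S))"

definition section_mass :: "'n::finite \<Rightarrow> (real^'n \<Rightarrow> real) \<Rightarrow> real^'n \<Rightarrow> ennreal" where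
  "section_mass i0 g y = (\<integral>\<^sup>+s. ennreal (g (y + s *\<^sub>R axis i0 1)) \<partial>lborel)"

text \<open>The symmetrization replaces \<open>g\<close> on every line in direction \<open>i0\<close> by the indicator of
  the centered interval of the same mass, so it turns densities into indicators at once.\<close>

definition steiner :: "'n::finite set \<Rightarrow> 'n \<Rightarrow> (real^'n \<Rightarrow> real) \<Rightarrow> real^'n \<Rightarrow> real" where
  "steiner S i0 g x = (if ennreal (2 * \<bar>x $ i0\<bar>) < section_mass i0 g (coord_proj (S - {i0}) x) then 1 else 0)"

text \<open>The support is bounded inside the coordinate subspace, the part of the space that the
  measure sees.\<close>

definition bounded_density :: "'n::finite set \<Rightarrow> real \<Rightarrow> (real^'n \<Rightarrow> real) \<Rightarrow> bool" where
  "bounded_density S R g \<longleftrightarrow> g \<in> borel_measurable borel \<and> (\<forall>x. 0 \<le> g x \<and> g x \<le> 1) \<and>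
     (\<forall>x\<in>span (coord_basis S). g x \<noteq> 0 \<longrightarrow> norm x \<le> R)"

text \<open>For a density between 0 and 1 whose mass is the volume of the ball, the mass outside the
  ball is half the L1 distance from \<open>g\<close> to the indicator of the ball. This number
  measures the progress of the symmetrization.\<close>

definition defect :: "'n::finite set \<Rightarrow> real \<Rightarrow> (real^'n \<Rightarrow> real) \<Rightarrow> ennreal" where
  "defect S r g = (\<integral>\<^sup>+x. ennreal (g x) * indicator (- cball 0 r) x \<partial>coord_lborel S)"

lemma measurable_line: "(\<lambda>p. fst p + snd p *\<^sub>R (axis i0 1 :: real^'n)) \<in> borel_measurable (borel \<Otimes>\<^sub>M lborel)"
  by (intro borel_measurable_add borel_measurable_scaleR) (auto intro: measurable_compose[OF measurable_snd])

lemma measurable_section_mass: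
  assumes [measurable]: "g \<in> borel_measurable borel"
  shows "section_mass i0 g \<in> borel_measurable (borel :: (real^'n) measure)"
proof -
  have "(\<lambda>(y, s). ennreal (g (y + s *\<^sub>R axis i0 1))) \<in> borel_measurable ((borel :: (real^'n) measure) \<Otimes>\<^sub>M lborel)"
    unfolding split_beta using measurable_compose[OF measurable_line assms] by measurable
  then show ?thesis unfolding section_mass_def by (rule lborel.borel_measurable_nn_integral)
qed

lemma measurable_steiner:
  assumes "g \<in> borel_measurable borel"
  shows "steiner S i0 g \<in> borel_measurable (borel :: (real^'n) measure)"
proof -
  have [measurable]: "(\<lambda>x. section_mass i0 g (coord_proj (S - {i0}) x)) \<in> borel_measurable borel"
    using measurable_compose[OF measurable_linear[OF linear_coord_proj] measurable_section_mass[OF assms]] .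
  have [measurable]: "(\<lambda>x::real^'n. x $ i0) \<in> borel_measurable borel" by (rule measurable_nth_borel)
  show ?thesis unfolding steiner_def[abs_def] by measurable
qed

lemma nn_integral_coord_section:
  assumes i0: "i0 \<in> S" and [measurable]: "g \<in> borel_measurable borel"
  shows "(\<integral>\<^sup>+x. g x \<partial>coord_lborel S) =
     (\<integral>\<^sup>+y. \<integral>\<^sup>+s. g (y + s *\<^sub>R axis i0 1) \<partial>lborel \<partial>coord_lborel (S - {i0}))"
proof -
  interpret product_sigma_finite "\<lambda>_::real^'a. lborel :: real measure" by (rule product_sigma_finite_lborel)
  let ?u = "axis i0 1 :: real^'a"
  have S: "coord_basis S = coord_basis (S - {i0}) \<union> {?u}" "coord_basis (S - {i0}) \<inter> {?u} = {}"
    using i0 by (auto simp: coord_basis_def axis_eq_axis)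
  have 1: "(\<integral>\<^sup>+z. f z \<partial>span_lborel {?u}) = (\<integral>\<^sup>+s. f (s *\<^sub>R ?u) \<partial>lborel)" if [measurable]: "f \<in> borel_measurable borel" for f
    using product_nn_integral_singleton[of "\<lambda>s. f (s *\<^sub>R ?u)" ?u] by (simp add: nn_integral_span_lborel)
  show ?thesis
    unfolding S(1) by (subst nn_integral_span_lborel_Un) (use S(2) in \<open>auto simp: 1\<close>)
qed

lemma section_coords:
  assumes i0: "i0 \<in> S" and y: "y \<in> span (coord_basis (S - {i0}))"
  shows "coord_proj (S - {i0}) (y + s *\<^sub>R axis i0 1) = y" "(y + s *\<^sub>R axis i0 1) $ i0 = s"
    "y + s *\<^sub>R axis i0 1 \<in> span (coord_basis S)" "(norm (y + s *\<^sub>R axis i0 1))\<^sup>2 = (norm y)\<^sup>2 + s\<^sup>2"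
proof -
  have y0: "y $ i = 0" if "i \<notin> S \<or> i = i0" for i using y that by (auto simp: span_coord_basis)
  show "coord_proj (S - {i0}) (y + s *\<^sub>R axis i0 1) = y" using y0 by (auto simp: vec_eq_iff coord_proj_def axis_def)
  show "(y + s *\<^sub>R axis i0 1) $ i0 = s" using y0 by simp
  show "y + s *\<^sub>R axis i0 1 \<in> span (coord_basis S)" using y0 i0 by (auto simp: span_coord_basis axis_def)
  have "y \<bullet> (s *\<^sub>R axis i0 1) = 0" using y0 by (simp add: inner_axis)
  then have "(norm (y + s *\<^sub>R axis i0 1))\<^sup>2 = (norm y)\<^sup>2 + (norm (s *\<^sub>R axis i0 (1::real)))\<^sup>2"
    by (intro norm_add_Pythagorean) (simp add: orthogonal_def)
  then show "(norm (y + s *\<^sub>R axis i0 1))\<^sup>2 = (norm y)\<^sup>2 + s\<^sup>2" by simp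
qed

lemma steiner_section:
  assumes "i0 \<in> S" "y \<in> span (coord_basis (S - {i0}))"
  shows "steiner S i0 g (y + s *\<^sub>R axis i0 1) = (if ennreal (2 * \<bar>s\<bar>) < section_mass i0 g y then 1 else 0)"
  by (simp only: steiner_def section_coords[OF assms])

lemma emeasure_centered: "0 \<le> r \<Longrightarrow> {s. ennreal (2 * \<bar>s\<bar>) < ennreal r} = {-r/2<..<r/2}"
  by (auto simp: ennreal_less_iff)

lemma section_bound:
  assumes g: "bounded_density S R g" and i0: "i0 \<in> S" and y: "y \<in> span (coord_basis (S - {i0}))"
  shows "section_mass i0 g y \<le> ennreal (2 * sqrt (R\<^sup>2 - (norm y)\<^sup>2))" "g (y + s *\<^sub>R axis i0 1) \<noteq> 0 \<Longrightarrow> \<bar>s\<bar> \<le> sqrt (R\<^sup>2 - (norm y)\<^sup>2)"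
proof -
  have b: "\<bar>s\<bar> \<le> sqrt (R\<^sup>2 - (norm y)\<^sup>2)" if "g (y + s *\<^sub>R axis i0 1) \<noteq> 0" for s
  proof -
    have "norm (y + s *\<^sub>R axis i0 1) \<le> R" using g section_coords(3)[OF i0 y] that by (auto simp: bounded_density_def)
    then have "(norm (y + s *\<^sub>R axis i0 1))\<^sup>2 \<le> R\<^sup>2" by (intro power_mono) auto
    then have "s\<^sup>2 \<le> R\<^sup>2 - (norm y)\<^sup>2" unfolding section_coords(4)[OF i0 y] by simp
    then show ?thesis using real_le_rsqrt by (metis power2_abs)
  qed
  show "g (y + s *\<^sub>R axis i0 1) \<noteq> 0 \<Longrightarrow> \<bar>s\<bar> \<le> sqrt (R\<^sup>2 - (norm y)\<^sup>2)" by (rule b)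
  let ?q = "sqrt (R\<^sup>2 - (norm y)\<^sup>2)"
  have "section_mass i0 g y \<le> (\<integral>\<^sup>+s. indicator {-?q..?q} s \<partial>lborel)"
    unfolding section_mass_def
  proof (rule nn_integral_mono)
    fix s show "ennreal (g (y + s *\<^sub>R axis i0 1)) \<le> indicator {-?q..?q} s"
      using b[of s] g by (cases "g (y + s *\<^sub>R axis i0 1) = 0") (auto simp: bounded_density_def indicator_def abs_le_iff)
  qed
  also have "\<dots> \<le> ennreal (2 * ?q)" by (cases "0 \<le> ?q") simp_all
  finally show "section_mass i0 g y \<le> ennreal (2 * ?q)" .
qed

text \<open>A line in direction \<open>i0\<close> meets the ball of radius \<open>R\<close> in a
  centred interval, and the mass of \<open>g\<close> on the line is at most the length of that
  interval. The centred interval of the same mass therefore stays in the ball.\<close>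

lemma bounded_density_steiner:
  assumes g: "bounded_density S R g" and i0: "i0 \<in> S" and R: "0 \<le> R"
  shows "bounded_density S R (steiner S i0 g)"
  unfolding bounded_density_def
proof (intro conjI allI ballI impI)
  show "steiner S i0 g \<in> borel_measurable borel" using g by (intro measurable_steiner) (simp add: bounded_density_def)
  show "0 \<le> steiner S i0 g x" "steiner S i0 g x \<le> 1" for x by (simp_all add: steiner_def)
  fix x assume x: "x \<in> span (coord_basis S)" "steiner S i0 g x \<noteq> 0"
  define y where "y = coord_proj (S - {i0}) x"
  have y: "y \<in> span (coord_basis (S - {i0}))" by (simp add: y_def)
  have xy: "x = y + (x $ i0) *\<^sub>R axis i0 1"
    using x(1) by (auto simp: y_def vec_eq_iff coord_proj_def axis_def span_coord_basis)
  have "ennreal (2 * \<bar>x $ i0\<bar>) < section_mass i0 g y" using x(2) by (simp add: steiner_def y_def split: if_splits)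
  also have "\<dots> \<le> ennreal (2 * sqrt (R\<^sup>2 - (norm y)\<^sup>2))" by (rule section_bound[OF g i0 y])
  finally have "2 * \<bar>x $ i0\<bar> < 2 * sqrt (R\<^sup>2 - (norm y)\<^sup>2)" by (subst (asm) ennreal_less_iff) auto
  then have "\<bar>x $ i0\<bar> < sqrt (R\<^sup>2 - (norm y)\<^sup>2)" by simp
  moreover from this have "0 < sqrt (R\<^sup>2 - (norm y)\<^sup>2)" by linarith
  ultimately have "\<bar>x $ i0\<bar>\<^sup>2 \<le> R\<^sup>2 - (norm y)\<^sup>2"
    using power_mono[of "\<bar>x $ i0\<bar>" "sqrt (R\<^sup>2 - (norm y)\<^sup>2)" 2] by (simp add: real_sqrt_gt_0_iff)
  then have "(norm x)\<^sup>2 \<le> R\<^sup>2" by (subst xy, subst section_coords(4)[OF i0 y]) simp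
  then show "norm x \<le> R" using R by (rule power2_le_imp_le)
qed

lemma nn_integral_steiner:
  assumes g: "bounded_density S R g" and i0: "i0 \<in> S"
  shows "(\<integral>\<^sup>+x. ennreal (steiner S i0 g x) \<partial>coord_lborel S) = (\<integral>\<^sup>+x. ennreal (g x) \<partial>coord_lborel S)"
proof -
  have [measurable]: "g \<in> borel_measurable borel" using g by (simp add: bounded_density_def)
  have [measurable]: "steiner S i0 g \<in> borel_measurable borel" by (rule measurable_steiner) measurable
  show ?thesis
    unfolding nn_integral_coord_section[OF i0, of "\<lambda>x. ennreal (steiner S i0 g x)", simplified]
      nn_integral_coord_section[OF i0, of "\<lambda>x. ennreal (g x)", simplified]
  proof (rule nn_integral_cong_AE, rule AE_mp[OF AE_span_lborel AE_I2], intro impI)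
    fix y :: "real^'a" assume y: "y \<in> span (coord_basis (S - {i0}))"
    have "section_mass i0 g y < \<infinity>" using section_bound(1)[OF g i0 y] by (simp add: le_less_trans)
    then obtain r where r: "section_mass i0 g y = ennreal r" "0 \<le> r" by (cases "section_mass i0 g y") auto
    have "(\<integral>\<^sup>+s. ennreal (steiner S i0 g (y + s *\<^sub>R axis i0 1)) \<partial>lborel) = (\<integral>\<^sup>+s. indicator {s. ennreal (2 * \<bar>s\<bar>) < ennreal r} s \<partial>lborel)"
      by (intro nn_integral_cong) (simp add: steiner_section[OF i0 y] r indicator_def)
    also have "\<dots> = ennreal r" unfolding emeasure_centered[OF r(2)] using r(2) by simp
    finally show "(\<integral>\<^sup>+s. ennreal (steiner S i0 g (y + s *\<^sub>R axis i0 1)) \<partial>lborel) = (\<integral>\<^sup>+s. ennreal (g (y + s *\<^sub>R axis i0 1)) \<partial>lborel)"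
      using r by (simp add: section_mass_def)
  qed
qed

text \<open>Along lines in direction \<open>i0\<close> the determinant is linear: it is expanded along row \<open>i0\<close>,
  the only one that depends on the parameters of the lines.\<close>

lemma gram_vol_linear_section:
  fixes y :: "'n \<Rightarrow> real^'n"
  assumes i0: "i0 \<in> S" and j0: "j0 \<notin> S" and y: "\<And>i. i \<in> insert j0 S \<Longrightarrow> y i \<in> span (coord_basis (S - {i0}))"
  shows "\<exists>a. \<forall>s. gram_vol S (\<lambda>j. (y j + s j *\<^sub>R axis i0 1) - (y j0 + s j0 *\<^sub>R axis i0 1)) = \<bar>\<Sum>i\<in>insert j0 S. a i * s i\<bar>"
proof -
  let ?u = "axis i0 1 :: real^'n"
  define Y where "Y = col_matrix S (\<lambda>j. y j - y j0)"
  define l where "l v = det ((\<chi> r. if r = i0 then v else row r Y) :: real^'n^'n)" for v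
  have ll: "linear l"
    by (rule linearI) (simp_all add: l_def det_row_add[where a="\<lambda>i. x" for x] det_row_mul scalar_mult_eq_scaleR[symmetric])
  define a where "a i = (if i = j0 then - (\<Sum>j\<in>S. l (axis j 1)) else l (axis i 1))" for i
  have "gram_vol S (\<lambda>j. (y j + s j *\<^sub>R ?u) - (y j0 + s j0 *\<^sub>R ?u)) = \<bar>\<Sum>i\<in>insert j0 S. a i * s i\<bar>" for s
  proof -
    let ?X = "\<lambda>j. (y j + s j *\<^sub>R ?u) - (y j0 + s j0 *\<^sub>R ?u)"
    have "?X j \<in> span (coord_basis S)" if "j \<in> S" for j
      using section_coords(3)[OF i0 y] that by (intro span_diff) auto
    then have "gram_vol S ?X = \<bar>det (col_matrix S ?X)\<bar>" by (rule gram_vol_coord)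
    also have "col_matrix S ?X = (\<chi> r. if r = i0 then (\<Sum>j\<in>S. (s j - s j0) *\<^sub>R axis j 1) else row r Y)"
    proof -
      have y0: "y i $ i0 = 0" if "i \<in> insert j0 S" for i using y[OF that] by (simp add: span_coord_basis)
      have e: "(\<Sum>j\<in>S. (s j - s j0) * axis j 1 $ c) = (if c \<in> S then s c - s j0 else 0)" for c
      proof -
        have "(\<Sum>j\<in>S. (s j - s j0) * axis j 1 $ c) = (\<Sum>j\<in>S. if j = c then s c - s j0 else 0)"
          by (rule sum.cong) (auto simp: axis_def)
        then show ?thesis by simp
      qed
      have "col_matrix S ?X $ r $ c = (\<chi> r. if r = i0 then (\<Sum>j\<in>S. (s j - s j0) *\<^sub>R axis j 1) else row r Y) $ r $ c" for r c
      proof (cases "r = i0")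
        case True
        then show ?thesis using i0 y0[of c] y0[of j0] by (auto simp: e col_matrix_def)
      next
        case False
        then show ?thesis by (auto simp: col_matrix_def Y_def row_def axis_def)
      qed
      then show ?thesis by (simp only: vec_eq_iff) blast
    qed
    also have "det \<dots> = l (\<Sum>j\<in>S. (s j - s j0) *\<^sub>R axis j 1)" by (simp add: l_def)
    also have "\<dots> = (\<Sum>j\<in>S. (s j - s j0) * l (axis j 1))" by (simp add: linear_sum[OF ll] linear_cmul[OF ll])
    also have "\<dots> = (\<Sum>i\<in>insert j0 S. a i * s i)"
    proof -
      have "(\<Sum>i\<in>S. a i * s i) = (\<Sum>i\<in>S. l (axis i 1) * s i)" by (rule sum.cong) (use j0 in \<open>auto simp: a_def\<close>)
      then show ?thesis using j0 by (simp add: a_def algebra_simps sum_subtractf sum_distrib_left)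
    qed
    finally show ?thesis .
  qed
  then show ?thesis by blast
qed

lemma measurable_energy_integrand:
  assumes M: "sets M = sets (borel :: (real^'n) measure)" and [measurable]: "g \<in> borel_measurable borel"
  shows "(\<lambda>X. ennreal (gram_vol S (\<lambda>j. X j - X j0) ^ N) * (\<Prod>i\<in>insert j0 S. ennreal (g (X i))))
     \<in> borel_measurable (powM (insert j0 S) M)"
proof -
  have c: "(\<lambda>X. X i) \<in> borel_measurable (powM (insert j0 S) M)" if "i \<in> insert j0 S" for i
    using M that by (rule measurable_component_borel)
  have gv: "(\<lambda>X. gram_vol S (\<lambda>j. X j - X j0)) \<in> borel_measurable (powM (insert j0 S) M)"
    using c by (intro measurable_gram_vol borel_measurable_diff) auto
  have "(\<lambda>X. \<Prod>i\<in>insert j0 S. ennreal (g (X i))) \<in> borel_measurable (powM (insert j0 S) M)"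
    by (intro borel_measurable_prod_ennreal measurable_compose[OF c]) measurable
  then show ?thesis using gv by measurable
qed

lemma simplex_energy_section:
  fixes S :: "'n::finite set"
  assumes i0: "i0 \<in> S" and [measurable]: "g \<in> borel_measurable borel"
  shows "simplex_energy S j0 N g =
    (\<integral>\<^sup>+y. \<integral>\<^sup>+s. ennreal (gram_vol S (\<lambda>j. (y j + s j *\<^sub>R axis i0 1) - (y j0 + s j0 *\<^sub>R axis i0 1)) ^ N)
        * (\<Prod>i\<in>insert j0 S. ennreal (g (y i + s i *\<^sub>R axis i0 1)))
      \<partial>powM (insert j0 S) lborel \<partial>powM (insert j0 S) (coord_lborel (S - {i0})))"
proof -
  let ?T = "insert j0 S"
  let ?X = "\<lambda>y s. \<lambda>i\<in>?T. y i + s i *\<^sub>R axis i0 (1::real) :: real^'n"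
  have "simplex_energy S j0 N g = (\<integral>\<^sup>+y. \<integral>\<^sup>+s. ennreal (gram_vol S (\<lambda>j. ?X y s j - ?X y s j0) ^ N) * (\<Prod>i\<in>?T. ennreal (g (?X y s i)))
      \<partial>powM ?T lborel \<partial>powM ?T (coord_lborel (S - {i0})))"
    unfolding simplex_energy_def
  proof (rule nn_integral_PiM_split[where \<phi>="\<lambda>y s. y + s *\<^sub>R axis i0 1"])
    show "(\<lambda>(y, s). y + s *\<^sub>R axis i0 1) \<in> measurable (coord_lborel (S - {i0}) \<Otimes>\<^sub>M lborel) (coord_lborel S)"
      using measurable_line[of i0] by (simp add: split_beta cong: measurable_cong_sets sets_pair_measure_cong)
    show "(\<integral>\<^sup>+x. f x \<partial>coord_lborel S) = (\<integral>\<^sup>+y. \<integral>\<^sup>+s. f (y + s *\<^sub>R axis i0 1) \<partial>lborel \<partial>coord_lborel (S - {i0}))"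
      if "f \<in> borel_measurable (coord_lborel S)" for f
      by (rule nn_integral_coord_section[OF i0]) (use that in simp)
  qed (auto intro: sigma_finite_span_lborel orthonormal_coord_basis sigma_finite_lborel measurable_energy_integrand)
  also have "\<dots> = (\<integral>\<^sup>+y. \<integral>\<^sup>+s. ennreal (gram_vol S (\<lambda>j. (y j + s j *\<^sub>R axis i0 1) - (y j0 + s j0 *\<^sub>R axis i0 1)) ^ N)
        * (\<Prod>i\<in>?T. ennreal (g (y i + s i *\<^sub>R axis i0 1)))
      \<partial>powM ?T lborel \<partial>powM ?T (coord_lborel (S - {i0})))"
  proof (intro nn_integral_cong arg_cong2[where f="(*)"] prod.cong refl)
    fix y :: "'n \<Rightarrow> real^'n" and s :: "'n \<Rightarrow> real"
    have "gram_vol S (\<lambda>j. ?X y s j - ?X y s j0) = gram_vol S (\<lambda>j. (y j + s j *\<^sub>R axis i0 1) - (y j0 + s j0 *\<^sub>R axis i0 1))"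
      by (rule gram_vol_cong) simp
    then show "ennreal (gram_vol S (\<lambda>j. ?X y s j - ?X y s j0) ^ N) =
        ennreal (gram_vol S (\<lambda>j. (y j + s j *\<^sub>R axis i0 1) - (y j0 + s j0 *\<^sub>R axis i0 1)) ^ N)" by (simp only:)
  qed simp
  finally show ?thesis .
qed

text \<open>With the feet of the lines fixed, the Gram volume is the absolute value of a linear form
  in the positions on the lines, and its \<open>N\<close>-th power is an even convex function of
  that form. Symmetrization replaces the densities on the lines by centred intervals of the same
  masses, which is exactly the comparison of \<open>intervals_minimize\<close>.\<close>

lemma simplex_energy_steiner_le:
  fixes S :: "'n::finite set"
  assumes g: "bounded_density S R g" and i0: "i0 \<in> S" and j0: "j0 \<notin> S" and R: "0 \<le> R"
  shows "simplex_energy S j0 N (steiner S i0 g) \<le> simplex_energy S j0 N g"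
proof -
  let ?T = "insert j0 S"
  let ?u = "axis i0 1 :: real^'n"
  let ?L' = "coord_lborel (S - {i0})"
  have gm: "g \<in> borel_measurable borel" using g by (simp add: bounded_density_def)
  have g01: "0 \<le> g x" "g x \<le> 1" for x using g by (simp_all add: bounded_density_def)
  have "AE y in powM ?T ?L'. \<forall>i\<in>?T. y i \<in> span (coord_basis (S - {i0}))"
    by (intro AE_finite_allI AE_PiM_component_finite sigma_finite_span_lborel orthonormal_coord_basis AE_span_lborel) auto
  then show ?thesis
    unfolding simplex_energy_section[OF i0 gm] simplex_energy_section[OF i0 measurable_steiner[OF gm]]
  proof (intro nn_integral_mono_AE, eventually_elim)
    fix y :: "'n \<Rightarrow> real^'n" assume y: "\<forall>i\<in>?T. y i \<in> span (coord_basis (S - {i0}))"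
    then have y': "y i \<in> span (coord_basis (S - {i0}))" if "i \<in> ?T" for i using that by blast
    have "\<exists>a. \<forall>s. gram_vol S (\<lambda>j. (y j + s j *\<^sub>R ?u) - (y j0 + s j0 *\<^sub>R ?u)) = \<bar>\<Sum>i\<in>?T. a i * s i\<bar>"
      by (rule gram_vol_linear_section[OF i0 j0]) (rule y')
    then obtain a where a: "\<And>s. gram_vol S (\<lambda>j. (y j + s j *\<^sub>R ?u) - (y j0 + s j0 *\<^sub>R ?u)) = \<bar>\<Sum>i\<in>?T. a i * s i\<bar>"
      by blast
    define m where "m i = enn2real (section_mass i0 g (y i))" for i
    have m: "ennreal (m i) = section_mass i0 g (y i)" if "i \<in> ?T" for i
      unfolding m_def using section_bound(1)[OF g i0 y'[OF that]] by (simp add: le_less_trans)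
    have m0: "0 \<le> m i" for i by (simp add: m_def)
    have fm: "(\<lambda>s. g (z + s *\<^sub>R ?u)) \<in> borel_measurable borel" for z
      using gm by measurable
    have "(\<integral>\<^sup>+s. ennreal (gram_vol S (\<lambda>j. (y j + s j *\<^sub>R ?u) - (y j0 + s j0 *\<^sub>R ?u)) ^ N)
        * (\<Prod>i\<in>?T. ennreal (steiner S i0 g (y i + s i *\<^sub>R ?u))) \<partial>powM ?T lborel)
      = (\<integral>\<^sup>+s. ennreal (\<bar>\<Sum>i\<in>?T. a i * s i\<bar> ^ N) * (\<Prod>i\<in>?T. indicator {-m i/2<..<m i/2} (s i)) \<partial>powM ?T lborel)"
      unfolding a
    proof (intro nn_integral_cong arg_cong2[where f="(*)"] refl prod.cong)
      fix s :: "'n \<Rightarrow> real" and i assume i: "i \<in> ?T"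
      show "ennreal (steiner S i0 g (y i + s i *\<^sub>R ?u)) = indicator {-m i/2<..<m i/2} (s i)"
        unfolding steiner_section[OF i0 y'[OF i]] m[OF i, symmetric] emeasure_centered[OF m0, symmetric]
        by (simp add: indicator_def)
    qed
    also have "\<dots> \<le> (\<integral>\<^sup>+s. ennreal (\<bar>\<Sum>i\<in>?T. a i * s i\<bar> ^ N) * (\<Prod>i\<in>?T. ennreal (g (y i + s i *\<^sub>R ?u))) \<partial>powM ?T lborel)"
    proof (rule intervals_minimize[where f="\<lambda>i s. g (y i + s *\<^sub>R ?u)" and \<phi>="\<lambda>x. \<bar>x\<bar> ^ N" and R=R])
      show "g (y i + s *\<^sub>R ?u) = 0" if "i \<in> ?T" "R < \<bar>s\<bar>" for i s
      proof (rule ccontr)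
        assume "g (y i + s *\<^sub>R ?u) \<noteq> 0"
        then have "\<bar>s\<bar> \<le> sqrt (R\<^sup>2 - (norm (y i))\<^sup>2)" by (rule section_bound(2)[OF g i0 y'[OF that(1)]])
        also have "\<dots> \<le> sqrt (R\<^sup>2)" by (intro real_sqrt_le_mono) simp
        finally show False using that(2) R by simp
      qed
      show "ennreal (m i) = (\<integral>\<^sup>+s. ennreal (g (y i + s *\<^sub>R ?u)) \<partial>lborel)" if "i \<in> ?T" for i
        using m[OF that] by (simp add: section_mass_def)
    qed (use fm g01 m0 convex_abs_power in auto)
    finally show "(\<integral>\<^sup>+s. ennreal (gram_vol S (\<lambda>j. (y j + s j *\<^sub>R ?u) - (y j0 + s j0 *\<^sub>R ?u)) ^ N)
        * (\<Prod>i\<in>?T. ennreal (steiner S i0 g (y i + s i *\<^sub>R ?u))) \<partial>powM ?T lborel)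
      \<le> (\<integral>\<^sup>+s. ennreal (gram_vol S (\<lambda>j. (y j + s j *\<^sub>R ?u) - (y j0 + s j0 *\<^sub>R ?u)) ^ N)
        * (\<Prod>i\<in>?T. ennreal (g (y i + s i *\<^sub>R ?u))) \<partial>powM ?T lborel)"
      unfolding a .
  qed
qed

text \<open>On each line, the ball and the symmetrized density occupy centred intervals, so one
  contains the other. If the ball contains the density, nothing is left outside. Otherwise the
  density fills the whole section of the ball, and the mass outside drops by all the room that
  \<open>g\<close> had left inside. The integral with \<tau> pairs mass outside the ball with room
  inside, displaced by \<tau> along the line, so it exceeds neither the mass outside nor the room
  inside.\<close>

lemma defect_steiner_gain:
  fixes S :: "'n::finite set"
  assumes g: "bounded_density S R g" and i0: "i0 \<in> S"
  shows "defect S r (steiner S i0 g) + (\<integral>\<^sup>+x. ennreal (g x) * indicator (- cball 0 r) x *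
      (ennreal (1 - g (x + \<tau> *\<^sub>R axis i0 1)) * indicator (cball 0 r) (x + \<tau> *\<^sub>R axis i0 1)) \<partial>coord_lborel S)
    \<le> defect S r g"
proof -
  let ?u = "axis i0 1 :: real^'n"
  let ?L' = "coord_lborel (S - {i0})"
  let ?B = "cball 0 r :: (real^'n) set"
  have gm[measurable]: "g \<in> borel_measurable borel" using g by (simp add: bounded_density_def)
  have g01: "0 \<le> g x" "g x \<le> 1" for x using g by (simp_all add: bounded_density_def)
  have sm[measurable]: "steiner S i0 g \<in> borel_measurable borel" by (rule measurable_steiner[OF gm])
  have Bc[measurable]: "?B \<in> sets borel" by (rule cball_borel)
  have line[measurable]: "(\<lambda>s. y + s *\<^sub>R ?u) \<in> borel_measurable borel" for y by measurable
  let ?f1 = "\<lambda>x. ennreal (steiner S i0 g x) * indicator (- ?B) x"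
  let ?f2 = "\<lambda>x. ennreal (g x) * indicator (- ?B) x * (ennreal (1 - g (x + \<tau> *\<^sub>R ?u)) * indicator ?B (x + \<tau> *\<^sub>R ?u))"
  let ?f3 = "\<lambda>x. ennreal (g x) * indicator (- ?B) x"
  have m1: "?f1 \<in> borel_measurable borel" and m3: "?f3 \<in> borel_measurable borel" by measurable
  have "(\<lambda>x. x + \<tau> *\<^sub>R ?u) \<in> borel_measurable borel" by measurable
  note [measurable] = this
  have m2: "?f2 \<in> borel_measurable borel" by measurable
  have "defect S r (steiner S i0 g) + (\<integral>\<^sup>+x. ?f2 x \<partial>coord_lborel S) = (\<integral>\<^sup>+x. ?f1 x + ?f2 x \<partial>coord_lborel S)"
    unfolding defect_def by (rule nn_integral_add[symmetric]) (use m1 m2 in simp_all)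
  also have "\<dots> = (\<integral>\<^sup>+y. \<integral>\<^sup>+s. ?f1 (y + s *\<^sub>R ?u) + ?f2 (y + s *\<^sub>R ?u) \<partial>lborel \<partial>?L')"
    by (rule nn_integral_coord_section[OF i0]) (use m1 m2 in measurable)
  also have "\<dots> \<le> (\<integral>\<^sup>+y. \<integral>\<^sup>+s. ?f3 (y + s *\<^sub>R ?u) \<partial>lborel \<partial>?L')"
  proof (rule nn_integral_mono_AE, rule AE_mp[OF AE_span_lborel AE_I2], intro impI)
    fix y :: "real^'n" assume y: "y \<in> span (coord_basis (S - {i0}))"
    define h where "h s = g (y + s *\<^sub>R ?u)" for s
    define b where "b s = (indicator ?B (y + s *\<^sub>R ?u) :: ennreal)" for s
    define b' where "b' s = (indicator (- ?B) (y + s *\<^sub>R ?u) :: ennreal)" for s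
    have hm[measurable]: "h \<in> borel_measurable borel" unfolding h_def by measurable
    have bm[measurable]: "b \<in> borel_measurable borel" unfolding b_def by measurable
    have bm'[measurable]: "b' \<in> borel_measurable borel" unfolding b'_def by measurable
    have h01: "0 \<le> h s" "h s \<le> 1" for s by (simp_all add: h_def g01)
    have bb: "b s = 1 \<and> b' s = 0 \<or> b s = 0 \<and> b' s = 1" for s by (auto simp: b_def b'_def indicator_def)
    have "section_mass i0 g y < \<infinity>" using section_bound(1)[OF g i0 y] by (simp add: le_less_trans)
    then obtain q where q: "section_mass i0 g y = ennreal q" "0 \<le> q" by (cases "section_mass i0 g y") auto
    define st where "st s = (indicator {s. ennreal (2 * \<bar>s\<bar>) < ennreal q} s :: ennreal)" for s
    have st: "ennreal (steiner S i0 g (y + s *\<^sub>R ?u)) = st s" for s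
      by (simp add: steiner_section[OF i0 y] q st_def indicator_def)
    have stm[measurable]: "st \<in> borel_measurable borel" unfolding st_def emeasure_centered[OF q(2)] by measurable
    let ?A = "\<integral>\<^sup>+s. ennreal (h s) * b' s \<partial>lborel" and ?C = "\<integral>\<^sup>+s. ennreal (h s) * b s \<partial>lborel"
      and ?D = "\<integral>\<^sup>+s. ennreal (1 - h s) * b s \<partial>lborel" and ?b = "\<integral>\<^sup>+s. b s \<partial>lborel"
      and ?I = "\<integral>\<^sup>+s. (ennreal (h s) * b' s) * (ennreal (1 - h (s + \<tau>)) * b (s + \<tau>)) \<partial>lborel"
      and ?E = "\<integral>\<^sup>+s. st s * b' s \<partial>lborel"
    have AC: "ennreal q = ?A + ?C"
    proof -
      have "ennreal q = (\<integral>\<^sup>+s. ennreal (h s) * b' s + ennreal (h s) * b s \<partial>lborel)"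
        unfolding q(1)[symmetric] section_mass_def using bb by (intro nn_integral_cong) (metis h_def add.left_neutral add.right_neutral mult.right_neutral mult_zero_right)
      then show ?thesis by (simp add: nn_integral_add)
    qed
    have bCD: "?b = ?C + ?D"
    proof -
      have "b s = ennreal (h s) * b s + ennreal (1 - h s) * b s" for s
        using h01[of s] by (simp add: distrib_right[symmetric] ennreal_plus[symmetric] del: ennreal_plus)
      then have "?b = (\<integral>\<^sup>+s. ennreal (h s) * b s + ennreal (1 - h s) * b s \<partial>lborel)" by (intro nn_integral_cong) metis
      then show ?thesis by (simp add: nn_integral_add)
    qed
    have IA: "?I \<le> ?A"
    proof (rule nn_integral_mono)
      fix s
      have "ennreal (1 - h (s + \<tau>)) * b (s + \<tau>) \<le> 1 * 1"
        using h01 bb[of "s + \<tau>"] by (intro mult_mono) auto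
      then show "(ennreal (h s) * b' s) * (ennreal (1 - h (s + \<tau>)) * b (s + \<tau>)) \<le> ennreal (h s) * b' s"
        using mult_left_mono[of "ennreal (1 - h (s + \<tau>)) * b (s + \<tau>)" 1 "ennreal (h s) * b' s"] by simp
    qed
    have ID: "?I \<le> ?D"
    proof -
      have "?I \<le> (\<integral>\<^sup>+s. ennreal (1 - h (s + \<tau>)) * b (s + \<tau>) \<partial>lborel)"
      proof (rule nn_integral_mono)
        fix s
        have "ennreal (h s) * b' s \<le> 1 * 1" using h01 bb[of s] by (intro mult_mono) auto
        then show "(ennreal (h s) * b' s) * (ennreal (1 - h (s + \<tau>)) * b (s + \<tau>)) \<le> ennreal (1 - h (s + \<tau>)) * b (s + \<tau>)"
          using mult_right_mono[of "ennreal (h s) * b' s" 1 "ennreal (1 - h (s + \<tau>)) * b (s + \<tau>)"] by simp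
      qed
      also have "\<dots> = ?D"
        using nn_integral_real_affine[of "\<lambda>s. ennreal (1 - h s) * b s" 1 \<tau>] by (simp add: add.commute)
      finally show ?thesis .
    qed
    have stint: "(\<integral>\<^sup>+s. st s \<partial>lborel) = ennreal q" unfolding st_def emeasure_centered[OF q(2)] using q(2) by simp
    have conv: "b s = 1" if "\<bar>s\<bar> \<le> \<bar>t\<bar>" "b t = 1" for s t
    proof -
      have t: "norm (y + t *\<^sub>R ?u) \<le> r" using that(2) by (auto simp: b_def indicator_def split: if_splits)
      have "(norm (y + s *\<^sub>R ?u))\<^sup>2 \<le> (norm (y + t *\<^sub>R ?u))\<^sup>2"
        unfolding section_coords(4)[OF i0 y] using that(1) by (simp add: abs_le_square_iff)
      then have "norm (y + s *\<^sub>R ?u) \<le> norm (y + t *\<^sub>R ?u)" by (rule power2_le_imp_le) simp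
      then show ?thesis using t by (simp add: b_def)
    qed
    have stconv: "st s = 1" if "\<bar>s\<bar> \<le> \<bar>t\<bar>" "st t = 1" for s t
    proof -
      have "ennreal (2 * \<bar>s\<bar>) \<le> ennreal (2 * \<bar>t\<bar>)" using that(1) by (intro ennreal_leI) simp
      also have "\<dots> < ennreal q" using that(2) by (auto simp: st_def indicator_def split: if_splits)
      finally show ?thesis by (simp add: st_def)
    qed
    have st01: "st s = 0 \<or> st s = 1" for s by (auto simp: st_def indicator_def)
    \<comment> \<open>The cases distinguish which of the two centred intervals contains the other.
      In the second one the mass \<open>?C\<close> inside the ball is cancelled, which requires it
      to be finite.\<close>
    have "?E + ?I \<le> ?A"
    proof (cases "\<forall>s. st s = 1 \<longrightarrow> b s = 1")
      case True
      have "st s * b' s = 0" for s using True st01[of s] bb[of s] by auto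
      then have "?E = (\<integral>\<^sup>+s. 0 \<partial>(lborel :: real measure))" by (intro nn_integral_cong)
      then show ?thesis using IA by simp
    next
      case False
      then obtain t where t: "st t = 1" "b t = 0" using bb by metis
      have bst: "b s = b s * st s" for s
      proof (cases "b s = 1")
        case True
        then have "\<not> \<bar>t\<bar> \<le> \<bar>s\<bar>" using conv[of t s] t(2) by auto
        then show ?thesis using stconv[of s t] t(1) by simp
      next
        case False
        then show ?thesis using bb[of s] by simp
      qed
      have "st s = st s * b' s + b s" for s using bb[of s] bst[of s] by (metis add.left_neutral add.right_neutral mult.right_neutral mult_zero_right mult.left_neutral)
      then have "ennreal q = (\<integral>\<^sup>+s. st s * b' s + b s \<partial>lborel)" unfolding stint[symmetric] by (intro nn_integral_cong) metis
      also have "\<dots> = ?E + ?b" by (simp add: nn_integral_add)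
      finally have "?C + (?E + ?D) = ?C + ?A" unfolding AC bCD by (simp only: ac_simps)
      moreover have "?C \<noteq> \<infinity>" using AC by (metis ennreal_add_eq_top ennreal_neq_top infinity_ennreal_def)
      ultimately have "?E + ?D = ?A" by (simp add: ennreal_add_left_cancel)
      then show ?thesis using add_left_mono[OF ID, of "?E"] by simp
    qed
    also have "?E + ?I = (\<integral>\<^sup>+s. ?f1 (y + s *\<^sub>R ?u) + ?f2 (y + s *\<^sub>R ?u) \<partial>lborel)"
      by (subst nn_integral_add[symmetric]) (auto intro!: nn_integral_cong simp: st b_def b'_def h_def scaleR_add_left add.assoc)
    also have "?A = (\<integral>\<^sup>+s. ?f3 (y + s *\<^sub>R ?u) \<partial>lborel)" by (simp add: h_def b'_def)
    finally show "(\<integral>\<^sup>+s. ?f1 (y + s *\<^sub>R ?u) + ?f2 (y + s *\<^sub>R ?u) \<partial>lborel) \<le> (\<integral>\<^sup>+s. ?f3 (y + s *\<^sub>R ?u) \<partial>lborel)" .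
  qed
  also have "\<dots> = defect S r g"
    unfolding defect_def by (rule nn_integral_coord_section[OF i0, symmetric]) (rule m3)
  finally show ?thesis .
qed

text \<open>The Householder reflection in the hyperplane orthogonal to \<open>u - w\<close>. Being
  an involution that maps \<open>V\<close> into itself, it maps \<open>V\<close> onto itself, and
  the same map undoes the substitution.\<close>

lemma reflection_between_unit_vectors:
  fixes u w :: "'a::euclidean_space"
  assumes "norm u = 1" "norm w = 1" "subspace V" "u \<in> V" "w \<in> V"
  obtains U where "orthogonal_transformation U" "U u = w" "\<And>x. U (U x) = x" "\<And>x. x \<in> V \<Longrightarrow> U x \<in> V"
proof (cases "u = w")
  case True
  then show ?thesis using that[of "\<lambda>x. x"] orthogonal_transformation_id by simp
next
  case False
  define d where "d = u - w"
  define c where "c x = 2 * (x \<bullet> d) / (d \<bullet> d)" for x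
  define U where "U x = x - c x *\<^sub>R d" for x
  have d: "d \<bullet> d \<noteq> 0" using False by (simp add: d_def)
  have uu: "u \<bullet> u = 1" "w \<bullet> w = 1" using assms(1,2) by (simp_all add: dot_square_norm)
  have lin: "linear U"
    by (rule linearI) (simp_all add: U_def c_def inner_add_left scaleR_add_left add_divide_distrib algebra_simps)
  have "U v \<bullet> U w = v \<bullet> w" for v w
  proof -
    have "U v \<bullet> U w = v \<bullet> w - c w * (v \<bullet> d) - c v * (d \<bullet> w) + c v * c w * (d \<bullet> d)"
      by (simp add: U_def inner_diff_left inner_diff_right algebra_simps)
    also have "c v * c w * (d \<bullet> d) = c v * (2 * (w \<bullet> d))" using d by (simp add: c_def)
    also have "c w * (v \<bullet> d) = c v * (w \<bullet> d)" by (simp add: c_def)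
    finally show ?thesis by (simp add: inner_commute[of d w])
  qed
  then have o: "orthogonal_transformation U" using lin by (simp add: orthogonal_transformation_def)
  have "2 * (u \<bullet> d) = d \<bullet> d" by (simp add: d_def inner_diff_left inner_diff_right uu inner_commute)
  then have "c u = 1" using d by (simp add: c_def)
  then have Uu: "U u = w" by (simp add: U_def d_def)
  have "c (U x) = - c x" for x
  proof -
    have "U x \<bullet> d = x \<bullet> d - c x * (d \<bullet> d)" by (simp add: U_def inner_diff_left)
    also have "c x * (d \<bullet> d) = 2 * (x \<bullet> d)" using d by (simp add: c_def)
    finally show ?thesis by (simp add: c_def)
  qed
  then have UU: "U (U x) = x" for x by (simp add: U_def[of "U x"]) (simp add: U_def)
  have "d \<in> V" using assms by (simp add: d_def subspace_diff)
  then have "x \<in> V \<Longrightarrow> U x \<in> V" for x using assms(3) by (simp add: U_def subspace_diff subspace_scale)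
  then show ?thesis using that o Uu UU by blast
qed

lemma nn_integral_span_lborel_isometry:
  fixes U :: "real^'n \<Rightarrow> real^'n"
  assumes U: "orthogonal_transformation U" "\<And>x. U (U x) = x" "\<And>x. x \<in> span B \<Longrightarrow> U x \<in> span B"
    and B: "orthonormal_set B" and [measurable]: "f \<in> borel_measurable borel"
  shows "(\<integral>\<^sup>+x. f (U x) \<partial>span_lborel B) = (\<integral>\<^sup>+x. f x \<partial>span_lborel B)"
proof -
  have [measurable]: "U \<in> borel_measurable borel" using U(1) by (intro measurable_linear orthogonal_transformation_linear)
  have "U ` span B = span B" using U(2,3) by (metis (no_types, lifting) image_eqI image_subsetI subsetI subset_antisym)
  then have "span (U ` B) = span B" by (simp add: span_orthogonal_image[OF U(1)])
  then have "span_lborel (U ` B) = span_lborel B" by (intro span_lborel_cong orthonormal_set_image U(1) B)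
  moreover have "distr (span_lborel B) borel U = span_lborel (U ` B)"
    by (rule distr_span_lborel) (use U(1) B in \<open>simp_all add: orthogonal_transformation_linear orthonormal_set_finite
      inj_on_subset[OF orthogonal_transformation_inj]\<close>)
  ultimately have "distr (span_lborel B) borel U = span_lborel B" by simp
  then have "(\<integral>\<^sup>+x. f x \<partial>span_lborel B) = (\<integral>\<^sup>+x. f x \<partial>distr (span_lborel B) borel U)" by simp
  also have "\<dots> = (\<integral>\<^sup>+x. f (U x) \<partial>span_lborel B)" by (subst nn_integral_distr) auto
  finally show ?thesis by simp
qed

lemma simplex_energy_isometry:
  fixes U :: "real^'n \<Rightarrow> real^'n" and S :: "'n set"
  assumes U: "orthogonal_transformation U" "\<And>x. U (U x) = x" "\<And>x. x \<in> span (coord_basis S) \<Longrightarrow> U x \<in> span (coord_basis S)"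
    and gm: "g \<in> borel_measurable borel"
  shows "simplex_energy S j0 N (\<lambda>x. g (U x)) = simplex_energy S j0 N g"
proof -
  let ?T = "insert j0 S" and ?L = "coord_lborel S"
  have Um: "U \<in> borel_measurable borel" using U(1) by (intro measurable_linear orthogonal_transformation_linear)
  let ?G = "\<lambda>X. ennreal (gram_vol S (\<lambda>j. X j - X j0) ^ N) * (\<Prod>i\<in>?T. ennreal (g (X i)))"
  have Gm: "?G \<in> borel_measurable (powM ?T ?L)" by (rule measurable_energy_integrand[OF _ gm]) simp
  have "(\<Prod>i\<in>?T. 1) * (\<integral>\<^sup>+X. ?G (\<lambda>i\<in>?T. U (X i)) \<partial>powM ?T ?L) = (\<integral>\<^sup>+X. ?G X \<partial>powM ?T ?L)"
  proof (rule nn_integral_PiM_componentwise[OF sigma_finite_span_lborel[OF orthonormal_coord_basis] _ _ _ Gm])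
    show "U \<in> measurable ?L ?L" using Um by (simp cong: measurable_cong_sets)
    show "1 * (\<integral>\<^sup>+x. f (U x) \<partial>?L) = (\<integral>\<^sup>+x. f x \<partial>?L)" if "f \<in> borel_measurable ?L" for f
      using nn_integral_span_lborel_isometry[OF U orthonormal_coord_basis, of f] that by simp
  qed simp
  moreover have "?G (\<lambda>i\<in>?T. U (X i)) = ennreal (gram_vol S (\<lambda>j. X j - X j0) ^ N) * (\<Prod>i\<in>?T. ennreal (g (U (X i))))" for X
  proof -
    have "gram_vol S (\<lambda>j. (\<lambda>i\<in>?T. U (X i)) j - (\<lambda>i\<in>?T. U (X i)) j0) = gram_vol S (\<lambda>j. U (X j - X j0))"
      by (rule gram_vol_cong) (simp add: linear_diff[OF orthogonal_transformation_linear[OF U(1)]])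
    also have "\<dots> = gram_vol S (\<lambda>j. X j - X j0)" by (rule gram_vol_orthogonal[OF U(1)])
    finally show ?thesis by (intro arg_cong2[where f="(*)"] prod.cong) simp_all
  qed
  ultimately show ?thesis by (simp add: simplex_energy_def)
qed

section \<open>Repeated symmetrization approaches the ball\<close>

lemma emeasure_coord_cball:
  "0 < r \<Longrightarrow> emeasure (coord_lborel S) (cball 0 r) = ennreal (unit_ball_vol (real (card S)) * r ^ card S)"
  using emeasure_span_lborel_cball[OF orthonormal_coord_basis] by simp

text \<open>The mass of \<open>g\<close> and the volume of the ball both contain the mass of
  \<open>g\<close> inside the ball. As the totals agree, what is missing inside equals what is in
  excess outside.\<close>

lemma defect_complement:
  assumes g: "bounded_density S R g" and r: "0 < r"
    and mass: "(\<integral>\<^sup>+x. ennreal (g x) \<partial>coord_lborel S) = emeasure (coord_lborel S) (cball 0 r)"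
  shows "(\<integral>\<^sup>+x. ennreal (1 - g x) * indicator (cball 0 r) x \<partial>coord_lborel S) = defect S r g"
proof -
  let ?L = "coord_lborel S" and ?B = "cball 0 r :: (real^'a) set"
  have [measurable]: "g \<in> borel_measurable borel" using g by (simp add: bounded_density_def)
  have g01: "0 \<le> g x" "g x \<le> 1" for x using g by (simp_all add: bounded_density_def)
  let ?C = "\<integral>\<^sup>+x. ennreal (g x) * indicator ?B x \<partial>?L"
  have "(\<integral>\<^sup>+x. ennreal (g x) \<partial>?L) = (\<integral>\<^sup>+x. ennreal (g x) * indicator ?B x + ennreal (g x) * indicator (- ?B) x \<partial>?L)"
    by (intro nn_integral_cong) (auto simp: indicator_def)
  then have 1: "(\<integral>\<^sup>+x. ennreal (g x) \<partial>?L) = ?C + defect S r g" unfolding defect_def by (simp add: nn_integral_add)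
  have "emeasure ?L ?B = (\<integral>\<^sup>+x. indicator ?B x \<partial>?L)" by simp
  also have "\<dots> = (\<integral>\<^sup>+x. ennreal (g x) * indicator ?B x + ennreal (1 - g x) * indicator ?B x \<partial>?L)"
    using g01 by (intro nn_integral_cong) (simp add: distrib_right[symmetric] ennreal_plus[symmetric] del: ennreal_plus)
  finally have 2: "emeasure ?L ?B = ?C + (\<integral>\<^sup>+x. ennreal (1 - g x) * indicator ?B x \<partial>?L)" by (simp add: nn_integral_add)
  have "?C + (\<integral>\<^sup>+x. ennreal (1 - g x) * indicator ?B x \<partial>?L) = ?C + defect S r g" using 1 2 mass by simp
  moreover have "?C \<noteq> \<infinity>" using 2 emeasure_coord_cball[OF r, of S] by (metis ennreal_add_eq_top ennreal_neq_top infinity_ennreal_def)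
  ultimately show ?thesis by (simp add: ennreal_add_left_cancel)
qed

text \<open>Integrated over all translations \<open>v\<close>, the overlap of shifted excess and
  missing mass gives the product of the two masses, the square of the defect. Only translations of
  norm at most \<open>2 * R\<close> contribute, so a bound \<open>c\<close> on every overlap bounds
  the square. Read backwards, a large defect yields a translation with a large overlap.\<close>

lemma defect_square_le:
  fixes S :: "'n::finite set"
  assumes g: "bounded_density S R g" and r: "0 < r" "r \<le> R"
    and mass: "(\<integral>\<^sup>+x. ennreal (g x) \<partial>coord_lborel S) = emeasure (coord_lborel S) (cball 0 r)"
    and J: "\<And>v. v \<in> span (coord_basis S) \<Longrightarrow>
      (\<integral>\<^sup>+x. ennreal (g x) * indicator (- cball 0 r) x * (ennreal (1 - g (x + v)) * indicator (cball 0 r) (x + v))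
        \<partial>coord_lborel S) \<le> c"
  shows "defect S r g * defect S r g \<le> c * emeasure (coord_lborel S) (cball 0 (2 * R))"
proof -
  let ?L = "coord_lborel S" and ?B = "cball 0 r :: (real^'n) set"
  interpret L: sigma_finite_measure ?L by (rule sigma_finite_span_lborel[OF orthonormal_coord_basis])
  interpret pair_sigma_finite ?L ?L ..
  have gm[measurable]: "g \<in> borel_measurable borel" using g by (simp add: bounded_density_def)
  let ?a = "\<lambda>x. ennreal (g x) * indicator (- ?B) x" and ?b = "\<lambda>x. ennreal (1 - g x) * indicator ?B x"
  have am[measurable]: "?a \<in> borel_measurable borel" and bm[measurable]: "?b \<in> borel_measurable borel" by measurable
  have sum[measurable]: "(\<lambda>p. fst p + snd p) \<in> borel_measurable (?L \<Otimes>\<^sub>M ?L)" by measurable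
  have fs: "(\<lambda>p. ?a (fst p)) \<in> borel_measurable (?L \<Otimes>\<^sub>M ?L)"
    by (rule measurable_compose[OF measurable_fst]) (use am in simp)
  have m: "(\<lambda>(x, v). ?a x * ?b (x + v)) \<in> borel_measurable (?L \<Otimes>\<^sub>M ?L)"
    unfolding split_beta by (rule borel_measurable_times_ennreal[OF fs measurable_compose[OF sum bm]])
  have "defect S r g * defect S r g = (\<integral>\<^sup>+x. ?a x * defect S r g \<partial>?L)"
    unfolding defect_def by (rule nn_integral_multc[symmetric]) measurable
  also have "\<dots> = (\<integral>\<^sup>+x. \<integral>\<^sup>+v. ?a x * ?b (x + v) \<partial>?L \<partial>?L)"
  proof (rule nn_integral_cong_AE, rule AE_mp[OF AE_span_lborel AE_I2], intro impI)
    fix x :: "real^'n" assume x: "x \<in> span (coord_basis S)"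
    have "(\<integral>\<^sup>+v. ?a x * ?b (x + v) \<partial>?L) = ?a x * (\<integral>\<^sup>+v. ?b (x + v) \<partial>?L)"
      by (rule nn_integral_cmult) measurable
    also have "(\<integral>\<^sup>+v. ?b (x + v) \<partial>?L) = (\<integral>\<^sup>+v. ?b v \<partial>?L)"
      by (rule nn_integral_span_lborel_translate[OF _ x bm]) simp
    finally show "?a x * defect S r g = (\<integral>\<^sup>+v. ?a x * ?b (x + v) \<partial>?L)"
      by (simp only: defect_complement[OF g r(1) mass])
  qed
  also have "\<dots> = (\<integral>\<^sup>+v. \<integral>\<^sup>+x. ?a x * ?b (x + v) \<partial>?L \<partial>?L)" by (rule Fubini'[OF m, symmetric])
  also have "\<dots> \<le> (\<integral>\<^sup>+v. c * indicator (cball 0 (2 * R)) v \<partial>?L)"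
  proof (rule nn_integral_mono_AE, rule AE_mp[OF AE_span_lborel AE_I2], intro impI)
    fix v :: "real^'n" assume v: "v \<in> span (coord_basis S)"
    show "(\<integral>\<^sup>+x. ?a x * ?b (x + v) \<partial>?L) \<le> c * indicator (cball 0 (2 * R)) v"
    proof (cases "norm v \<le> 2 * R")
      case True
      then show ?thesis using J[OF v] by simp
    next
      case False
      have "(\<integral>\<^sup>+x. ?a x * ?b (x + v) \<partial>?L) = (\<integral>\<^sup>+x. 0 \<partial>?L)"
      proof (rule nn_integral_cong_AE, rule AE_mp[OF AE_span_lborel AE_I2], intro impI)
        fix x :: "real^'n" assume x: "x \<in> span (coord_basis S)"
        show "?a x * ?b (x + v) = 0"
        proof (rule ccontr)
          assume "?a x * ?b (x + v) \<noteq> 0"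
          then have "g x \<noteq> 0" "norm (x + v) \<le> r" by (auto simp: indicator_def split: if_splits)
          then have "norm x \<le> R" "norm (x + v) \<le> R" using g x r by (auto simp: bounded_density_def)
          then show False using False norm_triangle_ineq4[of "x + v" x] by simp
        qed
      qed
      then show ?thesis by simp
    qed
  qed
  also have "\<dots> = c * emeasure ?L (cball 0 (2 * R))" by (rule nn_integral_cmult_indicator) simp
  finally show ?thesis .
qed

text \<open>A translation \<open>v\<close> whose overlap exceeds \<open>c\<close> tells in which
  direction to symmetrize. A reflection turns this direction into the axis \<open>i0\<close>;
  energy, mass and defect do not change under it, and symmetrization along \<open>i0\<close> lowers
  the defect by at least the overlap.\<close>

lemma steiner_step:
  fixes S :: "'n::finite set"
  assumes i0: "i0 \<in> S" and j0: "j0 \<notin> S" and g: "bounded_density S R g" and r: "0 < r" "r \<le> R"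
    and mass: "(\<integral>\<^sup>+x. ennreal (g x) \<partial>coord_lborel S) = emeasure (coord_lborel S) (cball 0 r)"
    and c: "c * emeasure (coord_lborel S) (cball 0 (2 * R)) < defect S r g * defect S r g"
  shows "\<exists>g'. bounded_density S R g' \<and>
    (\<integral>\<^sup>+x. ennreal (g' x) \<partial>coord_lborel S) = emeasure (coord_lborel S) (cball 0 r) \<and>
    simplex_energy S j0 N g' \<le> simplex_energy S j0 N g \<and> defect S r g' + c \<le> defect S r g"
proof -
  let ?L = "coord_lborel S" and ?u = "axis i0 1 :: real^'n"
  have gm[measurable]: "g \<in> borel_measurable borel" using g by (simp add: bounded_density_def)
  let ?J = "\<lambda>v x. ennreal (g x) * indicator (- cball 0 r) x * (ennreal (1 - g (x + v)) * indicator (cball 0 r) (x + v))"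
  have Jm: "?J v \<in> borel_measurable borel" for v
  proof -
    have [measurable]: "(\<lambda>x::real^'n. x + v) \<in> borel_measurable borel" by measurable
    show ?thesis by measurable
  qed
  obtain v where v: "v \<in> span (coord_basis S)" "c < (\<integral>\<^sup>+x. ?J v x \<partial>?L)"
    using defect_square_le[OF g r mass, of c] c by (meson not_le)
  \<comment> \<open>For \<open>v = 0\<close> the overlap vanishes, since no point is both outside
    and inside the ball; so the direction of \<open>v\<close> is defined.\<close>
  have "v \<noteq> 0"
  proof
    assume "v = 0"
    then have "(\<integral>\<^sup>+x. ?J v x \<partial>?L) = (\<integral>\<^sup>+x. 0 \<partial>?L)" by (intro nn_integral_cong) (auto simp: indicator_def)
    then show False using v(2) by simp
  qed
  then have v0: "norm v \<noteq> 0" by simp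
  have w: "norm (v /\<^sub>R norm v) = 1" "v /\<^sub>R norm v \<in> span (coord_basis S)" using v0 v(1) by (simp_all add: span_scale)
  obtain U where U: "orthogonal_transformation U" "U ?u = v /\<^sub>R norm v" "\<And>x. U (U x) = x"
    "\<And>x. x \<in> span (coord_basis S) \<Longrightarrow> U x \<in> span (coord_basis S)"
    using reflection_between_unit_vectors[of ?u "v /\<^sub>R norm v" "span (coord_basis S)"] w axis_in_span_coord_basis[OF i0] by auto
  have Um[measurable]: "U \<in> borel_measurable borel" using U(1) by (intro measurable_linear orthogonal_transformation_linear)
  have Un: "norm (U x) = norm x" for x by (rule orthogonal_transformation_norm[OF U(1)])
  have inv: "(\<integral>\<^sup>+x. f (U x) \<partial>?L) = (\<integral>\<^sup>+x. f x \<partial>?L)" if "f \<in> borel_measurable borel" for f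
    by (rule nn_integral_span_lborel_isometry[OF U(1,3,4) orthonormal_coord_basis that])
  let ?h = "\<lambda>x. g (U x)"
  have R: "0 \<le> R" using r by simp
  have h: "bounded_density S R ?h"
    unfolding bounded_density_def
  proof (intro conjI ballI impI allI)
    show "?h \<in> borel_measurable borel" by measurable
    show "norm x \<le> R" if "x \<in> span (coord_basis S)" "?h x \<noteq> 0" for x
      using g U(4)[OF that(1)] that(2) Un[of x] unfolding bounded_density_def by metis
  qed (use g in \<open>auto simp: bounded_density_def\<close>)
  have hmass: "(\<integral>\<^sup>+x. ennreal (?h x) \<partial>?L) = (\<integral>\<^sup>+x. ennreal (g x) \<partial>?L)"
    using inv[of "\<lambda>x. ennreal (g x)"] by simp
  have hdef: "defect S r ?h = defect S r g"
  proof -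
    have "defect S r ?h = (\<integral>\<^sup>+x. ennreal (g (U x)) * indicator (- cball 0 r) (U x) \<partial>?L)"
      unfolding defect_def by (intro nn_integral_cong) (simp add: indicator_def Un)
    also have "\<dots> = defect S r g" unfolding defect_def by (rule inv) measurable
    finally show ?thesis .
  qed
  have shift: "U (x + norm v *\<^sub>R ?u) = U x + v" for x
    using v0 U(2) orthogonal_transformation_linear[OF U(1)] by (simp add: linear_add linear_cmul)
  have gain: "(\<integral>\<^sup>+x. ennreal (?h x) * indicator (- cball 0 r) x *
      (ennreal (1 - ?h (x + norm v *\<^sub>R ?u)) * indicator (cball 0 r) (x + norm v *\<^sub>R ?u)) \<partial>?L) = (\<integral>\<^sup>+x. ?J v x \<partial>?L)"
  proof -
    have "indicator (cball 0 r) (x + norm v *\<^sub>R ?u) = (indicator (cball 0 r) (U x + v) :: ennreal)" for x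
      unfolding shift[symmetric] by (simp add: indicator_def Un)
    moreover have "indicator (- cball 0 r) x = (indicator (- cball 0 r) (U x) :: ennreal)" for x
      by (simp add: indicator_def Un)
    ultimately have "(\<integral>\<^sup>+x. ennreal (?h x) * indicator (- cball 0 r) x *
      (ennreal (1 - ?h (x + norm v *\<^sub>R ?u)) * indicator (cball 0 r) (x + norm v *\<^sub>R ?u)) \<partial>?L) = (\<integral>\<^sup>+x. ?J v (U x) \<partial>?L)"
      by (simp only: shift)
    also have "\<dots> = (\<integral>\<^sup>+x. ?J v x \<partial>?L)" by (rule inv[OF Jm])
    finally show ?thesis .
  qed
  show ?thesis
  proof (intro exI conjI)
    show "bounded_density S R (steiner S i0 ?h)" by (rule bounded_density_steiner[OF h i0 R])
    show "(\<integral>\<^sup>+x. ennreal (steiner S i0 ?h x) \<partial>?L) = emeasure ?L (cball 0 r)"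
      unfolding nn_integral_steiner[OF h i0] hmass mass ..
    show "simplex_energy S j0 N (steiner S i0 ?h) \<le> simplex_energy S j0 N g"
      using simplex_energy_steiner_le[OF h i0 j0 R] simplex_energy_isometry[OF U(1,3,4) gm] by metis
    have "defect S r (steiner S i0 ?h) + c \<le> defect S r (steiner S i0 ?h) + (\<integral>\<^sup>+x. ?J v x \<partial>?L)"
      using v(2) by (intro add_left_mono) simp
    also have "\<dots> \<le> defect S r g"
      using defect_steiner_gain[OF h i0, of r "norm v"] unfolding gain hdef .
    finally show "defect S r (steiner S i0 ?h) + c \<le> defect S r g" .
  qed
qed

text \<open>As long as the defect is at least \<open>e\<close>, a step lowers it by a fixed amount
  \<open>c\<close>. It starts at no more than the volume of the ball, so after finitely many steps
  it must fall below \<open>e\<close>. No limit of symmetrized densities is taken.\<close>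

lemma steiner_iteration:
  fixes S :: "'n::finite set"
  assumes i0: "i0 \<in> S" and j0: "j0 \<notin> S" and g: "bounded_density S R g" and r: "0 < r" "r \<le> R"
    and mass: "(\<integral>\<^sup>+x. ennreal (g x) \<partial>coord_lborel S) = emeasure (coord_lborel S) (cball 0 r)"
    and e: "0 < e"
  shows "\<exists>g'. bounded_density S R g' \<and>
    (\<integral>\<^sup>+x. ennreal (g' x) \<partial>coord_lborel S) = emeasure (coord_lborel S) (cball 0 r) \<and>
    simplex_energy S j0 N g' \<le> simplex_energy S j0 N g \<and> defect S r g' < ennreal e"
proof (rule ccontr)
  assume no: "\<not> ?thesis"
  let ?L = "coord_lborel S"
  define V where "V = unit_ball_vol (real (card S)) * (2 * R) ^ card S"
  have R: "0 < R" using r by simp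
  have V: "emeasure ?L (cball 0 (2 * R)) = ennreal V" "V > 0"
    using emeasure_coord_cball[of "2 * R" S] R by (simp_all add: V_def)
  \<comment> \<open>The factor 2 makes \<open>c * V\<close> strictly smaller than the square of
    \<open>e\<close>, as the strict hypothesis of \<open>steiner_step\<close> demands.\<close>
  define c where "c = e\<^sup>2 / (2 * V)"
  have c: "c > 0" using e V(2) by (simp add: c_def)
  define m where "m = unit_ball_vol (real (card S)) * r ^ card S"
  have m: "emeasure ?L (cball 0 r) = ennreal m" "0 \<le> m" using emeasure_coord_cball[OF r(1), of S] r by (simp_all add: m_def)
  have "\<exists>g'. bounded_density S R g' \<and> (\<integral>\<^sup>+x. ennreal (g' x) \<partial>?L) = emeasure ?L (cball 0 r) \<and>
    simplex_energy S j0 N g' \<le> simplex_energy S j0 N g \<and> defect S r g' + ennreal (real i * c) \<le> ennreal m" for i :: nat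
  proof (induction i)
    case 0
    have "defect S r g \<le> (\<integral>\<^sup>+x. ennreal (g x) \<partial>?L)" unfolding defect_def by (intro nn_integral_mono) (simp add: indicator_def)
    then show ?case using g mass m(1) by (intro exI[of _ g]) simp
  next
    case (Suc i)
    then obtain g' where g': "bounded_density S R g'" "(\<integral>\<^sup>+x. ennreal (g' x) \<partial>?L) = emeasure ?L (cball 0 r)"
      "simplex_energy S j0 N g' \<le> simplex_energy S j0 N g" "defect S r g' + ennreal (real i * c) \<le> ennreal m" by blast
    have "\<not> defect S r g' < ennreal e" using no g'(1-3) by blast
    then have "ennreal e * ennreal e \<le> defect S r g' * defect S r g'" by (intro mult_mono) auto
    moreover have "ennreal c * ennreal V < ennreal e * ennreal e"
    proof -
      have "c * V = e\<^sup>2 / 2" using V(2) by (simp add: c_def)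
      also have "\<dots> < e * e" using e by (simp add: power2_eq_square)
      finally show ?thesis using e c V(2) by (simp add: ennreal_mult[symmetric] ennreal_less_iff)
    qed
    ultimately have "ennreal c * emeasure ?L (cball 0 (2 * R)) < defect S r g' * defect S r g'" by (simp add: V(1))
    from steiner_step[OF i0 j0 g'(1) r g'(2) this, of N] obtain g'' where
      g'': "bounded_density S R g''" "(\<integral>\<^sup>+x. ennreal (g'' x) \<partial>?L) = emeasure ?L (cball 0 r)"
      "simplex_energy S j0 N g'' \<le> simplex_energy S j0 N g'" "defect S r g'' + ennreal c \<le> defect S r g'" by blast
    have "defect S r g'' + ennreal (real (Suc i) * c) = defect S r g'' + ennreal c + ennreal (real i * c)"
      using c by (simp add: algebra_simps ennreal_plus[symmetric] del: ennreal_plus)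
    also have "\<dots> \<le> defect S r g' + ennreal (real i * c)" by (rule add_right_mono[OF g''(4)])
    also have "\<dots> \<le> ennreal m" by (rule g'(4))
    finally show ?case using g''(1,2) order_trans[OF g''(3) g'(3)] by blast
  qed
  note all = this
  obtain i :: nat where i: "m < real i * c" using c reals_Archimedean3 by blast
  obtain g' where "defect S r g' + ennreal (real i * c) \<le> ennreal m" using all[of i] by blast
  then have "ennreal (real i * c) \<le> ennreal m" by (meson add_increasing order_refl order_trans zero_le)
  then show False using i m(2) by (simp add: ennreal_le_iff)
qed

section \<open>Groemer's inequality\<close>

lemma abs_det_le:
  fixes A :: "real^'n^'n"
  assumes "\<And>i j. \<bar>A $ i $ j\<bar> \<le> c"
  shows "\<bar>det A\<bar> \<le> fact CARD('n) * c ^ CARD('n)"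
proof -
  have "\<bar>det A\<bar> \<le> (\<Sum>p\<in>{p. p permutes (UNIV::'n set)}. \<bar>of_int (sign p) * (\<Prod>i\<in>UNIV. A $ i $ p i)\<bar>)"
    unfolding det_def by (rule sum_abs)
  also have "\<dots> \<le> (\<Sum>p\<in>{p. p permutes (UNIV::'n set)}. c ^ CARD('n))"
  proof (rule sum_mono)
    fix p :: "'n \<Rightarrow> 'n"
    have "\<bar>of_int (sign p) * (\<Prod>i\<in>UNIV. A $ i $ p i)\<bar> = (\<Prod>i\<in>UNIV. \<bar>A $ i $ p i\<bar>)"
      by (simp add: abs_mult abs_prod sign_def)
    also have "\<dots> \<le> (\<Prod>i\<in>(UNIV::'n set). c)" by (rule prod_mono) (use assms in auto)
    finally show "\<bar>of_int (sign p) * (\<Prod>i\<in>UNIV. A $ i $ p i)\<bar> \<le> c ^ CARD('n)" by simp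
  qed
  also have "\<dots> = fact CARD('n) * c ^ CARD('n)" by (simp add: card_permutations)
  finally show ?thesis .
qed

text \<open>Expanding the determinant bounds it by a factorial times a power of a bound on the
  entries; the 1 in the maximum accounts for the entries of the identity padding.\<close>

lemma gram_vol_bounded:
  fixes S :: "'n::finite set"
  obtains C where "0 \<le> C" "\<And>Y::'n \<Rightarrow> 'a::real_inner. (\<And>j. j \<in> S \<Longrightarrow> norm (Y j) \<le> r) \<Longrightarrow> gram_vol S Y ^ N \<le> C"
proof
  let ?C = "sqrt (fact CARD('n) * (max 1 (r * r)) ^ CARD('n)) ^ N"
  show "0 \<le> ?C" by (intro zero_le_power real_sqrt_ge_zero mult_nonneg_nonneg) auto
  fix Y :: "'n \<Rightarrow> 'a" assume Y: "\<And>j. j \<in> S \<Longrightarrow> norm (Y j) \<le> r"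
  have "\<bar>det (gram S Y)\<bar> \<le> fact CARD('n) * (max 1 (r * r)) ^ CARD('n)"
  proof (rule abs_det_le)
    fix i j
    show "\<bar>gram S Y $ i $ j\<bar> \<le> max 1 (r * r)"
    proof (cases "i \<in> S \<and> j \<in> S")
      case True
      have "\<bar>Y i \<bullet> Y j\<bar> \<le> norm (Y i) * norm (Y j)" by (rule Cauchy_Schwarz_ineq2)
      also have "\<dots> \<le> r * r" using Y True by (intro mult_mono) (auto intro: order_trans[OF norm_ge_zero])
      finally show ?thesis using True by (simp add: gram_def)
    qed (auto simp: gram_def)
  qed
  then show "gram_vol S Y ^ N \<le> ?C" unfolding gram_vol_def by (intro power_mono real_sqrt_le_mono) auto
qed

text \<open>The Weierstrass product inequality. It exchanges the indicator of the ball at all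
  vertices for the density at all vertices, at the cost of one error term per vertex.\<close>

lemma one_le_prod_plus_sum:
  fixes g :: "'i \<Rightarrow> real"
  assumes "finite T" "\<And>i. i \<in> T \<Longrightarrow> 0 \<le> g i" "\<And>i. i \<in> T \<Longrightarrow> g i \<le> 1"
  shows "1 \<le> (\<Prod>i\<in>T. g i) + (\<Sum>i\<in>T. 1 - g i)"
  using assms
proof (induction T rule: finite_induct)
  case (insert i T)
  let ?P = "\<Prod>i\<in>T. g i"
  have P: "?P \<le> 1" using insert.prems by (intro prod_le_1) auto
  have "0 \<le> (1 - g i) * (1 - ?P)" using P insert.prems by simp
  then have "1 \<le> g i * ?P + (1 - g i) + (1 - ?P)" using insert.prems by (simp add: algebra_simps)
  moreover have "1 - ?P \<le> (\<Sum>i\<in>T. 1 - g i)" using insert by simp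
  ultimately show ?case using insert(1,2) by simp
qed simp

text \<open>One-sided continuity of the energy at the ball. In each error term of the product
  inequality one vertex carries the missing mass, whose total is the defect, while the others range
  over the ball, where the Gram volume of the edges is bounded.\<close>

lemma simplex_energy_ball_le_defect:
  fixes S :: "'n::finite set"
  assumes j0: "j0 \<notin> S" and r: "0 < r"
  shows "\<exists>C\<ge>0. \<forall>R g. bounded_density S R g \<longrightarrow>
    (\<integral>\<^sup>+x. ennreal (g x) \<partial>coord_lborel S) = emeasure (coord_lborel S) (cball 0 r) \<longrightarrow>
    simplex_energy S j0 N (indicator (cball 0 r)) \<le> simplex_energy S j0 N g + ennreal C * defect S r g"
proof -
  let ?L = "coord_lborel S" and ?T = "insert j0 S" and ?B = "cball 0 r :: (real^'n) set"
  interpret L: sigma_finite_measure ?L by (rule sigma_finite_span_lborel[OF orthonormal_coord_basis])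
  interpret P: product_sigma_finite "\<lambda>_::'n. ?L" by (rule L.product_power)
  obtain C where C: "0 \<le> C" "\<And>Y::'n \<Rightarrow> real^'n. (\<And>j. j \<in> S \<Longrightarrow> norm (Y j) \<le> 2 * r) \<Longrightarrow> gram_vol S Y ^ N \<le> C"
    using gram_vol_bounded[of S "2 * r" N] by blast
  define m where "m = unit_ball_vol (real (card S)) * r ^ card S"
  have m: "emeasure ?L ?B = ennreal m" "0 \<le> m" using emeasure_coord_cball[OF r, of S] r by (simp_all add: m_def)
  \<comment> \<open>There are \<open>card ?T\<close> error terms; in each of them the remaining
    \<open>card S\<close> vertices contribute the volume \<open>m\<close> of the ball.\<close>
  define C' where "C' = C * (real (card ?T) * m ^ card S)"
  show ?thesis
  proof (intro exI[of _ C'] conjI allI impI)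
    show "0 \<le> C'" using C(1) m(2) by (simp add: C'_def)
    fix R and g :: "real^'n \<Rightarrow> real"
    assume g: "bounded_density S R g" and mass: "(\<integral>\<^sup>+x. ennreal (g x) \<partial>?L) = emeasure ?L ?B"
    have gm[measurable]: "g \<in> borel_measurable borel" using g by (simp add: bounded_density_def)
    have g01: "0 \<le> g x" "g x \<le> 1" for x using g by (simp_all add: bounded_density_def)
    let ?W = "\<lambda>X. ennreal (gram_vol S (\<lambda>j. X j - X j0) ^ N)"
    let ?h = "\<lambda>i j x. if j = i then ennreal (1 - g x) * indicator ?B x else indicator ?B x :: ennreal"
    have hm: "?h i j \<in> borel_measurable borel" for i j by (cases "j = i") auto
    have pm: "(\<lambda>X. \<Prod>j\<in>?T. ?h i j (X j)) \<in> borel_measurable (powM ?T ?L)" for i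
      by (intro borel_measurable_prod_ennreal measurable_compose[OF measurable_component_borel hm]) simp_all
    have em: "(\<lambda>X. ?W X * (\<Prod>i\<in>?T. ennreal (g (X i)))) \<in> borel_measurable (powM ?T ?L)"
      by (rule measurable_energy_integrand[OF _ gm]) simp
    have "simplex_energy S j0 N (indicator ?B) \<le>
      (\<integral>\<^sup>+X. ?W X * (\<Prod>i\<in>?T. ennreal (g (X i))) + ennreal C * (\<Sum>i\<in>?T. \<Prod>j\<in>?T. ?h i j (X j)) \<partial>powM ?T ?L)"
      unfolding simplex_energy_def
    proof (rule nn_integral_mono)
      fix X :: "'n \<Rightarrow> real^'n"
      show "?W X * (\<Prod>i\<in>?T. ennreal (indicator ?B (X i))) \<le>
        ?W X * (\<Prod>i\<in>?T. ennreal (g (X i))) + ennreal C * (\<Sum>i\<in>?T. \<Prod>j\<in>?T. ?h i j (X j))"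
      proof (cases "\<forall>i\<in>?T. X i \<in> ?B")
        case True
        have h1: "(\<Prod>j\<in>?T. ?h i j (X j)) = ennreal (1 - g (X i))" if i: "i \<in> ?T" for i
        proof -
          have "(\<Prod>j\<in>?T. ?h i j (X j)) = (\<Prod>j\<in>?T. if j = i then ennreal (1 - g (X i)) else 1)"
            by (rule prod.cong) (use True in auto)
          also have "\<dots> = ennreal (1 - g (X i))" using i by (simp add: prod.delta)
          finally show ?thesis .
        qed
        have "gram_vol S (\<lambda>j. X j - X j0) ^ N \<le> C"
        proof (rule C(2))
          fix j assume "j \<in> S"
          then have "norm (X j) \<le> r" "norm (X j0) \<le> r" using True by auto
          then show "norm (X j - X j0) \<le> 2 * r" using norm_triangle_ineq4[of "X j" "X j0"] by linarith
        qed
        then have WC: "?W X \<le> ennreal C" by (rule ennreal_leI)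
        have "(1::ennreal) = ennreal 1" by simp
        also have "\<dots> \<le> ennreal ((\<Prod>i\<in>?T. g (X i)) + (\<Sum>i\<in>?T. 1 - g (X i)))"
          using g01 by (intro ennreal_leI one_le_prod_plus_sum) auto
        also have "\<dots> = (\<Prod>i\<in>?T. ennreal (g (X i))) + (\<Sum>i\<in>?T. ennreal (1 - g (X i)))"
          using g01 by (subst ennreal_plus) (auto intro!: prod_nonneg sum_nonneg simp: prod_ennreal sum_ennreal)
        finally have 1: "(1::ennreal) \<le> (\<Prod>i\<in>?T. ennreal (g (X i))) + (\<Sum>i\<in>?T. ennreal (1 - g (X i)))" .
        have "?W X * (\<Prod>i\<in>?T. ennreal (indicator ?B (X i))) = ?W X * 1"
          using True by (intro arg_cong2[where f="(*)"] refl prod.neutral) auto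
        also have "\<dots> \<le> ?W X * ((\<Prod>i\<in>?T. ennreal (g (X i))) + (\<Sum>i\<in>?T. ennreal (1 - g (X i))))"
          by (rule mult_left_mono[OF 1]) simp
        also have "\<dots> = ?W X * (\<Prod>i\<in>?T. ennreal (g (X i))) + ?W X * (\<Sum>i\<in>?T. ennreal (1 - g (X i)))"
          by (rule distrib_left)
        also have "\<dots> \<le> ?W X * (\<Prod>i\<in>?T. ennreal (g (X i))) + ennreal C * (\<Sum>i\<in>?T. ennreal (1 - g (X i)))"
          by (intro add_left_mono mult_right_mono WC) simp
        also have "(\<Sum>i\<in>?T. ennreal (1 - g (X i))) = (\<Sum>i\<in>?T. \<Prod>j\<in>?T. ?h i j (X j))"
          by (rule sum.cong[OF refl]) (rule h1[symmetric])
        finally show ?thesis .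
      next
        case False
        then have z: "(\<Prod>i\<in>?T. ennreal (indicator ?B (X i))) = 0" by (intro prod_zero) (auto simp: indicator_def)
        show ?thesis unfolding z by simp
      qed
    qed
    also have "\<dots> = simplex_energy S j0 N g + ennreal C * (\<integral>\<^sup>+X. (\<Sum>i\<in>?T. \<Prod>j\<in>?T. ?h i j (X j)) \<partial>powM ?T ?L)"
    proof -
      have sm: "(\<lambda>X. \<Sum>i\<in>?T. \<Prod>j\<in>?T. ?h i j (X j)) \<in> borel_measurable (powM ?T ?L)"
        by (rule borel_measurable_sum) (rule pm)
      show ?thesis unfolding simplex_energy_def nn_integral_cmult[OF sm, symmetric]
        by (rule nn_integral_add[OF em]) (intro borel_measurable_times_ennreal borel_measurable_const sm)
    qed
    also have "(\<integral>\<^sup>+X. (\<Sum>i\<in>?T. \<Prod>j\<in>?T. ?h i j (X j)) \<partial>powM ?T ?L) = (\<Sum>i\<in>?T. \<integral>\<^sup>+X. (\<Prod>j\<in>?T. ?h i j (X j)) \<partial>powM ?T ?L)"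
      by (rule nn_integral_sum) (rule pm)
    also have "\<dots> = (\<Sum>i\<in>?T. defect S r g * ennreal m ^ card S)"
    proof (rule sum.cong[OF refl])
      fix i assume i: "i \<in> ?T"
      have "(\<integral>\<^sup>+X. (\<Prod>j\<in>?T. ?h i j (X j)) \<partial>powM ?T ?L) = (\<Prod>j\<in>?T. \<integral>\<^sup>+x. ?h i j x \<partial>?L)"
        by (rule P.product_nn_integral_prod) (use hm in auto)
      also have "\<dots> = (\<integral>\<^sup>+x. ?h i i x \<partial>?L) * (\<Prod>j\<in>?T - {i}. \<integral>\<^sup>+x. ?h i j x \<partial>?L)"
        using i by (intro prod.remove) auto
      also have "(\<integral>\<^sup>+x. ?h i i x \<partial>?L) = defect S r g" using defect_complement[OF g r mass] by simp
      also have "(\<Prod>j\<in>?T - {i}. \<integral>\<^sup>+x. ?h i j x \<partial>?L) = (\<Prod>j\<in>?T - {i}. ennreal m)"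
        by (rule prod.cong) (auto simp: m)
      also have "\<dots> = ennreal m ^ card S" using i j0 by simp
      finally show "(\<integral>\<^sup>+X. (\<Prod>j\<in>?T. ?h i j (X j)) \<partial>powM ?T ?L) = defect S r g * ennreal m ^ card S" .
    qed
    also have "ennreal C * (\<Sum>i\<in>?T. defect S r g * ennreal m ^ card S) = ennreal C' * defect S r g"
      using C(1) m(2) by (simp add: C'_def ennreal_mult ennreal_power ennreal_of_nat_eq_real_of_nat mult_ac del: card_insert_disjoint)
    finally show "simplex_energy S j0 N (indicator ?B) \<le> simplex_energy S j0 N g + ennreal C' * defect S r g" .
  qed
qed

text \<open>Symmetrization does not raise the energy and makes the defect arbitrarily small, while
  the energy of the ball exceeds that of a density by at most a fixed multiple of its
  defect.\<close>

lemma simplex_energy_ball_minimal: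
  fixes S :: "'n::finite set"
  assumes i0: "i0 \<in> S" and j0: "j0 \<notin> S" and g: "bounded_density S R g" and r: "0 < r" "r \<le> R"
    and mass: "(\<integral>\<^sup>+x. ennreal (g x) \<partial>coord_lborel S) = emeasure (coord_lborel S) (cball 0 r)"
  shows "simplex_energy S j0 N (indicator (cball 0 r)) \<le> simplex_energy S j0 N g"
proof (rule ennreal_le_epsilon)
  fix e :: real assume e: "0 < e"
  obtain C where C: "0 \<le> C" "\<And>R g. bounded_density S R g \<Longrightarrow>
    (\<integral>\<^sup>+x. ennreal (g x) \<partial>coord_lborel S) = emeasure (coord_lborel S) (cball 0 r) \<Longrightarrow>
    simplex_energy S j0 N (indicator (cball 0 r)) \<le> simplex_energy S j0 N g + ennreal C * defect S r g"
    using simplex_energy_ball_le_defect[OF j0 r(1), of N] by blast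
  define e' where "e' = e / (C + 1)"
  have e': "0 < e'" "C * e' \<le> e" using e C(1) by (simp_all add: e'_def field_simps)
  obtain g' where g': "bounded_density S R g'"
    "(\<integral>\<^sup>+x. ennreal (g' x) \<partial>coord_lborel S) = emeasure (coord_lborel S) (cball 0 r)"
    "simplex_energy S j0 N g' \<le> simplex_energy S j0 N g" "defect S r g' < ennreal e'"
    using steiner_iteration[OF i0 j0 g r mass e'(1), of N] by blast
  have "simplex_energy S j0 N (indicator (cball 0 r)) \<le> simplex_energy S j0 N g' + ennreal C * defect S r g'"
    by (rule C(2)[OF g'(1,2)])
  also have "\<dots> \<le> simplex_energy S j0 N g + ennreal C * ennreal e'"
    using g'(3,4) by (intro add_mono mult_left_mono) auto
  also have "ennreal C * ennreal e' \<le> ennreal e" using C(1) e' by (simp add: ennreal_mult[symmetric] ennreal_leI)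
  finally show "simplex_energy S j0 N (indicator (cball 0 r)) \<le> simplex_energy S j0 N g + ennreal e"
    by (simp add: add_left_mono)
qed

lemma gram_vol_scale:
  fixes Y :: "'n \<Rightarrow> real^'n"
  assumes r: "0 \<le> r"
  shows "gram_vol S (\<lambda>j. r *\<^sub>R Y j) = r ^ card S * gram_vol S Y"
proof -
  let ?Z = "\<lambda>j. r *\<^sub>R axis j 1 :: real^'n"
  have Z: "?Z j \<in> span (coord_basis S)" if "j \<in> S" for j by (intro span_scale axis_in_span_coord_basis that)
  have "tuple_mult S Y ?Z j = r *\<^sub>R Y j" if "j \<in> S" for j
  proof -
    have "(?Z j $ i) *\<^sub>R Y i = (if i = j then r *\<^sub>R Y j else 0)" for i by (auto simp: axis_def)
    then have "tuple_mult S Y ?Z j = (\<Sum>i\<in>S. if i = j then r *\<^sub>R Y j else 0)"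
      unfolding tuple_mult_def using that by (simp only: restrict_apply if_True)
    then show ?thesis using that by simp
  qed
  then have "gram_vol S (\<lambda>j. r *\<^sub>R Y j) = gram_vol S (tuple_mult S Y ?Z)" by (intro gram_vol_cong) simp
  also have "\<dots> = gram_vol S Y * \<bar>det (col_matrix S ?Z)\<bar>" by (rule gram_vol_tuple_mult[OF Z])
  also have "det (col_matrix S ?Z) = (\<Prod>i\<in>UNIV. col_matrix S ?Z $ i $ i)"
    by (rule det_diagonal) (auto simp: col_matrix_def axis_def)
  also have "\<dots> = (\<Prod>i\<in>UNIV. if i \<in> S then r else 1)" by (rule prod.cong) (auto simp: col_matrix_def)
  also have "\<dots> = r ^ card S" by (simp add: prod.If_cases)
  finally show ?thesis using r by simp
qed

text \<open>Scaling \<open>card S + 1\<close> vertices in dimension \<open>card S\<close> gives the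
  exponent \<open>card S * (card S + 1)\<close>; the \<open>N\<close>-th power of the Gram volume
  adds \<open>card S * N\<close>.\<close>

lemma simplex_energy_ball:
  fixes S :: "'n::finite set"
  assumes j0: "j0 \<notin> S" and r: "0 < r"
  shows "simplex_energy S j0 N (indicator (cball 0 r)) = ennreal (r ^ (card S * (card S + 1 + N))) * simplex_energy S j0 N (indicator (cball 0 1))"
proof -
  let ?L = "coord_lborel S" and ?T = "insert j0 S" and ?k = "card S"
  let ?G = "\<lambda>X. ennreal (gram_vol S (\<lambda>j. X j - X j0) ^ N) * (\<Prod>i\<in>?T. ennreal (indicator (cball 0 r) (X i)))"
  have Gm: "?G \<in> borel_measurable (powM ?T ?L)" by (rule measurable_energy_integrand) simp_all
  have "(\<Prod>i\<in>?T. ennreal (\<bar>r\<bar> ^ card (coord_basis S))) * (\<integral>\<^sup>+X. ?G (\<lambda>i\<in>?T. r *\<^sub>R X i) \<partial>powM ?T ?L) = (\<integral>\<^sup>+X. ?G X \<partial>powM ?T ?L)"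
  proof (rule nn_integral_PiM_componentwise[OF sigma_finite_span_lborel[OF orthonormal_coord_basis] _ _ _ Gm])
    show "(*\<^sub>R) r \<in> measurable ?L ?L" by (simp cong: measurable_cong_sets)
    show "ennreal (\<bar>r\<bar> ^ card (coord_basis S)) * (\<integral>\<^sup>+x. f (r *\<^sub>R x) \<partial>?L) = (\<integral>\<^sup>+x. f x \<partial>?L)" if "f \<in> borel_measurable ?L" for f
      by (rule nn_integral_span_lborel_scale) (use r that in auto)
  qed simp
  note eq = this
  have P: "(\<Prod>i\<in>?T. ennreal (\<bar>r\<bar> ^ card (coord_basis S))) = ennreal ((r ^ ?k) ^ (?k + 1))"
    using r j0 by (simp add: ennreal_power ennreal_mult)
  have 1: "simplex_energy S j0 N (indicator (cball 0 r)) = ennreal ((r ^ ?k) ^ (?k + 1)) * (\<integral>\<^sup>+X. ?G (\<lambda>i\<in>?T. r *\<^sub>R X i) \<partial>powM ?T ?L)"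
    unfolding simplex_energy_def using eq[symmetric] unfolding P .
  have G: "?G (\<lambda>i\<in>?T. r *\<^sub>R X i) = ennreal (r ^ (?k * N)) * (ennreal (gram_vol S (\<lambda>j. X j - X j0) ^ N) * (\<Prod>i\<in>?T. ennreal (indicator (cball 0 1) (X i))))" for X :: "'n \<Rightarrow> real^'n"
  proof -
    have "gram_vol S (\<lambda>j. (\<lambda>i\<in>?T. r *\<^sub>R X i) j - (\<lambda>i\<in>?T. r *\<^sub>R X i) j0) = gram_vol S (\<lambda>j. r *\<^sub>R (X j - X j0))"
      by (rule gram_vol_cong) (simp add: scaleR_diff_right)
    also have "\<dots> = r ^ ?k * gram_vol S (\<lambda>j. X j - X j0)"
      using gram_vol_scale[of r S "\<lambda>j. X j - X j0"] r by simp
    finally have a: "gram_vol S (\<lambda>j. (\<lambda>i\<in>?T. r *\<^sub>R X i) j - (\<lambda>i\<in>?T. r *\<^sub>R X i) j0) = r ^ ?k * gram_vol S (\<lambda>j. X j - X j0)" .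
    have b: "(\<Prod>i\<in>?T. ennreal (indicator (cball 0 r) ((\<lambda>i\<in>?T. r *\<^sub>R X i) i))) = (\<Prod>i\<in>?T. ennreal (indicator (cball 0 1) (X i)))"
      by (rule prod.cong) (use r in \<open>auto simp: indicator_def\<close>)
    show ?thesis unfolding a b using r by (simp add: power_mult_distrib power_mult ennreal_mult mult.assoc del: prod.insert)
  qed
  have m1: "(\<lambda>X. ennreal (gram_vol S (\<lambda>j. X j - X j0) ^ N) * (\<Prod>i\<in>?T. ennreal (indicator (cball 0 1) (X i)))) \<in> borel_measurable (powM ?T ?L)"
    by (rule measurable_energy_integrand) simp_all
  have "(\<integral>\<^sup>+X. ?G (\<lambda>i\<in>?T. r *\<^sub>R X i) \<partial>powM ?T ?L) = ennreal (r ^ (?k * N)) * simplex_energy S j0 N (indicator (cball 0 1))"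
    unfolding G simplex_energy_def by (rule nn_integral_cmult[OF m1])
  then have "simplex_energy S j0 N (indicator (cball 0 r)) = (ennreal ((r ^ ?k) ^ (?k + 1)) * ennreal (r ^ (?k * N))) * simplex_energy S j0 N (indicator (cball 0 1))"
    unfolding 1 by (simp only: mult.assoc)
  also have "ennreal ((r ^ ?k) ^ (?k + 1)) * ennreal (r ^ (?k * N)) = ennreal (r ^ (?k * (?k + 1 + N)))"
    using r by (simp only: ennreal_mult[symmetric] zero_le_power less_imp_le power_mult[symmetric] power_add[symmetric] distrib_left)
  finally show ?thesis .
qed

lemma simplex_energy_mono:
  assumes "\<And>x. 0 \<le> g x" "\<And>x. g x \<le> h x"
  shows "simplex_energy S j0 N g \<le> simplex_energy S j0 N h"
proof -
  have "0 \<le> h x" for x using assms order_trans by blast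
  then have "(\<Prod>i\<in>insert j0 S. ennreal (g (X i))) \<le> (\<Prod>i\<in>insert j0 S. ennreal (h (X i)))" for X
    using assms by (simp only: prod_ennreal) (intro ennreal_leI prod_mono, simp)
  then show ?thesis unfolding simplex_energy_def by (intro nn_integral_mono mult_left_mono) simp_all
qed

text \<open>The double supremum that arises in the induction is bounded along the diagonal, since
  the sequence increases.\<close>

lemma SUP_power_ennreal:
  fixes f :: "nat \<Rightarrow> ennreal"
  assumes "incseq f"
  shows "(SUP i. f i) ^ p \<le> (SUP i. f i ^ p)"
proof (induction p)
  case (Suc p)
  have "(SUP i. f i) ^ Suc p \<le> (SUP i. f i) * (SUP j. f j ^ p)" using Suc by (simp add: mult_left_mono)
  also have "\<dots> = (SUP j. (SUP i. f i) * f j ^ p)" by (rule SUP_mult_left_ennreal)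
  also have "\<dots> \<le> (SUP i. f i ^ Suc p)"
  proof (rule SUP_least)
    fix j
    have "(SUP i. f i) * f j ^ p = (SUP i. f i * f j ^ p)"
      by (subst (1 2) mult.commute) (rule SUP_mult_left_ennreal)
    also have "\<dots> \<le> (SUP i. f i ^ Suc p)"
    proof (rule SUP_least)
      fix i
      have "f i * f j ^ p \<le> f (max i j) * f (max i j) ^ p"
        using assms by (intro mult_mono power_mono) (auto simp: incseq_def)
      also have "\<dots> \<le> (SUP i. f i ^ Suc p)" by (rule SUP_upper2[of "max i j"]) simp_all
      finally show "f i * f j ^ p \<le> (SUP i. f i ^ Suc p)" .
    qed
    finally show "(SUP i. f i) * f j ^ p \<le> (SUP i. f i ^ Suc p)" .
  qed
  finally show ?case .
qed simp

text \<open>The function is truncated to a ball of radius \<open>m\<close>, where its support is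
  bounded and its mass finite, and compared with the ball of the same mass. For a ball of radius
  \<open>r\<close> the mass is a multiple of \<open>r ^ card S\<close> and the energy a multiple of
  \<open>r ^ (card S * (card S + 1 + N))\<close>, so the energy is proportional to the mass to the
  power \<open>card S + 1 + N\<close>. Monotone convergence removes the truncation.\<close>

theorem Groemer_inequality:
  fixes S :: "'n::finite set"
  assumes i0: "i0 \<in> S" and j0: "j0 \<notin> S" and gm [measurable]: "g \<in> borel_measurable borel"
    and g01: "\<And>x. 0 \<le> g x" "\<And>x. g x \<le> 1"
  shows "simplex_energy S j0 N (indicator (cball 0 1)) * (\<integral>\<^sup>+x. ennreal (g x) \<partial>coord_lborel S) ^ (card S + 1 + N)
     \<le> ennreal (unit_ball_vol (real (card S)) ^ (card S + 1 + N)) * simplex_energy S j0 N g"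
    (is "?A * ?I ^ ?p \<le> ?w * ?E")
proof -
  let ?L = "coord_lborel S" and ?k = "card S"
  define h where "h m x = g x * indicator (cball 0 (real m)) x" for m :: nat and x
  define I where "I m = (\<integral>\<^sup>+x. ennreal (h m x) \<partial>?L)" for m
  have k: "0 < ?k" using i0 by (auto simp: card_gt_0_iff)
  have hm[measurable]: "h m \<in> borel_measurable borel" for m unfolding h_def by measurable
  have h01: "0 \<le> h m x" "h m x \<le> g x" "h m x \<le> 1" for m x using g01[of x] by (auto simp: h_def indicator_def)
  have hinc: "h m x \<le> h m' x" if "m \<le> m'" for m m' x
  proof -
    have "indicator (cball 0 (real m)) x \<le> (indicator (cball 0 (real m')) x :: real)"
      using that by (intro indicator_leI) auto
    then show ?thesis unfolding h_def using g01(1)[of x] by (intro mult_left_mono) auto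
  qed
  have Iinc: "incseq I" unfolding incseq_def I_def by (intro allI impI nn_integral_mono ennreal_leI hinc)
  have "(SUP m. I m) = (\<integral>\<^sup>+x. (SUP m. ennreal (h m x)) \<partial>?L)"
    unfolding I_def by (rule nn_integral_monotone_convergence_SUP[symmetric])
      (auto simp: incseq_def le_fun_def intro!: ennreal_leI hinc)
  also have "\<dots> = ?I"
  proof (intro nn_integral_cong antisym)
    fix x
    show "(SUP m. ennreal (h m x)) \<le> ennreal (g x)" by (intro SUP_least ennreal_leI h01)
    obtain m :: nat where "norm x \<le> real m" using real_arch_simple by blast
    then have "h m x = g x" by (simp add: h_def)
    then show "ennreal (g x) \<le> (SUP m. ennreal (h m x))" by (intro SUP_upper2[of m]) simp_all
  qed
  finally have SUP: "(SUP m. I m) = ?I" .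
  have bd: "?A * I m ^ ?p \<le> ?w * ?E" for m
  proof (cases "I m = 0")
    case False
    have hb: "bounded_density S (real m) (h m)"
      unfolding bounded_density_def using h01 hm by (auto simp: h_def indicator_def split: if_splits)
    \<comment> \<open>For \<open>m = 0\<close> the support shrinks to the origin, which lies in the
      null hyperplane of points with coordinate \<open>i0\<close> equal to 0; this contradicts the
      positive mass.\<close>
    have "m \<noteq> 0"
    proof
      assume m: "m = 0"
      have "I m \<le> (\<integral>\<^sup>+x. indicator {x. x $ i0 = 0} x \<partial>?L)"
        unfolding I_def m using g01(2) by (intro nn_integral_mono) (auto simp: h_def indicator_def)
      also have "\<dots> = 0"
      proof -
        have lin: "linear (\<lambda>x::real^'n. x $ i0)" by (rule linearI) simp_all
        have "AE x in ?L. x $ i0 \<noteq> 0"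
          by (rule span_lborel_hyperplane_null[OF orthonormal_coord_basis lin axis_in_span_coord_basis[OF i0]]) simp
        moreover have [measurable]: "(\<lambda>x::real^'n. x $ i0) \<in> borel_measurable borel" by (rule measurable_nth_borel)
        ultimately show ?thesis by (subst nn_integral_0_iff_AE) auto
      qed
      finally show False using False by simp
    qed
    then have m0: "real m > 0" by simp
    have w0: "unit_ball_vol (real ?k) > 0" by simp
    have "I m \<le> (\<integral>\<^sup>+x. indicator (cball 0 (real m)) x \<partial>?L)"
      unfolding I_def using g01(2) by (intro nn_integral_mono) (auto simp: h_def indicator_def)
    also have "\<dots> = ennreal (unit_ball_vol (real ?k) * real m ^ ?k)" using emeasure_coord_cball[OF m0, of S] by simp
    finally have Ile: "I m \<le> ennreal (unit_ball_vol (real ?k) * real m ^ ?k)" .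
    then have "I m < \<infinity>" by (simp add: le_less_trans)
    then obtain c where c: "I m = ennreal c" "0 < c" using False by (cases "I m") (auto simp: ennreal_eq_0_iff less_le)
    \<comment> \<open>The radius of the ball with the mass of the truncated function. That mass is
      at most the volume of the ball of radius \<open>m\<close>, which gives the bound on
      \<open>r\<close> needed for symmetrization inside the larger ball.\<close>
    define r where "r = root ?k (c / unit_ball_vol (real ?k))"
    have r0: "0 < r" using k c(2) w0 by (simp add: r_def real_root_gt_zero)
    have rk: "unit_ball_vol (real ?k) * r ^ ?k = c"
      using k c(2) w0 less_imp_neq[OF w0] by (simp add: r_def real_root_pow_pos2)
    have "r ^ ?k \<le> real m ^ ?k"
    proof -
      have "c \<le> unit_ball_vol (real ?k) * real m ^ ?k" using Ile w0 unfolding c(1) by (subst (asm) ennreal_le_iff) auto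
      then have "unit_ball_vol (real ?k) * r ^ ?k \<le> unit_ball_vol (real ?k) * real m ^ ?k" unfolding rk .
      then show ?thesis using w0 by simp
    qed
    then have rm: "r \<le> real m" using k r0 by (intro power_le_imp_le_base[of r "?k - 1" "real m"]) auto
    have mass: "(\<integral>\<^sup>+x. ennreal (h m x) \<partial>?L) = emeasure ?L (cball 0 r)"
      using emeasure_coord_cball[OF r0, of S] c(1) rk by (simp add: I_def)
    have "I m ^ ?p = ennreal ((unit_ball_vol (real ?k) * r ^ ?k) ^ ?p)"
      unfolding c(1) rk using c(2) by (intro ennreal_power) simp
    also have "(unit_ball_vol (real ?k) * r ^ ?k) ^ ?p = unit_ball_vol (real ?k) ^ ?p * r ^ (?k * ?p)"
      by (simp only: power_mult_distrib power_mult)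
    also have "ennreal \<dots> = ?w * ennreal (r ^ (?k * ?p))" using r0 w0 by (intro ennreal_mult) auto
    finally have "?A * I m ^ ?p = ?A * (?w * ennreal (r ^ (?k * ?p)))" by (simp only:)
    also have "\<dots> = ?w * (ennreal (r ^ (?k * ?p)) * ?A)" by (simp only: mult_ac)
    also have "\<dots> = ?w * simplex_energy S j0 N (indicator (cball 0 r))" by (simp only: simplex_energy_ball[OF j0 r0])
    also have "\<dots> \<le> ?w * simplex_energy S j0 N (h m)"
      by (intro mult_left_mono simplex_energy_ball_minimal[OF i0 j0 hb r0 rm mass]) simp
    also have "\<dots> \<le> ?w * ?E" by (intro mult_left_mono simplex_energy_mono h01) simp
    finally show ?thesis .
  qed simp
  have "?A * ?I ^ ?p \<le> ?A * (SUP m. I m ^ ?p)"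
    unfolding SUP[symmetric] by (intro mult_left_mono SUP_power_ennreal Iinc) simp
  also have "\<dots> = (SUP m. ?A * I m ^ ?p)" by (rule SUP_mult_left_ennreal)
  also have "\<dots> \<le> ?w * ?E" by (rule SUP_least) (rule bd)
  finally show ?thesis .
qed

section \<open>The affine Blaschke-Petkantschin formula\<close>

lemma translated_subspaces_eq:
  fixes V W :: "'a::real_vector set"
  assumes "subspace V" "subspace W" "(+) a ` V = (+) z ` W"
  shows "V = W" "a - z \<in> W"
proof -
  have "a \<in> (+) z ` W" using assms(3) subspace_0[OF assms(1)] by (metis add.right_neutral image_eqI)
  then show d: "a - z \<in> W" by auto
  show "V = W"
  proof (intro equalityI subsetI)
    fix v assume "v \<in> V"
    then obtain w where "w \<in> W" "a + v = z + w" using assms(3) by blast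
    then have "v = w - (a - z)" by (simp add: algebra_simps)
    then show "v \<in> W" using d \<open>w \<in> W\<close> assms(2) by (simp add: subspace_diff)
  next
    fix w assume w: "w \<in> W"
    then have "(a - z) + w \<in> W" using d assms(2) by (simp add: subspace_add)
    then have "z + ((a - z) + w) \<in> (+) a ` V" using assms(3) by blast
    then show "w \<in> V" by auto
  qed
qed

lemma orthonormal_frame_translate:
  assumes fr: "orthonormal_frame ((+) z ` span B) a b" and B: "orthonormal_set (B :: (real^'n) set)"
  defines "m \<equiv> card B"
  shows "nat (aff_dim ((+) z ` span B)) = m" "orthonormal_set (b ` {..<m})" "inj_on b {..<m}" "span (b ` {..<m}) = span B" "a - z \<in> span B"
proof -
  have d: "aff_dim ((+) z ` span B) = int m"
    using orthonormal_set_card[OF B] by (simp add: aff_dim_translation_eq aff_dim_subspace m_def)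
  then show nd: "nat (aff_dim ((+) z ` span B)) = m" by simp
  have on: "b i \<bullet> b j = (if i = j then 1 else 0)" if "i < m" "j < m" for i j
    using fr that unfolding orthonormal_frame_def Let_def nd by blast
  have F: "(+) z ` span B = {a + (\<Sum>i<m. c i *\<^sub>R b i) | c. True}"
    using fr unfolding orthonormal_frame_def Let_def nd by blast
  show inj: "inj_on b {..<m}"
  proof (rule inj_onI, rule ccontr)
    fix i j assume "i \<in> {..<m}" "j \<in> {..<m}" "b i = b j" "i \<noteq> j"
    then show False using on[of i j] on[of i i] by auto
  qed
  show ob: "orthonormal_set (b ` {..<m})"
    unfolding orthonormal_set_def using on inj by (auto simp: inj_on_eq_iff)
  have "span (b ` {..<m}) = {\<Sum>i<m. c i *\<^sub>R b i | c. True}"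
  proof (intro equalityI subsetI)
    fix x assume "x \<in> span (b ` {..<m})"
    then obtain u where "x = (\<Sum>v\<in>b ` {..<m}. u v *\<^sub>R v)" using span_finite[of "b ` {..<m}"] by auto
    then have "x = (\<Sum>i<m. u (b i) *\<^sub>R b i)" using inj by (simp add: sum.reindex)
    then show "x \<in> {\<Sum>i<m. c i *\<^sub>R b i | c. True}" by (intro CollectI exI[of _ "\<lambda>i. u (b i)"]) simp
  next
    fix x assume "x \<in> {\<Sum>i<m. c i *\<^sub>R b i | c. True}"
    then obtain c where x: "x = (\<Sum>i<m. c i *\<^sub>R b i)" by blast
    show "x \<in> span (b ` {..<m})" unfolding x by (rule span_sum, rule span_scale, rule span_base) simp
  qed
  then have "(+) a ` span (b ` {..<m}) = (+) z ` span B" unfolding F by (auto simp: image_def)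
  from translated_subspaces_eq[OF subspace_span subspace_span this]
  show "span (b ` {..<m}) = span B" "a - z \<in> span B" .
qed

lemma orthonormal_frame_exists:
  assumes B: "orthonormal_set (B :: (real^'n) set)"
  shows "\<exists>a b. orthonormal_frame ((+) z ` span B) a b"
proof -
  let ?m = "card B"
  have d: "nat (aff_dim ((+) z ` span B)) = ?m"
    using orthonormal_set_card[OF B] by (simp add: aff_dim_translation_eq aff_dim_subspace)
  obtain b where b: "bij_betw b {..<?m} B"
    using orthonormal_set_finite[OF B] by (metis ex_bij_betw_nat_finite atLeast0LessThan)
  have "(+) z ` span B = {z + (\<Sum>i<?m. c i *\<^sub>R b i) | c. True}"
  proof (intro equalityI subsetI)
    fix x assume "x \<in> (+) z ` span B"
    then obtain u where "x = z + (\<Sum>v\<in>B. u v *\<^sub>R v)" using span_finite[OF orthonormal_set_finite[OF B]] by auto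
    then have "x = z + (\<Sum>i<?m. u (b i) *\<^sub>R b i)" by (simp add: sum.reindex_bij_betw[OF b, of "\<lambda>v. u v *\<^sub>R v"])
    then show "x \<in> {z + (\<Sum>i<?m. c i *\<^sub>R b i) | c. True}" by (intro CollectI exI[of _ "\<lambda>i. u (b i)"]) simp
  next
    fix x assume "x \<in> {z + (\<Sum>i<?m. c i *\<^sub>R b i) | c. True}"
    then obtain c where x: "x = z + (\<Sum>i<?m. c i *\<^sub>R b i)" by blast
    have "b i \<in> B" if "i \<in> {..<?m}" for i using b that by (auto simp: bij_betw_def)
    then have "(\<Sum>i<?m. c i *\<^sub>R b i) \<in> span B" by (intro span_sum span_scale) (simp add: span_base)
    then show "x \<in> (+) z ` span B" unfolding x by (rule imageI)
  qed
  moreover have "b i \<bullet> b j = (if i = j then 1 else 0)" if "i < ?m" "j < ?m" for i j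
    using b B that unfolding orthonormal_set_def bij_betw_def by (metis imageI inj_on_eq_iff lessThan_iff)
  ultimately have "orthonormal_frame ((+) z ` span B) z b"
    unfolding orthonormal_frame_def Let_def d by blast
  then show ?thesis by blast
qed

text \<open>Whichever frame the choice in \<open>flat_lebesgue\<close> returns, its vectors form an
  orthonormal basis of the direction space, and its base point differs from \<open>z\<close> by a
  vector of that space. The measure depends on neither, by \<open>span_lborel_cong\<close> and
  translation invariance.\<close>

lemma flat_lebesgue_translate:
  fixes B :: "(real^'n) set" and z :: "real^'n"
  assumes B: "orthonormal_set B"
  defines "F \<equiv> (+) z ` span B"
  shows "space (flat_lebesgue F) = F"
    "\<And>g. g \<in> borel_measurable borel \<Longrightarrow> (g :: real^'n \<Rightarrow> ennreal) \<in> borel_measurable (flat_lebesgue F)"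
    "\<And>g. g \<in> borel_measurable borel \<Longrightarrow> (\<integral>\<^sup>+x. g x \<partial>flat_lebesgue F) = (\<integral>\<^sup>+x. g (z + x) \<partial>span_lborel B)"
    "\<And>A. A \<in> sets borel \<Longrightarrow> A \<inter> F \<in> sets (flat_lebesgue F)"
proof -
  let ?m = "card B"
  have dm: "nat (aff_dim F) = ?m"
    using orthonormal_set_card[OF B] by (simp add: F_def aff_dim_translation_eq aff_dim_subspace)
  have "\<exists>M a b. orthonormal_frame F a b \<and> M = completion
      (distr (\<Pi>\<^sub>M i\<in>{..<nat (aff_dim F)}. lborel) (restrict_space borel F) (\<lambda>c. a + (\<Sum>i<nat (aff_dim F). c i *\<^sub>R b i)))"
    using orthonormal_frame_exists[OF B, of z] unfolding F_def by blast
  from someI_ex[OF this] obtain a b where fr: "orthonormal_frame F a b" and M: "flat_lebesgue F = completion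
      (distr (\<Pi>\<^sub>M i\<in>{..<?m}. lborel) (restrict_space borel F) (\<lambda>c. a + (\<Sum>i<?m. c i *\<^sub>R b i)))"
    unfolding flat_lebesgue_def dm by blast
  note fr' = orthonormal_frame_translate[OF fr[unfolded F_def] B]
  let ?Bf = "b ` {..<?m}"
  let ?t = "\<lambda>c. a + (\<Sum>i<?m. c i *\<^sub>R b i)"
  let ?D = "distr (\<Pi>\<^sub>M i\<in>{..<?m}. lborel) (restrict_space borel F) ?t"
  have F: "F = {a + (\<Sum>i<?m. c i *\<^sub>R b i) | c. True}"
    using fr unfolding orthonormal_frame_def Let_def dm by blast
  have tb: "?t \<in> borel_measurable (\<Pi>\<^sub>M i\<in>{..<?m}. lborel)" by measurable
  have t: "?t \<in> measurable (\<Pi>\<^sub>M i\<in>{..<?m}. lborel) (restrict_space borel F)"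
    by (rule measurable_restrict_space2[OF _ tb]) (use F in blast)
  show sp: "space (flat_lebesgue F) = F" by (simp add: M space_restrict_space)
  have gD: "g \<in> borel_measurable ?D" if "g \<in> borel_measurable borel" for g :: "real^'n \<Rightarrow> ennreal"
    using measurable_restrict_space1[OF that, of F] by simp
  show "g \<in> borel_measurable (flat_lebesgue F)" if "g \<in> borel_measurable borel" for g :: "real^'n \<Rightarrow> ennreal"
    unfolding M by (rule measurable_completion[OF gD[OF that]])
  show "A \<inter> F \<in> sets (flat_lebesgue F)" if "A \<in> sets borel" for A
  proof -
    have "A \<inter> F \<in> sets ?D" using that by (auto simp: sets_restrict_space)
    then show ?thesis unfolding M by (rule sets_completionI_sets)
  qed
  have slB: "span_lborel ?Bf = span_lborel B" by (rule span_lborel_cong[OF fr'(2) B fr'(4)])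
  have bij: "bij_betw b {..<?m} ?Bf" using fr'(3) by (simp add: bij_betw_def)
  have re: "distr (powM ?Bf lborel) (powM {..<?m} lborel) (\<lambda>c. \<lambda>i\<in>{..<?m}. c (b i)) = powM {..<?m} (lborel :: real measure)"
    by (rule distr_PiM_reindex_finite[OF sigma_finite_lborel _ bij]) simp
  have rm: "(\<lambda>c. \<lambda>i\<in>{..<?m}. c (b i)) \<in> measurable (powM ?Bf lborel) (powM {..<?m} (lborel :: real measure))"
    by (intro measurable_restrict measurable_component_singleton) auto
  fix g :: "real^'n \<Rightarrow> ennreal" assume g[measurable]: "g \<in> borel_measurable borel"
  have "(\<integral>\<^sup>+x. g x \<partial>flat_lebesgue F) = (\<integral>\<^sup>+x. g x \<partial>?D)" unfolding M by (rule nn_integral_completion)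
  also have "\<dots> = (\<integral>\<^sup>+c. g (?t c) \<partial>powM {..<?m} lborel)" by (rule nn_integral_distr[OF t]) (use gD[OF g] in simp)
  also have "\<dots> = (\<integral>\<^sup>+c. g (?t c) \<partial>distr (powM ?Bf lborel) (powM {..<?m} lborel) (\<lambda>c. \<lambda>i\<in>{..<?m}. c (b i)))"
    unfolding re ..
  also have "\<dots> = (\<integral>\<^sup>+c. g (?t (\<lambda>i\<in>{..<?m}. c (b i))) \<partial>powM ?Bf lborel)"
    by (rule nn_integral_distr[OF rm]) (use measurable_compose[OF tb g] in simp)
  also have "\<dots> = (\<integral>\<^sup>+c. g (a + (\<Sum>v\<in>?Bf. c v *\<^sub>R v)) \<partial>powM ?Bf lborel)"
    using fr'(3) by (simp add: sum.reindex)
  also have "\<dots> = (\<integral>\<^sup>+x. g (a + x) \<partial>span_lborel ?Bf)" by (rule nn_integral_span_lborel[symmetric]) measurable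
  also have "\<dots> = (\<integral>\<^sup>+x. g (z + ((a - z) + x)) \<partial>span_lborel B)" by (simp add: slB)
  also have "\<dots> = (\<integral>\<^sup>+x. g (z + x) \<partial>span_lborel B)"
    by (rule nn_integral_span_lborel_translate[OF orthonormal_set_finite[OF B] fr'(5)]) measurable
  finally show "(\<integral>\<^sup>+x. g x \<partial>flat_lebesgue F) = (\<integral>\<^sup>+x. g (z + x) \<partial>span_lborel B)" .
qed

section \<open>Coordinates of flats and the measure on the affine Grassmannian\<close>

lemma closest_point_translate_subspace:
  fixes E :: "'a::euclidean_space set"
  assumes E: "subspace E"
  shows "closest_point ((+) z ` E) x = z + closest_point E (x - z)"
proof (rule sym, rule closest_point_unique)
  show "convex ((+) z ` E)" "closed ((+) z ` E)"
    using E by (simp_all add: convex_translation subspace_imp_convex closed_translation closed_subspace)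
  show "z + closest_point E (x - z) \<in> (+) z ` E" using closest_point_subspace(1)[OF E] by blast
  show "\<forall>w\<in>(+) z ` E. dist x (z + closest_point E (x - z)) \<le> dist x w"
  proof
    fix w assume "w \<in> (+) z ` E"
    then obtain e where e: "e \<in> E" "w = z + e" by blast
    have "dist (x - z) (closest_point E (x - z)) \<le> dist (x - z) e"
      by (rule closest_point_le[OF closed_subspace[OF E] e(1)])
    then show "dist x (z + closest_point E (x - z)) \<le> dist x w"
      by (simp add: e(2) dist_norm algebra_simps)
  qed
qed

lemma flat_coords_translate:
  fixes E :: "(real^'n) set"
  assumes E: "subspace E" and z: "\<And>x. x \<in> E \<Longrightarrow> orthogonal x z"
  shows "flat_coords ((+) z ` E) = (z, matrix (closest_point E))"
proof -
  have l: "linear (closest_point E)" by (rule linear_closest_point[OF E])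
  have z0: "closest_point E z = 0"
    by (rule closest_point_subspace_eq[OF E subspace_0[OF E]]) (use z in \<open>simp add: orthogonal_def inner_commute\<close>)
  have "closest_point ((+) z ` E) x = z + closest_point E x" for x
    unfolding closest_point_translate_subspace[OF E] using z0 by (simp add: linear_diff[OF l])
  moreover have "closest_point E 0 = 0" using l by (rule linear_0)
  ultimately show ?thesis by (simp add: flat_coords_def)
qed

lemma affine_grassmannian_translate:
  "(E :: (real^'n) set) \<in> linear_grassmannian k \<Longrightarrow> (+) z ` E \<in> affine_grassmannian k"
  by (simp add: linear_grassmannian_def affine_grassmannian_def affine_translation[symmetric] subspace_imp_affine
      aff_dim_translation_eq aff_dim_subspace)

lemma orthogonal_comp_span: "(span B)\<^sup>\<bottom> = {y. \<forall>x\<in>span B. orthogonal x y}"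
  by (auto simp: orthogonal_comp_def)

lemma linear_grassmannian_bases:
  fixes E :: "(real^'n) set"
  assumes E: "E \<in> linear_grassmannian k"
  obtains B C where "orthonormal_set B" "span B = E" "card B = k" "orthonormal_set C" "span C = E\<^sup>\<bottom>"
    "B \<inter> C = {}" "orthonormal_set (B \<union> C)" "card C = CARD('n) - k" "card B + card C = CARD('n)"
proof -
  have "subspace E" "dim E = k" using E by (simp_all add: linear_grassmannian_def)
  then obtain B where B: "orthonormal_set B" "card B = k" "span B = E" using orthonormal_set_basis_exists by blast
  obtain C where C: "orthonormal_set C" "B \<inter> C = {}" "orthonormal_set (B \<union> C)" "card B + card C = DIM(real^'n)"
      "span C = {y. \<forall>x\<in>span B. orthogonal x y}"
    by (rule orthonormal_set_extend[OF B(1)]) (rule that; assumption)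
  have "span C = E\<^sup>\<bottom>" using C(5) orthogonal_comp_span[of B] B(3) by simp
  then show ?thesis using that[OF B(1,3,2) C(1) _ C(2,3)] C(4) B(2) by simp
qed

lemma closest_point_orthogonal_complement:
  fixes E :: "'a::euclidean_space set"
  assumes E: "subspace E"
  shows "closest_point (E\<^sup>\<bottom>) x = x - closest_point E x"
proof (rule closest_point_subspace_eq[OF subspace_orthogonal_comp])
  show "x - closest_point E x \<in> E\<^sup>\<bottom>"
    using closest_point_subspace(2)[OF E] by (auto simp: orthogonal_comp_def orthogonal_def inner_commute)
  show "(x - (x - closest_point E x)) \<bullet> z = 0" if "z \<in> E\<^sup>\<bottom>" for z
    using that closest_point_subspace(1)[OF E, of x] by (auto simp: orthogonal_comp_def orthogonal_def)
qed

text \<open>The cylinder formula for the orthogonal complement of \<open>E\<close>. The projection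
  onto the complement is the identity minus that onto \<open>E\<close>, so the distance of
  \<open>x\<close> from the complement is the norm of its projection onto \<open>E\<close>.\<close>

lemma nn_integral_complement_cylinder:
  fixes E :: "(real^'n) set" and \<phi> :: "real^'n \<Rightarrow> ennreal"
  assumes E: "E \<in> linear_grassmannian k" and C: "orthonormal_set C" "span C = E\<^sup>\<bottom>" "card C = CARD('n) - k" "k \<le> CARD('n)"
    and \<phi>: "\<phi> \<in> borel_measurable borel"
  shows "ball_vol k * (\<integral>\<^sup>+z. \<phi> z \<partial>span_lborel C)
    = (\<integral>\<^sup>+x. \<phi> (x - flat_proj E *v x) * indicator (cball 0 1) (flat_proj E *v x) \<partial>lborel)"
proof -
  have sE: "subspace E" using E by (simp add: linear_grassmannian_def)
  have P: "flat_proj E *v x = closest_point E x" for x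
    by (simp add: flat_proj_subspace[OF sE] linear_closest_point[OF sE])
  show ?thesis
    using nn_integral_span_lborel_cylinder[OF C(1) \<phi>] C(3,4)
    by (simp add: C(2) closest_point_orthogonal_complement[OF sE] P)
qed

text \<open>The flat with direction \<open>E\<close> through an arbitrary point of the whole space,
  moved by its foot in the complement of \<open>E\<close>. Letting the point range over the whole
  space gives a fixed product as parameter space, in place of complements that vary with
  \<open>E\<close>.\<close>

definition flat_of :: "(real^'n) set \<times> (real^'n) \<Rightarrow> (real^'n) set" where
  "flat_of p = (+) (snd p - flat_proj (fst p) *v snd p) ` fst p"

lemma flat_coords_flat_of:
  assumes E: "E \<in> linear_grassmannian k"
  shows "flat_coords (flat_of (E, x)) = (x - flat_proj E *v x, flat_proj E)"
proof -
  have sE: "subspace E" using E by (simp add: linear_grassmannian_def)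
  have P: "flat_proj E *v x = closest_point E x" for x
    by (simp add: flat_proj_subspace[OF sE] linear_closest_point[OF sE])
  have "flat_coords ((+) (x - closest_point E x) ` E) = (x - closest_point E x, matrix (closest_point E))"
    by (rule flat_coords_translate[OF sE]) (use closest_point_subspace(2)[OF sE] in \<open>simp add: orthogonal_def inner_commute\<close>)
  then show ?thesis by (simp add: flat_of_def P) (simp add: flat_proj_subspace[OF sE])
qed

text \<open>The invariant measure is defined by a formula for the measure of a set, and
  \<open>measure_of\<close> reproduces this formula only if it is countably additive. So a measure
  \<open>\<nu>'\<close> is built as the image of a weighted product measure and shown to agree with
  the formula on measurable sets. The third claim is the resulting integration rule: inner integrals
  may be evaluated in any convenient orthonormal basis of the complement.\<close>

lemma affine_grassmannian_measure_props:
  fixes k :: nat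
  assumes k: "k \<le> CARD('n)"
  defines "\<nu> \<equiv> affine_grassmannian_measure k :: (real^'n) set measure"
    and "\<mu> \<equiv> grassmannian_measure k :: (real^'n) set measure"
  shows "space \<nu> = affine_grassmannian k" "sets \<nu> = sets (flat_borel (affine_grassmannian k))"
    "\<And>h \<Phi>. h \<in> borel_measurable borel \<Longrightarrow> (\<And>E. E \<in> linear_grassmannian k \<Longrightarrow>
        \<exists>C. orthonormal_set C \<and> span C = E\<^sup>\<bottom> \<and> card C = CARD('n) - k \<and> (\<integral>\<^sup>+z. h (z, flat_proj E) \<partial>span_lborel C) = \<Phi> E) \<Longrightarrow>
      (\<integral>\<^sup>+F. h (flat_coords F) \<partial>\<nu>) = (\<integral>\<^sup>+E. \<Phi> E \<partial>\<mu>)"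
proof -
  let ?w = "ball_vol k"
  have haar: "grassmannian_haar k \<mu>" unfolding \<mu>_def by (rule grassmannian_measure_haar[OF k])
  interpret prob_space \<mu> by (rule grassmannian_haar_facts(1)[OF haar])
  interpret pair_sigma_finite \<mu> "lborel :: (real^'n) measure" ..
  note space_\<mu> = grassmannian_haar_facts(3)[OF haar]
  let ?PL = "\<mu> \<Otimes>\<^sub>M (lborel :: (real^'n) measure)"
  have P1: "(\<lambda>p. flat_proj (fst p)) \<in> borel_measurable ?PL"
    by (rule measurable_compose[OF measurable_fst grassmannian_haar_facts(4)[OF haar]])
  have P2: "(\<lambda>p. flat_proj (fst p) *v snd p) \<in> borel_measurable ?PL"
    by (rule measurable_matrix_vector_mult[OF P1]) simp
  have P3: "(\<lambda>p. (snd p - flat_proj (fst p) *v snd p, flat_proj (fst p))) \<in> borel_measurable ?PL"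
    using P1 P2 by (intro borel_measurable_Pair borel_measurable_diff) simp_all
  let ?FB = "flat_borel (affine_grassmannian k) :: (real^'n) set measure"
  have fo: "flat_of \<in> measurable ?PL ?FB"
    unfolding flat_borel_def
  proof (rule measurable_vimage_algebra2)
    show "flat_of \<in> space ?PL \<rightarrow> affine_grassmannian k"
      by (auto simp: space_pair_measure space_\<mu> flat_of_def intro!: affine_grassmannian_translate)
    show "(\<lambda>p. flat_coords (flat_of p)) \<in> borel_measurable ?PL"
    proof (rule measurable_cong[THEN iffD1, OF _ P3])
      fix p assume "p \<in> space ?PL"
      then have "fst p \<in> linear_grassmannian k" by (auto simp: space_pair_measure space_\<mu>)
      from flat_coords_flat_of[OF this, of "snd p"]
      show "(snd p - flat_proj (fst p) *v snd p, flat_proj (fst p)) = flat_coords (flat_of p)" by simp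
    qed
  qed
  \<comment> \<open>The indicator of the unit cylinder around the complement of \<open>E\<close>,
    divided by the volume of the unit ball in \<open>E\<close>. Integrating a function of the flat
    against this weight amounts to integrating over the complement.\<close>
  let ?d = "\<lambda>p. indicator (cball 0 1) (flat_proj (fst p) *v snd p) / ?w"
  have d: "?d \<in> borel_measurable ?PL"
    using measurable_compose[OF P2 borel_measurable_indicator[OF cball_borel]] by measurable
  define \<nu>' where "\<nu>' = distr (density ?PL ?d) ?FB flat_of"
  have sets_\<nu>': "sets \<nu>' = sets ?FB" and space_\<nu>': "space \<nu>' = affine_grassmannian k"
    by (simp_all add: \<nu>'_def flat_borel_def)
  have int: "(\<integral>\<^sup>+F. h (flat_coords F) \<partial>\<nu>') = (\<integral>\<^sup>+E. \<Phi> E \<partial>\<mu>)"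
    if h: "h \<in> borel_measurable borel" and \<Phi>: "\<And>E. E \<in> linear_grassmannian k \<Longrightarrow>
        \<exists>C. orthonormal_set C \<and> span C = E\<^sup>\<bottom> \<and> card C = CARD('n) - k \<and> (\<integral>\<^sup>+z. h (z, flat_proj E) \<partial>span_lborel C) = \<Phi> E" for h \<Phi>
  proof -
    have H: "(\<lambda>F. h (flat_coords F)) \<in> borel_measurable ?FB" by (rule measurable_compose[OF measurable_flat_coords h])
    have Hf: "(\<lambda>p. h (flat_coords (flat_of p))) \<in> borel_measurable ?PL" by (rule measurable_compose[OF fo H])
    have "(\<integral>\<^sup>+F. h (flat_coords F) \<partial>\<nu>') = (\<integral>\<^sup>+p. ?d p * h (flat_coords (flat_of p)) \<partial>?PL)"
      unfolding \<nu>'_def using fo H Hf d by (subst nn_integral_distr) (auto simp: nn_integral_density)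
    also have "\<dots> = (\<integral>\<^sup>+E. \<integral>\<^sup>+x. ?d (E, x) * h (flat_coords (flat_of (E, x))) \<partial>lborel \<partial>\<mu>)"
      by (subst lborel.nn_integral_fst[symmetric]) (use Hf d in \<open>auto intro: borel_measurable_times_ennreal\<close>)
    also have "\<dots> = (\<integral>\<^sup>+E. \<Phi> E \<partial>\<mu>)"
    proof (rule nn_integral_cong)
      fix E assume "E \<in> space \<mu>"
      then have E: "E \<in> linear_grassmannian k" by (simp add: space_\<mu>)
      from \<Phi>[OF E] obtain C where C: "orthonormal_set C" "span C = E\<^sup>\<bottom>" "card C = CARD('n) - k"
        "(\<integral>\<^sup>+z. h (z, flat_proj E) \<partial>span_lborel C) = \<Phi> E" by blast
      let ?f = "\<lambda>x. h (x - flat_proj E *v x, flat_proj E) * indicator (cball 0 1) (flat_proj E *v x)"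
      have hE: "(\<lambda>z. h (z, flat_proj E)) \<in> borel_measurable borel" by (intro measurable_compose[OF _ h] borel_measurable_Pair) simp_all
      have lm: "(*v) (flat_proj E) \<in> borel_measurable (borel :: (real^'n) measure)" by (intro measurable_linear) simp
      have "(\<integral>\<^sup>+x. ?d (E, x) * h (flat_coords (flat_of (E, x))) \<partial>lborel) = (\<integral>\<^sup>+x. ?f x / ?w \<partial>lborel)"
        by (rule nn_integral_cong) (simp add: indicator_def flat_coords_flat_of[OF E] divide_ennreal_def mult.commute)
      also have "\<dots> = (\<integral>\<^sup>+x. ?f x \<partial>lborel) / ?w"
        using lm by (intro nn_integral_divide borel_measurable_times_ennreal measurable_compose[OF _ hE] borel_measurable_diff
            measurable_compose[OF _ borel_measurable_indicator[OF cball_borel]]) simp_all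
      also have "\<dots> = \<Phi> E"
        unfolding nn_integral_complement_cylinder[OF E C(1,2,3) k hE, symmetric] C(4) mult.commute[of ?w]
        using unit_ball_vol_ennreal[of k] by (intro mult_divide_eq_ennreal) simp_all
      finally show "(\<integral>\<^sup>+x. ?d (E, x) * h (flat_coords (flat_of (E, x))) \<partial>lborel) = \<Phi> E" .
    qed
    finally show ?thesis .
  qed
  have em: "emeasure \<nu>' A = (\<integral>\<^sup>+E. emeasure (flat_lebesgue (E\<^sup>\<bottom>)) {x \<in> E\<^sup>\<bottom>. (+) x ` E \<in> A} \<partial>\<mu>)" if A: "A \<in> sets ?FB" for A
  proof -
    obtain D where D: "D \<in> sets borel" "A = flat_coords -` D \<inter> affine_grassmannian k"
      using A unfolding flat_borel_def by (subst (asm) sets_vimage_algebra2) auto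
    have "emeasure \<nu>' A = (\<integral>\<^sup>+F. indicator A F \<partial>\<nu>')" using A by (simp add: sets_\<nu>')
    also have "\<dots> = (\<integral>\<^sup>+F. indicator D (flat_coords F) \<partial>\<nu>')"
      by (rule nn_integral_cong) (simp add: D(2) space_\<nu>' indicator_def)
    also have "\<dots> = (\<integral>\<^sup>+E. emeasure (flat_lebesgue (E\<^sup>\<bottom>)) {x \<in> E\<^sup>\<bottom>. (+) x ` E \<in> A} \<partial>\<mu>)"
    proof (rule int)
      show "(indicator D :: _ \<Rightarrow> ennreal) \<in> borel_measurable borel" using D(1) by simp
      fix E :: "(real^'n) set" assume E: "E \<in> linear_grassmannian k"
      then have sE: "subspace E" by (simp add: linear_grassmannian_def)
      obtain B C where BC: "orthonormal_set B" "span B = E" "card B = k" "orthonormal_set C" "span C = E\<^sup>\<bottom>"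
        "card C = CARD('n) - k" using linear_grassmannian_bases[OF E] by metis
      define DE where "DE = (\<lambda>x. (x, flat_proj E)) -` D"
      have "(\<lambda>x::real^'n. (x, flat_proj E)) \<in> borel_measurable borel" by (intro borel_measurable_Pair) simp_all
      from measurable_sets[OF this D(1)] have DE: "DE \<in> sets borel" by (simp add: DE_def)
      have t0: "(+) 0 ` span C = E\<^sup>\<bottom>" using BC(5) by simp
      note fl = flat_lebesgue_translate[OF BC(4), where z = 0, unfolded t0]
      have "{x \<in> E\<^sup>\<bottom>. (+) x ` E \<in> A} = DE \<inter> E\<^sup>\<bottom>"
        using flat_coords_translate[OF sE] affine_grassmannian_translate[OF E]
        by (auto simp: D(2) DE_def orthogonal_comp_def flat_proj_subspace[OF sE])
      then have "emeasure (flat_lebesgue (E\<^sup>\<bottom>)) {x \<in> E\<^sup>\<bottom>. (+) x ` E \<in> A} = (\<integral>\<^sup>+x. indicator (DE \<inter> E\<^sup>\<bottom>) x \<partial>flat_lebesgue (E\<^sup>\<bottom>))"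
        using fl(4)[OF DE] by simp
      also have "\<dots> = (\<integral>\<^sup>+x. indicator DE x \<partial>flat_lebesgue (E\<^sup>\<bottom>))"
        by (rule nn_integral_cong) (simp add: fl(1) indicator_def)
      also have "\<dots> = (\<integral>\<^sup>+x. indicator D (x, flat_proj E) \<partial>span_lborel C)"
        using fl(3)[of "indicator DE"] DE by (simp add: DE_def indicator_def)
      finally show "\<exists>C. orthonormal_set C \<and> span C = E\<^sup>\<bottom> \<and> card C = CARD('n) - k \<and> (\<integral>\<^sup>+z. indicator D (z, flat_proj E) \<partial>span_lborel C)
          = emeasure (flat_lebesgue (E\<^sup>\<bottom>)) {x \<in> E\<^sup>\<bottom>. (+) x ` E \<in> A}"
        using BC by (intro exI[of _ C]) simp
    qed
    finally show ?thesis .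
  qed
  have spFB: "space ?FB = affine_grassmannian k" by (simp add: flat_borel_def)
  \<comment> \<open>\<open>measure_of\<close> looks only at values on the generated sigma-algebra,
    where the defining formula and \<open>\<nu>'\<close> agree.\<close>
  have "\<nu> = measure_of (space \<nu>') (sets \<nu>') (emeasure \<nu>')"
    unfolding \<nu>_def affine_grassmannian_measure_def space_\<nu>' sets_\<nu>' \<mu>_def[symmetric]
  proof (rule measure_of_eq)
    show "sets ?FB \<subseteq> Pow (affine_grassmannian k)" using sets.space_closed[of ?FB] by (simp add: spFB)
    fix a assume "a \<in> sigma_sets (affine_grassmannian k) (sets ?FB)"
    then have "a \<in> sets ?FB" using sets.sigma_sets_eq[of ?FB] by (simp add: spFB)
    then show "(\<integral>\<^sup>+E. emeasure (flat_lebesgue (E\<^sup>\<bottom>)) {x \<in> E\<^sup>\<bottom>. (+) x ` E \<in> a} \<partial>\<mu>) = emeasure \<nu>' a" by (rule em[symmetric])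
  qed
  then have \<nu>: "\<nu> = \<nu>'" by (simp add: measure_of_of_measure)
  show "space \<nu> = affine_grassmannian k" "sets \<nu> = sets ?FB" by (simp_all add: \<nu> space_\<nu>' sets_\<nu>')
  show "(\<integral>\<^sup>+F. h (flat_coords F) \<partial>\<nu>) = (\<integral>\<^sup>+E. \<Phi> E \<partial>\<mu>)"
    if "h \<in> borel_measurable borel" "\<And>E. E \<in> linear_grassmannian k \<Longrightarrow>
        \<exists>C. orthonormal_set C \<and> span C = E\<^sup>\<bottom> \<and> card C = CARD('n) - k \<and> (\<integral>\<^sup>+z. h (z, flat_proj E) \<partial>span_lborel C) = \<Phi> E" for h \<Phi>
    unfolding \<nu> using that by (rule int)
qed

lemmas nn_integral_affine_grassmannian = affine_grassmannian_measure_props(3)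

text \<open>\<open>x\<close> is the base vertex of a simplex, and the other vertices are
  \<open>x + X j\<close> with \<open>X j\<close> in the subspace onto which \<open>P\<close>
  projects. Up to ball volumes this is the part of the energy, on the flat through \<open>x\<close>,
  in which the base vertex is held at \<open>x\<close>.\<close>

definition pinned_avg :: "'n::finite set \<Rightarrow> nat \<Rightarrow> (real^'n \<Rightarrow> real) \<Rightarrow> real^'n \<Rightarrow> real^'n^'n \<Rightarrow> ennreal" where
  "pinned_avg S N f x P = ennreal (f x) * proj_avg S N (\<lambda>X. \<Prod>j\<in>S. ennreal (f (x + X j))) P"

lemma measurable_pinned_prod:
  assumes f: "f \<in> borel_measurable borel"
  shows "(\<lambda>X. \<Prod>j\<in>S. ennreal (f (x + X j))) \<in> borel_measurable (powM S lborel)"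
  using f by (intro borel_measurable_prod_ennreal measurable_compose[OF _ measurable_ennreal]
      measurable_compose[OF _ f] borel_measurable_add measurable_component_borel) simp_all

lemma measurable_pinned_avg:
  fixes f :: "real^'n \<Rightarrow> real"
  assumes f: "f \<in> borel_measurable borel" and x: "x \<in> borel_measurable M" and P: "P \<in> borel_measurable M"
  shows "(\<lambda>\<omega>. pinned_avg S N f (x \<omega>) (P \<omega>)) \<in> borel_measurable M"
proof -
  let ?\<Lambda> = "powM S (lborel :: (real^'n) measure)"
  have Y: "(\<lambda>p. snd p j) \<in> borel_measurable (M \<Otimes>\<^sub>M ?\<Lambda>)" if "j \<in> S" for j
    by (rule measurable_compose[OF measurable_snd measurable_component_borel]) (use that in simp_all)
  have "(\<lambda>(\<omega>, X). \<Prod>j\<in>S. ennreal (f (x \<omega> + X j))) \<in> borel_measurable (M \<Otimes>\<^sub>M ?\<Lambda>)"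
    unfolding split_beta
    by (intro borel_measurable_prod_ennreal measurable_compose[OF _ measurable_ennreal]
      measurable_compose[OF _ f] borel_measurable_add measurable_compose[OF measurable_fst x] Y)
  from measurable_proj_avg_param[OF this P] show ?thesis
    unfolding pinned_avg_def
    by (intro borel_measurable_times_ennreal measurable_compose[OF _ measurable_ennreal] measurable_compose[OF x f])
qed

text \<open>Translating the free vertices by the base vertex replaces points by edges. This brings
  the energy into the form in which \<open>pinned_avg\<close> is written.\<close>

lemma simplex_energy_pinned:
  fixes S :: "'n::finite set"
  assumes j0: "j0 \<notin> S" and g [measurable]: "g \<in> borel_measurable borel"
  shows "simplex_energy S j0 N g = (\<integral>\<^sup>+x. ennreal (g x) * (\<integral>\<^sup>+Z. ennreal (gram_vol S Z ^ N) *
      (\<Prod>j\<in>S. ennreal (g (x + Z j))) \<partial>powM S (coord_lborel S)) \<partial>coord_lborel S)"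
proof -
  let ?L = "coord_lborel S"
  have sf: "sigma_finite_measure ?L" by (rule sigma_finite_span_lborel[OF orthonormal_coord_basis])
  interpret pl: product_sigma_finite "\<lambda>_::'n. ?L" by (rule sigma_finite_measure.product_power[OF sf])
  have c: "(\<lambda>X. X j) \<in> borel_measurable (powM S ?L)" if "j \<in> S" for j
    by (rule measurable_component_borel) (use that in simp_all)
  have gS: "(\<lambda>X. \<Prod>i\<in>S. ennreal (g (X i))) \<in> borel_measurable (powM S ?L)"
    by (intro borel_measurable_prod_ennreal measurable_compose[OF _ measurable_ennreal] measurable_compose[OF c g])
  have gv: "(\<lambda>X. ennreal (gram_vol S (\<lambda>j. X j - y) ^ N)) \<in> borel_measurable (powM S ?L)" for y
    using c by (intro measurable_compose[OF _ measurable_ennreal] borel_measurable_power measurable_gram_vol borel_measurable_diff) simp_all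
  have "simplex_energy S j0 N g = (\<integral>\<^sup>+y. \<integral>\<^sup>+X. ennreal (gram_vol S (\<lambda>j. (X(j0 := y)) j - (X(j0 := y)) j0) ^ N) *
      (\<Prod>i\<in>insert j0 S. ennreal (g ((X(j0 := y)) i))) \<partial>powM S ?L \<partial>?L)"
    unfolding simplex_energy_def
    by (rule pl.product_nn_integral_insert_rev[OF _ j0]) (simp_all add: measurable_energy_integrand)
  also have "\<dots> = (\<integral>\<^sup>+y. \<integral>\<^sup>+X. ennreal (g y) * (ennreal (gram_vol S (\<lambda>j. X j - y) ^ N) * (\<Prod>i\<in>S. ennreal (g (X i)))) \<partial>powM S ?L \<partial>?L)"
  proof (intro nn_integral_cong)
    fix X :: "'n \<Rightarrow> real^'n" and y
    have "gram_vol S (\<lambda>j. (X(j0 := y)) j - (X(j0 := y)) j0) = gram_vol S (\<lambda>j. X j - y)"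
      by (rule gram_vol_cong) (use j0 in auto)
    moreover have "(\<Prod>i\<in>insert j0 S. ennreal (g ((X(j0 := y)) i))) = ennreal (g y) * (\<Prod>i\<in>S. ennreal (g (X i)))"
      using j0 by (auto intro!: arg_cong2[where f = "(*)"] prod.cong)
    ultimately show "ennreal (gram_vol S (\<lambda>j. (X(j0 := y)) j - (X(j0 := y)) j0) ^ N) * (\<Prod>i\<in>insert j0 S. ennreal (g ((X(j0 := y)) i)))
      = ennreal (g y) * (ennreal (gram_vol S (\<lambda>j. X j - y) ^ N) * (\<Prod>i\<in>S. ennreal (g (X i))))"
      by (simp only: mult.left_commute)
  qed
  also have "\<dots> = (\<integral>\<^sup>+y. ennreal (g y) * (\<integral>\<^sup>+X. ennreal (gram_vol S (\<lambda>j. X j - y) ^ N) * (\<Prod>i\<in>S. ennreal (g (X i))) \<partial>powM S ?L) \<partial>?L)"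
    by (intro nn_integral_cong nn_integral_cmult borel_measurable_times_ennreal gv gS)
  also have "\<dots> = (\<integral>\<^sup>+x. ennreal (g x) * (\<integral>\<^sup>+Z. ennreal (gram_vol S Z ^ N) *
      (\<Prod>j\<in>S. ennreal (g (x + Z j))) \<partial>powM S ?L) \<partial>?L)"
  proof (rule nn_integral_cong_AE, rule AE_mp[OF AE_span_lborel AE_I2], intro impI)
    fix y assume y: "y \<in> span (coord_basis S)"
    let ?G = "\<lambda>X. ennreal (gram_vol S (\<lambda>j. X j - y) ^ N) * (\<Prod>i\<in>S. ennreal (g (X i)))"
    have G: "?G \<in> borel_measurable (powM S ?L)" by (intro borel_measurable_times_ennreal gv gS)
    have "(\<integral>\<^sup>+X. ?G X \<partial>powM S ?L) = (\<Prod>i\<in>S. 1) * (\<integral>\<^sup>+X. ?G (\<lambda>i\<in>S. y + X i) \<partial>powM S ?L)"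
    proof (rule nn_integral_PiM_componentwise[OF sf _ _ _ G, symmetric])
      fix h :: "real^'n \<Rightarrow> ennreal" assume "h \<in> borel_measurable ?L"
      then show "1 * (\<integral>\<^sup>+x. h (y + x) \<partial>?L) = (\<integral>\<^sup>+x. h x \<partial>?L)"
        by (simp add: nn_integral_span_lborel_translate[OF _ y])
    qed simp_all
    also have "\<dots> = (\<integral>\<^sup>+Z. ennreal (gram_vol S Z ^ N) * (\<Prod>j\<in>S. ennreal (g (y + Z j))) \<partial>powM S ?L)"
    proof (simp, rule nn_integral_cong)
      fix Z :: "'n \<Rightarrow> real^'n"
      have "gram_vol S (\<lambda>j. (\<lambda>i\<in>S. y + Z i) j - y) = gram_vol S Z" by (rule gram_vol_cong) simp
      then show "ennreal (gram_vol S (\<lambda>j. (if j \<in> S then y + Z j else undefined) - y) ^ N) * (\<Prod>i\<in>S. ennreal (g (y + Z i)))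
         = ennreal (gram_vol S Z ^ N) * (\<Prod>j\<in>S. ennreal (g (y + Z j)))" by (simp add: restrict_def)
    qed
    finally show "ennreal (g y) * (\<integral>\<^sup>+X. ?G X \<partial>powM S ?L) = ennreal (g y) * (\<integral>\<^sup>+Z. ennreal (gram_vol S Z ^ N) *
      (\<Prod>j\<in>S. ennreal (g (y + Z j))) \<partial>powM S ?L)" by simp
  qed
  finally show ?thesis .
qed

text \<open>Integration of the base vertex over the flat completes the pinned average to the full
  energy. The ball volumes come from the cylinders of the \<open>card S\<close> free
  vertices.\<close>

lemma nn_integral_pinned_avg:
  fixes S :: "'n::finite set"
  assumes j0: "j0 \<notin> S" and f: "f \<in> borel_measurable borel" and U: "orthogonal_transformation (U :: real^'n \<Rightarrow> real^'n)"
  shows "(\<integral>\<^sup>+u. pinned_avg S N f (z + u) (flat_proj (U ` span (coord_basis S))) \<partial>span_lborel (U ` coord_basis S)) =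
     ball_vol (CARD('n) - card S) ^ card S * simplex_energy S j0 N (\<lambda>x. f (z + U x))"
proof -
  let ?L = "coord_lborel S" and ?B = "U ` coord_basis S" and ?E = "U ` span (coord_basis S)"
  let ?w = "ball_vol (CARD('n) - card S) ^ card S"
  have lU: "linear U" by (rule orthogonal_transformation_linear[OF U])
  have Um [measurable]: "U \<in> borel_measurable borel" by (rule measurable_linear[OF lU])
  have injU: "inj_on U A" for A by (rule inj_on_subset[OF orthogonal_transformation_inj[OF U]]) simp
  have oB: "orthonormal_set ?B" using U orthonormal_coord_basis by (rule orthonormal_set_image)
  have E: "?E = span ?B" by (simp add: span_orthogonal_image[OF U])
  have P: "flat_proj ?E = matrix (closest_point (span ?B))" unfolding E by (rule flat_proj_subspace[OF subspace_span])
  have cB: "card ?B = card S" using injU by (simp add: card_image)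
  have sl: "span_lborel ?B = distr ?L borel U" by (rule distr_span_lborel[OF lU injU, symmetric]) simp
  have fzU: "(\<lambda>x. f (z + U x)) \<in> borel_measurable borel" using measurable_compose[OF _ f, of "\<lambda>x. z + U x" borel] by simp
  have pm: "(\<lambda>u. pinned_avg S N f (z + u) (flat_proj ?E)) \<in> borel_measurable borel"
    by (rule measurable_pinned_avg[OF f]) simp_all
  have "(\<integral>\<^sup>+u. pinned_avg S N f (z + u) (flat_proj ?E) \<partial>span_lborel ?B) = (\<integral>\<^sup>+x. pinned_avg S N f (z + U x) (flat_proj ?E) \<partial>?L)"
    unfolding sl using pm by (subst nn_integral_distr) simp_all
  also have "\<dots> = (\<integral>\<^sup>+x. ?w * (ennreal (f (z + U x)) * (\<integral>\<^sup>+Z. ennreal (gram_vol S Z ^ N) *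
      (\<Prod>j\<in>S. ennreal (f (z + U (x + Z j)))) \<partial>powM S ?L)) \<partial>?L)"
  proof (rule nn_integral_cong)
    fix x :: "real^'n"
    let ?F = "\<lambda>X. \<Prod>j\<in>S. ennreal (f (z + U x + X j))"
    have Fm: "?F \<in> borel_measurable (powM S lborel)" by (rule measurable_pinned_prod[OF f])
    have "proj_avg S N ?F (flat_proj ?E) = ?w * flat_avg S N ?F ?B"
      unfolding P flat_avg_cylinder[OF oB Fm, symmetric] cB ..
    also have "flat_avg S N ?F ?B = (\<integral>\<^sup>+Z. ennreal (gram_vol S Z ^ N) * (\<Prod>j\<in>S. ennreal (f (z + U (x + Z j)))) \<partial>powM S ?L)"
      unfolding flat_avg_image[OF U Fm]
    proof (rule nn_integral_cong_AE, rule AE_mp[OF AE_coord_tuple AE_I2], intro impI, elim conjE)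
      fix Z :: "'n \<Rightarrow> real^'n" assume "\<forall>j\<in>S. Z j \<in> span (coord_basis S)"
      then have "gram_vol S Z = \<bar>det (col_matrix S Z)\<bar>" by (intro gram_vol_coord) blast
      then show "ennreal (\<bar>det (col_matrix S Z)\<bar> ^ N) * ?F (\<lambda>j\<in>S. U (Z j)) =
        ennreal (gram_vol S Z ^ N) * (\<Prod>j\<in>S. ennreal (f (z + U (x + Z j))))"
        by (simp add: linear_add[OF lU] add.assoc)
    qed
    finally show "pinned_avg S N f (z + U x) (flat_proj ?E) = ?w * (ennreal (f (z + U x)) * (\<integral>\<^sup>+Z. ennreal (gram_vol S Z ^ N) *
      (\<Prod>j\<in>S. ennreal (f (z + U (x + Z j)))) \<partial>powM S ?L))"
      unfolding pinned_avg_def by (simp only: mult.left_commute)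
  qed
  also have "\<dots> = ?w * simplex_energy S j0 N (\<lambda>x. f (z + U x))"
    unfolding simplex_energy_pinned[OF j0 fzU]
  proof (rule nn_integral_cmult)
    let ?\<Lambda> = "powM S ?L"
    have sf: "sigma_finite_measure ?L" by (rule sigma_finite_span_lborel[OF orthonormal_coord_basis])
    interpret pl: product_sigma_finite "\<lambda>_::'n. ?L" by (rule sigma_finite_measure.product_power[OF sf])
    interpret Lam: sigma_finite_measure ?\<Lambda> by (rule pl.sigma_finite) simp
    have Z: "(\<lambda>p. snd p j) \<in> borel_measurable (?L \<Otimes>\<^sub>M ?\<Lambda>)" if "j \<in> S" for j
      by (rule measurable_compose[OF measurable_snd measurable_component_borel]) (use that in simp_all)
    have fs: "fst \<in> borel_measurable (?L \<Otimes>\<^sub>M ?\<Lambda>)"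
      using measurable_fst[of ?L ?\<Lambda>] by (simp cong: measurable_cong_sets)
    have gv: "(\<lambda>p. ennreal (gram_vol S (snd p) ^ N)) \<in> borel_measurable (?L \<Otimes>\<^sub>M ?\<Lambda>)"
      using Z by (intro measurable_compose[OF _ measurable_ennreal] borel_measurable_power measurable_gram_vol)
    have "(\<lambda>(x, Z). ennreal (gram_vol S Z ^ N) * (\<Prod>j\<in>S. ennreal (f (z + U (x + Z j))))) \<in> borel_measurable (?L \<Otimes>\<^sub>M ?\<Lambda>)"
      unfolding split_beta
      by (intro borel_measurable_times_ennreal gv borel_measurable_prod_ennreal measurable_compose[OF _ measurable_ennreal]
          measurable_compose[OF _ fzU] borel_measurable_add fs Z)
    then have "(\<lambda>x. \<integral>\<^sup>+Z. ennreal (gram_vol S Z ^ N) * (\<Prod>j\<in>S. ennreal (f (z + U (x + Z j)))) \<partial>?\<Lambda>) \<in> borel_measurable ?L"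
      by (rule Lam.borel_measurable_nn_integral)
    then show "(\<lambda>x. ennreal (f (z + U x)) * (\<integral>\<^sup>+Z. ennreal (gram_vol S Z ^ N) * (\<Prod>j\<in>S. ennreal (f (z + U (x + Z j)))) \<partial>?\<Lambda>)) \<in> borel_measurable ?L"
      using fzU by simp
  qed
  finally show ?thesis .
qed

text \<open>For each base vertex \<open>x\<close> the linear formula is applied to the product of
  the values \<open>f (x + X j)\<close>, whose integral over all tuples is a power of the integral
  of \<open>f\<close> by translation invariance. Multiplying by \<open>f x\<close> and integrating
  over \<open>x\<close> supplies the last factor.\<close>

theorem Blaschke_Petkantschin_affine:
  fixes \<mu> :: "(real^'n) set measure" and S :: "'n set"
  assumes haar: "grassmannian_haar (card S) \<mu>"
  shows "\<exists>c. \<forall>f\<in>borel_measurable borel.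
     (\<integral>\<^sup>+x. ennreal (f x) \<partial>lborel) ^ (card S + 1) =
       c * (\<integral>\<^sup>+E. \<integral>\<^sup>+x. pinned_avg S (CARD('n) - card S) f x (flat_proj E) \<partial>lborel \<partial>\<mu>)"
proof -
  let ?N = "CARD('n) - card S" and ?\<Lambda> = "powM S (lborel :: (real^'n) measure)"
  obtain c where c: "\<And>F. F \<in> borel_measurable ?\<Lambda> \<Longrightarrow> (\<integral>\<^sup>+X. F X \<partial>?\<Lambda>) = c * (\<integral>\<^sup>+E. proj_avg S ?N F (flat_proj E) \<partial>\<mu>)"
    using Blaschke_Petkantschin_linear[OF haar] by blast
  interpret prob_space \<mu> using haar by (simp add: grassmannian_haar_def)
  have sf: "sigma_finite_measure \<mu>" ..
  interpret pair_sigma_finite \<mu> "lborel :: (real^'n) measure" ..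
  interpret pl: product_sigma_finite "\<lambda>_::'n. lborel :: (real^'n) measure" by (rule product_sigma_finite_lborel)
  note fp = grassmannian_haar_facts(4)[OF haar]
  show ?thesis
  proof (intro exI ballI)
    fix f :: "real^'n \<Rightarrow> real" assume f: "f \<in> borel_measurable borel"
    have jm: "(\<lambda>p. pinned_avg S ?N f (snd p) (flat_proj (fst p))) \<in> borel_measurable (\<mu> \<Otimes>\<^sub>M lborel)"
      by (rule measurable_pinned_avg[OF f]) (use measurable_compose[OF measurable_fst fp] in simp_all)
    have pw: "ennreal (f x) * (\<integral>\<^sup>+x. ennreal (f x) \<partial>lborel) ^ card S = c * (\<integral>\<^sup>+E. pinned_avg S ?N f x (flat_proj E) \<partial>\<mu>)" for x
    proof -
      let ?F = "\<lambda>X. \<Prod>j\<in>S. ennreal (f (x + X j))"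
      have Fm: "?F \<in> borel_measurable ?\<Lambda>" by (rule measurable_pinned_prod[OF f])
      have "(\<integral>\<^sup>+y. ennreal (f y) \<partial>lborel) = (\<integral>\<^sup>+y. ennreal (f (x + y)) \<partial>lborel)"
        unfolding lborel_eq_span_lborel using f
        by (intro nn_integral_span_lborel_translate[where g = "\<lambda>x. ennreal (f x)", symmetric]) simp_all
      then have "(\<integral>\<^sup>+x. ennreal (f x) \<partial>lborel) ^ card S = (\<Prod>j\<in>S. \<integral>\<^sup>+y. ennreal (f (x + y)) \<partial>lborel)" by simp
      also have "\<dots> = (\<integral>\<^sup>+X. ?F X \<partial>?\<Lambda>)"
        by (rule pl.product_nn_integral_prod[symmetric]) (use measurable_compose[OF _ f, of "\<lambda>y. x + y"] in simp_all)
      also have "\<dots> = c * (\<integral>\<^sup>+E. proj_avg S ?N ?F (flat_proj E) \<partial>\<mu>)" by (rule c[OF Fm])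
      finally have "ennreal (f x) * (\<integral>\<^sup>+x. ennreal (f x) \<partial>lborel) ^ card S =
        c * (ennreal (f x) * (\<integral>\<^sup>+E. proj_avg S ?N ?F (flat_proj E) \<partial>\<mu>))" by (simp only: mult.left_commute)
      also have "ennreal (f x) * (\<integral>\<^sup>+E. proj_avg S ?N ?F (flat_proj E) \<partial>\<mu>) = (\<integral>\<^sup>+E. pinned_avg S ?N f x (flat_proj E) \<partial>\<mu>)"
        unfolding pinned_avg_def using measurable_compose[OF fp measurable_proj_avg[OF Fm]] by (rule nn_integral_cmult[symmetric])
      finally show ?thesis .
    qed
    have "(\<integral>\<^sup>+x. ennreal (f x) \<partial>lborel) ^ (card S + 1) = (\<integral>\<^sup>+x. ennreal (f x) * (\<integral>\<^sup>+x. ennreal (f x) \<partial>lborel) ^ card S \<partial>lborel)"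
      using f by (simp add: nn_integral_multc)
    also have "\<dots> = (\<integral>\<^sup>+x. c * (\<integral>\<^sup>+E. pinned_avg S ?N f x (flat_proj E) \<partial>\<mu>) \<partial>lborel)" by (simp only: pw)
    also have "\<dots> = c * (\<integral>\<^sup>+x. \<integral>\<^sup>+E. pinned_avg S ?N f x (flat_proj E) \<partial>\<mu> \<partial>lborel)"
    proof (rule nn_integral_cmult)
      have "(\<lambda>p. pinned_avg S ?N f (fst p) (flat_proj (snd p))) \<in> borel_measurable (lborel \<Otimes>\<^sub>M \<mu>)"
        by (rule measurable_pinned_avg[OF f]) (use measurable_compose[OF measurable_snd fp] in simp_all)
      then show "(\<lambda>x. \<integral>\<^sup>+E. pinned_avg S ?N f x (flat_proj E) \<partial>\<mu>) \<in> borel_measurable lborel"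
        by (intro sigma_finite_measure.borel_measurable_nn_integral[OF sf]) (simp add: split_beta)
    qed
    also have "(\<integral>\<^sup>+x. \<integral>\<^sup>+E. pinned_avg S ?N f x (flat_proj E) \<partial>\<mu> \<partial>lborel) = (\<integral>\<^sup>+E. \<integral>\<^sup>+x. pinned_avg S ?N f x (flat_proj E) \<partial>lborel \<partial>\<mu>)"
      by (rule Fubini') (use jm in \<open>simp add: split_beta\<close>)
    finally show "(\<integral>\<^sup>+x. ennreal (f x) \<partial>lborel) ^ (card S + 1) =
       c * (\<integral>\<^sup>+E. \<integral>\<^sup>+x. pinned_avg S ?N f x (flat_proj E) \<partial>lborel \<partial>\<mu>)" .
  qed
qed

text \<open>Energy of \<open>f\<close> on the flat with coordinates \<open>p\<close>, up to ball
  volumes. The base vertex is put in cylinder form as well, so that the energy is a Borel function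
  of the coordinates of the flat.\<close>

definition flat_energy :: "'n::finite set \<Rightarrow> nat \<Rightarrow> (real^'n \<Rightarrow> real) \<Rightarrow> (real^'n) \<times> (real^'n^'n) \<Rightarrow> ennreal" where
  "flat_energy S N f p = (\<integral>\<^sup>+x. pinned_avg S N f (fst p + snd p *v x) (snd p) * indicator (cball 0 1) (x - snd p *v x) \<partial>lborel)"

lemma measurable_flat_energy:
  assumes f: "f \<in> borel_measurable borel"
  shows "flat_energy S N f \<in> borel_measurable borel"
proof -
  let ?PL = "(borel :: ((real^'n) \<times> (real^'n^'n)) measure) \<Otimes>\<^sub>M (lborel :: (real^'n) measure)"
  have p1: "(\<lambda>q. fst (fst q)) \<in> borel_measurable ?PL" by (rule measurable_compose[OF measurable_fst measurable_fst_borel])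
  have p2: "(\<lambda>q. snd (fst q)) \<in> borel_measurable ?PL" by (rule measurable_compose[OF measurable_fst measurable_snd_borel])
  have p3: "snd \<in> borel_measurable ?PL" using measurable_snd[of borel lborel] by simp
  have p4: "(\<lambda>q. snd (fst q) *v snd q) \<in> borel_measurable ?PL" by (rule measurable_matrix_vector_mult[OF p2 p3])
  have "(\<lambda>q. pinned_avg S N f (fst (fst q) + snd (fst q) *v snd q) (snd (fst q)) * indicator (cball 0 1) (snd q - snd (fst q) *v snd q))
    \<in> borel_measurable ?PL"
    by (intro borel_measurable_times_ennreal measurable_pinned_avg[OF f] borel_measurable_add borel_measurable_diff p1 p2 p3 p4
        measurable_compose[OF _ borel_measurable_indicator[OF cball_borel]])
  then show ?thesis unfolding flat_energy_def[abs_def]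
    by (intro lborel.borel_measurable_nn_integral) (simp add: split_beta)
qed

lemma flat_energy_span:
  fixes B :: "(real^'n) set"
  assumes f: "f \<in> borel_measurable borel" and B: "orthonormal_set B"
  shows "flat_energy S N f (z, flat_proj (span B)) =
    ball_vol (CARD('n) - card B) * (\<integral>\<^sup>+u. pinned_avg S N f (z + u) (flat_proj (span B)) \<partial>span_lborel B)"
proof -
  have P: "flat_proj (span B) *v x = closest_point (span B) x" for x
    by (simp add: flat_proj_subspace[OF subspace_span] linear_closest_point[OF subspace_span])
  have "(\<lambda>u. pinned_avg S N f (z + u) (flat_proj (span B))) \<in> borel_measurable borel"
    by (rule measurable_pinned_avg[OF f]) simp_all
  from nn_integral_span_lborel_cylinder[OF B this] show ?thesis by (simp add: flat_energy_def P)
qed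

text \<open>The flat is pulled back to the coordinate subspace by \<open>U\<close>. Each of the
  \<open>card S + 1\<close> vertices contributes one ball volume from its cylinder.\<close>

lemma flat_energy_image:
  fixes S :: "'n::finite set"
  assumes j0: "j0 \<notin> S" and f: "f \<in> borel_measurable borel" and U: "orthogonal_transformation (U :: real^'n \<Rightarrow> real^'n)"
  shows "flat_energy S N f (z, flat_proj (U ` span (coord_basis S))) =
    ball_vol (CARD('n) - card S) ^ (card S + 1) * simplex_energy S j0 N (\<lambda>x. f (z + U x))"
proof -
  have oB: "orthonormal_set (U ` coord_basis S)" using U orthonormal_coord_basis by (rule orthonormal_set_image)
  have cB: "card (U ` coord_basis S) = card S"
    by (simp add: card_image inj_on_subset[OF orthogonal_transformation_inj[OF U]])
  show ?thesis
    using flat_energy_span[OF f oB, of S N z] nn_integral_pinned_avg[OF j0 f U, of N z]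
    by (simp add: span_orthogonal_image[OF U] cB mult.assoc)
qed

text \<open>Splitting the base vertex into its components in the complement of \<open>E\<close> and
  in \<open>E\<close> turns the integral over the whole space into one over the complement, which
  selects the flat, and one over the flat. The cylinder form of the base vertex accounts for the
  ball volume on the left.\<close>

lemma Blaschke_Petkantschin_affine_grassmannian:
  fixes S :: "'n::finite set"
  shows "\<exists>c. \<forall>f\<in>borel_measurable borel.
     ball_vol (CARD('n) - card S) * (\<integral>\<^sup>+x. ennreal (f x) \<partial>(lborel :: (real^'n) measure)) ^ (card S + 1) =
       c * (\<integral>\<^sup>+F. flat_energy S (CARD('n) - card S) f (flat_coords F) \<partial>affine_grassmannian_measure (card S))"
proof -
  let ?N = "CARD('n) - card S" and ?\<mu> = "grassmannian_measure (card S) :: (real^'n) set measure"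
  let ?w = "ball_vol ?N"
  have k: "card S \<le> CARD('n)" by (rule card_mono) simp_all
  have haar: "grassmannian_haar (card S) ?\<mu>" by (rule grassmannian_measure_haar[OF k])
  note fp = grassmannian_haar_facts(4)[OF haar]
  obtain c where c: "\<And>f. f \<in> borel_measurable borel \<Longrightarrow> (\<integral>\<^sup>+x. ennreal (f x) \<partial>lborel) ^ (card S + 1) =
       c * (\<integral>\<^sup>+E. \<integral>\<^sup>+x. pinned_avg S ?N f x (flat_proj E) \<partial>lborel \<partial>?\<mu>)"
    using Blaschke_Petkantschin_affine[OF haar] by blast
  show ?thesis
  proof (intro exI ballI)
    fix f :: "real^'n \<Rightarrow> real" assume f: "f \<in> borel_measurable borel"
    have "(\<lambda>p. pinned_avg S ?N f (snd p) (flat_proj (fst p))) \<in> borel_measurable (?\<mu> \<Otimes>\<^sub>M lborel)"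
      by (rule measurable_pinned_avg[OF f]) (use measurable_compose[OF measurable_fst fp] in simp_all)
    then have Im: "(\<lambda>E. \<integral>\<^sup>+x. pinned_avg S ?N f x (flat_proj E) \<partial>lborel) \<in> borel_measurable ?\<mu>"
      by (intro lborel.borel_measurable_nn_integral) (simp add: split_beta)
    have "(\<integral>\<^sup>+F. flat_energy S ?N f (flat_coords F) \<partial>affine_grassmannian_measure (card S)) =
      (\<integral>\<^sup>+E. ?w * (\<integral>\<^sup>+x. pinned_avg S ?N f x (flat_proj E) \<partial>lborel) \<partial>?\<mu>)"
    proof (rule nn_integral_affine_grassmannian[OF k measurable_flat_energy[OF f]])
      fix E :: "(real^'n) set" assume E: "E \<in> linear_grassmannian (card S)"
      obtain B C where BC: "orthonormal_set B" "span B = E" "card B = card S" "orthonormal_set C" "span C = E\<^sup>\<bottom>"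
        "B \<inter> C = {}" "orthonormal_set (B \<union> C)" "card C = CARD('n) - card S" "card B + card C = CARD('n)"
        by (rule linear_grassmannian_bases[OF E])
      have pm: "(\<lambda>u. pinned_avg S ?N f u (flat_proj E)) \<in> borel_measurable borel"
        by (rule measurable_pinned_avg[OF f]) simp_all
      have sf: "sigma_finite_measure (span_lborel B)" by (rule sigma_finite_span_lborel[OF BC(1)])
      have "(\<lambda>p. pinned_avg S ?N f (fst p + snd p) (flat_proj E)) \<in> borel_measurable (borel \<Otimes>\<^sub>M span_lborel B)"
        using measurable_snd[of borel "span_lborel B"] by (intro measurable_compose[OF _ pm] borel_measurable_add) (simp_all cong: measurable_cong_sets)
      then have im: "(\<lambda>z. \<integral>\<^sup>+u. pinned_avg S ?N f (z + u) (flat_proj E) \<partial>span_lborel B) \<in> borel_measurable borel"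
        by (intro sigma_finite_measure.borel_measurable_nn_integral[OF sf]) (simp add: split_beta)
      have "(\<integral>\<^sup>+z. flat_energy S ?N f (z, flat_proj E) \<partial>span_lborel C) =
        (\<integral>\<^sup>+z. ?w * (\<integral>\<^sup>+u. pinned_avg S ?N f (z + u) (flat_proj E) \<partial>span_lborel B) \<partial>span_lborel C)"
        using flat_energy_span[OF f BC(1), of S ?N] by (simp add: BC(2,3))
      also have "\<dots> = ?w * (\<integral>\<^sup>+z. \<integral>\<^sup>+u. pinned_avg S ?N f (z + u) (flat_proj E) \<partial>span_lborel B \<partial>span_lborel C)"
        by (rule nn_integral_cmult) (use im in simp)
      also have "(\<integral>\<^sup>+z. \<integral>\<^sup>+u. pinned_avg S ?N f (z + u) (flat_proj E) \<partial>span_lborel B \<partial>span_lborel C) =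
        (\<integral>\<^sup>+x. pinned_avg S ?N f x (flat_proj E) \<partial>lborel)"
        by (rule nn_integral_lborel_orthogonal_split[symmetric, OF _ _ _ pm]) (use BC in \<open>auto simp: Un_commute\<close>)
      finally show "\<exists>C. orthonormal_set C \<and> span C = E\<^sup>\<bottom> \<and> card C = CARD('n) - card S \<and>
        (\<integral>\<^sup>+z. flat_energy S ?N f (z, flat_proj E) \<partial>span_lborel C) = ?w * (\<integral>\<^sup>+x. pinned_avg S ?N f x (flat_proj E) \<partial>lborel)"
        using BC by blast
    qed
    also have "\<dots> = ?w * (\<integral>\<^sup>+E. \<integral>\<^sup>+x. pinned_avg S ?N f x (flat_proj E) \<partial>lborel \<partial>?\<mu>)" by (rule nn_integral_cmult[OF Im])
    finally show "?w * (\<integral>\<^sup>+x. ennreal (f x) \<partial>lborel) ^ (card S + 1) =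
       c * (\<integral>\<^sup>+F. flat_energy S ?N f (flat_coords F) \<partial>affine_grassmannian_measure (card S))"
      unfolding c[OF f] by (simp only: mult.left_commute)
  qed
qed

section \<open>The inequality\<close>

text \<open>The unit ball of dimension \<open>card C + p\<close> is sliced along \<open>p\<close>
  extra coordinates: over \<open>z\<close> lies a ball of dimension \<open>p\<close> and radius
  \<open>sqrt (1 - (norm z)\<^sup>2)\<close>.\<close>

lemma nn_integral_ball_sections:
  fixes C :: "(real^'n) set"
  assumes C: "orthonormal_set C" and p: "0 < p"
  shows "ball_vol p * (\<integral>\<^sup>+z. ennreal (sqrt (1 - (norm z)\<^sup>2) ^ p) * indicator (cball 0 1) z \<partial>span_lborel C)
    = ball_vol (card C + p)"
proof -
  have finC: "finite C" by (rule orthonormal_set_finite[OF C])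
  \<comment> \<open>The extra coordinates are indexed by any \<open>p\<close> vectors outside
    \<open>C\<close>, used as mere labels. Since \<open>p\<close> may exceed the dimension of the
    space, they are drawn from the infinite type and not from a basis.\<close>
  have "infinite (UNIV - C)" using finC infinite_UNIV_char_0[where 'a = "real^'n"] by (simp add: Diff_infinite_finite)
  then obtain D where D: "finite D" "card D = p" "D \<subseteq> UNIV - C" using infinite_arbitrarily_large by blast
  then have CD: "C \<inter> D = {}" by blast
  have Dne: "D \<noteq> {}" using D(2) p by auto
  interpret pl: product_sigma_finite "\<lambda>_::real^'n. lborel :: real measure" by (rule product_sigma_finite_lborel)
  let ?w = "ball_vol p"
  let ?A = "{f. sqrt (\<Sum>i\<in>C \<union> D. (f i)\<^sup>2) \<le> 1} \<inter> space (powM (C \<union> D) (lborel :: real measure))"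
  have A: "?A \<in> sets (powM (C \<union> D) lborel)"
    using finC D(1) by measurable
  have sec: "(\<integral>\<^sup>+g. indicator ?A (merge C D (c, g)) \<partial>powM D lborel) =
      ?w * (ennreal (sqrt (1 - (\<Sum>b\<in>C. (c b)\<^sup>2)) ^ p) * indicator {..1} (\<Sum>b\<in>C. (c b)\<^sup>2))"
    if c: "c \<in> space (powM C lborel)" for c :: "real^'n \<Rightarrow> real"
  proof -
    let ?s = "\<Sum>b\<in>C. (c b)\<^sup>2"
    let ?D = "\<lambda>t. {g. (\<Sum>i\<in>D. (g i)\<^sup>2) \<le> t} \<inter> space (powM D (lborel :: real measure))"
    have Dm: "?D t \<in> sets (powM D lborel)" for t using D(1) by measurable
    have "merge C D (c, g) \<in> ?A \<longleftrightarrow> g \<in> ?D (1 - ?s)" if g: "g \<in> space (powM D lborel)" for g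
    proof -
      have "(\<Sum>i\<in>C \<union> D. (merge C D (c, g) i)\<^sup>2) = (\<Sum>i\<in>C. (merge C D (c, g) i)\<^sup>2) + (\<Sum>i\<in>D. (merge C D (c, g) i)\<^sup>2)"
        by (rule sum.union_disjoint[OF finC D(1) CD])
      also have "\<dots> = ?s + (\<Sum>i\<in>D. (g i)\<^sup>2)"
        using CD by (intro arg_cong2[where f = "(+)"] sum.cong) (auto simp: merge_def)
      finally have e: "(\<Sum>i\<in>C \<union> D. (merge C D (c, g) i)\<^sup>2) = ?s + (\<Sum>i\<in>D. (g i)\<^sup>2)" .
      have "merge C D (c, g) \<in> space (powM (C \<union> D) lborel)"
        using c g by (simp add: space_PiM PiE_def extensional_def merge_def)
      then show ?thesis using g by (auto simp: e real_sqrt_le_1_iff)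
    qed
    then have "(\<integral>\<^sup>+g. indicator ?A (merge C D (c, g)) \<partial>powM D lborel) = (\<integral>\<^sup>+g. indicator (?D (1 - ?s)) g \<partial>powM D lborel)"
      by (intro nn_integral_cong) (simp add: indicator_def)
    also have "\<dots> = emeasure (powM D lborel) (?D (1 - ?s))" using Dm by simp
    also have "\<dots> = ?w * (ennreal (sqrt (1 - ?s) ^ p) * indicator {..1} ?s)"
    proof (rule linorder_cases[of ?s 1])
      assume s: "?s < 1"
      have "?D (1 - ?s) = {g. sqrt (\<Sum>i\<in>D. (g i)\<^sup>2) \<le> sqrt (1 - ?s)} \<inter> space (powM D lborel)" by simp
      then show ?thesis using emeasure_cball_aux[OF D(1), of "sqrt (1 - ?s)"] s
        by (simp add: D(2) ennreal_mult)
    next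
      assume s: "?s = 1"
      \<comment> \<open>Over the boundary sphere the slice is a single point, which has measure 0
        because \<open>p\<close> is positive.\<close>
      have "?D 0 = PiE D (\<lambda>_. {0})"
      proof (intro equalityI subsetI)
        fix g assume g: "g \<in> ?D 0"
        then have "(\<Sum>i\<in>D. (g i)\<^sup>2) = 0" by (intro antisym sum_nonneg) auto
        then have "\<forall>i\<in>D. g i = 0" using D(1) by (simp add: sum_nonneg_eq_0_iff)
        then show "g \<in> PiE D (\<lambda>_. {0})" using g by (intro PiE_I) (auto simp: space_PiM PiE_def extensional_def)
      qed (auto simp: space_PiM PiE_def)
      moreover have "emeasure (powM D lborel) (PiE D (\<lambda>_. {0::real})) = 0"
        using Dne D(1) by (subst pl.emeasure_PiM) (auto simp: zero_power)
      ultimately show ?thesis using s p by (simp add: zero_power)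
    next
      assume s: "1 < ?s"
      have "?D (1 - ?s) = {}"
      proof (rule ccontr)
        assume "?D (1 - ?s) \<noteq> {}"
        then obtain g where "(\<Sum>i\<in>D. (g i)\<^sup>2) \<le> 1 - ?s" by blast
        moreover have "0 \<le> (\<Sum>i\<in>D. (g i)\<^sup>2)" by (rule sum_nonneg) simp
        ultimately show False using s by linarith
      qed
      then show ?thesis using s by simp
    qed
    finally show ?thesis .
  qed
  have m: "(\<lambda>z::real^'n. ennreal (sqrt (1 - (norm z)\<^sup>2) ^ p) * indicator (cball 0 1) z) \<in> borel_measurable borel" by measurable
  have nc: "(norm (\<Sum>b\<in>C. c b *\<^sub>R b))\<^sup>2 = (\<Sum>b\<in>C. (c b)\<^sup>2)" for c
    by (simp add: norm_sum_orthonormal[OF C] sum_nonneg)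
  have ic: "indicator (cball 0 1) z = (indicator {..1} ((norm z)\<^sup>2) :: ennreal)" for z :: "real^'n"
    by (simp add: indicator_def abs_square_le_1)
  have "?w * (\<integral>\<^sup>+z. ennreal (sqrt (1 - (norm z)\<^sup>2) ^ p) * indicator (cball 0 1) z \<partial>span_lborel C) =
    (\<integral>\<^sup>+z. ?w * (ennreal (sqrt (1 - (norm z)\<^sup>2) ^ p) * indicator (cball 0 1) z) \<partial>span_lborel C)"
    by (rule nn_integral_cmult[symmetric]) (use m in simp)
  also have "\<dots> = (\<integral>\<^sup>+c. ?w * (ennreal (sqrt (1 - (\<Sum>b\<in>C. (c b)\<^sup>2)) ^ p) * indicator {..1} (\<Sum>b\<in>C. (c b)\<^sup>2)) \<partial>powM C lborel)"
    by (subst nn_integral_span_lborel) (use m in \<open>simp_all add: ic nc\<close>)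
  also have "\<dots> = (\<integral>\<^sup>+c. \<integral>\<^sup>+g. indicator ?A (merge C D (c, g)) \<partial>powM D lborel \<partial>powM C lborel)"
    by (rule nn_integral_cong) (simp only: sec)
  also have "\<dots> = (\<integral>\<^sup>+f. indicator ?A f \<partial>powM (C \<union> D) lborel)"
    by (rule pl.product_nn_integral_fold[OF CD finC D(1), symmetric]) (use A in simp)
  also have "\<dots> = emeasure (powM (C \<union> D) lborel) ?A" using A by simp
  also have "\<dots> = ball_vol (card C + p)"
    using emeasure_cball_aux[of "C \<union> D" 1] finC D(1,2) CD by (simp add: card_Un_disjoint)
  finally show ?thesis .
qed

lemma simplex_energy_cmult:
  fixes S :: "'n::finite set"
  assumes j0: "j0 \<notin> S" and r: "0 \<le> r" and g: "g \<in> borel_measurable borel" "\<And>x. 0 \<le> g x"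
  shows "simplex_energy S j0 N (\<lambda>x. r * g x) = ennreal (r ^ (card S + 1)) * simplex_energy S j0 N g"
proof -
  have "(\<Prod>i\<in>insert j0 S. ennreal (r * g (X i))) = ennreal (r ^ (card S + 1)) * (\<Prod>i\<in>insert j0 S. ennreal (g (X i)))" for X
    using j0 r g(2) by (simp add: ennreal_mult prod.distrib ennreal_power ac_simps)
  then show ?thesis
    unfolding simplex_energy_def
    by (subst nn_integral_cmult[symmetric]) (auto intro!: measurable_energy_integrand g(1) simp only: sets_span_lborel mult.left_commute)
qed

lemma AE_simplex_span:
  "AE X in powM (T::'n set) (coord_lborel (S::'n::finite set)). \<forall>j\<in>T. X j \<in> span (coord_basis S)"
  by (intro AE_finite_allI AE_PiM_component_finite sigma_finite_span_lborel orthonormal_coord_basis AE_span_lborel) auto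

lemma gram_vol_zero:
  assumes "i \<in> S" "Y i = 0"
  shows "gram_vol S Y = 0"
proof -
  have "row i (gram S Y) = 0" using assms by (auto simp: row_def gram_def vec_eq_iff)
  then show ?thesis by (simp add: gram_vol_def det_zero_row)
qed

text \<open>A flat whose foot is \<open>z\<close> meets the unit ball in a ball about
  \<open>z\<close> of radius \<open>sqrt (1 - (norm z)\<^sup>2)\<close>, and the energy of a ball
  scales by \<open>simplex_energy_ball\<close>. If \<open>norm z\<close> is at least 1, at most the
  foot remains, all vertices coincide, and a positive power of the degenerate Gram volume
  vanishes.\<close>

lemma simplex_energy_ball_section:
  fixes S :: "'n::finite set"
  assumes i0: "i0 \<in> S" and j0: "j0 \<notin> S" and N: "0 < N" and U: "orthogonal_transformation (U :: real^'n \<Rightarrow> real^'n)"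
    and z: "\<And>x. x \<in> span (coord_basis S) \<Longrightarrow> orthogonal (U x) z"
  shows "simplex_energy S j0 N (\<lambda>x. indicator (cball 0 1) (z + U x)) =
    ennreal (sqrt (1 - (norm z)\<^sup>2) ^ (card S * (card S + 1 + N))) * indicator (cball 0 1) z * simplex_energy S j0 N (indicator (cball 0 1))"
proof -
  have nz: "(norm (z + U x))\<^sup>2 = (norm z)\<^sup>2 + (norm x)\<^sup>2" if "x \<in> span (coord_basis S)" for x
    using norm_add_Pythagorean[of z "U x"] z[OF that] orthogonal_transformation_norm[OF U]
    by (simp add: orthogonal_commute)
  have le: "norm (z + U x) \<le> 1 \<longleftrightarrow> (norm z)\<^sup>2 + (norm x)\<^sup>2 \<le> 1" if "x \<in> span (coord_basis S)" for x
    unfolding nz[OF that, symmetric] by (simp add: abs_square_le_1)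
  let ?p = "card S * (card S + 1 + N)" and ?T = "insert j0 S"
  have p: "0 < ?p" using i0 by (auto simp: card_gt_0_iff)
  show ?thesis
  proof (cases "norm z < 1")
    case True
    define r where "r = sqrt (1 - (norm z)\<^sup>2)"
    have r: "0 < r" and r2: "r\<^sup>2 = 1 - (norm z)\<^sup>2"
      using True abs_square_less_1[of "norm z"] by (simp_all add: r_def)
    have ind: "indicator (cball 0 1) (z + U x) = (indicator (cball 0 r) x :: real)" if x: "x \<in> span (coord_basis S)" for x
    proof -
      have "norm x \<le> r \<longleftrightarrow> (norm x)\<^sup>2 \<le> r\<^sup>2" using r by (simp add: power_mono_iff)
      then show ?thesis using le[OF x] by (simp add: indicator_def r2)
    qed
    have "simplex_energy S j0 N (\<lambda>x. indicator (cball 0 1) (z + U x)) = simplex_energy S j0 N (indicator (cball 0 r))"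
      unfolding simplex_energy_def
    proof (rule nn_integral_cong_AE, rule AE_mp[OF AE_simplex_span AE_I2], intro impI)
      fix X :: "'n \<Rightarrow> real^'n" assume X: "\<forall>j\<in>?T. X j \<in> span (coord_basis S)"
      have "(\<Prod>i\<in>?T. ennreal (indicator (cball 0 1) (z + U (X i)))) = (\<Prod>i\<in>?T. ennreal (indicator (cball 0 r) (X i)))"
        by (rule prod.cong[OF refl]) (use X in \<open>simp only: ind\<close>)
      then show "ennreal (gram_vol S (\<lambda>j. X j - X j0) ^ N) * (\<Prod>i\<in>?T. ennreal (indicator (cball 0 1) (z + U (X i)))) =
        ennreal (gram_vol S (\<lambda>j. X j - X j0) ^ N) * (\<Prod>i\<in>?T. ennreal (indicator (cball 0 r) (X i)))" by simp
    qed
    then show ?thesis using simplex_energy_ball[OF j0 r, of N] True by (simp add: r_def)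
  next
    case False
    then have nz1: "1 \<le> (norm z)\<^sup>2" by (simp add: one_le_power)
    have "simplex_energy S j0 N (\<lambda>x. indicator (cball 0 1) (z + U x)) = (\<integral>\<^sup>+X. 0 \<partial>powM ?T (coord_lborel S))"
      unfolding simplex_energy_def
    proof (rule nn_integral_cong_AE, rule AE_mp[OF AE_simplex_span AE_I2], intro impI)
      fix X :: "'n \<Rightarrow> real^'n" assume X: "\<forall>j\<in>?T. X j \<in> span (coord_basis S)"
      have x0: "X i = 0" if "i \<in> ?T" "norm (z + U (X i)) \<le> 1" for i
      proof -
        have "(norm z)\<^sup>2 + (norm (X i))\<^sup>2 \<le> 1" using le X that by blast
        then have "(norm (X i))\<^sup>2 \<le> 0" using nz1 by linarith
        then show ?thesis by simp
      qed
      show "ennreal (gram_vol S (\<lambda>j. X j - X j0) ^ N) * (\<Prod>i\<in>?T. ennreal (indicator (cball 0 1) (z + U (X i)))) = 0"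
      proof (cases "\<forall>i\<in>?T. norm (z + U (X i)) \<le> 1")
        case True
        then have "X i0 = 0" "X j0 = 0" using x0 i0 by blast+
        then have "X i0 - X j0 = 0" by simp
        then have "gram_vol S (\<lambda>j. X j - X j0) = 0" by (rule gram_vol_zero[OF i0])
        then show ?thesis using N by (simp add: zero_power)
      next
        case False
        then have "\<exists>i\<in>?T. ennreal (indicator (cball 0 1) (z + U (X i))) = 0" by (auto simp: indicator_def)
        then have "(\<Prod>i\<in>?T. ennreal (indicator (cball 0 1) (z + U (X i)))) = 0" by (intro prod_zero) simp_all
        then show ?thesis by (simp only: mult_zero_right)
      qed
    qed
    moreover have "ennreal (sqrt (1 - (norm z)\<^sup>2) ^ ?p) * indicator (cball 0 1) z = (0 :: ennreal)"
    proof (cases "norm z = 1")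
      case True then show ?thesis using p by (simp add: zero_power)
    qed (use False in simp)
    ultimately show ?thesis by (simp only: nn_integral_const mult_zero_left)
  qed
qed

text \<open>The energy of the unit ball on a flat is a power of the radius of the section, with
  exponent \<open>card S * (CARD('n) + 1)\<close>. Integrated over the complement, of dimension
  \<open>CARD('n) - card S\<close>, it gives by slicing the volume of the unit ball of dimension
  \<open>CARD('n) * (card S + 1)\<close> divided by that of dimension
  \<open>card S * (CARD('n) + 1)\<close>. This is the origin of these two ball volumes in the
  theorem.\<close>

lemma flat_energy_ball:
  fixes S :: "'n::finite set"
  assumes i0: "i0 \<in> S" and j0: "j0 \<notin> S"
  defines "N \<equiv> CARD('n) - card S"
  shows "ball_vol (card S * (CARD('n) + 1)) *
      (\<integral>\<^sup>+F. flat_energy S N (indicator (cball 0 1)) (flat_coords F) \<partial>affine_grassmannian_measure (card S)) =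
    ball_vol N ^ (card S + 1) * simplex_energy S j0 N (indicator (cball 0 1)) * ball_vol (CARD('n) * (card S + 1))"
proof -
  have k: "card S \<le> CARD('n)" by (rule card_mono) simp_all
  have "card S < CARD('n)" using j0 by (intro psubset_card_mono) auto
  then have N: "0 < N" by (simp add: N_def)
  have S0: "0 < card S" using i0 by (auto simp: card_gt_0_iff)
  let ?\<mu> = "grassmannian_measure (card S) :: (real^'n) set measure"
  let ?p = "card S * (CARD('n) + 1)" and ?A = "simplex_energy S j0 N (indicator (cball 0 1))"
  let ?W = "ball_vol N ^ (card S + 1)" and ?w = "ball_vol ?p"
  let ?v = "ball_vol (CARD('n) * (card S + 1))"
  have pp: "card S * (card S + 1 + N) = ?p" using k by (simp add: N_def)
  have nk: "CARD('n) - card S + ?p = CARD('n) * (card S + 1)"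
    using k by (simp add: algebra_simps)
  have haar: "grassmannian_haar (card S) ?\<mu>" by (rule grassmannian_measure_haar[OF k])
  interpret prob_space ?\<mu> using haar by (simp add: grassmannian_haar_def)
  have im: "(indicator (cball 0 1) :: real^'n \<Rightarrow> real) \<in> borel_measurable borel" by measurable
  \<comment> \<open>\<open>nn_integral_ball_sections\<close> evaluates the slice integral only after
    multiplication by \<open>?w\<close>, so this factor is introduced and divided out.\<close>
  have w: "a = (?w * a) / ?w" for a
    using mult_divide_eq_ennreal[of ?w a] unit_ball_vol_ennreal[of ?p] by (simp add: mult.commute)
  have "(\<integral>\<^sup>+F. flat_energy S N (indicator (cball 0 1)) (flat_coords F) \<partial>affine_grassmannian_measure (card S)) =
    (\<integral>\<^sup>+E. (?W * ?A * ?v) / ?w \<partial>?\<mu>)"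
  proof (rule nn_integral_affine_grassmannian[OF k measurable_flat_energy[OF im]])
    fix E :: "(real^'n) set" assume E: "E \<in> linear_grassmannian (card S)"
    obtain B C where BC: "orthonormal_set B" "span B = E" "card B = card S" "orthonormal_set C" "span C = E\<^sup>\<bottom>"
        "B \<inter> C = {}" "orthonormal_set (B \<union> C)" "card C = CARD('n) - card S" "card B + card C = CARD('n)"
      by (rule linear_grassmannian_bases[OF E])
    obtain U :: "real^'n \<Rightarrow> real^'n" where U: "orthogonal_transformation U" "E = U ` span (coord_basis S)"
      by (rule subspace_mem_linear_grassmannian_image[OF E])
    let ?h = "\<lambda>z::real^'n. ennreal (sqrt (1 - (norm z)\<^sup>2) ^ ?p) * indicator (cball 0 1) z"
    have "(\<integral>\<^sup>+z. flat_energy S N (indicator (cball 0 1)) (z, flat_proj E) \<partial>span_lborel C) = (\<integral>\<^sup>+z. (?W * ?A) * ?h z \<partial>span_lborel C)"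
    proof (rule nn_integral_cong_AE, rule AE_mp[OF AE_span_lborel AE_I2], intro impI)
      fix z assume "z \<in> span C"
      then have z: "orthogonal (U x) z" if "x \<in> span (coord_basis S)" for x
        using that BC(5) U(2) by (auto simp: orthogonal_comp_def orthogonal_commute)
      have se: "simplex_energy S j0 N (\<lambda>x. indicator (cball 0 1) (z + U x)) =
        ennreal (sqrt (1 - (norm z)\<^sup>2) ^ (card S * (card S + 1 + N))) * indicator (cball 0 1) z * ?A"
        by (rule simplex_energy_ball_section[OF i0 j0 N U(1)]) (rule z)
      show "flat_energy S N (indicator (cball 0 1)) (z, flat_proj E) = (?W * ?A) * ?h z"
        unfolding U(2) flat_energy_image[OF j0 im U(1)] se pp N_def[symmetric]
        by (simp only: ac_simps)
    qed
    also have "\<dots> = (?W * ?A) * (\<integral>\<^sup>+z. ?h z \<partial>span_lborel C)"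
    proof (rule nn_integral_cmult)
      have "?h \<in> borel_measurable borel" by measurable
      then show "?h \<in> borel_measurable (span_lborel C)" by simp
    qed
    also have "\<dots> = (?w * ((?W * ?A) * (\<integral>\<^sup>+z. ?h z \<partial>span_lborel C))) / ?w" by (rule w)
    also have "?w * ((?W * ?A) * (\<integral>\<^sup>+z. ?h z \<partial>span_lborel C)) = (?W * ?A) * (?w * (\<integral>\<^sup>+z. ?h z \<partial>span_lborel C))"
      by (rule mult.left_commute)
    also have "?w * (\<integral>\<^sup>+z. ?h z \<partial>span_lborel C) = ?v"
      using nn_integral_ball_sections[OF BC(4), of ?p] S0 by (simp only: BC(8) nk) simp
    finally show "\<exists>C. orthonormal_set C \<and> span C = E\<^sup>\<bottom> \<and> card C = CARD('n) - card S \<and>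
        (\<integral>\<^sup>+z. flat_energy S N (indicator (cball 0 1)) (z, flat_proj E) \<partial>span_lborel C) = (?W * ?A * ?v) / ?w"
      using BC by blast
  qed
  also have "\<dots> = (?W * ?A * ?v) / ?w" by (simp add: emeasure_space_1)
  finally show ?thesis by (simp only: ennreal_times_divide w[symmetric])
qed

section \<open>Parametrization, null sets and the energy bound on a single flat\<close>

lemma affine_grassmannian_cases:
  fixes F :: "(real^'n) set" and S :: "'n set"
  assumes F: "F \<in> affine_grassmannian (card S)"
  obtains U z where "orthogonal_transformation U" "F = (+) z ` span (U ` coord_basis S)"
    "flat_coords F = (z, flat_proj (U ` span (coord_basis S)))"
proof -
  have aF: "affine F" "aff_dim F = int (card S)" using F by (simp_all add: affine_grassmannian_def)
  then have "F \<noteq> {}" by auto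
  then obtain a where a: "a \<in> F" by blast
  define E where "E = (+) (- a) ` F"
  have sE: "subspace E" unfolding E_def using affine_diffs_subspace[OF aF(1) a] by (simp add: image_def)
  have Fa: "F = (+) a ` E" by (simp add: E_def image_image)
  have "int (dim E) = aff_dim E" by (rule aff_dim_subspace[OF sE, symmetric])
  moreover have "aff_dim E = aff_dim F" unfolding E_def by (rule aff_dim_translation_eq)
  ultimately have "dim E = card S" using aF(2) by simp
  then have E: "E \<in> linear_grassmannian (card S)" using sE by (simp add: linear_grassmannian_def)
  obtain U :: "real^'n \<Rightarrow> real^'n" where U: "orthogonal_transformation U" "E = U ` span (coord_basis S)"
    by (rule subspace_mem_linear_grassmannian_image[OF E])
  define z where "z = a - closest_point E a"
  have "F = (+) z ` E"
  proof -
    have "(+) (closest_point E a) ` E = E"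
    proof (intro equalityI subsetI)
      fix x assume "x \<in> E"
      then have "x = closest_point E a + (x - closest_point E a)" "x - closest_point E a \<in> E"
        using subspace_diff[OF sE _ closest_point_subspace(1)[OF sE]] by auto
      then show "x \<in> (+) (closest_point E a) ` E" by (rule image_eqI)
    qed (use subspace_add[OF sE closest_point_subspace(1)[OF sE]] in auto)
    then have "F = (+) (z + closest_point E a) ` E" by (simp add: Fa z_def)
    also have "\<dots> = (+) z ` ((+) (closest_point E a) ` E)" by (simp add: image_image add.assoc)
    finally show ?thesis using \<open>(+) (closest_point E a) ` E = E\<close> by simp
  qed
  moreover have "flat_coords ((+) z ` E) = (z, matrix (closest_point E))"
    by (rule flat_coords_translate[OF sE])
      (use closest_point_subspace(2)[OF sE] in \<open>simp add: z_def orthogonal_def inner_commute\<close>)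
  ultimately show ?thesis
    using that[OF U(1), of z] by (simp add: span_orthogonal_image[OF U(1)] U(2)[symmetric] flat_proj_subspace[OF sE])
qed

lemma nn_integral_flat_lebesgue_image:
  fixes U :: "real^'n \<Rightarrow> real^'n"
  assumes U: "orthogonal_transformation U" and g: "g \<in> borel_measurable borel"
  shows "(\<integral>\<^sup>+x. g x \<partial>flat_lebesgue ((+) z ` span (U ` coord_basis S))) = (\<integral>\<^sup>+x. g (z + U x) \<partial>coord_lborel S)"
proof -
  have oB: "orthonormal_set (U ` coord_basis S)" using U orthonormal_coord_basis by (rule orthonormal_set_image)
  have lU: "linear U" by (rule orthogonal_transformation_linear[OF U])
  have Um: "U \<in> borel_measurable borel" by (rule measurable_linear[OF lU])
  have gz: "(\<lambda>x. g (z + x)) \<in> borel_measurable borel" using measurable_compose[OF _ g, of "\<lambda>x. z + x"] by simp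
  have "span_lborel (U ` coord_basis S) = distr (coord_lborel S) borel U"
    by (rule distr_span_lborel[OF lU _ finite_coord_basis, symmetric]) (simp add: inj_on_subset[OF orthogonal_transformation_inj[OF U]])
  then show ?thesis
    unfolding flat_lebesgue_translate(3)[OF oB g] using Um gz by (simp add: nn_integral_distr)
qed

lemma AE_flat_lebesgue_image:
  fixes U :: "real^'n \<Rightarrow> real^'n"
  assumes U: "orthogonal_transformation U" and M: "M \<in> sets borel"
    and null: "(\<integral>\<^sup>+x. indicator M (z + U x) \<partial>coord_lborel S) = 0"
  shows "AE x in flat_lebesgue ((+) z ` span (U ` coord_basis S)). x \<notin> M"
proof -
  let ?F = "(+) z ` span (U ` coord_basis S)"
  have oB: "orthonormal_set (U ` coord_basis S)" using U orthonormal_coord_basis by (rule orthonormal_set_image)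
  have im: "(indicator M :: real^'n \<Rightarrow> ennreal) \<in> borel_measurable borel" using M by simp
  have "(\<integral>\<^sup>+x. indicator M x \<partial>flat_lebesgue ?F) = 0"
    unfolding nn_integral_flat_lebesgue_image[OF U im] by (rule null)
  then have "AE x in flat_lebesgue ?F. indicator M x = (0::ennreal)"
    using flat_lebesgue_translate(2)[OF oB im] by (simp add: nn_integral_0_iff_AE)
  then show ?thesis by eventually_elim (simp add: indicator_def split: if_splits)
qed

text \<open>Truncation at \<open>r\<close> and division by \<open>r\<close> give a function with
  values in [0, 1], to which Groemer's inequality applies. The energy is homogeneous of degree
  \<open>card S + 1\<close> and the power of the integral of degree \<open>card S + 1 + N\<close>;
  the difference is the exponent \<open>N\<close> in the denominator.\<close>

lemma Groemer_inequality_scaled: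
  fixes S :: "'n::finite set"
  assumes i0: "i0 \<in> S" and j0: "j0 \<notin> S" and g [measurable]: "g \<in> borel_measurable borel" and g0: "\<And>x. 0 \<le> g x" and r: "0 < r"
  shows "simplex_energy S j0 N (indicator (cball 0 1)) *
      ((\<integral>\<^sup>+x. ennreal (min (g x) r) \<partial>coord_lborel S) ^ (card S + 1 + N) / ennreal r ^ N)
    \<le> ennreal (unit_ball_vol (real (card S)) ^ (card S + 1 + N)) * simplex_energy S j0 N g"
proof -
  let ?L = "coord_lborel S" and ?k = "card S" and ?A = "simplex_energy S j0 N (indicator (cball 0 1))"
  let ?w = "ennreal (unit_ball_vol (real (card S)) ^ (card S + 1 + N))"
  define h where "h = (\<lambda>x. min (g x) r / r)"
  have h [measurable]: "h \<in> borel_measurable borel" unfolding h_def by measurable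
  have h01: "0 \<le> h x" "h x \<le> 1" for x using g0[of x] r by (simp_all add: h_def)
  have rh: "r * h x = min (g x) r" for x using r by (simp add: h_def)
  let ?I = "\<integral>\<^sup>+x. ennreal (h x) \<partial>?L"
  have "(\<integral>\<^sup>+x. ennreal (min (g x) r) \<partial>?L) = (\<integral>\<^sup>+x. ennreal r * ennreal (h x) \<partial>?L)"
    by (rule nn_integral_cong) (use r h01 in \<open>simp add: rh[symmetric] ennreal_mult\<close>)
  also have "\<dots> = ennreal r * ?I" by (rule nn_integral_cmult) (use measurable_compose[OF h measurable_ennreal] in simp)
  finally have I: "(\<integral>\<^sup>+x. ennreal (min (g x) r) \<partial>?L) = ennreal r * ?I" .
  have rN: "ennreal r ^ N \<noteq> 0" "ennreal r ^ N \<noteq> \<top>" using r by (simp_all add: ennreal_power ennreal_eq_0_iff not_le)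
  have "(ennreal r * ?I) ^ (?k + 1 + N) / ennreal r ^ N = (ennreal r ^ (?k + 1) * ?I ^ (?k + 1 + N)) * ennreal r ^ N / ennreal r ^ N"
    by (simp only: power_mult_distrib power_add ac_simps)
  also have "\<dots> = ennreal r ^ (?k + 1) * ?I ^ (?k + 1 + N)" by (rule mult_divide_eq_ennreal[OF rN])
  finally have "?A * ((\<integral>\<^sup>+x. ennreal (min (g x) r) \<partial>?L) ^ (?k + 1 + N) / ennreal r ^ N) =
    ennreal r ^ (?k + 1) * (?A * ?I ^ (?k + 1 + N))"
    unfolding I by (simp only: mult.left_commute)
  also have "\<dots> \<le> ennreal r ^ (?k + 1) * (?w * simplex_energy S j0 N h)"
    by (intro mult_left_mono Groemer_inequality[OF i0 j0 h h01]) simp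
  also have "\<dots> = ?w * simplex_energy S j0 N (\<lambda>x. r * h x)"
    unfolding simplex_energy_cmult[OF j0 less_imp_le[OF r] h h01(1)] ennreal_power[OF less_imp_le[OF r]] by (rule mult.left_commute)
  also have "\<dots> \<le> ?w * simplex_energy S j0 N g"
    by (intro mult_left_mono simplex_energy_mono) (use g0 r in \<open>simp_all add: rh\<close>)
  finally show ?thesis .
qed

text \<open>On the flat, \<open>f\<close> agrees almost everywhere with \<open>g\<close> and stays
  below its essential supremum \<open>e\<close>, so it agrees with \<open>g\<close> cut off at
  \<open>e\<close>, and the scaled inequality applies. The integrand on the left keeps
  \<open>f\<close>, while the energy on the right is taken of the Borel function
  \<open>g\<close>.\<close>

lemma flat_energy_lower_bound:
  fixes f g :: "real^'n \<Rightarrow> real" and S :: "'n set" and F :: "(real^'n) set"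
  defines "N \<equiv> CARD('n) - card S"
  assumes F: "F \<in> affine_grassmannian (card S)" and i0: "i0 \<in> S" and j0: "j0 \<notin> S"
    and g: "g \<in> borel_measurable borel" and g0: "\<And>x. 0 \<le> g x" and fg: "AE x in flat_lebesgue F. f x = g x"
  defines "e \<equiv> esssup (flat_lebesgue F) (\<lambda>x. ennreal (f x))"
  shows "ball_vol N ^ (card S + 1) * simplex_energy S j0 N (indicator (cball 0 1)) *
      (if e = 0 then 0 else (\<integral>\<^sup>+x. ennreal (f x) \<partial>flat_lebesgue F) ^ (CARD('n) + 1) / e ^ N)
    \<le> ennreal (unit_ball_vol (real (card S)) ^ (CARD('n) + 1)) * flat_energy S N g (flat_coords F)"
proof -
  have "card S < CARD('n)" using j0 by (intro psubset_card_mono) auto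
  then have N: "0 < N" and n: "card S + 1 + N = CARD('n) + 1" by (simp_all add: N_def)
  obtain U z where U: "orthogonal_transformation U" and Fz: "F = (+) z ` span (U ` coord_basis S)"
    and fc: "flat_coords F = (z, flat_proj (U ` span (coord_basis S)))" by (rule affine_grassmannian_cases[OF F])
  have Um [measurable]: "U \<in> borel_measurable borel" by (intro measurable_linear orthogonal_transformation_linear U)
  have gU: "(\<lambda>x. g (z + U x)) \<in> borel_measurable borel" using measurable_compose[OF _ g, of "\<lambda>x. z + U x" borel] by simp
  let ?W = "ball_vol N ^ (card S + 1)" and ?A = "simplex_energy S j0 N (indicator (cball 0 1))"
  let ?w = "ennreal (unit_ball_vol (real (card S)) ^ (CARD('n) + 1))"
  have H: "flat_energy S N g (flat_coords F) = ?W * simplex_energy S j0 N (\<lambda>x. g (z + U x))"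
    unfolding fc flat_energy_image[OF j0 g U] N_def ..
  consider "e = 0 \<or> e = \<top>" | r where "e = ennreal r" "0 < r"
    by (cases e) (auto simp: less_le)
  then show ?thesis
  proof cases
    \<comment> \<open>If the essential supremum is infinite, so is its power, because
      \<open>N\<close> is positive, and the quotient is 0 by the convention for division by
      \<top>.\<close>
    case 1
    then show ?thesis using N by (auto simp: ennreal_top_eq_mult_iff power_eq_top_ennreal)
  next
    case 2
    have "AE x in flat_lebesgue F. ennreal (f x) \<le> e" unfolding e_def by (rule esssup_AE)
    with fg have "AE x in flat_lebesgue F. ennreal (f x) = ennreal (min (g x) r)"
    proof eventually_elim
      case (elim x)
      then show ?case using 2 g0[of x] by (simp add: ennreal_le_iff2 min_def)
    qed
    then have "(\<integral>\<^sup>+x. ennreal (f x) \<partial>flat_lebesgue F) = (\<integral>\<^sup>+x. ennreal (min (g x) r) \<partial>flat_lebesgue F)"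
      by (rule nn_integral_cong_AE)
    also have "\<dots> = (\<integral>\<^sup>+x. ennreal (min (g (z + U x)) r) \<partial>coord_lborel S)"
      unfolding Fz by (rule nn_integral_flat_lebesgue_image[OF U]) (use g in measurable)
    finally have "?A * ((\<integral>\<^sup>+x. ennreal (f x) \<partial>flat_lebesgue F) ^ (CARD('n) + 1) / e ^ N) \<le> ?w * simplex_energy S j0 N (\<lambda>x. g (z + U x))"
      using Groemer_inequality_scaled[OF i0 j0 gU g0 2(2), of N] unfolding n 2(1) by simp
    from mult_left_mono[OF this, of ?W] show ?thesis using 2 by (simp add: H ac_simps)
  qed
qed

theorem theorem1p3:
  fixes f :: "real^'n \<Rightarrow> real" and k :: nat
  assumes "1 \<le> k" and "k \<le> CARD('n) - 1"
    and "\<And>x. 0 \<le> f x"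
    and "bounded (range f)"
    and "integrable lebesgue f"
  shows "(\<integral>\<^sup>+ F.
            (if esssup (flat_lebesgue F) (\<lambda>x. ennreal (f x)) = 0 then 0
             else (\<integral>\<^sup>+ x. ennreal (f x) \<partial>flat_lebesgue F) ^ (CARD('n) + 1)
                    / esssup (flat_lebesgue F) (\<lambda>x. ennreal (f x)) ^ (CARD('n) - k))
          \<partial>affine_grassmannian_measure k)
    \<le> ennreal
        (unit_ball_vol (real k) ^ (CARD('n) + 1) * unit_ball_vol (real (CARD('n) * (k + 1)))
           / (unit_ball_vol (real CARD('n)) ^ (k + 1) * unit_ball_vol (real (k * (CARD('n) + 1))))
         * (integral\<^sup>L lebesgue f) ^ (k + 1))"
    (is "(\<integral>\<^sup>+ F. ?G F \<partial>?\<nu>) \<le> ennreal (?wk ^ _ * ?v / (?wn ^ _ * ?wp) * ?X ^ _)")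
proof -
  have k: "k \<le> CARD('n)" "k < CARD('n)" using assms(1,2) by simp_all
  obtain S :: "'n set" where S: "card S = k"
    using k obtain_subset_with_card_n[of k "UNIV :: 'n set"] by auto
  have "S \<noteq> {}" "S \<noteq> UNIV" using S assms(1) k(2) by auto
  then obtain i0 j0 where i0: "i0 \<in> S" and j0: "j0 \<notin> S" by blast
  define N where "N = CARD('n) - k"
  let ?A = "simplex_energy S j0 N (indicator (cball 0 1))" and ?W = "ball_vol N ^ (k + 1)"
  let ?H = "\<lambda>g. \<integral>\<^sup>+F. flat_energy S N g (flat_coords F) \<partial>?\<nu>"
  let ?wN = "unit_ball_vol (real N)"
  obtain c where c: "\<And>g. g \<in> borel_measurable borel \<Longrightarrow> ennreal ?wN * (\<integral>\<^sup>+x. ennreal (g x) \<partial>lborel) ^ (k + 1) = c * ?H g"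
    using Blaschke_Petkantschin_affine_grassmannian[of S] unfolding S N_def[symmetric] by blast
  have pos: "0 < ?wN" "0 < ?wk" "0 < ?wn" "0 < ?wp" "0 < ?v" by simp_all
  have ball: "ennreal ?wp * ?H (indicator (cball 0 1)) = ?W * ?A * ennreal ?v"
    using flat_energy_ball[OF i0 j0] unfolding S N_def[symmetric] .
  have "(\<integral>\<^sup>+x. ennreal (indicator (cball 0 1) x) \<partial>(lborel :: (real^'n) measure)) = ennreal ?wn"
    using emeasure_cball[of 1 "0 :: real^'n"] by (simp add: ennreal_indicator)
  \<comment> \<open>The formula is evaluated at the indicator of the unit ball. Neither
    \<open>c\<close> nor the energy \<open>?A\<close> of the ball is known, but the final estimate
    involves them only through \<open>c * (?W * ?A)\<close>, which is determined here.\<close>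
  then have "ennreal ?wN * ennreal ?wn ^ (k + 1) = c * ?H (indicator (cball 0 1))"
    using c[of "indicator (cball 0 1)"] by simp
  then have "ennreal (?wN * ?wn ^ (k + 1) * ?wp) = ennreal ?wp * (c * ?H (indicator (cball 0 1)))"
    using pos by (simp add: ennreal_mult ennreal_power mult.commute del: power_Suc)
  also have "\<dots> = c * (?W * ?A) * ennreal ?v" by (simp only: mult.left_commute[of _ c] ball mult.assoc)
  finally have c_ball: "ennreal (?wN * ?wn ^ (k + 1) * ?wp) = c * (?W * ?A) * ennreal ?v" .
  have "ennreal (?wN * ?wn ^ (k + 1) * ?wp) \<noteq> 0" using pos by (simp only: ennreal_eq_0_iff) (simp add: not_le)
  then have nz: "c * (?W * ?A) * ennreal ?v \<noteq> 0" "c * (?W * ?A) * ennreal ?v \<noteq> \<top>"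
    unfolding c_ball[symmetric] by simp_all
  \<comment> \<open>The product is positive and finite, which rules out vanishing factors and an
    infinite \<open>?W * ?A\<close>. So this factor may serve as a divisor, and vanishing of
    \<open>c\<close> times an integral implies vanishing of the integral.\<close>
  have "a \<noteq> 0 \<and> b \<noteq> 0 \<and> b \<noteq> \<top>" if "a * b * d \<noteq> 0" "a * b * d \<noteq> \<top>" for a b d :: ennreal
    using that by (auto simp: ennreal_mult_eq_top_iff)
  from this[OF nz] have cWA: "c \<noteq> 0" "?W * ?A \<noteq> 0" "?W * ?A \<noteq> \<top>" by blast+
  have X: "0 \<le> ?X" by (rule Bochner_Integration.integral_nonneg) (use assms(3) in simp)
  \<comment> \<open>\<open>f\<close> is only Lebesgue measurable, while the formula concerns Borel
    functions. It is replaced by a non-negative Borel function \<open>g\<close> that differs from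
    \<open>f\<close> only inside a Borel null set \<open>M\<close>.\<close>
  obtain g' where g': "g' \<in> borel_measurable lborel" "AE x in lborel. f x = g' x"
    using completion_ex_borel_measurable_real[OF borel_measurable_integrable[OF assms(5)]] by blast
  define g where "g x = max 0 (g' x)" for x
  have g: "g \<in> borel_measurable borel" and g0: "\<And>x. 0 \<le> g x" using g'(1) by (simp_all add: g_def[abs_def])
  have "AE x in lborel. f x = g x" using g'(2) by eventually_elim (metis assms(3) g_def max.absorb2)
  then obtain M where M: "{x. f x \<noteq> g x} \<subseteq> M" "M \<in> null_sets lborel"
    by (auto simp: eventually_ae_filter)
  have "(\<integral>\<^sup>+x. ennreal (g x) \<partial>lborel) = (\<integral>\<^sup>+x. ennreal (g x) \<partial>lebesgue)" by (rule nn_integral_completion[symmetric])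
  also have "\<dots> = (\<integral>\<^sup>+x. ennreal (f x) \<partial>lebesgue)"
    by (rule nn_integral_cong_AE) (use AE_completion[OF \<open>AE x in lborel. f x = g x\<close>] in eventually_elim, simp)
  also have "\<dots> = ennreal ?X" by (rule nn_integral_eq_integral[OF assms(5)]) (use assms(3) in simp)
  finally have gX: "(\<integral>\<^sup>+x. ennreal (g x) \<partial>lborel) = ennreal ?X" .
  have Mb: "M \<in> sets borel" using null_setsD2[OF M(2)] by simp
  have iM: "(indicator M :: real^'n \<Rightarrow> real) \<in> borel_measurable borel" using M(2) by auto
  have "(\<integral>\<^sup>+x. ennreal (indicator M x) \<partial>lborel) = 0" using nn_integral_indicator[OF null_setsD2[OF M(2)]] null_setsD1[OF M(2)] by (simp add: ennreal_indicator)
  \<comment> \<open>The formula is applied to the indicator of the null set \<open>M\<close>: the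
    total energy is 0, so the energy of \<open>M\<close> vanishes on almost every flat.\<close>
  then have "?H (indicator M) = 0" using c[OF iM] cWA(1) by simp
  moreover have sets_\<nu>: "sets ?\<nu> = sets (flat_borel (affine_grassmannian k))" and space_\<nu>: "space ?\<nu> = affine_grassmannian k"
    using affine_grassmannian_measure_props(1,2)[OF k(1)] by blast+
  have fm: "(\<lambda>F. flat_energy S N h (flat_coords F)) \<in> borel_measurable ?\<nu>" if "h \<in> borel_measurable borel" for h
    using measurable_compose[OF measurable_flat_coords measurable_flat_energy[OF that]] measurable_cong_sets[OF sets_\<nu> refl] by blast
  ultimately have "AE F in ?\<nu>. flat_energy S N (indicator M) (flat_coords F) = 0"
    using fm[OF iM] by (simp add: nn_integral_0_iff_AE)
  moreover have "AE F in ?\<nu>. F \<in> affine_grassmannian k" using AE_space[of ?\<nu>] by (simp add: space_\<nu>)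
  ultimately have "AE F in ?\<nu>. ?G F \<le> (ennreal (?wk ^ (CARD('n) + 1)) * flat_energy S N g (flat_coords F)) / (?W * ?A)"
  proof eventually_elim
    case (elim F)
    then have F: "F \<in> affine_grassmannian (card S)" by (simp add: S)
    obtain U z where U: "orthogonal_transformation U" and Fz: "F = (+) z ` span (U ` coord_basis S)"
      and fc: "flat_coords F = (z, flat_proj (U ` span (coord_basis S)))" by (rule affine_grassmannian_cases[OF F])
    have Um [measurable]: "U \<in> borel_measurable borel" by (intro measurable_linear orthogonal_transformation_linear U)
    have iU: "(\<lambda>x. indicator M (z + U x) :: real) \<in> borel_measurable borel" using measurable_compose[OF _ iM, of "\<lambda>x. z + U x" borel] by simp
    have "?W * simplex_energy S j0 N (\<lambda>x. indicator M (z + U x)) = 0"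
      using elim(1) flat_energy_image[OF j0 iM U, of N z] unfolding fc S N_def[symmetric] by simp
    then have "simplex_energy S j0 N (\<lambda>x. indicator M (z + U x)) = 0" using unit_ball_vol_ennreal[of N] by simp
    \<comment> \<open>Groemer's inequality bounds a power of the measure of \<open>M\<close> on the
      flat by the energy of \<open>M\<close>. As \<open>?A\<close> does not vanish, \<open>M\<close>
      is null on the flat, and \<open>f\<close> agrees with \<open>g\<close> almost everywhere
      there.\<close>
    then have "?A * (\<integral>\<^sup>+x. ennreal (indicator M (z + U x)) \<partial>coord_lborel S) ^ (card S + 1 + N) = 0"
      using Groemer_inequality[OF i0 j0 iU, of N] by simp
    then have "(\<integral>\<^sup>+x. indicator M (z + U x) \<partial>coord_lborel S) = 0"
      using cWA(2) by (auto simp: ennreal_indicator)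
    from AE_flat_lebesgue_image[OF U Mb this] have "AE x in flat_lebesgue F. x \<notin> M" unfolding Fz .
    then have "AE x in flat_lebesgue F. f x = g x" by eventually_elim (use M(1) in blast)
    from flat_energy_lower_bound[OF F i0 j0 g g0 this]
    have le: "(?W * ?A) * ?G F \<le> ennreal (?wk ^ (CARD('n) + 1)) * flat_energy S N g (flat_coords F)"
      unfolding S N_def[symmetric] by simp
    have "?G F = ?G F * (?W * ?A) / (?W * ?A)" by (rule mult_divide_eq_ennreal[OF cWA(2) cWA(3), symmetric])
    also have "\<dots> \<le> (ennreal (?wk ^ (CARD('n) + 1)) * flat_energy S N g (flat_coords F)) / (?W * ?A)"
      using le by (intro divide_right_mono_ennreal) (simp only: mult.commute)
    finally show ?case .
  qed
  then have "(\<integral>\<^sup>+F. ?G F \<partial>?\<nu>) \<le> (\<integral>\<^sup>+F. (ennreal (?wk ^ (CARD('n) + 1)) * flat_energy S N g (flat_coords F)) / (?W * ?A) \<partial>?\<nu>)"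
    by (rule nn_integral_mono_AE)
  also have "\<dots> = ennreal (?wk ^ (CARD('n) + 1)) * ?H g / (?W * ?A)"
    using fm[OF g] by (subst nn_integral_divide) (simp_all add: nn_integral_cmult)
  \<comment> \<open>Both sides are multiplied by the right side of \<open>c_ball\<close>. On the
    right the divisor \<open>?W * ?A\<close> cancels and \<open>c * ?H g\<close> becomes a power of
    the integral of \<open>f\<close>; on the left the unknown factors turn into known ball
    volumes.\<close>
  finally have "(c * ennreal ?v) * (?W * ?A) * (\<integral>\<^sup>+F. ?G F \<partial>?\<nu>) \<le>
      (c * ennreal ?v) * (?W * ?A) * (ennreal (?wk ^ (CARD('n) + 1)) * ?H g / (?W * ?A))"
    by (rule mult_left_mono) simp
  also have "\<dots> = (c * ennreal ?v) * (ennreal (?wk ^ (CARD('n) + 1)) * ?H g * (?W * ?A) / (?W * ?A))"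
    by (simp only: ennreal_times_divide ac_simps)
  also have "\<dots> = (c * ennreal ?v) * (ennreal (?wk ^ (CARD('n) + 1)) * ?H g)"
    by (simp only: mult_divide_eq_ennreal[OF cWA(2) cWA(3)])
  also have "\<dots> = ennreal ?v * ennreal (?wk ^ (CARD('n) + 1)) * (c * ?H g)" by (simp only: ac_simps)
  also have "\<dots> = ennreal (?v * ?wk ^ (CARD('n) + 1) * (?wN * ?X ^ (k + 1)))"
    unfolding c[OF g, symmetric] gX using pos X by (simp add: ennreal_mult ennreal_power ac_simps del: power_Suc)
  also have "?v * ?wk ^ (CARD('n) + 1) * (?wN * ?X ^ (k + 1)) = (?wN * ?wn ^ (k + 1) * ?wp) *
      (?wk ^ (CARD('n) + 1) * ?v / (?wn ^ (k + 1) * ?wp) * ?X ^ (k + 1))"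
  proof -
    have alg: "v * a * (b * x) = (b * d * p) * (a * v / (d * p) * x)" if "d \<noteq> 0" "p \<noteq> 0" for a b d p v x :: real
      using that by (simp add: field_simps)
    show ?thesis by (rule alg[OF power_not_zero[OF less_imp_neq[OF pos(3), symmetric]] less_imp_neq[OF pos(4), symmetric]])
  qed
  also have "ennreal \<dots> = ennreal (?wN * ?wn ^ (k + 1) * ?wp) * ennreal (?wk ^ (CARD('n) + 1) * ?v / (?wn ^ (k + 1) * ?wp) * ?X ^ (k + 1))"
    by (rule ennreal_mult) (use pos X in simp_all)
  finally have "ennreal (?wN * ?wn ^ (k + 1) * ?wp) * (\<integral>\<^sup>+F. ?G F \<partial>?\<nu>) \<le>
      ennreal (?wN * ?wn ^ (k + 1) * ?wp) * ennreal (?wk ^ (CARD('n) + 1) * ?v / (?wn ^ (k + 1) * ?wp) * ?X ^ (k + 1))"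
    unfolding c_ball by (simp only: ac_simps)
  then show ?thesis
    using \<open>ennreal (?wN * ?wn ^ (k + 1) * ?wp) \<noteq> 0\<close> by (simp only: ennreal_mult_le_mult_iff ennreal_neq_top not_False_eq_True)
qed

end
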